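(* Let $K\in\mathbb R$ and let $\mathcal X_n$, $n\in\mathbb N$, be a sequence of $\mathrm{CD}(K,\infty)$ pointed metric measure spaces converging to a pointed metric measure space $\mathcal X_\infty$ in the pointed measured Gromov (pmG) sense. Then $\mathcal X_\infty$ is a $\mathrm{CD}(K,\infty)$ space as well.
   Context: A pointed metric measure (p.m.m.) space $(X,\mathsf d,\mathfrak m,\bar x)$ consists of a complete separable metric space $(X,\mathsf d)$, a nonzero nonnegative Borel measure $\mathfrak m$ finite on bounded sets, and a point $\bar x\in\operatorname{supp}(\mathfrak m)$. Two p.m.m. spaces are isomorphic if there is an isometric embedding $\iota:\operatorname{supp}(\mathfrak m_1)\to X_2$ with $\iota_\sharp\mathfrak m_1=\mathfrak m_2$ and $\iota(\bar x_1)=\bar x_2$; the symbol $\mathcal X=[X,\mathsf d,\mathfrak m,\bar x]$ denotes the isomorphism class. pmG convergence: $[X_n,\mathsf d_n,\mathfrak m_n,\bar x_n]\to[X_\infty,\mathsf d_\infty,\mathfrak m_\infty,\bar x_\infty]$ if there are a complete separable metric space $(X,\mathsf d)$ and isometric embeddings $\iota_n:X_n\to X$, $n\in\mathbb N\cup\{\infty\}$, such that $\int\varphi\,d(\iota_n)_\sharp\mathfrak m_n\to\int\varphi\,d(\iota_\infty)_\sharp\mathfrak m_\infty$ for all bounded continuous $\varphi$ with bounded support and $\iota_n(\bar x_n)\to\iota_\infty(\bar x_\infty)$ in $X$. $\mathscr P_2(X)$ is the set of Borel probability measures with finite second moment, with the quadratic Kantorovich–Wasserstein distance $W_2$. For a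 p.m.m. space satisfying $\mathfrak m(B_r(\bar x))\le c_1e^{c_2r^2}$ for all $r>0$ and some constants $c_1,c_2$, the relative entropy $\mathrm{Ent}_{\mathfrak m}:\mathscr P_2(X)\to\mathbb R\cup\{+\infty\}$ is $\mathrm{Ent}_{\mathfrak m}(\mu)=\int\rho\log\rho\,d\mathfrak m$ if $\mu=\rho\mathfrak m\ll\mathfrak m$ and $+\infty$ otherwise (the growth condition makes it well defined); $D(\mathrm{Ent}_{\mathfrak m})=\{\mathrm{Ent}_{\mathfrak m}<\infty\}$. A p.m.m. space is $\mathrm{CD}(K,\infty)$ if it satisfies such a growth condition and for all $\mu^0,\mu^1\in D(\mathrm{Ent}_{\mathfrak m})$ there is a $W_2$-geodesic $(\mu_t)_{t\in[0,1]}$ (i.e. $W_2(\mu_t,\mu_s)=|t-s|W_2(\mu_0,\mu_1)$) with $\mu_0=\mu^0$, $\mu_1=\mu^1$ and, for all $t\in[0,1]$, $$\mathrm{Ent}_{\mathfrak m}(\mu_t)\le(1-t)\mathrm{Ent}_{\mathfrak m}(\mu_0)+t\,\mathrm{Ent}_{\mathfrak m}(\mu_1)-\tfrac K2t(1-t)W_2^2(\mu_0,\mu_1).$$ This property depends only on the isomorphism class. *)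

theory Defs
  imports "HOL-Analysis.Analysis" "HOL-Probability.Probability_Measure"
begin

definition metric_borel :: "'a metric \<Rightarrow> 'a measure" where
  "metric_borel S = sigma (mspace S) {U. openin (mtopology_of S) U}"

definition polish_metric :: "'a metric \<Rightarrow> bool" where
  "polish_metric S \<longleftrightarrow> mcomplete_of S \<and> separable_space (mtopology_of S)"

definition bounded_in :: "'a metric \<Rightarrow> 'a set \<Rightarrow> bool" where
  "bounded_in S A \<longleftrightarrow> Metric_space.mbounded (mspace S) (mdist S) A"

definition isometric_on :: "'a metric \<Rightarrow> 'a set \<Rightarrow> 'b metric \<Rightarrow> ('a \<Rightarrow> 'b) \<Rightarrow> bool" where
  "isometric_on S A T f \<longleftrightarrow>
     f ` A \<subseteq> mspace T \<and> (\<forall>x\<in>A. \<forall>y\<in>A. mdist T (f x) (f y) = mdist S x y)"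

definition msupp :: "'a metric \<Rightarrow> 'a measure \<Rightarrow> 'a set" where
  "msupp S m = {x \<in> mspace S. \<forall>r>0. emeasure m (mball_of S x r) > 0}"


text \<open>The spaces of a sequence are carried by subsets of one type; since that type is
  arbitrary, this does not restrict the sequence.\<close>

record 'a pmm =
  pmm_metric :: "'a metric"
  pmm_measure :: "'a measure"
  pmm_point :: 'a

definition pmm_space :: "'a pmm \<Rightarrow> bool" where
  "pmm_space X \<longleftrightarrow>
     polish_metric (pmm_metric X) \<and>
     space (pmm_measure X) = mspace (pmm_metric X) \<and>
     sets (pmm_measure X) = sets (metric_borel (pmm_metric X)) \<and>
     emeasure (pmm_measure X) (mspace (pmm_metric X)) \<noteq> 0 \<and>
     (\<forall>B\<in>sets (pmm_measure X). bounded_in (pmm_metric X) B \<longrightarrow> emeasure (pmm_measure X) B < \<infinity>) \<and>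
     pmm_point X \<in> msupp (pmm_metric X) (pmm_measure X)"

text \<open>The isomorphism is only defined on the support, so the push-forward is that of the
  measure restricted to its support; on a separable space no mass is lost.\<close>

definition pmm_isomorphic :: "'a pmm \<Rightarrow> 'b pmm \<Rightarrow> bool" where
  "pmm_isomorphic X Y \<longleftrightarrow> pmm_space X \<and> pmm_space Y \<and>
     (\<exists>f. isometric_on (pmm_metric X) (msupp (pmm_metric X) (pmm_measure X)) (pmm_metric Y) f \<and>
        distr (restrict_space (pmm_measure X) (msupp (pmm_metric X) (pmm_measure X)))
          (metric_borel (pmm_metric Y)) f = pmm_measure Y \<and>
        f (pmm_point X) = pmm_point Y)"

definition bounded_test_function :: "'a metric \<Rightarrow> ('a \<Rightarrow> real) \<Rightarrow> bool" where
  "bounded_test_function Z \<phi> \<longleftrightarrow>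
     continuous_map (mtopology_of Z) euclideanreal \<phi> \<and> bounded (\<phi> ` mspace Z) \<and>
     bounded_in Z (mtopology_of Z closure_of {z \<in> mspace Z. \<phi> z \<noteq> 0})"

definition pmG_realization ::
  "'z metric \<Rightarrow> (nat \<Rightarrow> 'a \<Rightarrow> 'z) \<Rightarrow> ('b \<Rightarrow> 'z) \<Rightarrow> (nat \<Rightarrow> 'a pmm) \<Rightarrow> 'b pmm \<Rightarrow> bool" where
  "pmG_realization Z \<iota> \<iota>_inf X X_inf \<longleftrightarrow> polish_metric Z \<and>
     (\<forall>n. isometric_on (pmm_metric (X n)) (mspace (pmm_metric (X n))) Z (\<iota> n)) \<and>
     isometric_on (pmm_metric X_inf) (mspace (pmm_metric X_inf)) Z \<iota>_inf \<and>
     (\<forall>\<phi>. bounded_test_function Z \<phi> \<longrightarrow>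
        (\<lambda>n. \<integral>z. \<phi> z \<partial>distr (pmm_measure (X n)) (metric_borel Z) (\<iota> n))
          \<longlonglongrightarrow> (\<integral>z. \<phi> z \<partial>distr (pmm_measure X_inf) (metric_borel Z) \<iota>_inf)) \<and>
     limitin (mtopology_of Z) (\<lambda>n. \<iota> n (pmm_point (X n))) (\<iota>_inf (pmm_point X_inf)) sequentially"

text \<open>pmG convergence is a relation between isomorphism classes: it holds if some
  representatives are realized in a common complete separable space. The type argument is
  the type carrying that space, because HOL cannot quantify over types inside a formula;
  a theorem with this notion as a hypothesis is universal in it.\<close>

definition pmG_converges :: "'z itself \<Rightarrow> (nat \<Rightarrow> 'a pmm) \<Rightarrow> 'b pmm \<Rightarrow> bool" where
  "pmG_converges T X X_inf \<longleftrightarrow>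
     (\<exists>Y Y_inf. (\<forall>n. pmm_isomorphic (X n) (Y n :: 'a pmm)) \<and> pmm_isomorphic X_inf (Y_inf :: 'b pmm) \<and>
        (\<exists>(Z :: 'z metric) \<iota> \<iota>_inf. pmG_realization Z \<iota> \<iota>_inf Y Y_inf))"


definition P2 :: "'a metric \<Rightarrow> 'a measure set" where
  "P2 S = {\<mu>. space \<mu> = mspace S \<and> sets \<mu> = sets (metric_borel S) \<and> prob_space \<mu> \<and>
     (\<exists>x\<in>mspace S. (\<integral>\<^sup>+y. ennreal ((mdist S x y)\<^sup>2) \<partial>\<mu>) < \<infinity>)}"

text \<open>On a separable space the product of the Borel sigma-algebras is the Borel
  sigma-algebra of the product.\<close>

definition couplings :: "'a metric \<Rightarrow> 'a measure \<Rightarrow> 'a measure \<Rightarrow> ('a \<times> 'a) measure set" where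
  "couplings S \<mu> \<nu> = {\<gamma>. sets \<gamma> = sets (metric_borel S \<Otimes>\<^sub>M metric_borel S) \<and>
     distr \<gamma> (metric_borel S) fst = \<mu> \<and> distr \<gamma> (metric_borel S) snd = \<nu>}"

text \<open>Meant for members of \<open>P2 S\<close>, where the infimum is finite.\<close>

definition W2 :: "'a metric \<Rightarrow> 'a measure \<Rightarrow> 'a measure \<Rightarrow> real" where
  "W2 S \<mu> \<nu> = sqrt (enn2real
     (INF \<gamma>\<in>couplings S \<mu> \<nu>. \<integral>\<^sup>+z. ennreal ((mdist S (fst z) (snd z))\<^sup>2) \<partial>\<gamma>))"

definition W2_geodesic :: "'a metric \<Rightarrow> (real \<Rightarrow> 'a measure) \<Rightarrow> bool" where
  "W2_geodesic S \<mu> \<longleftrightarrow> (\<forall>t\<in>{0..1}. \<mu> t \<in> P2 S) \<and>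
     (\<forall>s\<in>{0..1}. \<forall>t\<in>{0..1}. W2 S (\<mu> t) (\<mu> s) = \<bar>t - s\<bar> * W2 S (\<mu> 0) (\<mu> 1))"

text \<open>The integral of \<open>\<rho> log \<rho>\<close> may be \<open>\<infinity>\<close>, so it is the difference of the integrals of the
  positive and negative parts (\<open>ennreal\<close> truncates negative arguments to 0). The latter is
  finite on \<open>P2\<close> under the growth condition below. The Bochner integral, and with it the
  library's \<open>KL_divergence\<close>, would give 0 when \<open>\<rho> log \<rho>\<close> is not integrable.\<close>

definition Ent :: "'a measure \<Rightarrow> 'a measure \<Rightarrow> ereal" where
  "Ent m \<mu> = (if absolutely_continuous m \<mu>
     then (let \<rho> = (\<lambda>x. enn2real (RN_deriv m \<mu> x)) in
        enn2ereal (\<integral>\<^sup>+x. ennreal (\<rho> x * ln (\<rho> x)) \<partial>m)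
        - enn2ereal (\<integral>\<^sup>+x. ennreal (- (\<rho> x * ln (\<rho> x))) \<partial>m))
     else \<infinity>)"

definition Ent_dom :: "'a metric \<Rightarrow> 'a measure \<Rightarrow> 'a measure set" where
  "Ent_dom S m = {\<mu> \<in> P2 S. Ent m \<mu> < \<infinity>}"

definition growth_condition :: "'a pmm \<Rightarrow> bool" where
  "growth_condition X \<longleftrightarrow> (\<exists>c\<^sub>1 c\<^sub>2 :: real. \<forall>r>0.
     emeasure (pmm_measure X) (mball_of (pmm_metric X) (pmm_point X) r)
       \<le> ennreal (c\<^sub>1 * exp (c\<^sub>2 * r\<^sup>2)))"

definition CD_infinity :: "real \<Rightarrow> 'a pmm \<Rightarrow> bool" where
  "CD_infinity K X \<longleftrightarrow> pmm_space X \<and> growth_condition X \<and>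
     (let S = pmm_metric X; m = pmm_measure X in
      \<forall>\<mu>0\<in>Ent_dom S m. \<forall>\<mu>1\<in>Ent_dom S m.
        \<exists>\<mu>. W2_geodesic S \<mu> \<and> \<mu> 0 = \<mu>0 \<and> \<mu> 1 = \<mu>1 \<and>
          (\<forall>t\<in>{0..1}. Ent m (\<mu> t) \<le> ereal (1 - t) * Ent m (\<mu> 0) + ereal t * Ent m (\<mu> 1)
             - ereal (K / 2 * t * (1 - t) * (W2 S (\<mu> 0) (\<mu> 1))\<^sup>2)))"

end

theory Submission
  imports Defs "HOL-Probability.Probability"
begin

text \<open>All \<open>W2\<close> estimates use countable partitions into small cells: couplings are glued along the
  index of the cell containing the middle point instead of along the point itself, which costs
  one cell diameter and needs no disintegration. Test function convergence gives
  partitions whose cells have almost the same mass for \<open>m\<^sub>n\<close> and for the limit \<open>m\<close>.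
  Keeping the masses of the cells and replacing \<open>m\<^sub>n\<close> by \<open>m\<close> inside them carries measures of
  bounded entropy over to measures close in \<open>W2\<close> and in entropy. The endpoints are
  carried from \<open>m\<close> to \<open>m\<^sub>n\<close> in this way, and the points of the geodesics provided by the
  \<open>CD\<close> condition are carried back.

  The interpolation inequality itself bounds the growth of balls, uniformly in \<open>n\<close>, hence the
  negative part of the entropies. Bounded entropy makes the densities uniformly integrable, so along a
  filter obtained from compactness of a product of unit intervals the measures of all Borel
  sets converge, simultaneously for all times. Since almost-geodesic intermediate points have
  uniformly integrable second moments, this limit is a limit in \<open>W2\<close>, and the entropy is lower
  semicontinuous by its dual formula. The supports are finally identified with their isometric
  images in the common space.\<close>

section \<open>Borel sets and second moments\<close>

text \<open>Two obstacles shape the argument. The common space need not be locally compact, so its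
  bounded sets give no compactness; it is drawn instead from uniform absolute continuity with
  respect to one fixed measure. This is why the curves are carried back to \<open>m\<close> before
  any limit is taken. The errors of this transfer are not uniform in time, so a subsequence
  depending on t would be useless and one filter has to serve all times. Second, the growth
  constants in the \<open>CD\<close> condition of the approximating spaces may degenerate with n,
  whereas bounds independent of n are required. They are needed for the Gaussian weight exp (- c
  d^2): its logarithm is integrable for every measure with finite second moment, so the weight can
  be inserted in the dual formula of the entropy, where it controls everything far from the base
  point. Couplings are never optimal and geodesics of the underlying space never appear: an almost
  intermediate measure is described by a coupling of three points whose middle one sits at almost
  the right distance in L2.\<close>

lemma openin_mtopology_of_subset: "openin (mtopology_of S) U \<Longrightarrow> U \<subseteq> mspace S"
  using openin_subset by fastforce

lemma space_metric_borel [simp]: "space (metric_borel S) = mspace S"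
  unfolding metric_borel_def by (rule space_measure_of) (auto dest: openin_mtopology_of_subset)

lemma mspace_sets [measurable, simp]: "mspace S \<in> sets (metric_borel S)"
  using sets.top[of "metric_borel S"] by simp

lemma sets_metric_borel: "sets (metric_borel S) = sigma_sets (mspace S) {U. openin (mtopology_of S) U}"
  unfolding metric_borel_def by (rule sets_measure_of) (auto dest: openin_mtopology_of_subset)

lemma openin_metric_borel: "openin (mtopology_of S) U \<Longrightarrow> U \<in> sets (metric_borel S)"
  unfolding sets_metric_borel by auto

lemma closedin_metric_borel: "closedin (mtopology_of S) F \<Longrightarrow> F \<in> sets (metric_borel S)"
  using openin_metric_borel[of S "mspace S - F"] sets.Diff[of "mspace S" "metric_borel S" "mspace S - F"]
  by (metis Diff_Diff_Int closedin_def inf.absorb2 sets.top space_metric_borel topspace_mtopology_of)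

lemma mdist_self [simp]: "x \<in> mspace S \<Longrightarrow> mdist S x x = 0"
  by (simp only: mdist_zero)

lemma openin_mball_of: "openin (mtopology_of S) (mball_of S x r)"
  by (simp add: Metric_space.openin_mball mball_of_def mtopology_of_def)

lemma mball_of_sets [measurable]: "mball_of S x r \<in> sets (metric_borel S)"
  by (rule openin_metric_borel[OF openin_mball_of])

lemma measurable_metric_borel_continuous:
  assumes "continuous_map (mtopology_of S) euclideanreal f"
  shows "f \<in> borel_measurable (metric_borel S)"
proof (rule borel_measurableI)
  fix U :: "real set" assume "open U"
  then have "openin (mtopology_of S) {x \<in> topspace (mtopology_of S). f x \<in> U}"
    by (intro openin_continuous_map_preimage[OF assms]) auto
  moreover have "{x \<in> topspace (mtopology_of S). f x \<in> U} = f -` U \<inter> space (metric_borel S)" by auto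
  ultimately show "f -` U \<inter> space (metric_borel S) \<in> sets (metric_borel S)"
    using openin_metric_borel by metis
qed

locale separable_metric =
  fixes S :: "'a metric"
  assumes sep: "separable_space (mtopology_of S)"
begin

abbreviation "d \<equiv> mdist S"
abbreviation "B \<equiv> metric_borel S"
abbreviation "\<Omega> \<equiv> mspace S"

lemma dense_sequence:
  assumes "\<Omega> \<noteq> {}"
  obtains z :: "nat \<Rightarrow> 'a" where "\<And>k. z k \<in> \<Omega>" "\<And>x r. x \<in> \<Omega> \<Longrightarrow> r > 0 \<Longrightarrow> \<exists>k. d x (z k) < r"
proof -
  obtain C where C: "countable C" "C \<subseteq> \<Omega>" "mtopology_of S closure_of C = \<Omega>"
    using sep unfolding separable_space_def by auto
  have "C \<noteq> {}" using C assms by auto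
  define z where "z = from_nat_into C"
  have z: "z k \<in> C" for k unfolding z_def using \<open>C \<noteq> {}\<close> by (simp add: from_nat_into)
  have "\<exists>k. d x (z k) < r" if "x \<in> \<Omega>" "r > 0" for x r
  proof -
    have "x \<in> mtopology_of S closure_of C" using C that by simp
    moreover have "x \<in> mball_of S x r" using that by simp
    ultimately obtain y where "y \<in> C" "y \<in> mball_of S x r"
      using openin_mball_of[of S x r] unfolding in_closure_of by blast
    moreover obtain k where "z k = y" unfolding z_def using C(1) \<open>y \<in> C\<close> by (metis from_nat_into_surj)
    ultimately show ?thesis by auto
  qed
  then show ?thesis using that[of z] z C by blast
qed

lemma d_point_measurable: "a \<in> \<Omega> \<Longrightarrow> d a \<in> borel_measurable B"
  by (intro measurable_metric_borel_continuous continuous_on_mdist)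

text \<open>Separability makes the distance measurable for the product of the Borel sigma-algebras:
  d x y < a holds exactly if some member z of a dense sequence satisfies d z x + d z y < a, a
  countable union of sets that involve each coordinate only through a one-variable function.\<close>

lemma d_measurable_pair: "(\<lambda>p. d (fst p) (snd p)) \<in> borel_measurable (B \<Otimes>\<^sub>M B)"
proof (cases "\<Omega> = {}")
  case True
  then have "space (B \<Otimes>\<^sub>M B) = {}" by (simp add: space_pair_measure)
  then show ?thesis by (auto intro!: measurableI)
next
  case False
  obtain z :: "nat \<Rightarrow> 'a" where z: "\<And>k. z k \<in> \<Omega>" "\<And>x r. x \<in> \<Omega> \<Longrightarrow> r > 0 \<Longrightarrow> \<exists>k. d x (z k) < r"
    using dense_sequence[OF False] by blast
  have [measurable]: "d (z k) \<in> borel_measurable B" for k by (rule d_point_measurable[OF z(1)])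
  have eq: "d x y < a \<longleftrightarrow> (\<exists>k. d (z k) x + d (z k) y < a)" if xy: "x \<in> \<Omega>" "y \<in> \<Omega>" for x y a
  proof
    assume "d x y < a"
    then obtain k where k: "d x (z k) < (a - d x y) / 2" using z(2)[of x "(a - d x y) / 2"] xy by auto
    have "d (z k) y \<le> d (z k) x + d x y" using xy z(1) by (intro mdist_triangle)
    then have "d (z k) x + d (z k) y < a" using k by (simp add: mdist_commute[of S x])
    then show "\<exists>k. d (z k) x + d (z k) y < a" by blast
  next
    assume "\<exists>k. d (z k) x + d (z k) y < a"
    then obtain k where "d (z k) x + d (z k) y < a" by blast
    moreover have "d x y \<le> d x (z k) + d (z k) y" using xy z(1) by (intro mdist_triangle)
    ultimately show "d x y < a" by (simp add: mdist_commute[of S x])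
  qed
  show ?thesis unfolding borel_measurable_iff_less
  proof
    fix a
    have "{w \<in> space (B \<Otimes>\<^sub>M B). d (fst w) (snd w) < a}
        = (\<Union>k. {w \<in> space (B \<Otimes>\<^sub>M B). d (z k) (fst w) + d (z k) (snd w) < a})"
      using eq by (auto simp: space_pair_measure)
    also have "\<dots> \<in> sets (B \<Otimes>\<^sub>M B)" by measurable
    finally show "{w \<in> space (B \<Otimes>\<^sub>M B). d (fst w) (snd w) < a} \<in> sets (B \<Otimes>\<^sub>M B)" .
  qed
qed

lemma d_measurable [measurable (raw)]:
  assumes [measurable]: "f \<in> M \<rightarrow>\<^sub>M B" "g \<in> M \<rightarrow>\<^sub>M B"
  shows "(\<lambda>x. d (f x) (g x)) \<in> borel_measurable M"
proof -
  have "(\<lambda>p. d (fst p) (snd p)) \<circ> (\<lambda>x. (f x, g x)) \<in> borel_measurable M"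
    by (rule measurable_comp[OF _ d_measurable_pair]) measurable
  then show ?thesis by (simp add: comp_def)
qed

text \<open>A point is sent to the index of the first member of a dense sequence at distance less
  than \<delta> / 2. The fibres are countably many Borel sets of diameter at most \<delta>; they are
  the cells along which couplings are glued.\<close>

lemma cell_function:
  assumes "\<delta> > 0"
  obtains c :: "'a \<Rightarrow> nat" where "c \<in> B \<rightarrow>\<^sub>M count_space UNIV"
    "\<And>x y. x \<in> \<Omega> \<Longrightarrow> y \<in> \<Omega> \<Longrightarrow> c x = c y \<Longrightarrow> d x y \<le> \<delta>"
proof (cases "\<Omega> = {}")
  case True
  show ?thesis by (rule that[of "\<lambda>_. 0"]) (use True in auto)
next
  case False
  obtain z :: "nat \<Rightarrow> 'a" where z: "\<And>k. z k \<in> \<Omega>" "\<And>x r. x \<in> \<Omega> \<Longrightarrow> r > 0 \<Longrightarrow> \<exists>k. d x (z k) < r"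
    using dense_sequence[OF False] by blast
  have [measurable]: "d (z k) \<in> borel_measurable B" for k by (rule d_point_measurable[OF z(1)])
  define c where "c x = (LEAST k. d (z k) x < \<delta> / 2)" for x
  have "c \<in> B \<rightarrow>\<^sub>M count_space UNIV" unfolding c_def[abs_def] by measurable
  moreover have "d x y \<le> \<delta>" if xy: "x \<in> \<Omega>" "y \<in> \<Omega>" "c x = c y" for x y
  proof -
    have "d (z (c u)) u < \<delta> / 2" if u: "u \<in> \<Omega>" for u
    proof -
      obtain k where "d u (z k) < \<delta> / 2" using z(2)[OF u, of "\<delta> / 2"] assms by auto
      then show ?thesis unfolding c_def using LeastI[of "\<lambda>k. d (z k) u < \<delta> / 2" k] by (simp add: mdist_commute)
    qed
    from this[OF xy(1)] this[OF xy(2)] have "d x (z (c x)) < \<delta>/2" "d (z (c x)) y < \<delta> / 2"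
      using xy(3) by (auto simp: mdist_commute)
    moreover have "d x y \<le> d x (z (c x)) + d (z (c x)) y" using xy z(1) by (intro mdist_triangle)
    ultimately show ?thesis by simp
  qed
  ultimately show ?thesis by (rule that)
qed

lemma P2_D:
  assumes "\<mu> \<in> P2 S"
  shows "space \<mu> = \<Omega>" "sets \<mu> = sets B" "prob_space \<mu>"
  using assms unfolding P2_def by auto

lemma d_sq_triangle: "x \<in> \<Omega> \<Longrightarrow> y \<in> \<Omega> \<Longrightarrow> a \<in> \<Omega> \<Longrightarrow> (d x y)\<^sup>2 \<le> 2 * (d a x)\<^sup>2 + 2 * (d a y)\<^sup>2"
proof -
  assume "x \<in> \<Omega>" "y \<in> \<Omega>" "a \<in> \<Omega>"
  then have "d x y \<le> d a x + d a y" using mdist_triangle[of x S a y] by (simp add: mdist_commute)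
  then have "(d x y)\<^sup>2 \<le> (d a x + d a y)\<^sup>2" by (intro power_mono) auto
  also have "\<dots> \<le> 2 * (d a x)\<^sup>2 + 2 * (d a y)\<^sup>2"
    using zero_le_power2[of "d a x - d a y"] by (simp add: power2_eq_square algebra_simps)
  finally show ?thesis .
qed

text \<open>The squared triangle inequality carries finiteness of the second moment from the base
  point provided by \<open>P2\<close> to any other one.\<close>

lemma P2_integrable:
  assumes \<mu>: "\<mu> \<in> P2 S" and a: "a \<in> \<Omega>"
  shows "integrable \<mu> (\<lambda>x. (d a x)\<^sup>2)"
proof -
  interpret prob_space \<mu> using P2_D[OF \<mu>] by simp
  obtain b where b: "b \<in> \<Omega>" "(\<integral>\<^sup>+y. ennreal ((d b y)\<^sup>2) \<partial>\<mu>) < \<infinity>"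
    using \<mu> unfolding P2_def by auto
  note [simp] = P2_D(1,2)[OF \<mu>]
  have [measurable_cong]: "sets \<mu> = sets B" by simp
  have [measurable]: "d a \<in> borel_measurable B" "d b \<in> borel_measurable B"
    using d_point_measurable a b by auto
  have "integrable \<mu> (\<lambda>x. (d b x)\<^sup>2)"
    by (rule integrableI_bounded) (use b in \<open>auto\<close>)
  then have "integrable \<mu> (\<lambda>x. 2 * (d b a)\<^sup>2 + 2 * (d b x)\<^sup>2)" by simp
  then show ?thesis
    by (rule Bochner_Integration.integrable_bound) (use a b d_sq_triangle in auto)
qed

lemma P2_I:
  assumes "space \<mu> = \<Omega>" "sets \<mu> = sets B" "prob_space \<mu>" "a \<in> \<Omega>" "integrable \<mu> (\<lambda>x. (d a x)\<^sup>2)"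
  shows "\<mu> \<in> P2 S"
  using assms unfolding P2_def
  by (auto intro!: bexI[of _ a] simp: real_integrable_def nn_integral_eq_integral[OF assms(5)])

lemma P2_I':
  assumes "sets \<mu> = sets B" "prob_space \<mu>" "a \<in> \<Omega>" "(\<integral>\<^sup>+x. ennreal ((d a x)\<^sup>2) \<partial>\<mu>) < \<infinity>"
  shows "\<mu> \<in> P2 S"
  using assms sets_eq_imp_space_eq[OF assms(1)] unfolding P2_def by auto

end

text \<open>Minkowski's inequality in L2 from the weighted inequality (a + b)^2 \<le> (1 + q/p) a^2
  + (1 + p/q) b^2, whose weights turn the bounds p^2 and q^2 into exactly (p + q)^2. The weights
  require p and q to be positive, so the users enlarge their distances by a small amount
  first.\<close>

lemma nn_integral_Minkowski:
  assumes [measurable]: "f \<in> borel_measurable M" "g \<in> borel_measurable M"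
    and f0: "\<And>x. x \<in> space M \<Longrightarrow> 0 \<le> (f x :: real)" and g0: "\<And>x. x \<in> space M \<Longrightarrow> 0 \<le> (g x :: real)"
    and f: "(\<integral>\<^sup>+x. ennreal ((f x)\<^sup>2) \<partial>M) \<le> ennreal (p\<^sup>2)"
    and g: "(\<integral>\<^sup>+x. ennreal ((g x)\<^sup>2) \<partial>M) \<le> ennreal (q\<^sup>2)" and pq: "0 < p" "0 < q"
  shows "(\<integral>\<^sup>+x. ennreal ((f x + g x)\<^sup>2) \<partial>M) \<le> ennreal ((p + q)\<^sup>2)"
proof -
  have pw: "(a + b)\<^sup>2 \<le> (1 + q / p) * a\<^sup>2 + (1 + p / q) * b\<^sup>2" for a b :: real
  proof -
    have "0 \<le> (q * a - p * b)\<^sup>2 / (p * q)" using pq by simp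
    also have "\<dots> = q / p * a\<^sup>2 + p / q * b\<^sup>2 - 2 * a * b"
      using pq by (simp add: field_simps power2_eq_square)
    finally show ?thesis by (simp add: power2_sum algebra_simps)
  qed
  have "(\<integral>\<^sup>+x. ennreal ((f x + g x)\<^sup>2) \<partial>M)
    \<le> (\<integral>\<^sup>+x. ennreal (1 + q / p) * ennreal ((f x)\<^sup>2) + ennreal (1 + p / q) * ennreal ((g x)\<^sup>2) \<partial>M)"
    using pq by (intro nn_integral_mono) (auto simp: ennreal_mult'[symmetric] ennreal_plus[symmetric] simp del: ennreal_plus intro!: ennreal_leI pw)
  also have "\<dots> = ennreal (1 + q / p) * (\<integral>\<^sup>+x. ennreal ((f x)\<^sup>2) \<partial>M) + ennreal (1 + p / q) * (\<integral>\<^sup>+x. ennreal ((g x)\<^sup>2) \<partial>M)"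
    by (simp add: nn_integral_add nn_integral_cmult)
  also have "\<dots> \<le> ennreal (1 + q / p) * ennreal (p\<^sup>2) + ennreal (1 + p / q) * ennreal (q\<^sup>2)"
    by (intro add_mono mult_left_mono f g) auto
  also have "\<dots> = ennreal ((1 + q / p) * p\<^sup>2 + (1 + p / q) * q\<^sup>2)"
    using pq by (simp add: ennreal_mult'[symmetric] ennreal_plus[symmetric] del: ennreal_plus)
  also have "(1 + q / p) * p\<^sup>2 + (1 + p / q) * q\<^sup>2 = (p + q)\<^sup>2"
    using pq by (simp add: field_simps power2_eq_square)
  finally show ?thesis .
qed

section \<open>Gluing of couplings\<close>

text \<open>The coupling is independent inside each cell: with respect to the product measure it has
  the density 1 / a j on the block where both indices equal j. Integrating one variable out gives 1
  wherever a j is positive, hence the right marginals.\<close>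

lemma glue_measures:
  fixes p :: "'a \<Rightarrow> nat" and q :: "'b \<Rightarrow> nat"
  assumes M: "prob_space M" and N: "prob_space N"
    and p [measurable]: "p \<in> M \<rightarrow>\<^sub>M count_space UNIV" and q [measurable]: "q \<in> N \<rightarrow>\<^sub>M count_space UNIV"
    and eq: "\<And>j. measure M {x \<in> space M. p x = j} = measure N {x \<in> space N. q x = j}"
  obtains \<Gamma> where "sets \<Gamma> = sets (M \<Otimes>\<^sub>M N)" "prob_space \<Gamma>" "distr \<Gamma> M fst = M" "distr \<Gamma> N snd = N"
    "AE z in \<Gamma>. p (fst z) = q (snd z)"
proof -
  interpret M: prob_space M by fact
  interpret N: prob_space N by fact
  interpret pair_prob_space M N ..
  define a where "a j = measure M {x \<in> space M. p x = j}" for j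
  have aN: "a j = measure N {x \<in> space N. q x = j}" for j unfolding a_def eq ..
  have a0: "0 \<le> a j" for j unfolding a_def by simp
  \<comment> \<open>For a cell of mass 0 the quotient 1 / a j is 0, so the block is left empty;
    almost no point of either space lies in such a cell.\<close>
  define h where "h z = (if p (fst z) = q (snd z) then ennreal (1 / a (p (fst z))) else 0)" for z
  have [measurable]: "h \<in> borel_measurable (M \<Otimes>\<^sub>M N)" unfolding h_def[abs_def]
  proof (rule measurable_If)
    show "(\<lambda>z. ennreal (1 / a (p (fst z)))) \<in> borel_measurable (M \<Otimes>\<^sub>M N)"
      by (rule measurable_compose[where N="count_space UNIV" and f="\<lambda>z. p (fst z)"]) auto
    have "{z \<in> space (M \<Otimes>\<^sub>M N). p (fst z) = q (snd z)}
      = (\<Union>j. {z \<in> space (M \<Otimes>\<^sub>M N). p (fst z) = j} \<inter> {z \<in> space (M \<Otimes>\<^sub>M N). q (snd z) = j})" by auto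
    also have "\<dots> \<in> sets (M \<Otimes>\<^sub>M N)" by measurable
    finally show "{z \<in> space (M \<Otimes>\<^sub>M N). p (fst z) = q (snd z)} \<in> sets (M \<Otimes>\<^sub>M N)" .
  qed simp
  define \<Gamma> where "\<Gamma> = density (M \<Otimes>\<^sub>M N) h"
  have [measurable_cong, simp]: "sets \<Gamma> = sets (M \<Otimes>\<^sub>M N)" unfolding \<Gamma>_def by simp
  have one: "ennreal (1 / a j) * ennreal (a j) = 1" if "a j \<noteq> 0" for j
    using that a0[of j] by (simp add: ennreal_mult'[symmetric])
  have pos1: "AE x in M. a (p x) \<noteq> 0"
  proof -
    have "AE x in M. \<forall>j. a j = 0 \<longrightarrow> p x \<noteq> j"
      unfolding AE_all_countable
    proof
      fix j
      show "AE x in M. a j = 0 \<longrightarrow> p x \<noteq> j"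
      proof (cases "a j = 0")
        case True
        then have "emeasure M {x \<in> space M. p x = j} = 0" by (simp add: a_def M.emeasure_eq_measure)
        then have "{x \<in> space M. p x = j} \<in> null_sets M" by (auto simp: null_sets_def)
        from AE_not_in[OF this] show ?thesis by (auto elim!: AE_mp)
      qed simp
    qed
    then show ?thesis by (auto elim!: AE_mp)
  qed
  have pos2: "AE x in N. a (q x) \<noteq> 0"
  proof -
    have "AE x in N. \<forall>j. a j = 0 \<longrightarrow> q x \<noteq> j"
      unfolding AE_all_countable
    proof
      fix j
      show "AE x in N. a j = 0 \<longrightarrow> q x \<noteq> j"
      proof (cases "a j = 0")
        case True
        then have "emeasure N {x \<in> space N. q x = j} = 0" by (simp add: aN N.emeasure_eq_measure)
        then have "{x \<in> space N. q x = j} \<in> null_sets N" by (auto simp: null_sets_def)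
        from AE_not_in[OF this] show ?thesis by (auto elim!: AE_mp)
      qed simp
    qed
    then show ?thesis by (auto elim!: AE_mp)
  qed
  have in1: "(\<integral>\<^sup>+y. h (x, y) \<partial>N) = 1" if "x \<in> space M" "a (p x) \<noteq> 0" for x
  proof -
    have "(\<integral>\<^sup>+y. h (x, y) \<partial>N) = (\<integral>\<^sup>+y. ennreal (1 / a (p x)) * indicator {y \<in> space N. q y = p x} y \<partial>N)"
      unfolding h_def by (intro nn_integral_cong) (auto split: split_indicator)
    also have "\<dots> = ennreal (1 / a (p x)) * ennreal (a (p x))"
      unfolding aN by (subst nn_integral_cmult_indicator) (auto simp: N.emeasure_eq_measure)
    finally show ?thesis using one that by simp
  qed
  have in2: "(\<integral>\<^sup>+x. h (x, y) \<partial>M) = 1" if "y \<in> space N" "a (q y) \<noteq> 0" for y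
  proof -
    have "(\<integral>\<^sup>+x. h (x, y) \<partial>M) = (\<integral>\<^sup>+x. ennreal (1 / a (q y)) * indicator {x \<in> space M. p x = q y} x \<partial>M)"
      unfolding h_def by (intro nn_integral_cong) (auto split: split_indicator)
    also have "\<dots> = ennreal (1 / a (q y)) * ennreal (a (q y))"
      unfolding a_def by (subst nn_integral_cmult_indicator) (auto simp: M.emeasure_eq_measure)
    finally show ?thesis using one that by simp
  qed
  have d1: "distr \<Gamma> M fst = M"
  proof (rule measure_eqI)
    fix A assume "A \<in> sets (distr \<Gamma> M fst)"
    then have A [measurable]: "A \<in> sets M" by simp
    have "emeasure (distr \<Gamma> M fst) A = (\<integral>\<^sup>+x. indicator A x \<partial>distr \<Gamma> M fst)" by simp
    also have "\<dots> = (\<integral>\<^sup>+z. indicator A (fst z) \<partial>\<Gamma>)" by (subst nn_integral_distr) auto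
    also have "\<dots> = (\<integral>\<^sup>+z. h z * indicator A (fst z) \<partial>(M \<Otimes>\<^sub>M N))"
      unfolding \<Gamma>_def by (subst nn_integral_density) auto
    also have "\<dots> = (\<integral>\<^sup>+x. \<integral>\<^sup>+y. h (x, y) * indicator A x \<partial>N \<partial>M)"
      by (subst N.nn_integral_fst[symmetric]) auto
    also have "\<dots> = (\<integral>\<^sup>+x. (\<integral>\<^sup>+y. h (x, y) \<partial>N) * indicator A x \<partial>M)"
      by (intro nn_integral_cong nn_integral_multc measurable_Pair2[of h M N]) auto
    also have "\<dots> = (\<integral>\<^sup>+x. indicator A x \<partial>M)"
      by (rule nn_integral_cong_AE, rule AE_mp[OF pos1], rule AE_I2) (simp add: in1)
    finally show "emeasure (distr \<Gamma> M fst) A = emeasure M A" by simp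
  qed simp
  have d2: "distr \<Gamma> N snd = N"
  proof (rule measure_eqI)
    fix A assume "A \<in> sets (distr \<Gamma> N snd)"
    then have A [measurable]: "A \<in> sets N" by simp
    have "emeasure (distr \<Gamma> N snd) A = (\<integral>\<^sup>+x. indicator A x \<partial>distr \<Gamma> N snd)" by simp
    also have "\<dots> = (\<integral>\<^sup>+z. indicator A (snd z) \<partial>\<Gamma>)" by (subst nn_integral_distr) auto
    also have "\<dots> = (\<integral>\<^sup>+z. h z * indicator A (snd z) \<partial>(M \<Otimes>\<^sub>M N))"
      unfolding \<Gamma>_def by (subst nn_integral_density) auto
    also have "\<dots> = (\<integral>\<^sup>+y. \<integral>\<^sup>+x. h (x, y) * indicator A y \<partial>M \<partial>N)"
      by (subst nn_integral_snd[symmetric]) auto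
    also have "\<dots> = (\<integral>\<^sup>+y. (\<integral>\<^sup>+x. h (x, y) \<partial>M) * indicator A y \<partial>N)"
      by (intro nn_integral_cong nn_integral_multc measurable_Pair1[of h M N]) auto
    also have "\<dots> = (\<integral>\<^sup>+x. indicator A x \<partial>N)"
      by (rule nn_integral_cong_AE, rule AE_mp[OF pos2], rule AE_I2) (simp add: in2)
    finally show "emeasure (distr \<Gamma> N snd) A = emeasure N A" by simp
  qed simp
  have pr: "prob_space \<Gamma>" by (rule prob_space_distrD[of fst _ M]) (use d1 M in auto)
  have ae: "AE z in \<Gamma>. p (fst z) = q (snd z)"
    unfolding \<Gamma>_def by (subst AE_density) (auto simp: h_def intro!: AE_I2)
  show ?thesis by (rule that[OF _ pr d1 d2 ae]) simp
qed

context separable_metric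
begin

lemma couplings_D:
  assumes "\<gamma> \<in> couplings S \<mu> \<nu>"
  shows "sets \<gamma> = sets (B \<Otimes>\<^sub>M B)" "distr \<gamma> B fst = \<mu>" "distr \<gamma> B snd = \<nu>"
  using assms unfolding couplings_def by auto

lemma couplings_prob_space:
  assumes "\<gamma> \<in> couplings S \<mu> \<nu>" "prob_space \<mu>"
  shows "prob_space \<gamma>"
proof (rule prob_space_distrD)
  show "fst \<in> \<gamma> \<rightarrow>\<^sub>M B"
    using couplings_D(1)[OF assms(1)] measurable_fst measurable_cong_sets by blast
  show "prob_space (distr \<gamma> B fst)" using couplings_D(2)[OF assms(1)] assms(2) by simp
qed

lemma W2_le:
  assumes "\<gamma> \<in> couplings S \<mu> \<nu>" "(\<integral>\<^sup>+z. ennreal ((d (fst z) (snd z))\<^sup>2) \<partial>\<gamma>) \<le> ennreal (w\<^sup>2)" "0 \<le> w"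
  shows "W2 S \<mu> \<nu> \<le> w"
proof -
  have "(INF \<gamma>\<in>couplings S \<mu> \<nu>. \<integral>\<^sup>+z. ennreal ((d (fst z) (snd z))\<^sup>2) \<partial>\<gamma>) \<le> ennreal (w\<^sup>2)"
    using assms by (meson INF_lower2)
  then have "enn2real (INF \<gamma>\<in>couplings S \<mu> \<nu>. \<integral>\<^sup>+z. ennreal ((d (fst z) (snd z))\<^sup>2) \<partial>\<gamma>) \<le> w\<^sup>2"
    by (intro enn2real_leI) auto
  then show ?thesis unfolding W2_def using assms(3) by (metis real_sqrt_le_mono real_sqrt_unique)
qed

lemma couplings_distr:
  assumes [measurable]: "f \<in> M \<rightarrow>\<^sub>M B" "g \<in> M \<rightarrow>\<^sub>M B"
  shows "distr M (B \<Otimes>\<^sub>M B) (\<lambda>x. (f x, g x)) \<in> couplings S (distr M B f) (distr M B g)"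
  unfolding couplings_def by (auto simp: distr_distr comp_def)

lemma W2_le_distr:
  assumes [measurable]: "f \<in> M \<rightarrow>\<^sub>M B" "g \<in> M \<rightarrow>\<^sub>M B"
    and le: "(\<integral>\<^sup>+x. ennreal ((d (f x) (g x))\<^sup>2) \<partial>M) \<le> ennreal (w\<^sup>2)" "0 \<le> w"
  shows "W2 S (distr M B f) (distr M B g) \<le> w"
  by (rule W2_le[OF couplings_distr[OF assms(1,2)]]) (use le in \<open>simp_all add: nn_integral_distr\<close>)

lemma W2_nonneg: "0 \<le> W2 S \<mu> \<nu>"
  unfolding W2_def by simp

text \<open>\<open>enn2real\<close> sends \<infinity> to 0, so a small value of \<open>W2\<close>
  means something only once the infimum is known to be finite. The product measure is a coupling of
  finite cost for members of \<open>P2\<close>, which settles this.\<close>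

lemma W2_lessE:
  assumes \<mu>: "\<mu> \<in> P2 S" and \<nu>: "\<nu> \<in> P2 S" and w: "W2 S \<mu> \<nu> < w"
  obtains \<gamma> where "\<gamma> \<in> couplings S \<mu> \<nu>" "(\<integral>\<^sup>+z. ennreal ((d (fst z) (snd z))\<^sup>2) \<partial>\<gamma>) \<le> ennreal (w\<^sup>2)"
proof -
  interpret M: prob_space \<mu> using P2_D[OF \<mu>] by simp
  interpret N: prob_space \<nu> using P2_D[OF \<nu>] by simp
  interpret pair_prob_space \<mu> \<nu> ..
  note [simp] = P2_D(1,2)[OF \<mu>] P2_D(1,2)[OF \<nu>]
  have [measurable_cong]: "sets \<mu> = sets B" "sets \<nu> = sets B" by simp_all
  have "\<Omega> \<noteq> {}" using M.not_empty by simp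
  then obtain a where a: "a \<in> \<Omega>" by auto
  have [measurable]: "d a \<in> borel_measurable B" by (rule d_point_measurable[OF a])
  have m1: "distr (\<mu> \<Otimes>\<^sub>M \<nu>) B fst = \<mu>"
  proof (rule measure_eqI)
    fix A assume "A \<in> sets (distr (\<mu> \<Otimes>\<^sub>M \<nu>) B fst)"
    then have A [measurable]: "A \<in> sets B" by simp
    have "emeasure (distr (\<mu> \<Otimes>\<^sub>M \<nu>) B fst) A = emeasure (\<mu> \<Otimes>\<^sub>M \<nu>) (A \<times> \<Omega>)"
      using sets.sets_into_space[OF A] by (subst emeasure_distr) (auto simp: space_pair_measure intro!: arg_cong2[where f=emeasure])
    also have "\<dots> = emeasure \<mu> A"
      using N.emeasure_space_1 A by (subst N.emeasure_pair_measure_Times) auto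
    finally show "emeasure (distr (\<mu> \<Otimes>\<^sub>M \<nu>) B fst) A = emeasure \<mu> A" .
  qed simp
  have m2: "distr (\<mu> \<Otimes>\<^sub>M \<nu>) B snd = \<nu>"
  proof (rule measure_eqI)
    fix A assume "A \<in> sets (distr (\<mu> \<Otimes>\<^sub>M \<nu>) B snd)"
    then have A [measurable]: "A \<in> sets B" by simp
    have "emeasure (distr (\<mu> \<Otimes>\<^sub>M \<nu>) B snd) A = emeasure (\<mu> \<Otimes>\<^sub>M \<nu>) (\<Omega> \<times> A)"
      using sets.sets_into_space[OF A] by (subst emeasure_distr) (auto simp: space_pair_measure intro!: arg_cong2[where f=emeasure])
    also have "\<dots> = emeasure \<nu> A"
      using M.emeasure_space_1 A by (subst N.emeasure_pair_measure_Times) auto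
    finally show "emeasure (distr (\<mu> \<Otimes>\<^sub>M \<nu>) B snd) A = emeasure \<nu> A" .
  qed simp
  have c: "distr (\<mu> \<Otimes>\<^sub>M \<nu>) (B \<Otimes>\<^sub>M B) (\<lambda>x. (fst x, snd x)) \<in> couplings S \<mu> \<nu>"
    using couplings_distr[of fst "\<mu> \<Otimes>\<^sub>M \<nu>" snd] m1 m2 by simp
  have "(\<integral>\<^sup>+z. ennreal ((d (fst z) (snd z))\<^sup>2) \<partial>(distr (\<mu> \<Otimes>\<^sub>M \<nu>) (B \<Otimes>\<^sub>M B) (\<lambda>x. (fst x, snd x))))
    = (\<integral>\<^sup>+z. ennreal ((d (fst z) (snd z))\<^sup>2) \<partial>(\<mu> \<Otimes>\<^sub>M \<nu>))"
    by (subst nn_integral_distr) auto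
  also have "\<dots> \<le> (\<integral>\<^sup>+z. ennreal (2 * (d a (fst z))\<^sup>2) + ennreal (2 * (d a (snd z))\<^sup>2) \<partial>(\<mu> \<Otimes>\<^sub>M \<nu>))"
    using a by (intro nn_integral_mono)
      (auto simp: space_pair_measure ennreal_plus[symmetric] simp del: ennreal_plus intro!: ennreal_leI d_sq_triangle)
  also have "\<dots> = (\<integral>\<^sup>+z. ennreal (2 * (d a (fst z))\<^sup>2) \<partial>(\<mu> \<Otimes>\<^sub>M \<nu>)) + (\<integral>\<^sup>+z. ennreal (2 * (d a (snd z))\<^sup>2) \<partial>(\<mu> \<Otimes>\<^sub>M \<nu>))"
    by (rule nn_integral_add) auto
  also have "(\<integral>\<^sup>+z. ennreal (2 * (d a (fst z))\<^sup>2) \<partial>(\<mu> \<Otimes>\<^sub>M \<nu>)) = (\<integral>\<^sup>+x. ennreal (2 * (d a x)\<^sup>2) \<partial>distr (\<mu> \<Otimes>\<^sub>M \<nu>) B fst)"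
    by (subst nn_integral_distr) auto
  also have "(\<integral>\<^sup>+z. ennreal (2 * (d a (snd z))\<^sup>2) \<partial>(\<mu> \<Otimes>\<^sub>M \<nu>)) = (\<integral>\<^sup>+x. ennreal (2 * (d a x)\<^sup>2) \<partial>distr (\<mu> \<Otimes>\<^sub>M \<nu>) B snd)"
    by (subst nn_integral_distr) auto
  also have "(\<integral>\<^sup>+x. ennreal (2 * (d a x)\<^sup>2) \<partial>distr (\<mu> \<Otimes>\<^sub>M \<nu>) B fst) + (\<integral>\<^sup>+x. ennreal (2 * (d a x)\<^sup>2) \<partial>distr (\<mu> \<Otimes>\<^sub>M \<nu>) B snd)
    = (\<integral>\<^sup>+x. ennreal (2 * (d a x)\<^sup>2) \<partial>\<mu>) + (\<integral>\<^sup>+x. ennreal (2 * (d a x)\<^sup>2) \<partial>\<nu>)"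
    unfolding m1 m2 ..
  also have "\<dots> < \<infinity>"
    using P2_integrable[OF \<mu> a] P2_integrable[OF \<nu> a]
    by (simp add: nn_integral_eq_integral)
  finally have fin: "(INF \<gamma>\<in>couplings S \<mu> \<nu>. \<integral>\<^sup>+z. ennreal ((d (fst z) (snd z))\<^sup>2) \<partial>\<gamma>) < \<infinity>"
    by (rule le_less_trans[OF INF_lower[OF c]])
  have w0: "0 < w" using w W2_nonneg[of \<mu> \<nu>] by simp
  have "(INF \<gamma>\<in>couplings S \<mu> \<nu>. \<integral>\<^sup>+z. ennreal ((d (fst z) (snd z))\<^sup>2) \<partial>\<gamma>) < ennreal (w\<^sup>2)"
  proof -
    have "enn2real (INF \<gamma>\<in>couplings S \<mu> \<nu>. \<integral>\<^sup>+z. ennreal ((d (fst z) (snd z))\<^sup>2) \<partial>\<gamma>) < w\<^sup>2"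
      using power_strict_mono[OF w W2_nonneg, of 2] by (simp add: W2_def)
    then have "ennreal (enn2real (INF \<gamma>\<in>couplings S \<mu> \<nu>. \<integral>\<^sup>+z. ennreal ((d (fst z) (snd z))\<^sup>2) \<partial>\<gamma>)) < ennreal (w\<^sup>2)"
      using w0 by (intro ennreal_lessI) auto
    then show ?thesis using fin by simp
  qed
  then show ?thesis using that by (meson INF_less_iff less_imp_le)
qed

lemma W2_commute:
  assumes "\<mu> \<in> P2 S" "\<nu> \<in> P2 S"
  shows "W2 S \<mu> \<nu> = W2 S \<nu> \<mu>"
proof -
  have le: "W2 S \<nu> \<mu> \<le> W2 S \<mu> \<nu>" if a: "\<mu> \<in> P2 S" "\<nu> \<in> P2 S" for \<mu> \<nu>
  proof (rule field_le_epsilon)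
    fix e :: real assume "0 < e"
    then obtain \<gamma> where \<gamma>: "\<gamma> \<in> couplings S \<mu> \<nu>" "(\<integral>\<^sup>+z. ennreal ((d (fst z) (snd z))\<^sup>2) \<partial>\<gamma>) \<le> ennreal ((W2 S \<mu> \<nu> + e)\<^sup>2)"
      using W2_lessE[OF a, of "W2 S \<mu> \<nu> + e"] by auto
    note D = couplings_D[OF \<gamma>(1)]
    note [measurable_cong] = D(1)
    have "W2 S (distr \<gamma> B snd) (distr \<gamma> B fst) \<le> W2 S \<mu> \<nu> + e"
      by (rule W2_le_distr) (use \<gamma> \<open>0 < e\<close> W2_nonneg[of \<mu> \<nu>] in \<open>auto simp: mdist_commute\<close>)
    then show "W2 S \<nu> \<mu> \<le> W2 S \<mu> \<nu> + e" using D by simp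
  qed
  show ?thesis using le[OF assms] le[OF assms(2,1)] by simp
qed

text \<open>The cell index of the middle coordinate has the same law under both couplings, namely
  the one it has under \<sigma>, so \<open>glue_measures\<close> applies to the pairs. The two
  copies of the middle point share a cell instead of being equal.\<close>

lemma glue_couplings:
  assumes \<gamma>: "\<gamma> \<in> couplings S \<mu> \<sigma>" "\<gamma>' \<in> couplings S \<sigma> \<nu>" and \<mu>: "prob_space \<mu>" and \<sigma>: "prob_space \<sigma>" and \<delta>: "\<delta> > 0"
  obtains \<Gamma> where "sets \<Gamma> = sets ((B \<Otimes>\<^sub>M B) \<Otimes>\<^sub>M (B \<Otimes>\<^sub>M B))" "prob_space \<Gamma>"
    "distr \<Gamma> (B \<Otimes>\<^sub>M B) fst = \<gamma>" "distr \<Gamma> (B \<Otimes>\<^sub>M B) snd = \<gamma>'"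
    "AE z in \<Gamma>. d (snd (fst z)) (fst (snd z)) \<le> \<delta>"
proof -
  obtain c :: "'a \<Rightarrow> nat" where c [measurable]: "c \<in> B \<rightarrow>\<^sub>M count_space UNIV"
    and cd: "\<And>x y. x \<in> \<Omega> \<Longrightarrow> y \<in> \<Omega> \<Longrightarrow> c x = c y \<Longrightarrow> d x y \<le> \<delta>" using cell_function[OF \<delta>] by blast
  note D = couplings_D[OF \<gamma>(1)] and D' = couplings_D[OF \<gamma>(2)]
  note [measurable_cong] = D(1) D'(1)
  have sp: "space \<gamma> = space (B \<Otimes>\<^sub>M B)" "space \<gamma>' = space (B \<Otimes>\<^sub>M B)"
    using D(1) D'(1) sets_eq_imp_space_eq by blast+
  have eq: "measure \<gamma> {z \<in> space \<gamma>. c (snd z) = j} = measure \<gamma>' {z \<in> space \<gamma>'. c (fst z) = j}" for j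
  proof -
    have "measure \<gamma> {z \<in> space \<gamma>. c (snd z) = j} = measure (distr \<gamma> B snd) {x \<in> \<Omega>. c x = j}"
      by (subst measure_distr) (auto simp: sp space_pair_measure intro!: arg_cong2[where f=measure])
    also have "\<dots> = measure (distr \<gamma>' B fst) {x \<in> \<Omega>. c x = j}" using D D' by simp
    also have "\<dots> = measure \<gamma>' {z \<in> space \<gamma>'. c (fst z) = j}"
      by (subst measure_distr) (auto simp: sp space_pair_measure intro!: arg_cong2[where f=measure])
    finally show ?thesis .
  qed
  have "(\<lambda>z. c (snd z)) \<in> \<gamma> \<rightarrow>\<^sub>M count_space UNIV" "(\<lambda>z. c (fst z)) \<in> \<gamma>' \<rightarrow>\<^sub>M count_space UNIV" by measurable
  from glue_measures[OF couplings_prob_space[OF \<gamma>(1) \<mu>] couplings_prob_space[OF \<gamma>(2) \<sigma>] this eq]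
  obtain \<Gamma> where \<Gamma>: "sets \<Gamma> = sets (\<gamma> \<Otimes>\<^sub>M \<gamma>')" "prob_space \<Gamma>" "distr \<Gamma> \<gamma> fst = \<gamma>" "distr \<Gamma> \<gamma>' snd = \<gamma>'"
    "AE z in \<Gamma>. c (snd (fst z)) = c (fst (snd z))" by blast
  have s: "sets \<Gamma> = sets ((B \<Otimes>\<^sub>M B) \<Otimes>\<^sub>M (B \<Otimes>\<^sub>M B))"
    unfolding \<Gamma>(1) by (intro sets_pair_measure_cong D D')
  have spG: "space \<Gamma> = (\<Omega> \<times> \<Omega>) \<times> (\<Omega> \<times> \<Omega>)"
    using sets_eq_imp_space_eq[OF s] by (simp add: space_pair_measure)
  show ?thesis
  proof (rule that[OF s \<Gamma>(2)])
    show "distr \<Gamma> (B \<Otimes>\<^sub>M B) fst = \<gamma>" using \<Gamma>(3) D(1) distr_cong[OF refl D(1)] by metis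
    show "distr \<Gamma> (B \<Otimes>\<^sub>M B) snd = \<gamma>'" using \<Gamma>(4) D'(1) distr_cong[OF refl D'(1)] by metis
    show "AE z in \<Gamma>. d (snd (fst z)) (fst (snd z)) \<le> \<delta>"
      using \<Gamma>(5) by (rule AE_mp) (auto intro!: AE_I2 cd simp: spG)
  qed
qed

lemma W2_triangle:
  assumes \<mu>: "\<mu> \<in> P2 S" and \<sigma>: "\<sigma> \<in> P2 S" and \<nu>: "\<nu> \<in> P2 S"
  shows "W2 S \<mu> \<nu> \<le> W2 S \<mu> \<sigma> + W2 S \<sigma> \<nu>"
proof (rule field_le_epsilon)
  fix e :: real assume e: "0 < e"
  \<comment> \<open>The error e is split into thirds: one for each of the two almost optimal
    couplings and one for the diameter of the cells at the middle point.\<close>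
  define p where "p = W2 S \<mu> \<sigma> + e / 3"
  define q where "q = W2 S \<sigma> \<nu> + e / 3"
  have pq: "0 < p" "0 < q" using e W2_nonneg[of \<mu> \<sigma>] W2_nonneg[of \<sigma> \<nu>] by (auto simp: p_def q_def)
  obtain \<gamma> where \<gamma>: "\<gamma> \<in> couplings S \<mu> \<sigma>" "(\<integral>\<^sup>+z. ennreal ((d (fst z) (snd z))\<^sup>2) \<partial>\<gamma>) \<le> ennreal (p\<^sup>2)"
    using W2_lessE[OF \<mu> \<sigma>, of p] e by (auto simp: p_def)
  obtain \<gamma>' where \<gamma>': "\<gamma>' \<in> couplings S \<sigma> \<nu>" "(\<integral>\<^sup>+z. ennreal ((d (fst z) (snd z))\<^sup>2) \<partial>\<gamma>') \<le> ennreal (q\<^sup>2)"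
    using W2_lessE[OF \<sigma> \<nu>, of q] e by (auto simp: q_def)
  obtain \<Gamma> where \<Gamma>: "sets \<Gamma> = sets ((B \<Otimes>\<^sub>M B) \<Otimes>\<^sub>M (B \<Otimes>\<^sub>M B))" "prob_space \<Gamma>"
    "distr \<Gamma> (B \<Otimes>\<^sub>M B) fst = \<gamma>" "distr \<Gamma> (B \<Otimes>\<^sub>M B) snd = \<gamma>'"
    "AE z in \<Gamma>. d (snd (fst z)) (fst (snd z)) \<le> e / 3"
    using glue_couplings[OF \<gamma>(1) \<gamma>'(1) P2_D(3)[OF \<mu>] P2_D(3)[OF \<sigma>], of "e/3"] e by auto
  interpret prob_space \<Gamma> by fact
  note [measurable_cong] = \<Gamma>(1)
  have spG: "space \<Gamma> = (\<Omega> \<times> \<Omega>) \<times> (\<Omega> \<times> \<Omega>)"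
    using sets_eq_imp_space_eq[OF \<Gamma>(1)] by (simp add: space_pair_measure)
  have 1: "(\<integral>\<^sup>+z. ennreal ((d (fst (fst z)) (snd (fst z)))\<^sup>2) \<partial>\<Gamma>) \<le> ennreal (p\<^sup>2)"
    using \<gamma>(2) unfolding \<Gamma>(3)[symmetric] by (subst (asm) nn_integral_distr) auto
  have 2: "(\<integral>\<^sup>+z. ennreal ((d (fst (snd z)) (snd (snd z)))\<^sup>2) \<partial>\<Gamma>) \<le> ennreal (q\<^sup>2)"
    using \<gamma>'(2) unfolding \<Gamma>(4)[symmetric] by (subst (asm) nn_integral_distr) auto
  have 3: "(\<integral>\<^sup>+z. ennreal ((e/3)\<^sup>2) \<partial>\<Gamma>) \<le> ennreal ((e/3)\<^sup>2)" by (simp add: emeasure_space_1)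
  have 4: "(\<integral>\<^sup>+z. ennreal ((d (fst (fst z)) (snd (fst z)) + e/3)\<^sup>2) \<partial>\<Gamma>) \<le> ennreal ((p + e/3)\<^sup>2)"
    by (rule nn_integral_Minkowski[OF _ _ _ _ 1 3]) (use e pq in auto)
  have 5: "(\<integral>\<^sup>+z. ennreal ((d (fst (fst z)) (snd (fst z)) + e/3 + d (fst (snd z)) (snd (snd z)))\<^sup>2) \<partial>\<Gamma>) \<le> ennreal ((p + e/3 + q)\<^sup>2)"
    by (rule nn_integral_Minkowski[OF _ _ _ _ 4 2]) (use e pq in auto)
  have "(\<integral>\<^sup>+z. ennreal ((d (fst (fst z)) (snd (snd z)))\<^sup>2) \<partial>\<Gamma>)
    \<le> (\<integral>\<^sup>+z. ennreal ((d (fst (fst z)) (snd (fst z)) + e/3 + d (fst (snd z)) (snd (snd z)))\<^sup>2) \<partial>\<Gamma>)"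
  proof (rule nn_integral_mono_AE, rule AE_mp[OF \<Gamma>(5)], rule AE_I2, rule impI, intro ennreal_leI power_mono)
    fix z assume z: "z \<in> space \<Gamma>" and le: "d (snd (fst z)) (fst (snd z)) \<le> e / 3"
    have "d (fst (fst z)) (snd (snd z)) \<le> d (fst (fst z)) (snd (fst z)) + d (snd (fst z)) (snd (snd z))"
      "d (snd (fst z)) (snd (snd z)) \<le> d (snd (fst z)) (fst (snd z)) + d (fst (snd z)) (snd (snd z))"
      using z by (auto simp: spG intro!: mdist_triangle)
    then show "d (fst (fst z)) (snd (snd z)) \<le> d (fst (fst z)) (snd (fst z)) + e/3 + d (fst (snd z)) (snd (snd z))"
      using le by simp
  qed simp
  with 5 have 6: "(\<integral>\<^sup>+z. ennreal ((d (fst (fst z)) (snd (snd z)))\<^sup>2) \<partial>\<Gamma>) \<le> ennreal ((p + e/3 + q)\<^sup>2)" by simp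
  have "W2 S (distr \<Gamma> B (\<lambda>z. fst (fst z))) (distr \<Gamma> B (\<lambda>z. snd (snd z))) \<le> p + e/3 + q"
    by (rule W2_le_distr[OF _ _ 6]) (use e pq in auto)
  moreover have "distr \<Gamma> B (\<lambda>z. fst (fst z)) = \<mu>" "distr \<Gamma> B (\<lambda>z. snd (snd z)) = \<nu>"
  proof -
    have "distr (distr \<Gamma> (B \<Otimes>\<^sub>M B) fst) B fst = \<mu>" using \<Gamma>(3) couplings_D[OF \<gamma>(1)] by simp
    then show "distr \<Gamma> B (\<lambda>z. fst (fst z)) = \<mu>" by (simp add: distr_distr comp_def)
    have "distr (distr \<Gamma> (B \<Otimes>\<^sub>M B) snd) B snd = \<nu>" using \<Gamma>(4) couplings_D[OF \<gamma>'(1)] by simp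
    then show "distr \<Gamma> B (\<lambda>z. snd (snd z)) = \<nu>" by (simp add: distr_distr comp_def)
  qed
  ultimately show "W2 S \<mu> \<nu> \<le> W2 S \<mu> \<sigma> + W2 S \<sigma> \<nu> + e" unfolding p_def q_def by simp
qed

end

section \<open>Couplings along cells\<close>

lemma nn_integral_count_space_bool_pair:
  assumes "sigma_finite_measure N" and [measurable]: "F \<in> borel_measurable (count_space (UNIV :: bool set) \<Otimes>\<^sub>M N)"
  shows "(\<integral>\<^sup>+z. F z \<partial>(count_space UNIV \<Otimes>\<^sub>M N)) = (\<integral>\<^sup>+y. F (True, y) \<partial>N) + (\<integral>\<^sup>+y. F (False, y) \<partial>N)"
proof -
  interpret N: sigma_finite_measure N by fact
  have "(\<integral>\<^sup>+z. F z \<partial>(count_space UNIV \<Otimes>\<^sub>M N)) = (\<integral>\<^sup>+b. \<integral>\<^sup>+y. F (b, y) \<partial>N \<partial>count_space UNIV)"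
    by (rule N.nn_integral_fst[symmetric]) measurable
  also have "\<dots> = (\<integral>\<^sup>+y. F (True, y) \<partial>N) + (\<integral>\<^sup>+y. F (False, y) \<partial>N)"
    by (subst nn_integral_count_space_finite) (auto simp: UNIV_bool add.commute)
  finally show ?thesis .
qed

lemma nn_integral_mult_pair:
  assumes "sigma_finite_measure N" and [measurable]: "f \<in> borel_measurable M" "g \<in> borel_measurable N"
  shows "(\<integral>\<^sup>+z. f (fst z) * g (snd z) \<partial>(M \<Otimes>\<^sub>M N)) = (\<integral>\<^sup>+x. f x \<partial>M) * (\<integral>\<^sup>+y. g y \<partial>N)"
proof -
  interpret N: sigma_finite_measure N by fact
  have "(\<integral>\<^sup>+z. f (fst z) * g (snd z) \<partial>(M \<Otimes>\<^sub>M N)) = (\<integral>\<^sup>+x. \<integral>\<^sup>+y. f x * g y \<partial>N \<partial>M)"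
    by (subst N.nn_integral_fst[symmetric]) auto
  also have "\<dots> = (\<integral>\<^sup>+x. f x \<partial>M) * (\<integral>\<^sup>+y. g y \<partial>N)"
    by (simp add: nn_integral_cmult nn_integral_multc)
  finally show ?thesis .
qed

context separable_metric
begin

lemma W2_self: "sets \<mu> = sets B \<Longrightarrow> W2 S \<mu> \<mu> = 0"
proof -
  assume [measurable_cong]: "sets \<mu> = sets B"
  have sp: "space \<mu> = \<Omega>" using sets_eq_imp_space_eq[OF \<open>sets \<mu> = sets B\<close>] by simp
  have "W2 S (distr \<mu> B (\<lambda>x. x)) (distr \<mu> B (\<lambda>x. x)) \<le> 0"
    by (rule W2_le_distr) (auto simp: sp intro!: order_eq_refl nn_integral_0_iff_AE[THEN iffD2] AE_I2)
  moreover have "distr \<mu> B (\<lambda>x. x) = \<mu>" by (simp add: distr_id2 \<open>sets \<mu> = sets B\<close>)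
  ultimately show ?thesis using W2_nonneg[of \<mu> \<mu>] by simp
qed

text \<open>The mass common to both measures stays put; only the excess \<open>(1 - g)\<^sup>+\<close> is moved,
  independently, to the deficit \<open>(g - 1)\<^sup>+\<close>.\<close>

lemma W2_density_le:
  assumes \<mu>: "\<mu> \<in> P2 S" and g [measurable]: "g \<in> borel_measurable B" and g0: "\<And>x. 0 \<le> g x"
    and pr: "prob_space (density \<mu> (\<lambda>x. ennreal (g x)))" and a: "a \<in> \<Omega>"
    and r: "(\<integral>\<^sup>+x. ennreal ((d a x)\<^sup>2 * \<bar>1 - g x\<bar>) \<partial>\<mu>) \<le> ennreal r" "0 \<le> r"
  shows "W2 S \<mu> (density \<mu> (\<lambda>x. ennreal (g x))) \<le> sqrt (2 * r)"
proof -
  interpret prob_space \<mu> using P2_D[OF \<mu>] by simp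
  note [simp] = P2_D(1,2)[OF \<mu>]
  have [measurable_cong]: "sets \<mu> = sets B" by simp
  have [measurable]: "d a \<in> borel_measurable B" by (rule d_point_measurable[OF a])
  define m where "m x = min 1 (g x)" for x
  define fp where "fp x = max 0 (g x - 1)" for x
  define fn where "fn x = max 0 (1 - g x)" for x
  have [measurable]: "m \<in> borel_measurable B" "fp \<in> borel_measurable B" "fn \<in> borel_measurable B"
    unfolding m_def[abs_def] fp_def[abs_def] fn_def[abs_def] by measurable
  have nn: "0 \<le> m x" "0 \<le> fp x" "0 \<le> fn x" for x using g0[of x] by (auto simp: m_def fp_def fn_def)
  have mp: "ennreal (m x) + ennreal (fp x) = ennreal (g x)" and mn: "ennreal (m x) + ennreal (fn x) = 1" for x
  proof -
    have "m x + fp x = g x" "m x + fn x = 1" by (auto simp: m_def fp_def fn_def)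
    then show "ennreal (m x) + ennreal (fp x) = ennreal (g x)" "ennreal (m x) + ennreal (fn x) = 1"
      using nn[of x] by (simp_all add: ennreal_plus[symmetric] del: ennreal_plus)
  qed
  have g1: "(\<integral>\<^sup>+x. ennreal (g x) \<partial>\<mu>) = 1"
  proof -
    have "(\<integral>\<^sup>+x. ennreal (g x) \<partial>\<mu>) = (\<integral>\<^sup>+x. ennreal (g x) * indicator \<Omega> x \<partial>\<mu>)"
      by (intro nn_integral_cong) auto
    then show ?thesis using prob_space.emeasure_space_1[OF pr] by (subst (asm) emeasure_density) auto
  qed
  have I1: "(\<integral>\<^sup>+x. ennreal (m x) \<partial>\<mu>) + (\<integral>\<^sup>+x. ennreal (fp x) \<partial>\<mu>) = 1"
    unfolding g1[symmetric] mp[symmetric] by (rule nn_integral_add[symmetric]) auto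
  have I2: "(\<integral>\<^sup>+x. ennreal (m x) \<partial>\<mu>) + (\<integral>\<^sup>+x. ennreal (fn x) \<partial>\<mu>) = 1"
  proof -
    have "(\<integral>\<^sup>+x. ennreal (m x) \<partial>\<mu>) + (\<integral>\<^sup>+x. ennreal (fn x) \<partial>\<mu>) = (\<integral>\<^sup>+x. ennreal (m x) + ennreal (fn x) \<partial>\<mu>)"
      by (rule nn_integral_add[symmetric]) auto
    then show ?thesis using emeasure_space_1 by (simp add: mn)
  qed
  have fin: "(\<integral>\<^sup>+x. ennreal (m x) \<partial>\<mu>) \<noteq> \<infinity>" using I1 by (metis ennreal_add_eq_top ennreal_one_neq_top infinity_ennreal_def)
  \<comment> \<open>Both measures have mass 1, so the mass to be moved away equals the mass to be
    filled in. If this common value k is 0, the two measures coincide and the normalisation below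
    would be impossible.\<close>
  have keq: "(\<integral>\<^sup>+x. ennreal (fp x) \<partial>\<mu>) = (\<integral>\<^sup>+x. ennreal (fn x) \<partial>\<mu>)"
    using I1 I2 fin by (metis ennreal_add_left_cancel infinity_ennreal_def)
  define k where "k = enn2real (\<integral>\<^sup>+x. ennreal (fn x) \<partial>\<mu>)"
  have k: "(\<integral>\<^sup>+x. ennreal (fn x) \<partial>\<mu>) = ennreal k"
    unfolding k_def using I2 by (metis ennreal_add_eq_top ennreal_enn2real ennreal_one_neq_top less_top)
  have k0: "0 \<le> k" unfolding k_def by simp
  show ?thesis
  proof (cases "k = 0")
    case True
    have "AE x in \<mu>. ennreal (fn x) = 0" using k True nn_integral_0_iff_AE[of "\<lambda>x. ennreal (fn x)" \<mu>] by simp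
    moreover have "AE x in \<mu>. ennreal (fp x) = 0" using k keq True nn_integral_0_iff_AE[of "\<lambda>x. ennreal (fp x)" \<mu>] by simp
    ultimately have "AE x in \<mu>. g x = 1"
      by eventually_elim (auto simp: fn_def fp_def max_def split: if_splits)
    then have "density \<mu> (\<lambda>x. ennreal (g x)) = density \<mu> (\<lambda>x. 1)"
      by (intro density_cong) auto
    then have "density \<mu> (\<lambda>x. ennreal (g x)) = \<mu>" by (simp add: density_1)
    then show ?thesis using W2_self[of \<mu>] r(2) by simp
  next
    case False
    then have kp: "0 < k" using k0 by simp
    define l where "l = density \<mu> (\<lambda>x. ennreal (fp x / k))"
    have [measurable_cong, simp]: "sets l = sets B" unfolding l_def by simp
    have fpk: "ennreal (fp x / k) = ennreal (1/k) * ennreal (fp x)" for x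
      using kp nn by (simp add: ennreal_mult'[symmetric])
    have kk: "ennreal k * ennreal (1 / k) = 1" using kp by (simp add: ennreal_mult'[symmetric])
    have lint: "ennreal k * (\<integral>\<^sup>+x. f x \<partial>l) = (\<integral>\<^sup>+x. ennreal (fp x) * f x \<partial>\<mu>)" if [measurable]: "f \<in> borel_measurable B" for f
    proof -
      have "(\<integral>\<^sup>+x. f x \<partial>l) = (\<integral>\<^sup>+x. ennreal (1/k) * (ennreal (fp x) * f x) \<partial>\<mu>)"
        unfolding l_def by (subst nn_integral_density) (auto simp: fpk mult.assoc)
      also have "\<dots> = ennreal (1/k) * (\<integral>\<^sup>+x. ennreal (fp x) * f x \<partial>\<mu>)" by (rule nn_integral_cmult) auto
      finally show ?thesis using kk by (simp add: mult.assoc[symmetric])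
    qed
    have sl: "space l = \<Omega>" unfolding l_def by simp
    have l1: "emeasure l \<Omega> = 1"
    proof -
      have "emeasure l \<Omega> = ennreal (1/k) * (\<integral>\<^sup>+x. ennreal (fp x) \<partial>\<mu>)"
        unfolding l_def by (subst emeasure_density) (auto simp: fpk nn_integral_cmult[symmetric] intro!: nn_integral_cong)
      also have "\<dots> = 1" unfolding keq k using kk by (simp add: mult.commute)
      finally show ?thesis .
    qed
    interpret l: prob_space l by (rule prob_spaceI) (simp add: sl l1)
    interpret pair_prob_space \<mu> l ..
    \<comment> \<open>The Boolean records whether a point stays, with weight \<open>m\<close>, or
      moves, with weight \<open>fn\<close>. The last coordinate is the independent target, drawn
      from the normalised measure \<open>l\<close>; it is ignored by points that stay.\<close>
    define h where "h z = (if fst z then ennreal (m (fst (snd z))) else ennreal (fn (fst (snd z))))" for z :: "bool \<times> 'a \<times> 'a"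
    define G where "G z = (if fst z then fst (snd z) else snd (snd z))" for z :: "bool \<times> 'a \<times> 'a"
    let ?K = "count_space (UNIV :: bool set) \<Otimes>\<^sub>M (\<mu> \<Otimes>\<^sub>M l)"
    have [measurable]: "h \<in> borel_measurable ?K" unfolding h_def[abs_def] by measurable
    have [measurable]: "G \<in> ?K \<rightarrow>\<^sub>M B" unfolding G_def[abs_def] by measurable
    have [measurable]: "(\<lambda>z. fst (snd z)) \<in> ?K \<rightarrow>\<^sub>M B" by measurable
    define \<Gamma> where "\<Gamma> = density ?K h"
    have [measurable_cong, simp]: "sets \<Gamma> = sets ?K" unfolding \<Gamma>_def by simp
    have int\<Gamma>: "(\<integral>\<^sup>+z. f z \<partial>\<Gamma>) = (\<integral>\<^sup>+w. ennreal (m (fst w)) * f (True, w) \<partial>(\<mu> \<Otimes>\<^sub>M l)) + (\<integral>\<^sup>+w. ennreal (fn (fst w)) * f (False, w) \<partial>(\<mu> \<Otimes>\<^sub>M l))"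
      if [measurable]: "f \<in> borel_measurable ?K" for f
    proof -
      have "(\<integral>\<^sup>+z. f z \<partial>\<Gamma>) = (\<integral>\<^sup>+z. h z * f z \<partial>?K)" unfolding \<Gamma>_def by (rule nn_integral_density) auto
      also have "\<dots> = (\<integral>\<^sup>+w. h (True, w) * f (True, w) \<partial>(\<mu> \<Otimes>\<^sub>M l)) + (\<integral>\<^sup>+w. h (False, w) * f (False, w) \<partial>(\<mu> \<Otimes>\<^sub>M l))"
        by (rule nn_integral_count_space_bool_pair) (auto intro: sigma_finite_measure_axioms)
      finally show ?thesis by (simp add: h_def)
    qed
    have d1: "distr \<Gamma> B (\<lambda>z. fst (snd z)) = \<mu>"
    proof (rule measure_eqI)
      fix A assume "A \<in> sets (distr \<Gamma> B (\<lambda>z. fst (snd z)))"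
      then have A [measurable]: "A \<in> sets B" by simp
      have "emeasure (distr \<Gamma> B (\<lambda>z. fst (snd z))) A = (\<integral>\<^sup>+x. indicator A x \<partial>distr \<Gamma> B (\<lambda>z. fst (snd z)))" by simp
      also have "\<dots> = (\<integral>\<^sup>+z. indicator A (fst (snd z)) \<partial>\<Gamma>)" by (rule nn_integral_distr) auto
      also have "\<dots> = (\<integral>\<^sup>+w. (ennreal (m (fst w)) * indicator A (fst w)) * 1 \<partial>(\<mu> \<Otimes>\<^sub>M l)) + (\<integral>\<^sup>+w. (ennreal (fn (fst w)) * indicator A (fst w)) * 1 \<partial>(\<mu> \<Otimes>\<^sub>M l))"
        by (subst int\<Gamma>) auto
      also have "\<dots> = (\<integral>\<^sup>+x. ennreal (m x) * indicator A x \<partial>\<mu>) * (\<integral>\<^sup>+x. 1 \<partial>l) + (\<integral>\<^sup>+x. ennreal (fn x) * indicator A x \<partial>\<mu>) * (\<integral>\<^sup>+x. 1 \<partial>l)"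
        by (intro arg_cong2[where f="(+)"] nn_integral_mult_pair) (auto intro: l.sigma_finite_measure_axioms)
      also have "\<dots> = (\<integral>\<^sup>+x. ennreal (m x) * indicator A x + ennreal (fn x) * indicator A x \<partial>\<mu>)"
        by (subst nn_integral_add) (auto simp: sl l1)
      also have "\<dots> = (\<integral>\<^sup>+x. indicator A x \<partial>\<mu>)"
        by (intro nn_integral_cong) (auto simp: mn split: split_indicator)
      finally show "emeasure (distr \<Gamma> B (\<lambda>z. fst (snd z))) A = emeasure \<mu> A" by simp
    qed simp
    have d2: "distr \<Gamma> B G = density \<mu> (\<lambda>x. ennreal (g x))"
    proof (rule measure_eqI)
      fix A assume "A \<in> sets (distr \<Gamma> B G)"
      then have A [measurable]: "A \<in> sets B" by simp
      have "emeasure (distr \<Gamma> B G) A = (\<integral>\<^sup>+x. indicator A x \<partial>distr \<Gamma> B G)" by simp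
      also have "\<dots> = (\<integral>\<^sup>+z. indicator A (G z) \<partial>\<Gamma>)" by (rule nn_integral_distr) auto
      also have "\<dots> = (\<integral>\<^sup>+w. (ennreal (m (fst w)) * indicator A (fst w)) * 1 \<partial>(\<mu> \<Otimes>\<^sub>M l)) + (\<integral>\<^sup>+w. ennreal (fn (fst w)) * indicator A (snd w) \<partial>(\<mu> \<Otimes>\<^sub>M l))"
        by (subst int\<Gamma>) (auto simp: G_def)
      also have "\<dots> = (\<integral>\<^sup>+x. ennreal (m x) * indicator A x \<partial>\<mu>) * (\<integral>\<^sup>+x. 1 \<partial>l) + (\<integral>\<^sup>+x. ennreal (fn x) \<partial>\<mu>) * (\<integral>\<^sup>+x. indicator A x \<partial>l)"
        by (intro arg_cong2[where f="(+)"] nn_integral_mult_pair) (auto intro: l.sigma_finite_measure_axioms)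
      also have "\<dots> = (\<integral>\<^sup>+x. ennreal (m x) * indicator A x + ennreal (fp x) * indicator A x \<partial>\<mu>)"
        unfolding k by (subst lint, measurable, subst nn_integral_add) (auto simp: sl l1)
      also have "\<dots> = (\<integral>\<^sup>+x. ennreal (g x) * indicator A x \<partial>\<mu>)"
        by (intro nn_integral_cong) (auto simp: mp split: split_indicator)
      finally show "emeasure (distr \<Gamma> B G) A = emeasure (density \<mu> (\<lambda>x. ennreal (g x))) A"
        by (simp add: emeasure_density)
    qed simp
    have "(\<integral>\<^sup>+z. ennreal ((d (fst (snd z)) (G z))\<^sup>2) \<partial>\<Gamma>)
      = (\<integral>\<^sup>+w. ennreal (m (fst w)) * ennreal ((d (fst w) (fst w))\<^sup>2) \<partial>(\<mu> \<Otimes>\<^sub>M l)) + (\<integral>\<^sup>+w. ennreal (fn (fst w)) * ennreal ((d (fst w) (snd w))\<^sup>2) \<partial>(\<mu> \<Otimes>\<^sub>M l))"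
      by (subst int\<Gamma>) (auto simp: G_def)
    also have "(\<integral>\<^sup>+w. ennreal (m (fst w)) * ennreal ((d (fst w) (fst w))\<^sup>2) \<partial>(\<mu> \<Otimes>\<^sub>M l)) = (\<integral>\<^sup>+w. 0 \<partial>(\<mu> \<Otimes>\<^sub>M l))"
      by (intro nn_integral_cong) (auto simp: space_pair_measure)
    also have "(\<integral>\<^sup>+w. 0 \<partial>(\<mu> \<Otimes>\<^sub>M l)) + (\<integral>\<^sup>+w. ennreal (fn (fst w)) * ennreal ((d (fst w) (snd w))\<^sup>2) \<partial>(\<mu> \<Otimes>\<^sub>M l))
      \<le> (\<integral>\<^sup>+w. (ennreal (fn (fst w)) * ennreal (2 * (d a (fst w))\<^sup>2)) * 1 + ennreal (fn (fst w)) * ennreal (2 * (d a (snd w))\<^sup>2) \<partial>(\<mu> \<Otimes>\<^sub>M l))"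
    proof -
      have "ennreal (fn (fst w)) * ennreal ((d (fst w) (snd w))\<^sup>2) \<le>
        (ennreal (fn (fst w)) * ennreal (2 * (d a (fst w))\<^sup>2)) * 1 + ennreal (fn (fst w)) * ennreal (2 * (d a (snd w))\<^sup>2)"
        if "w \<in> space (\<mu> \<Otimes>\<^sub>M l)" for w
      proof -
        \<comment> \<open>Source and target are compared through a, since they are independent. This
          is the origin of the factor 2; the two resulting terms combine because fn + fp = |1 -
          g|.\<close>
        have "(d (fst w) (snd w))\<^sup>2 \<le> 2 * (d a (fst w))\<^sup>2 + 2 * (d a (snd w))\<^sup>2"
          using that a by (intro d_sq_triangle) (auto simp: space_pair_measure sl)
        then have "ennreal (fn (fst w)) * ennreal ((d (fst w) (snd w))\<^sup>2) \<le> ennreal (fn (fst w)) * ennreal (2 * (d a (fst w))\<^sup>2 + 2 * (d a (snd w))\<^sup>2)"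
          by (intro mult_left_mono ennreal_leI) auto
        then show ?thesis by (simp add: ennreal_plus distrib_left)
      qed
      then show ?thesis by (simp add: nn_integral_mono)
    qed
    also have "\<dots> = (\<integral>\<^sup>+w. (ennreal (fn (fst w)) * ennreal (2 * (d a (fst w))\<^sup>2)) * 1 \<partial>(\<mu> \<Otimes>\<^sub>M l)) + (\<integral>\<^sup>+w. ennreal (fn (fst w)) * ennreal (2 * (d a (snd w))\<^sup>2) \<partial>(\<mu> \<Otimes>\<^sub>M l))"
      by (rule nn_integral_add) auto
    also have "\<dots> = (\<integral>\<^sup>+x. ennreal (fn x) * ennreal (2 * (d a x)\<^sup>2) \<partial>\<mu>) * (\<integral>\<^sup>+x. 1 \<partial>l) + (\<integral>\<^sup>+x. ennreal (fn x) \<partial>\<mu>) * (\<integral>\<^sup>+x. ennreal (2 * (d a x)\<^sup>2) \<partial>l)"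
      by (intro arg_cong2[where f="(+)"] nn_integral_mult_pair) (auto intro: l.sigma_finite_measure_axioms)
    also have "\<dots> = (\<integral>\<^sup>+x. ennreal (fn x) * ennreal (2 * (d a x)\<^sup>2) \<partial>\<mu>) + (\<integral>\<^sup>+x. ennreal (fp x) * ennreal (2 * (d a x)\<^sup>2) \<partial>\<mu>)"
      unfolding k by (subst lint) (auto simp: sl l1)
    also have "\<dots> = (\<integral>\<^sup>+x. ennreal (fn x) * ennreal (2 * (d a x)\<^sup>2) + ennreal (fp x) * ennreal (2 * (d a x)\<^sup>2) \<partial>\<mu>)"
      by (rule nn_integral_add[symmetric]) auto
    also have "\<dots> = (\<integral>\<^sup>+x. 2 * ennreal ((d a x)\<^sup>2 * \<bar>1 - g x\<bar>) \<partial>\<mu>)"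
    proof (intro nn_integral_cong)
      fix x
      have "ennreal (fn x) * ennreal (2 * (d a x)\<^sup>2) + ennreal (fp x) * ennreal (2 * (d a x)\<^sup>2)
        = ennreal ((fn x + fp x) * (2 * (d a x)\<^sup>2))"
        using nn[of x] by (simp add: ennreal_mult' ennreal_plus distrib_right)
      also have "(fn x + fp x) * (2 * (d a x)\<^sup>2) = 2 * ((d a x)\<^sup>2 * \<bar>1 - g x\<bar>)"
        by (auto simp: fn_def fp_def max_def)
      finally show "ennreal (fn x) * ennreal (2 * (d a x)\<^sup>2) + ennreal (fp x) * ennreal (2 * (d a x)\<^sup>2) = 2 * ennreal ((d a x)\<^sup>2 * \<bar>1 - g x\<bar>)"
        by (simp add: ennreal_mult')
    qed
    also have "\<dots> = 2 * (\<integral>\<^sup>+x. ennreal ((d a x)\<^sup>2 * \<bar>1 - g x\<bar>) \<partial>\<mu>)" by (rule nn_integral_cmult) auto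
    also have "\<dots> \<le> 2 * ennreal r" by (intro mult_left_mono r) auto
    also have "\<dots> = ennreal ((sqrt (2 * r))\<^sup>2)" using r(2) by (simp add: ennreal_mult')
    finally have "(\<integral>\<^sup>+z. ennreal ((d (fst (snd z)) (G z))\<^sup>2) \<partial>\<Gamma>) \<le> ennreal ((sqrt (2 * r))\<^sup>2)" .
    from W2_le_distr[OF _ _ this] show ?thesis unfolding d1 d2 using r(2) by auto
  qed
qed


text \<open>Gluing along \<open>p\<close> pairs points of equal index, and almost surely both lie in
  E, so their distance is at most \<delta>. The diameter is restricted to E because the leftover
  fibre outside the cells is in general unbounded.\<close>

lemma W2_same_cells_le:
  fixes p :: "'a \<Rightarrow> nat"
  assumes \<mu>: "\<mu> \<in> P2 S" and \<nu>: "\<nu> \<in> P2 S" and p [measurable]: "p \<in> B \<rightarrow>\<^sub>M count_space UNIV"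
    and eq: "\<And>j. measure \<mu> {x \<in> \<Omega>. p x = j} = measure \<nu> {x \<in> \<Omega>. p x = j}"
    and E [measurable]: "E \<in> sets B" and mE: "measure \<mu> E = 1" "measure \<nu> E = 1"
    and diam: "\<And>x y. x \<in> E \<Longrightarrow> y \<in> E \<Longrightarrow> p x = p y \<Longrightarrow> d x y \<le> \<delta>" and "0 \<le> \<delta>"
  shows "W2 S \<mu> \<nu> \<le> \<delta>"
proof -
  note [simp] = P2_D(1,2)[OF \<mu>] P2_D(1,2)[OF \<nu>]
  have [measurable_cong]: "sets \<mu> = sets B" "sets \<nu> = sets B" by simp_all
  interpret M: prob_space \<mu> using P2_D[OF \<mu>] by simp
  interpret N: prob_space \<nu> using P2_D[OF \<nu>] by simp
  obtain \<Gamma> where \<Gamma>: "sets \<Gamma> = sets (\<mu> \<Otimes>\<^sub>M \<nu>)" "prob_space \<Gamma>" "distr \<Gamma> \<mu> fst = \<mu>" "distr \<Gamma> \<nu> snd = \<nu>"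
    "AE z in \<Gamma>. p (fst z) = p (snd z)"
    using glue_measures[OF P2_D(3)[OF \<mu>] P2_D(3)[OF \<nu>], of p p] eq by auto
  note [measurable_cong] = \<Gamma>(1)
  have d: "distr \<Gamma> B fst = \<mu>" "distr \<Gamma> B snd = \<nu>"
    using \<Gamma>(3,4) distr_cong[OF refl, of B \<mu> \<Gamma> fst fst] distr_cong[OF refl, of B \<nu> \<Gamma> snd snd] by simp_all
  interpret G: prob_space \<Gamma> by fact
  have "AE x in distr \<Gamma> B fst. x \<in> E" unfolding d using M.prob_eq_1[of E] mE by simp
  then have 1: "AE z in \<Gamma>. fst z \<in> E" by (subst (asm) AE_distr_iff) auto
  have "AE x in distr \<Gamma> B snd. x \<in> E" unfolding d using N.prob_eq_1[of E] mE by simp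
  then have 2: "AE z in \<Gamma>. snd z \<in> E" by (subst (asm) AE_distr_iff) auto
  have "(\<integral>\<^sup>+z. ennreal ((d (fst z) (snd z))\<^sup>2) \<partial>\<Gamma>) \<le> (\<integral>\<^sup>+z. ennreal (\<delta>\<^sup>2) \<partial>\<Gamma>)"
  proof (rule nn_integral_mono_AE)
    show "AE z in \<Gamma>. ennreal ((d (fst z) (snd z))\<^sup>2) \<le> ennreal (\<delta>\<^sup>2)"
      using 1 2 \<Gamma>(5) by eventually_elim (auto intro!: ennreal_leI power_mono diam)
  qed
  also have "\<dots> = ennreal (\<delta>\<^sup>2)" by (simp add: G.emeasure_space_1)
  finally have "(\<integral>\<^sup>+z. ennreal ((d (fst z) (snd z))\<^sup>2) \<partial>\<Gamma>) \<le> ennreal (\<delta>\<^sup>2)" .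
  from W2_le_distr[OF _ _ this \<open>0 \<le> \<delta>\<close>] show ?thesis unfolding d by auto
qed

text \<open>Cell i receives the index \<open>Suc i\<close>, which leaves 0 for the points outside
  all cells.\<close>

lemma cells_index:
  fixes I :: "nat set"
  assumes I: "finite I" and A [measurable]: "\<And>i. i \<in> I \<Longrightarrow> A i \<in> sets B" and disj: "disjoint_family_on A I"
  obtains p where "p \<in> B \<rightarrow>\<^sub>M count_space (UNIV :: nat set)"
    "\<And>x i. i \<in> I \<Longrightarrow> x \<in> A i \<Longrightarrow> p x = Suc i" "\<And>x. x \<notin> (\<Union>i\<in>I. A i) \<Longrightarrow> p x = 0"
proof -
  define p where "p x = (\<Sum>i\<in>I. if x \<in> A i then Suc i else 0)" for x
  have "p \<in> B \<rightarrow>\<^sub>M count_space UNIV" unfolding p_def[abs_def]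
    by (intro measurable_sum_nat measurable_If) (use A in auto)
  moreover have "p x = Suc i" if "i \<in> I" "x \<in> A i" for x i
  proof -
    have "p x = (\<Sum>j\<in>I. if j = i then Suc i else 0)" unfolding p_def
      by (rule sum.cong) (use that disj in \<open>auto simp: disjoint_family_on_def\<close>)
    then show ?thesis using that I by simp
  qed
  moreover have "p x = 0" if "x \<notin> (\<Union>i\<in>I. A i)" for x
    using that unfolding p_def by (intro sum.neutral) auto
  ultimately show ?thesis using that by blast
qed

text \<open>The intermediate measure is \<open>\<mu>\<close> rescaled on each cell to the mass that \<open>\<nu>\<close> gives it.\<close>

lemma W2_cells_le:
  fixes I :: "nat set"
  assumes \<mu>: "\<mu> \<in> P2 S" and \<nu>: "\<nu> \<in> P2 S" and I: "finite I" and A [measurable]: "\<And>i. i \<in> I \<Longrightarrow> A i \<in> sets B"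
    and disj: "disjoint_family_on A I" and diam: "\<And>i x y. i \<in> I \<Longrightarrow> x \<in> A i \<Longrightarrow> y \<in> A i \<Longrightarrow> d x y \<le> \<delta>" "0 \<le> \<delta>"
    and \<nu>E: "measure \<nu> (\<Union>i\<in>I. A i) = 1"
    and close: "\<And>i. i \<in> I \<Longrightarrow> \<bar>measure \<mu> (A i) - measure \<nu> (A i)\<bar> \<le> \<tau> * measure \<mu> (A i)" "0 \<le> \<tau>"
    and a: "a \<in> \<Omega>"
  shows "W2 S \<mu> \<nu> \<le> \<delta> + sqrt (2 * ((\<integral>x. (d a x)\<^sup>2 * indicator (\<Omega> - (\<Union>i\<in>I. A i)) x \<partial>\<mu>) + \<tau> * (\<integral>x. (d a x)\<^sup>2 \<partial>\<mu>)))"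
proof -
  note [simp] = P2_D(1,2)[OF \<mu>] P2_D(1,2)[OF \<nu>]
  have [measurable_cong]: "sets \<mu> = sets B" "sets \<nu> = sets B" by simp_all
  interpret M: prob_space \<mu> using P2_D[OF \<mu>] by simp
  interpret N: prob_space \<nu> using P2_D[OF \<nu>] by simp
  have [measurable]: "d a \<in> borel_measurable B" by (rule d_point_measurable[OF a])
  define E where "E = (\<Union>i\<in>I. A i)"
  have E [measurable]: "E \<in> sets B" unfolding E_def using I A by auto
  \<comment> \<open>On a cell that is null for \<mu>, the assumption of relative closeness makes it
    null for \<nu> too. The default value 1 then keeps |1 - q i| \<le> \<tau> true.\<close>
  define q where "q i = (if measure \<mu> (A i) = 0 then 1 else measure \<nu> (A i) / measure \<mu> (A i))" for i
  define g where "g x = (\<Sum>i\<in>I. q i * indicator (A i) x)" for x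
  have q0: "0 \<le> q i" for i unfolding q_def by simp
  have qm: "q i * measure \<mu> (A i) = measure \<nu> (A i)" if "i \<in> I" for i
    using close(1)[OF that] measure_nonneg[of \<nu> "A i"] unfolding q_def by (auto intro: antisym)
  have q1: "\<bar>1 - q i\<bar> \<le> \<tau>" if "i \<in> I" for i
  proof (cases "measure \<mu> (A i) = 0")
    case False
    then have pos: "0 < measure \<mu> (A i)" using measure_nonneg[of \<mu> "A i"] by linarith
    then have "1 - q i = (measure \<mu> (A i) - measure \<nu> (A i)) / measure \<mu> (A i)" unfolding q_def by (simp add: field_simps)
    then show ?thesis using close(1)[OF that] pos by (simp add: divide_le_eq)
  qed (use close(2) in \<open>simp add: q_def\<close>)
  have [measurable]: "g \<in> borel_measurable B" unfolding g_def[abs_def] using A by (intro borel_measurable_sum) auto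
  have g0: "0 \<le> g x" for x unfolding g_def by (intro sum_nonneg mult_nonneg_nonneg q0) auto
  have gA: "g x = q i" if "i \<in> I" "x \<in> A i" for x i
  proof -
    have "g x = (\<Sum>j\<in>I. if j = i then q i else 0)" unfolding g_def
      by (rule sum.cong) (use that disj in \<open>auto simp: disjoint_family_on_def split: split_indicator\<close>)
    then show ?thesis using that I by simp
  qed
  have gE: "g x = 0" if "x \<notin> E" for x using that unfolding g_def E_def by (intro sum.neutral) auto
  define \<nu>' where "\<nu>' = density \<mu> (\<lambda>x. ennreal (g x))"
  have [simp]: "sets \<nu>' = sets B" "space \<nu>' = \<Omega>" unfolding \<nu>'_def by auto
  have [measurable_cong]: "sets \<nu>' = sets B" by simp
  have em: "emeasure \<nu>' (A i) = ennreal (measure \<nu> (A i))" if "i \<in> I" for i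
  proof -
    have "emeasure \<nu>' (A i) = (\<integral>\<^sup>+x. ennreal (q i) * indicator (A i) x \<partial>\<mu>)"
      unfolding \<nu>'_def using that by (subst emeasure_density) (auto intro!: nn_integral_cong simp: gA split: split_indicator)
    also have "\<dots> = ennreal (q i) * ennreal (measure \<mu> (A i))"
      using that A by (simp add: nn_integral_cmult_indicator M.emeasure_eq_measure)
    finally show ?thesis using qm[OF that] q0[of i] by (simp add: ennreal_mult'[symmetric])
  qed
  have emE: "emeasure \<nu>' E = 1"
  proof -
    have "emeasure \<nu>' E = (\<Sum>i\<in>I. emeasure \<nu>' (A i))"
      unfolding E_def using I A disj by (intro sum_emeasure[symmetric]) auto
    also have "\<dots> = ennreal (\<Sum>i\<in>I. measure \<nu> (A i))" using em by simp
    also have "(\<Sum>i\<in>I. measure \<nu> (A i)) = measure \<nu> E"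
      unfolding E_def using I A disj by (intro N.finite_measure_finite_Union[symmetric]) auto
    finally show ?thesis using \<nu>E by (simp add: E_def)
  qed
  have emC: "emeasure \<nu>' (\<Omega> - E) = 0"
  proof -
    have "emeasure \<nu>' (\<Omega> - E) = (\<integral>\<^sup>+x. ennreal (g x) * indicator (\<Omega> - E) x \<partial>\<mu>)"
      unfolding \<nu>'_def by (subst emeasure_density) auto
    also have "\<dots> = (\<integral>\<^sup>+x. 0 \<partial>\<mu>)"
      by (intro nn_integral_cong) (simp add: gE split: split_indicator)
    finally show ?thesis by simp
  qed
  have EO: "E \<subseteq> \<Omega>" using sets.sets_into_space[OF E] by simp
  have pr: "prob_space \<nu>'"
  proof (rule prob_spaceI)
    have "emeasure \<nu>' (space \<nu>') = emeasure \<nu>' E + emeasure \<nu>' (\<Omega> - E)"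
      using EO by (subst plus_emeasure) (auto intro!: arg_cong2[where f=emeasure])
    then show "emeasure \<nu>' (space \<nu>') = 1" using emE emC by simp
  qed
  interpret N': prob_space \<nu>' by fact
  have gb: "g x \<le> 1 + \<tau>" for x
  proof (cases "x \<in> E")
    case True
    then obtain i where "i \<in> I" "x \<in> A i" unfolding E_def by auto
    then show ?thesis using q1[of i] gA[of i x] by auto
  qed (use gE close(2) in auto)
  have int: "integrable \<mu> (\<lambda>x. (d a x)\<^sup>2)" by (rule P2_integrable[OF \<mu> a])
  have \<nu>'P: "\<nu>' \<in> P2 S"
  proof (rule P2_I[OF _ _ pr a])
    have "integrable \<mu> (\<lambda>x. g x * (d a x)\<^sup>2)"
    proof (rule Bochner_Integration.integrable_bound)
      show "integrable \<mu> (\<lambda>x. (1 + \<tau>) * (d a x)\<^sup>2)" using int by simp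
      show "AE x in \<mu>. norm (g x * (d a x)\<^sup>2) \<le> norm ((1 + \<tau>) * (d a x)\<^sup>2)"
        using g0 gb close(2) by (intro AE_I2) (auto simp: abs_mult intro!: mult_right_mono)
    qed measurable
    then show "integrable \<nu>' (\<lambda>x. (d a x)\<^sup>2)"
      unfolding \<nu>'_def by (subst integrable_density) (auto simp: g0)
  qed auto
  \<comment> \<open>Outside the cells \<open>g\<close> vanishes, so |1 - g| is 1 there and yields
    the first term; on the cells it is at most \<tau> and yields the second.\<close>
  let ?r = "(\<integral>x. (d a x)\<^sup>2 * indicator (\<Omega> - E) x \<partial>\<mu>) + \<tau> * (\<integral>x. (d a x)\<^sup>2 \<partial>\<mu>)"
  have intC: "integrable \<mu> (\<lambda>x. (d a x)\<^sup>2 * indicator (\<Omega> - E) x)"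
    using int by (rule Bochner_Integration.integrable_bound) (auto intro!: AE_I2 split: split_indicator)
  have "W2 S \<mu> \<nu>' \<le> sqrt (2 * ?r)"
    unfolding \<nu>'_def
  proof (rule W2_density_le[OF \<mu> _ g0 _ a])
    show "prob_space (density \<mu> (\<lambda>x. ennreal (g x)))" using pr unfolding \<nu>'_def .
    have "(\<integral>\<^sup>+x. ennreal ((d a x)\<^sup>2 * \<bar>1 - g x\<bar>) \<partial>\<mu>) \<le> (\<integral>\<^sup>+x. ennreal ((d a x)\<^sup>2 * indicator (\<Omega> - E) x + \<tau> * (d a x)\<^sup>2) \<partial>\<mu>)"
    proof (intro nn_integral_mono ennreal_leI)
      fix x assume "x \<in> space \<mu>"
      show "(d a x)\<^sup>2 * \<bar>1 - g x\<bar> \<le> (d a x)\<^sup>2 * indicator (\<Omega> - E) x + \<tau> * (d a x)\<^sup>2"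
      proof (cases "x \<in> E")
        case True
        then obtain i where "i \<in> I" "x \<in> A i" unfolding E_def by auto
        then show ?thesis using q1[of i] gA[of i x] True by (simp add: mult.commute[of \<tau>] mult_left_mono)
      qed (use gE close(2) \<open>x \<in> space \<mu>\<close> in auto)
    qed
    also have "\<dots> = ennreal ?r"
      using int intC close(2) by (subst nn_integral_eq_integral) (auto intro!: AE_I2)
    finally show "(\<integral>\<^sup>+x. ennreal ((d a x)\<^sup>2 * \<bar>1 - g x\<bar>) \<partial>\<mu>) \<le> ennreal ?r" .
    show "0 \<le> ?r" using close(2) by (intro add_nonneg_nonneg integral_nonneg_AE AE_I2 mult_nonneg_nonneg) auto
  qed auto
  moreover have "W2 S \<nu>' \<nu> \<le> \<delta>"
  proof -
    obtain p where p [measurable]: "p \<in> B \<rightarrow>\<^sub>M count_space (UNIV :: nat set)"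
      and pA: "\<And>x i. i \<in> I \<Longrightarrow> x \<in> A i \<Longrightarrow> p x = Suc i" and p0: "\<And>x. x \<notin> (\<Union>i\<in>I. A i) \<Longrightarrow> p x = 0"
      using cells_index[OF I A disj] by blast
    have mC: "measure \<nu> (\<Omega> - E) = 0" using N.prob_compl[of E] \<nu>E by (simp add: E_def)
    show ?thesis
    proof (rule W2_same_cells_le[OF \<nu>'P \<nu> p _ E])
      fix j
      have "measure \<nu>' {x \<in> \<Omega>. p x = j} = measure \<nu> {x \<in> \<Omega>. p x = j}"
      proof (cases j)
        case 0
        then have "{x \<in> \<Omega>. p x = j} = \<Omega> - E" using p0 pA unfolding E_def by force
        then show ?thesis using mC emC by (simp add: measure_def)
      next
        case (Suc i)
        show ?thesis
        proof (cases "i \<in> I")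
          case True
          have "{x \<in> \<Omega>. p x = j} = A i"
          proof (intro equalityI subsetI)
            fix x assume "x \<in> {x \<in> \<Omega>. p x = j}"
            then have "p x = Suc i" using Suc by simp
            then obtain k where "k \<in> I" "x \<in> A k" using p0[of x] by auto
            then show "x \<in> A i" using pA[of k x] \<open>p x = Suc i\<close> by simp
          next
            fix x assume "x \<in> A i"
            then show "x \<in> {x \<in> \<Omega>. p x = j}" using pA[OF True] Suc EO True unfolding E_def by auto
          qed
          then show ?thesis using em[OF True] by (simp add: measure_def)
        next
          case False
          have "{x \<in> \<Omega>. p x = j} = {}"
          proof -
            have "p x \<noteq> Suc i" for x using p0[of x] pA False by (cases "x \<in> (\<Union>i\<in>I. A i)") auto
            then show ?thesis using Suc by auto
          qed
          then show ?thesis by (simp only: measure_empty)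
        qed
      qed
      then show "measure \<nu>' {x \<in> \<Omega>. p x = j} = measure \<nu> {x \<in> \<Omega>. p x = j}" .
    next
      show "measure \<nu>' E = 1" using emE by (simp add: measure_def)
      show "measure \<nu> E = 1" using \<nu>E by (simp add: E_def)
      fix x y assume "x \<in> E" "y \<in> E" "p x = p y"
      then obtain i j where "i \<in> I" "x \<in> A i" "j \<in> I" "y \<in> A j" unfolding E_def by auto
      then show "d x y \<le> \<delta>" using pA[of i x] pA[of j y] \<open>p x = p y\<close> diam by auto
    qed fact
  qed
  ultimately show ?thesis using W2_triangle[OF \<mu> \<nu>'P \<nu>] unfolding E_def by simp
qed

end

section \<open>Intermediate points\<close>

text \<open>This is the integrated form of \<open>intermediate_point_pointwise\<close>, with the
  bounds for the costs inserted. The terms quadratic in w cancel, because 2 (1 - t) t^2 + 2 t (1 -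
  t)^2 = 2 t (1 - t). For k \<le> w what remains is of order k w + k^2, and for w < k every term is
  of order k^2. The constant 200 is generous.\<close>

lemma intermediate_point_bound:
  fixes t w k :: real
  assumes t: "0 \<le> t" "t \<le> 1" and w: "0 \<le> w" and k: "0 < k"
  shows "2 * (1 - t) * (t * w + 2 * k)\<^sup>2 + 2 * t * ((1 - t) * w + 3 * k)\<^sup>2
    + (2 - 2 * t * (1 - t)) * (w + 5 * k)\<^sup>2 - 2 * (max 0 (w - k))\<^sup>2 \<le> 200 * k * (w + k)"
proof (cases "k \<le> w")
  case True
  have "2 * (1 - t) * (t * w + 2 * k)\<^sup>2 + 2 * t * ((1 - t) * w + 3 * k)\<^sup>2
    + (2 - 2 * t * (1 - t)) * (w + 5 * k)\<^sup>2 - 2 * (w - k)\<^sup>2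
    = 24 * (w * k) + (8 * (1 - t) + 18 * t + 48 - 50 * (t * (1 - t))) * k\<^sup>2"
    by (simp add: power2_eq_square algebra_simps)
  also have "\<dots> \<le> 24 * (w * k) + 200 * k\<^sup>2"
  proof -
    have "0 \<le> t * (1 - t)" using t by simp
    then have "8 * (1 - t) + 18 * t + 48 - 50 * (t * (1 - t)) \<le> 200" using t by argo
    then show ?thesis by (intro add_left_mono mult_right_mono) auto
  qed
  also have "\<dots> \<le> 200 * (w * k) + 200 * k\<^sup>2" using w k by simp
  finally show ?thesis using True by (simp add: power2_eq_square algebra_simps max_def)
next
  case False
  have tw: "t * w \<le> k" using False t w k by (metis less_eq_real_def linorder_not_le mult_left_le_one_le order_trans)
  have tw': "(1 - t) * w \<le> k" using False t w k mult_left_le_one_le[of w "1 - t"] by linarith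
  have "2 * (1 - t) * (t * w + 2 * k)\<^sup>2 \<le> 2 * 1 * (3 * k)\<^sup>2"
    using t w k tw by (intro mult_mono power_mono) auto
  moreover have "2 * t * ((1 - t) * w + 3 * k)\<^sup>2 \<le> 2 * 1 * (4 * k)\<^sup>2"
    using t w k tw' by (intro mult_mono power_mono) auto
  moreover have "(2 - 2 * t * (1 - t)) * (w + 5 * k)\<^sup>2 \<le> 2 * (6 * k)\<^sup>2"
    using t w k False by (intro mult_mono power_mono) auto
  ultimately have "2 * (1 - t) * (t * w + 2 * k)\<^sup>2 + 2 * t * ((1 - t) * w + 3 * k)\<^sup>2
    + (2 - 2 * t * (1 - t)) * (w + 5 * k)\<^sup>2 \<le> 122 * (k * k)"
    by (simp add: power2_eq_square)
  also have "\<dots> \<le> 200 * k * (w + k)" using w k by (simp add: algebra_simps)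
  finally show ?thesis using False by (simp add: max_def)
qed

text \<open>Write a - t D = ((1 - t) a - t b) + t (a + b - D) and use (u + v)^2 \<le> 2 u^2 + 2 v^2.
  The first square equals (1 - t) a^2 + t b^2 - t (1 - t) (a + b)^2, and (a + b - D)^2 \<le> (a +
  b)^2 - D^2 since D \<le> a + b. What matters is the negative sign of D^2, which lets a lower bound
  for the transport cost enter.\<close>

lemma intermediate_point_pointwise:
  fixes a b D t :: real
  assumes "0 \<le> t" "t \<le> 1" "0 \<le> D" "D \<le> a + b"
  shows "(a - t * D)\<^sup>2 \<le> 2 * (1 - t) * a\<^sup>2 + 2 * t * b\<^sup>2 + (2 - 2 * t * (1 - t)) * (a + b)\<^sup>2 - 2 * D\<^sup>2"
proof -
  have "(a - t * D)\<^sup>2 = (((1 - t) * a - t * b) + t * (a + b - D))\<^sup>2" by (simp add: algebra_simps)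
  also have "\<dots> \<le> 2 * ((1 - t) * a - t * b)\<^sup>2 + 2 * (t * (a + b - D))\<^sup>2"
    using zero_le_power2[of "((1 - t) * a - t * b) - t * (a + b - D)"] by (simp add: power2_eq_square algebra_simps)
  also have "(t * (a + b - D))\<^sup>2 \<le> (a + b)\<^sup>2 - D\<^sup>2"
  proof -
    have "t\<^sup>2 \<le> 1" using assms by (simp add: abs_square_le_1)
    then have "(t * (a + b - D))\<^sup>2 \<le> 1 * (a + b - D)\<^sup>2" unfolding power_mult_distrib by (intro mult_right_mono) auto
    also have "\<dots> = (a + b)\<^sup>2 - D\<^sup>2 - 2 * (D * (a + b - D))" by (simp add: power2_eq_square algebra_simps)
    also have "\<dots> \<le> (a + b)\<^sup>2 - D\<^sup>2" using assms by simp
    finally show ?thesis .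
  qed
  finally show ?thesis by (simp add: power2_eq_square algebra_simps)
qed

lemma numeral_mult_ennreal: "numeral v * ennreal x = ennreal (numeral v * x)"
  by (simp add: ennreal_mult')

context separable_metric
begin

text \<open>Almost optimal couplings of \<mu> with \<sigma> and of \<sigma> with \<nu> are glued,
  and the pointwise inequality is integrated with a = d X Z, b = d Z Y up to the cell diameter, and
  D = d X Y. If \<sigma> is almost a t-intermediate point of \<mu> and \<nu>, then Z lies in L2
  almost at the fraction t of the distance from X to Y.\<close>

lemma intermediate_point:
  assumes \<mu>: "\<mu> \<in> P2 S" and \<sigma>: "\<sigma> \<in> P2 S" and \<nu>: "\<nu> \<in> P2 S"
    and t: "0 \<le> t" "t \<le> 1" and w: "0 \<le> w" and k: "0 < k"
    and le: "W2 S \<mu> \<sigma> \<le> t * w + k" "W2 S \<sigma> \<nu> \<le> (1 - t) * w + k" "w - k \<le> W2 S \<mu> \<nu>"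
  obtains \<Gamma> :: "(('a \<times> 'a) \<times> ('a \<times> 'a)) measure" and X Y Z where "prob_space \<Gamma>"
    "X \<in> \<Gamma> \<rightarrow>\<^sub>M B" "Y \<in> \<Gamma> \<rightarrow>\<^sub>M B" "Z \<in> \<Gamma> \<rightarrow>\<^sub>M B"
    "distr \<Gamma> B X = \<mu>" "distr \<Gamma> B Z = \<sigma>" "distr \<Gamma> B Y = \<nu>"
    "(\<integral>\<^sup>+z. ennreal ((d (X z) (Z z) - t * d (X z) (Y z))\<^sup>2) \<partial>\<Gamma>) \<le> ennreal (200 * k * (w + k))"
proof -
  \<comment> \<open>One k is the tolerance in the assumption, the other makes the inequality strict
    so that a coupling of this cost exists. A further k is added to \<open>b\<close> for the cell
    diameter, which leads to q + k.\<close>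
  define p where "p = t * w + 2 * k"
  define q where "q = (1 - t) * w + 2 * k"
  have tw: "0 \<le> t * w" "0 \<le> (1 - t) * w" using t w by auto
  have pq: "0 < p" "0 < q" using k tw by (auto simp: p_def q_def)
  obtain \<gamma> where \<gamma>: "\<gamma> \<in> couplings S \<mu> \<sigma>" "(\<integral>\<^sup>+z. ennreal ((d (fst z) (snd z))\<^sup>2) \<partial>\<gamma>) \<le> ennreal (p\<^sup>2)"
    using W2_lessE[OF \<mu> \<sigma>, of p] le k by (auto simp: p_def)
  obtain \<gamma>' where \<gamma>': "\<gamma>' \<in> couplings S \<sigma> \<nu>" "(\<integral>\<^sup>+z. ennreal ((d (fst z) (snd z))\<^sup>2) \<partial>\<gamma>') \<le> ennreal (q\<^sup>2)"
    using W2_lessE[OF \<sigma> \<nu>, of q] le k by (auto simp: q_def)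
  obtain \<Gamma> where \<Gamma>: "sets \<Gamma> = sets ((B \<Otimes>\<^sub>M B) \<Otimes>\<^sub>M (B \<Otimes>\<^sub>M B))" "prob_space \<Gamma>"
    "distr \<Gamma> (B \<Otimes>\<^sub>M B) fst = \<gamma>" "distr \<Gamma> (B \<Otimes>\<^sub>M B) snd = \<gamma>'"
    "AE z in \<Gamma>. d (snd (fst z)) (fst (snd z)) \<le> k"
    using glue_couplings[OF \<gamma>(1) \<gamma>'(1) P2_D(3)[OF \<mu>] P2_D(3)[OF \<sigma>], of k] k by auto
  interpret prob_space \<Gamma> by fact
  note [measurable_cong] = \<Gamma>(1)
  have spG: "space \<Gamma> = (\<Omega> \<times> \<Omega>) \<times> (\<Omega> \<times> \<Omega>)"
    using sets_eq_imp_space_eq[OF \<Gamma>(1)] by (simp add: space_pair_measure)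
  define a where "a z = d (fst (fst z)) (snd (fst z))" for z :: "('a \<times> 'a) \<times> ('a \<times> 'a)"
  define b where "b z = d (fst (snd z)) (snd (snd z)) + k" for z :: "('a \<times> 'a) \<times> ('a \<times> 'a)"
  define D where "D z = d (fst (fst z)) (snd (snd z))" for z :: "('a \<times> 'a) \<times> ('a \<times> 'a)"
  have [measurable]: "a \<in> borel_measurable \<Gamma>" "b \<in> borel_measurable \<Gamma>" "D \<in> borel_measurable \<Gamma>"
    unfolding a_def[abs_def] b_def[abs_def] D_def[abs_def] by measurable
  have nn: "0 \<le> a z" "0 \<le> b z" "0 \<le> D z" for z using k by (auto simp: a_def b_def D_def)
  have 1: "(\<integral>\<^sup>+z. ennreal ((a z)\<^sup>2) \<partial>\<Gamma>) \<le> ennreal (p\<^sup>2)"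
    using \<gamma>(2) unfolding \<Gamma>(3)[symmetric] a_def by (subst (asm) nn_integral_distr) auto
  have 2: "(\<integral>\<^sup>+z. ennreal ((d (fst (snd z)) (snd (snd z)))\<^sup>2) \<partial>\<Gamma>) \<le> ennreal (q\<^sup>2)"
    using \<gamma>'(2) unfolding \<Gamma>(4)[symmetric] by (subst (asm) nn_integral_distr) auto
  have 3: "(\<integral>\<^sup>+z. ennreal (k\<^sup>2) \<partial>\<Gamma>) \<le> ennreal (k\<^sup>2)" by (simp add: emeasure_space_1)
  have 4: "(\<integral>\<^sup>+z. ennreal ((b z)\<^sup>2) \<partial>\<Gamma>) \<le> ennreal ((q + k)\<^sup>2)"
    unfolding b_def by (rule nn_integral_Minkowski[OF _ _ _ _ 2 3]) (use k pq in auto)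
  have 5: "(\<integral>\<^sup>+z. ennreal ((a z + b z)\<^sup>2) \<partial>\<Gamma>) \<le> ennreal ((p + (q + k))\<^sup>2)"
    by (rule nn_integral_Minkowski[OF _ _ _ _ 1 4]) (use nn k pq in auto)
  have D: "AE z in \<Gamma>. D z \<le> a z + b z"
  proof (rule AE_mp[OF \<Gamma>(5)], rule AE_I2, rule impI)
    fix z assume z: "z \<in> space \<Gamma>" and le: "d (snd (fst z)) (fst (snd z)) \<le> k"
    have "d (fst (fst z)) (snd (snd z)) \<le> d (fst (fst z)) (snd (fst z)) + d (snd (fst z)) (snd (snd z))"
      "d (snd (fst z)) (snd (snd z)) \<le> d (snd (fst z)) (fst (snd z)) + d (fst (snd z)) (snd (snd z))"
      using z by (auto simp: spG intro!: mdist_triangle)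
    then show "D z \<le> a z + b z" using le unfolding a_def b_def D_def by simp
  qed
  have int: "integrable \<Gamma> f \<and> (\<integral>z. f z \<partial>\<Gamma>) \<le> r" if "f \<in> borel_measurable \<Gamma>" "\<And>z. 0 \<le> f z" "(\<integral>\<^sup>+z. ennreal (f z) \<partial>\<Gamma>) \<le> ennreal r" "0 \<le> r" for f and r :: real
  proof
    show i: "integrable \<Gamma> f"
      by (rule integrableI_nonneg) (use that in \<open>auto intro: le_less_trans\<close>)
    show "(\<integral>z. f z \<partial>\<Gamma>) \<le> r"
      using that nn_integral_eq_integral[OF i] by simp
  qed
  have ia: "integrable \<Gamma> (\<lambda>z. (a z)\<^sup>2)" "(\<integral>z. (a z)\<^sup>2 \<partial>\<Gamma>) \<le> p\<^sup>2" using int[OF _ _ 1] by auto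
  have ib: "integrable \<Gamma> (\<lambda>z. (b z)\<^sup>2)" "(\<integral>z. (b z)\<^sup>2 \<partial>\<Gamma>) \<le> (q + k)\<^sup>2" using int[OF _ _ 4] by auto
  have iab: "integrable \<Gamma> (\<lambda>z. (a z + b z)\<^sup>2)" "(\<integral>z. (a z + b z)\<^sup>2 \<partial>\<Gamma>) \<le> (p + (q + k))\<^sup>2" using int[OF _ _ 5] by auto
  have iD: "integrable \<Gamma> (\<lambda>z. (D z)\<^sup>2)"
    by (rule Bochner_Integration.integrable_bound[OF iab(1)])
      (measurable, rule AE_mp[OF D], rule AE_I2, use nn in \<open>auto intro!: power_mono\<close>)
  have d1: "distr \<Gamma> B (\<lambda>z. fst (fst z)) = \<mu>" "distr \<Gamma> B (\<lambda>z. snd (fst z)) = \<sigma>" "distr \<Gamma> B (\<lambda>z. snd (snd z)) = \<nu>"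
  proof -
    have "distr (distr \<Gamma> (B \<Otimes>\<^sub>M B) fst) B fst = \<mu>" using \<Gamma>(3) couplings_D[OF \<gamma>(1)] by simp
    then show "distr \<Gamma> B (\<lambda>z. fst (fst z)) = \<mu>" by (simp add: distr_distr comp_def)
    have "distr (distr \<Gamma> (B \<Otimes>\<^sub>M B) fst) B snd = \<sigma>" using \<Gamma>(3) couplings_D[OF \<gamma>(1)] by simp
    then show "distr \<Gamma> B (\<lambda>z. snd (fst z)) = \<sigma>" by (simp add: distr_distr comp_def)
    have "distr (distr \<Gamma> (B \<Otimes>\<^sub>M B) snd) B snd = \<nu>" using \<Gamma>(4) couplings_D[OF \<gamma>'(1)] by simp
    then show "distr \<Gamma> B (\<lambda>z. snd (snd z)) = \<nu>" by (simp add: distr_distr comp_def)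
  qed
  have ID0: "0 \<le> (\<integral>z. (D z)\<^sup>2 \<partial>\<Gamma>)" by (intro integral_nonneg_AE AE_I2) auto
  \<comment> \<open>The outer two coordinates form a coupling of \<mu> and \<nu>, so their cost is
    at least the squared distance. The maximum with 0 covers w < k, where squaring w - k would not
    preserve the inequality.\<close>
  have lower: "(max 0 (w - k))\<^sup>2 \<le> (\<integral>z. (D z)\<^sup>2 \<partial>\<Gamma>)"
  proof -
    have "(\<integral>\<^sup>+z. ennreal ((d (fst (fst z)) (snd (snd z)))\<^sup>2) \<partial>\<Gamma>) \<le> ennreal ((sqrt (\<integral>z. (D z)\<^sup>2 \<partial>\<Gamma>))\<^sup>2)"
      using nn_integral_eq_integral[OF iD] ID0 by (simp add: D_def)
    from W2_le_distr[OF _ _ this] have "W2 S \<mu> \<nu> \<le> sqrt (\<integral>z. (D z)\<^sup>2 \<partial>\<Gamma>)"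
      unfolding d1 using ID0 by auto
    then have "max 0 (w - k) \<le> sqrt (\<integral>z. (D z)\<^sup>2 \<partial>\<Gamma>)" using le(3) ID0 by auto
    from power_mono[OF this, of 2] show ?thesis using ID0 by simp
  qed
  let ?F = "\<lambda>z. 2 * (1 - t) * (a z)\<^sup>2 + 2 * t * (b z)\<^sup>2 + (2 - 2 * t * (1 - t)) * (a z + b z)\<^sup>2 - 2 * (D z)\<^sup>2"
  have tt: "0 \<le> 2 - 2 * t * (1 - t)"
  proof -
    have "t * (1 - t) \<le> 1 * 1" using t by (intro mult_mono) auto
    then show ?thesis by simp
  qed
  have iF: "integrable \<Gamma> ?F" using ia(1) ib(1) iab(1) iD by auto
  have "(\<integral>\<^sup>+z. ennreal ((d (fst (fst z)) (snd (fst z)) - t * d (fst (fst z)) (snd (snd z)))\<^sup>2) \<partial>\<Gamma>) = (\<integral>\<^sup>+z. ennreal ((a z - t * D z)\<^sup>2) \<partial>\<Gamma>)"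
    by (simp add: a_def D_def)
  also have "\<dots> \<le> (\<integral>\<^sup>+z. ennreal (?F z) \<partial>\<Gamma>)"
    by (rule nn_integral_mono_AE, rule AE_mp[OF D], rule AE_I2, rule impI, rule ennreal_leI, rule intermediate_point_pointwise)
      (use nn t in auto)
  also have "\<dots> = ennreal (\<integral>z. ?F z \<partial>\<Gamma>)"
  proof (rule nn_integral_eq_integral[OF iF])
    show "AE z in \<Gamma>. 0 \<le> ?F z"
      by (rule AE_mp[OF D], rule AE_I2, rule impI, rule order_trans[OF zero_le_power2 intermediate_point_pointwise]) (use nn t in auto)
  qed
  also have "(\<integral>z. ?F z \<partial>\<Gamma>) = 2 * (1 - t) * (\<integral>z. (a z)\<^sup>2 \<partial>\<Gamma>) + 2 * t * (\<integral>z. (b z)\<^sup>2 \<partial>\<Gamma>)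
      + (2 - 2 * t * (1 - t)) * (\<integral>z. (a z + b z)\<^sup>2 \<partial>\<Gamma>) - 2 * (\<integral>z. (D z)\<^sup>2 \<partial>\<Gamma>)"
    using ia(1) ib(1) iab(1) iD by simp
  also have "\<dots> \<le> 2 * (1 - t) * p\<^sup>2 + 2 * t * (q + k)\<^sup>2 + (2 - 2 * t * (1 - t)) * (p + (q + k))\<^sup>2 - 2 * (max 0 (w - k))\<^sup>2"
    using t tt by (intro diff_mono add_mono mult_left_mono ia ib iab lower) auto
  also have "\<dots> \<le> 200 * k * (w + k)"
  proof -
    have 1: "q + k = (1 - t) * w + 3 * k" by (simp add: q_def)
    have 2: "p + ((1 - t) * w + 3 * k) = w + 5 * k" by (simp add: p_def algebra_simps)
    show ?thesis unfolding 1 2 unfolding p_def by (rule intermediate_point_bound[OF t w k])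
  qed
  finally have "(\<integral>\<^sup>+z. ennreal ((d (fst (fst z)) (snd (fst z)) - t * d (fst (fst z)) (snd (snd z)))\<^sup>2) \<partial>\<Gamma>) \<le> ennreal (200 * k * (w + k))"
    by (simp add: ennreal_leI)
  then show ?thesis
    by (intro that[of \<Gamma> "\<lambda>z. fst (fst z)" "\<lambda>z. snd (snd z)" "\<lambda>z. snd (fst z)"]) (use \<Gamma>(2) d1 in auto)
qed

section \<open>Uniform integrability of second moments at intermediate points\<close>

definition sq_tail :: "'a \<Rightarrow> real \<Rightarrow> 'a \<Rightarrow> real" where
  "sq_tail a r z = (if r < d a z then (d a z)\<^sup>2 else 0)"

lemma sq_tail_measurable [measurable]: "a \<in> \<Omega> \<Longrightarrow> sq_tail a r \<in> borel_measurable B"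
proof -
  assume "a \<in> \<Omega>"
  then have [measurable]: "d a \<in> borel_measurable B" by (rule d_point_measurable)
  show ?thesis unfolding sq_tail_def[abs_def] by measurable
qed

lemma sq_tail_nonneg: "0 \<le> sq_tail a r z" unfolding sq_tail_def by simp

lemma sq_tail_le: "sq_tail a r z \<le> (d a z)\<^sup>2" unfolding sq_tail_def by simp

lemma integrable_sq_tail: "\<mu> \<in> P2 S \<Longrightarrow> a \<in> \<Omega> \<Longrightarrow> integrable \<mu> (sq_tail a r)"
proof -
  assume \<mu>: "\<mu> \<in> P2 S" and a: "a \<in> \<Omega>"
  have [measurable_cong]: "sets \<mu> = sets B" using P2_D[OF \<mu>] by simp
  have [measurable]: "sq_tail a r \<in> borel_measurable B" using a by simp
  show "integrable \<mu> (sq_tail a r)"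
    by (rule Bochner_Integration.integrable_bound[OF P2_integrable[OF \<mu> a]])
      (auto intro!: AE_I2 simp: sq_tail_nonneg sq_tail_le)
qed

lemma sq_tail_tendsto:
  assumes \<mu>: "\<mu> \<in> P2 S" and a: "a \<in> \<Omega>"
  shows "(\<lambda>n. \<integral>z. sq_tail a (real n) z \<partial>\<mu>) \<longlonglongrightarrow> 0"
proof -
  have [measurable_cong]: "sets \<mu> = sets B" using P2_D[OF \<mu>] by simp
  have "(\<lambda>n. \<integral>z. sq_tail a (real n) z \<partial>\<mu>) \<longlonglongrightarrow> (\<integral>z. 0 \<partial>\<mu>)"
  proof (rule integral_dominated_convergence[where w="\<lambda>x. (d a x)\<^sup>2"])
    show "integrable \<mu> (\<lambda>x. (d a x)\<^sup>2)" by (rule P2_integrable[OF \<mu> a])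
    show "sq_tail a (real n) \<in> borel_measurable \<mu>" for n using sq_tail_measurable[OF a] by measurable
    show "AE x in \<mu>. (\<lambda>n. sq_tail a (real n) x) \<longlonglongrightarrow> 0"
    proof (rule AE_I2)
      fix x
      obtain N :: nat where N: "d a x < real N" using reals_Archimedean2 by blast
      have "\<forall>\<^sub>F n in sequentially. sq_tail a (real n) x = 0"
        using eventually_ge_at_top[of N] by eventually_elim (use N in \<open>auto simp: sq_tail_def\<close>)
      then show "(\<lambda>n. sq_tail a (real n) x) \<longlonglongrightarrow> 0" by (rule tendsto_eventually)
    qed
    show "AE x in \<mu>. norm (sq_tail a (real n) x) \<le> (d a x)\<^sup>2" for n
      by (rule AE_I2) (simp add: sq_tail_nonneg sq_tail_le)
  qed simp
  then show ?thesis by simp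
qed

text \<open>With e = |d x z - t d x y| the triangle inequality gives d a z \<le> 2 d a x + d a y +
  e. Taking r off each of the three distances to a on the right lowers the left side by 3 r, which
  for d a z > 6 r leaves more than half of it; hence the 6. Squaring twice the sum of three terms
  gives 4 * 3 * 4 = 48 and 4 * 3 = 12.\<close>

lemma intermediate_tail_pointwise:
  assumes "x \<in> \<Omega>" "y \<in> \<Omega>" "z \<in> \<Omega>" "a \<in> \<Omega>" and t: "0 \<le> t" "t \<le> 1" and r: "0 \<le> r"
  shows "sq_tail a (6 * r) z \<le> 48 * sq_tail a r x + 12 * sq_tail a r y + 12 * (d x z - t * d x y)\<^sup>2"
proof (cases "6 * r < d a z")
  case True
  define f where "f u = max 0 (d a u - r)" for u
  have f: "(f u)\<^sup>2 \<le> sq_tail a r u" for u using r unfolding f_def sq_tail_def by (auto simp: max_def intro!: power_mono)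
  define e where "e = \<bar>d x z - t * d x y\<bar>"
  have "d a z \<le> d a x + d x z" "d x y \<le> d a x + d a y"
    using assms mdist_triangle[of a S x z] mdist_triangle[of x S a y] by (auto simp: mdist_commute[of S x a])
  moreover have "t * d x y \<le> d x y" using t by (simp add: mult_left_le_one_le)
  ultimately have "d a z \<le> 2 * d a x + d a y + e" unfolding e_def by linarith
  moreover have "d a x - r \<le> f x" "d a y - r \<le> f y" unfolding f_def by auto
  ultimately have "d a z - 3 * r \<le> 2 * f x + f y + e" by linarith
  then have le: "d a z \<le> 2 * (2 * f x + f y + e)" using True by argo
  have "(d a z)\<^sup>2 \<le> (2 * (2 * f x + f y + e))\<^sup>2" by (rule power_mono[OF le]) simp
  also have "\<dots> \<le> 48 * (f x)\<^sup>2 + 12 * (f y)\<^sup>2 + 12 * e\<^sup>2"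
    using zero_le_power2[of "2 * f x - f y"] zero_le_power2[of "2 * f x - e"] zero_le_power2[of "f y - e"]
    by (simp add: power2_eq_square algebra_simps)
  also have "\<dots> \<le> 48 * sq_tail a r x + 12 * sq_tail a r y + 12 * e\<^sup>2" using f[of x] f[of y] by simp
  finally show ?thesis using True by (simp add: sq_tail_def e_def)
qed (use sq_tail_nonneg[of a r x] sq_tail_nonneg[of a r y] in \<open>simp add: sq_tail_def[of a "6 * r"]\<close>)

text \<open>The radius r and the tolerance k depend on \<mu>, \<nu> and e only, not on \<sigma> or
  t. Families of almost intermediate points thus have uniformly small tails, which is what turns
  setwise convergence into convergence in \<open>W2\<close>.\<close>

lemma intermediate_tail:
  assumes \<mu>: "\<mu> \<in> P2 S" and \<nu>: "\<nu> \<in> P2 S" and a: "a \<in> \<Omega>" and e: "0 < e"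
  obtains r k where "0 \<le> r" "0 < k"
    "\<And>\<sigma> t. \<sigma> \<in> P2 S \<Longrightarrow> 0 \<le> t \<Longrightarrow> t \<le> 1 \<Longrightarrow> W2 S \<mu> \<sigma> \<le> t * W2 S \<mu> \<nu> + k \<Longrightarrow> W2 S \<sigma> \<nu> \<le> (1 - t) * W2 S \<mu> \<nu> + k
      \<Longrightarrow> (\<integral>z. sq_tail a r z \<partial>\<sigma>) \<le> e"
proof -
  let ?w = "W2 S \<mu> \<nu>"
  \<comment> \<open>Each of the three terms of \<open>intermediate_tail_pointwise\<close> is
    allotted e / 3: 48 * e / 144 and 12 * e / 36 for the endpoints, and 12 times the L2 error for
    the rest.\<close>
  have "\<forall>\<^sub>F n in sequentially. (\<integral>z. sq_tail a (real n) z \<partial>\<mu>) < e / 144 \<and> (\<integral>z. sq_tail a (real n) z \<partial>\<nu>) < e / 36"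
    using e by (intro eventually_conj order_tendstoD[OF sq_tail_tendsto[OF \<mu> a]] order_tendstoD[OF sq_tail_tendsto[OF \<nu> a]]) auto
  then obtain n where n: "(\<integral>z. sq_tail a (real n) z \<partial>\<mu>) < e / 144" "(\<integral>z. sq_tail a (real n) z \<partial>\<nu>) < e / 36"
    using eventually_happens'[OF sequentially_bot] by blast
  have "((\<lambda>k. 12 * (200 * k * (?w + k))) \<longlongrightarrow> 12 * (200 * 0 * (?w + 0))) (at_right 0)"
    by (intro tendsto_intros)
  then have "\<forall>\<^sub>F k in at_right 0. 12 * (200 * k * (?w + k)) < e / 3 \<and> 0 < k"
    using e by (intro eventually_conj order_tendstoD(2) eventually_at_right_less) auto
  then obtain k where k: "12 * (200 * k * (?w + k)) < e / 3" "0 < k"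
    using eventually_happens'[OF trivial_limit_at_right_real] by blast
  show ?thesis
  proof (rule that[of "6 * real n" k])
    fix \<sigma> t assume \<sigma>: "\<sigma> \<in> P2 S" and t: "0 \<le> t" "t \<le> 1" and le: "W2 S \<mu> \<sigma> \<le> t * ?w + k" "W2 S \<sigma> \<nu> \<le> (1 - t) * ?w + k"
    have lw: "?w - k \<le> ?w" using k by simp
    obtain \<Gamma> :: "(('a \<times> 'a) \<times> ('a \<times> 'a)) measure" and X Y Z where \<Gamma>: "prob_space \<Gamma>"
      and [measurable]: "X \<in> \<Gamma> \<rightarrow>\<^sub>M B" "Y \<in> \<Gamma> \<rightarrow>\<^sub>M B" "Z \<in> \<Gamma> \<rightarrow>\<^sub>M B"
      and D: "distr \<Gamma> B X = \<mu>" "distr \<Gamma> B Z = \<sigma>" "distr \<Gamma> B Y = \<nu>"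
      and I: "(\<integral>\<^sup>+z. ennreal ((d (X z) (Z z) - t * d (X z) (Y z))\<^sup>2) \<partial>\<Gamma>) \<le> ennreal (200 * k * (?w + k))"
      using intermediate_point[OF \<mu> \<sigma> \<nu> t W2_nonneg k(2) le lw] by blast
    have [measurable]: "sq_tail a r \<in> borel_measurable B" for r using a by simp
    have in\<Omega>: "X z \<in> \<Omega>" "Y z \<in> \<Omega>" "Z z \<in> \<Omega>" if "z \<in> space \<Gamma>" for z
      using that measurable_space[of X \<Gamma> B z] measurable_space[of Y \<Gamma> B z] measurable_space[of Z \<Gamma> B z] by auto
    have ni: "(\<integral>\<^sup>+z. ennreal (sq_tail a r z) \<partial>\<rho>) = ennreal (\<integral>z. sq_tail a r z \<partial>\<rho>)" if "\<rho> \<in> P2 S" for \<rho> r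
      by (rule nn_integral_eq_integral[OF integrable_sq_tail[OF that a]]) (simp add: sq_tail_nonneg)
    have "ennreal (\<integral>z. sq_tail a (6 * real n) z \<partial>\<sigma>) = (\<integral>\<^sup>+z. ennreal (sq_tail a (6 * real n) (Z z)) \<partial>\<Gamma>)"
      unfolding ni[OF \<sigma>, symmetric] unfolding D(2)[symmetric] by (subst nn_integral_distr) auto
    also have "\<dots> \<le> (\<integral>\<^sup>+z. (48 * ennreal (sq_tail a (real n) (X z)) + 12 * ennreal (sq_tail a (real n) (Y z))) + 12 * ennreal ((d (X z) (Z z) - t * d (X z) (Y z))\<^sup>2) \<partial>\<Gamma>)"
    proof (rule nn_integral_mono)
      fix z assume "z \<in> space \<Gamma>"
      note z = in\<Omega>[OF this]
      have "ennreal (sq_tail a (6 * real n) (Z z)) \<le> ennreal (48 * sq_tail a (real n) (X z) + 12 * sq_tail a (real n) (Y z) + 12 * (d (X z) (Z z) - t * d (X z) (Y z))\<^sup>2)"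
        using z a t by (intro ennreal_leI intermediate_tail_pointwise) auto
      then show "ennreal (sq_tail a (6 * real n) (Z z)) \<le> (48 * ennreal (sq_tail a (real n) (X z)) + 12 * ennreal (sq_tail a (real n) (Y z))) + 12 * ennreal ((d (X z) (Z z) - t * d (X z) (Y z))\<^sup>2)"
        by (simp add: ennreal_plus ennreal_mult' sq_tail_nonneg)
    qed
    also have "\<dots> = (48 * (\<integral>\<^sup>+z. ennreal (sq_tail a (real n) (X z)) \<partial>\<Gamma>) + 12 * (\<integral>\<^sup>+z. ennreal (sq_tail a (real n) (Y z)) \<partial>\<Gamma>)) + 12 * (\<integral>\<^sup>+z. ennreal ((d (X z) (Z z) - t * d (X z) (Y z))\<^sup>2) \<partial>\<Gamma>)"
      by (simp add: nn_integral_add nn_integral_cmult)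
    also have "(\<integral>\<^sup>+z. ennreal (sq_tail a (real n) (X z)) \<partial>\<Gamma>) = (\<integral>\<^sup>+z. ennreal (sq_tail a (real n) z) \<partial>\<mu>)"
      unfolding D(1)[symmetric] by (subst nn_integral_distr) auto
    also have "(\<integral>\<^sup>+z. ennreal (sq_tail a (real n) (Y z)) \<partial>\<Gamma>) = (\<integral>\<^sup>+z. ennreal (sq_tail a (real n) z) \<partial>\<nu>)"
      unfolding D(3)[symmetric] by (subst nn_integral_distr) auto
    also have "(48 * (\<integral>\<^sup>+z. ennreal (sq_tail a (real n) z) \<partial>\<mu>) + 12 * (\<integral>\<^sup>+z. ennreal (sq_tail a (real n) z) \<partial>\<nu>)) + 12 * (\<integral>\<^sup>+z. ennreal ((d (X z) (Z z) - t * d (X z) (Y z))\<^sup>2) \<partial>\<Gamma>)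
      \<le> (48 * ennreal (e / 144) + 12 * ennreal (e / 36)) + 12 * ennreal (200 * k * (?w + k))"
      unfolding ni[OF \<mu>] ni[OF \<nu>] using n by (intro add_mono mult_left_mono I ennreal_leI) auto
    also have "\<dots> = ennreal (48 * (e / 144) + 12 * (e / 36) + 12 * (200 * k * (?w + k)))"
      unfolding numeral_mult_ennreal using e k(2) W2_nonneg[of \<mu> \<nu>] by (simp add: ennreal_plus[symmetric] del: ennreal_plus)
    also have "\<dots> \<le> ennreal e" using k(1) by (intro ennreal_leI) simp
    finally show "(\<integral>z. sq_tail a (6 * real n) z \<partial>\<sigma>) \<le> e" using e by (simp add: ennreal_le_iff)
  qed (use k in auto)
qed

end

section \<open>Entropy\<close>

lemma Ent_density:
  assumes m: "sigma_finite_measure m" and [measurable]: "\<rho> \<in> borel_measurable m" and \<rho>0: "\<And>x. 0 \<le> \<rho> x"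
  shows "Ent m (density m (\<lambda>x. ennreal (\<rho> x))) =
    enn2ereal (\<integral>\<^sup>+x. ennreal (\<rho> x * ln (\<rho> x)) \<partial>m) - enn2ereal (\<integral>\<^sup>+x. ennreal (- (\<rho> x * ln (\<rho> x))) \<partial>m)"
proof -
  interpret sigma_finite_measure m by fact
  let ?D = "RN_deriv m (density m (\<lambda>x. ennreal (\<rho> x)))"
  have ac: "absolutely_continuous m (density m (\<lambda>x. ennreal (\<rho> x)))"
    by (rule absolutely_continuousI_density) auto
  have "AE x in m. ennreal (\<rho> x) = ?D x" by (rule RN_deriv_unique) auto
  then have eq: "AE x in m. enn2real (?D x) = \<rho> x"
    by (rule eventually_mono) (metis \<rho>0 enn2real_ennreal)
  have 1: "AE x in m. ennreal (enn2real (?D x) * ln (enn2real (?D x))) = ennreal (\<rho> x * ln (\<rho> x))"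
    by (rule eventually_mono[OF eq]) (simp only:)
  have 2: "AE x in m. ennreal (- (enn2real (?D x) * ln (enn2real (?D x)))) = ennreal (- (\<rho> x * ln (\<rho> x)))"
    by (rule eventually_mono[OF eq]) (simp only:)
  show ?thesis unfolding Ent_def Let_def if_P[OF ac] nn_integral_cong_AE[OF 1] nn_integral_cong_AE[OF 2] ..
qed

lemma Ent_density_integrable:
  assumes "sigma_finite_measure m" "\<rho> \<in> borel_measurable m" "\<And>x. 0 \<le> \<rho> x"
    and i: "integrable m (\<lambda>x. \<rho> x * ln (\<rho> x))"
  shows "Ent m (density m (\<lambda>x. ennreal (\<rho> x))) = ereal (\<integral>x. \<rho> x * ln (\<rho> x) \<partial>m)"
proof -
  obtain r q where "0 \<le> r" "0 \<le> q"
    "(\<integral>\<^sup>+x. ennreal (\<rho> x * ln (\<rho> x)) \<partial>m) = ennreal r" "(\<integral>\<^sup>+x. ennreal (- (\<rho> x * ln (\<rho> x))) \<partial>m) = ennreal q"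
    "(\<integral>x. \<rho> x * ln (\<rho> x) \<partial>m) = r - q"
    by (rule integrableE[OF i])
  then show ?thesis unfolding Ent_density[OF assms(1-3)] by (simp add: enn2ereal_ennreal)
qed

lemma Ent_less_inftyE:
  assumes m: "sigma_finite_measure m" and \<mu>: "prob_space \<mu>" "sets \<mu> = sets m" and "Ent m \<mu> < \<infinity>"
  obtains \<rho> where "\<rho> \<in> borel_measurable m" "\<And>x. 0 \<le> \<rho> x" "\<mu> = density m (\<lambda>x. ennreal (\<rho> x))"
proof -
  interpret sigma_finite_measure m by fact
  interpret N: prob_space \<mu> by fact
  have ac: "absolutely_continuous m \<mu>" using assms(4) unfolding Ent_def by (auto split: if_splits)
  obtain D where D: "D \<in> borel_measurable m" "AE x in m. RN_deriv m \<mu> x = ennreal (D x)" "\<And>x. 0 \<le> D x"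
    using real_RN_deriv[OF N.finite_measure_axioms ac \<mu>(2)] by metis
  have "\<mu> = density m (RN_deriv m \<mu>)" using density_RN_deriv[OF ac \<mu>(2)] by simp
  also have "\<dots> = density m (\<lambda>x. ennreal (D x))" using D by (intro density_cong) auto
  finally show ?thesis using that D by blast
qed

text \<open>The left side is the tangent of the convex function r ln r taken at s, so this is
  convexity; the proof reduces it to ln u \<le> u - 1 with u = s / r. It is the pointwise form of
  the dual formula for the entropy.\<close>

lemma mult_ln_ge:
  fixes r s :: real
  assumes "0 \<le> r" "0 \<le> s" "r \<noteq> 0 \<Longrightarrow> 0 < s"
  shows "r * ln s + r - s \<le> r * ln r"
proof (cases "r = 0")
  case False
  then have rs: "0 < r" "0 < s" using assms by auto
  have "ln (s / r) \<le> s / r - 1" using rs by (intro ln_le_minus_one) auto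
  then have "r * (ln s - ln r) \<le> r * (s / r - 1)" using rs by (simp add: ln_div)
  also have "\<dots> = s - r" using rs by (simp add: field_simps)
  finally show ?thesis by (simp add: algebra_simps)
qed (use assms in auto)

text \<open>Integration of \<open>mult_ln_ge\<close> with s = \<theta> x. The function
  \<open>h\<close> is an integrable minorant of \<rho> ln \<rho>, so the negative part has finite
  integral and the difference in \<open>Ent\<close> is not of the form \<infinity> -
  \<infinity>.\<close>

lemma Ent_dual_density:
  assumes m: "sigma_finite_measure m" and [measurable]: "\<rho> \<in> borel_measurable m" and \<rho>0: "\<And>x. 0 \<le> \<rho> x"
    and \<mu>: "\<mu> = density m (\<lambda>x. ennreal (\<rho> x))" "prob_space \<mu>"
    and [measurable]: "\<theta> \<in> borel_measurable m" and \<theta>0: "\<And>x. x \<in> space m \<Longrightarrow> 0 \<le> \<theta> x" and pos: "AE x in \<mu>. 0 < \<theta> x"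
    and i: "integrable m \<theta>" "integrable \<mu> (\<lambda>x. ln (\<theta> x))"
  shows "Ent m \<mu> < \<infinity> \<Longrightarrow> integrable m (\<lambda>x. \<rho> x * ln (\<rho> x))"
    and "ereal ((\<integral>x. ln (\<theta> x) \<partial>\<mu>) + 1 - (\<integral>x. \<theta> x \<partial>m)) \<le> Ent m \<mu>"
proof -
  interpret prob_space \<mu> by fact
  have pos': "AE x in m. \<rho> x \<noteq> 0 \<longrightarrow> 0 < \<theta> x"
  proof -
    have "AE x in m. 0 < ennreal (\<rho> x) \<longrightarrow> 0 < \<theta> x"
      using pos unfolding \<mu>(1) by (subst (asm) AE_density) auto
    then show ?thesis by (rule AE_mp) (auto intro!: AE_I2 simp: less_le \<rho>0)
  qed
  define h where "h x = \<rho> x * ln (\<theta> x) + \<rho> x - \<theta> x" for x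
  have i1: "integrable m (\<lambda>x. \<rho> x * ln (\<theta> x))" using i(2) unfolding \<mu>(1)
    by (subst (asm) integrable_density) (auto simp: \<rho>0)
  have "integrable \<mu> (\<lambda>x. 1 :: real)" by simp
  then have i2: "integrable m \<rho>" unfolding \<mu>(1) by (subst (asm) integrable_density) (auto simp: \<rho>0)
  have ih: "integrable m h" unfolding h_def[abs_def] using i1 i2 i(1) by simp
  have hle: "AE x in m. h x \<le> \<rho> x * ln (\<rho> x)"
    by (rule AE_mp[OF pos'], rule AE_I2, rule impI) (auto simp: h_def \<rho>0 \<theta>0 intro!: mult_ln_ge)
  have inth: "(\<integral>x. h x \<partial>m) = (\<integral>x. ln (\<theta> x) \<partial>\<mu>) + 1 - (\<integral>x. \<theta> x \<partial>m)"
  proof -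
    have "(\<integral>x. \<rho> x \<partial>m) = (\<integral>x. 1 \<partial>\<mu>)" unfolding \<mu>(1) by (subst integral_density) (auto simp: \<rho>0)
    then have "(\<integral>x. \<rho> x \<partial>m) = 1" by (simp add: prob_space)
    moreover have "(\<integral>x. \<rho> x * ln (\<theta> x) \<partial>m) = (\<integral>x. ln (\<theta> x) \<partial>\<mu>)"
      unfolding \<mu>(1) by (subst integral_density) (auto simp: \<rho>0)
    ultimately show ?thesis unfolding h_def[abs_def] using i1 i2 i(1) by simp
  qed
  have neg: "(\<integral>\<^sup>+x. ennreal (- (\<rho> x * ln (\<rho> x))) \<partial>m) \<noteq> \<infinity>"
  proof -
    have "(\<integral>\<^sup>+x. ennreal (- (\<rho> x * ln (\<rho> x))) \<partial>m) \<le> (\<integral>\<^sup>+x. ennreal (- h x) \<partial>m)"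
      by (rule nn_integral_mono_AE, rule AE_mp[OF hle], rule AE_I2) (auto intro!: ennreal_leI)
    also have "\<dots> < \<infinity>" using ih unfolding real_integrable_def by (simp add: less_top)
    finally show ?thesis by simp
  qed
  have cases: "Ent m \<mu> = \<infinity> \<or> integrable m (\<lambda>x. \<rho> x * ln (\<rho> x))"
  proof (cases "(\<integral>\<^sup>+x. ennreal (\<rho> x * ln (\<rho> x)) \<partial>m) = \<infinity>")
    case True
    then have "Ent m \<mu> = \<infinity>" unfolding \<mu>(1) Ent_density[OF m assms(2) \<rho>0] using neg
      by (simp add: top_ereal_def minus_ereal_def enn2ereal_top)
    then show ?thesis ..
  next
    case False
    then show ?thesis using neg by (auto simp: real_integrable_def)
  qed
  then show "Ent m \<mu> < \<infinity> \<Longrightarrow> integrable m (\<lambda>x. \<rho> x * ln (\<rho> x))" by auto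
  show "ereal ((\<integral>x. ln (\<theta> x) \<partial>\<mu>) + 1 - (\<integral>x. \<theta> x \<partial>m)) \<le> Ent m \<mu>"
  proof (cases "Ent m \<mu> = \<infinity>")
    case False
    then have ii: "integrable m (\<lambda>x. \<rho> x * ln (\<rho> x))" using cases by auto
    have "(\<integral>x. h x \<partial>m) \<le> (\<integral>x. \<rho> x * ln (\<rho> x) \<partial>m)" by (rule integral_mono_AE[OF ih ii hle])
    then show ?thesis unfolding inth \<mu>(1) Ent_density_integrable[OF m assms(2) \<rho>0 ii] by simp
  qed simp
qed

text \<open>No density of \<mu> is mentioned any more: infinite entropy makes the bound trivial, and
  finite entropy provides a density. The later lower bounds for entropies are this inequality with a
  suitable \<theta>.\<close>

lemma Ent_dual:
  assumes m: "sigma_finite_measure m" and \<mu>: "prob_space \<mu>" "sets \<mu> = sets m"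
    and \<theta>: "\<theta> \<in> borel_measurable m" "\<And>x. x \<in> space m \<Longrightarrow> 0 \<le> \<theta> x" "AE x in \<mu>. 0 < \<theta> x"
    and i: "integrable m \<theta>" "integrable \<mu> (\<lambda>x. ln (\<theta> x))"
  shows "ereal ((\<integral>x. ln (\<theta> x) \<partial>\<mu>) + 1 - (\<integral>x. \<theta> x \<partial>m)) \<le> Ent m \<mu>"
proof (cases "Ent m \<mu> < \<infinity>")
  case True
  obtain \<rho> where \<rho>: "\<rho> \<in> borel_measurable m" "\<And>x. 0 \<le> \<rho> x" "\<mu> = density m (\<lambda>x. ennreal (\<rho> x))"
    using Ent_less_inftyE[OF m \<mu> True] by blast
  show ?thesis by (rule Ent_dual_density(2)[OF m \<rho>(1,2) \<rho>(3) \<mu>(1) \<theta> i])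
qed simp

section \<open>Transfer of measures along cells\<close>

text \<open>The mixture, with weights \<open>b i\<close>, of the normalised restrictions of
  \<open>m\<close> to the cells. Using the same weights with another reference measure is how a
  measure is carried from one space to another.\<close>

definition cell_measure :: "'a measure \<Rightarrow> nat set \<Rightarrow> (nat \<Rightarrow> 'a set) \<Rightarrow> (nat \<Rightarrow> real) \<Rightarrow> 'a measure" where
  "cell_measure m I A b = density m (\<lambda>x. ennreal (\<Sum>i\<in>I. b i / measure m (A i) * indicator (A i) x))"

lemma sum_indicator_cell:
  fixes f :: "nat \<Rightarrow> real"
  assumes "finite I" "disjoint_family_on A I" "i \<in> I" "x \<in> A i"
  shows "(\<Sum>i\<in>I. f i * indicator (A i) x) = f i"
proof -
  have "(\<Sum>j\<in>I. f j * indicator (A j) x) = (\<Sum>j\<in>I. if j = i then f i else 0)"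
    by (rule sum.cong) (use assms in \<open>auto simp: disjoint_family_on_def split: split_indicator\<close>)
  then show ?thesis using assms by simp
qed

locale cells =
  fixes m :: "'a measure" and I :: "nat set" and A :: "nat \<Rightarrow> 'a set" and b :: "nat \<Rightarrow> real"
  assumes m: "sigma_finite_measure m" and I: "finite I" and A [measurable]: "\<And>i. i \<in> I \<Longrightarrow> A i \<in> sets m"
    and disj: "disjoint_family_on A I"
    and pos: "\<And>i. i \<in> I \<Longrightarrow> 0 < measure m (A i)" and fin: "\<And>i. i \<in> I \<Longrightarrow> emeasure m (A i) < \<infinity>"
    and b0: "\<And>i. i \<in> I \<Longrightarrow> 0 \<le> b i" and b1: "(\<Sum>i\<in>I. b i) = 1"
begin

abbreviation "\<rho> x \<equiv> \<Sum>i\<in>I. b i / measure m (A i) * indicator (A i) x"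

lemma \<rho>_measurable [measurable]: "\<rho> \<in> borel_measurable m"
  using A by (intro borel_measurable_sum) auto

lemma \<rho>_nonneg: "0 \<le> \<rho> x"
  using b0 by (intro sum_nonneg mult_nonneg_nonneg divide_nonneg_nonneg) auto

lemma \<rho>_cell: "i \<in> I \<Longrightarrow> x \<in> A i \<Longrightarrow> \<rho> x = b i / measure m (A i)"
  by (rule sum_indicator_cell[OF I disj])

lemma \<rho>_outside: "x \<notin> (\<Union>i\<in>I. A i) \<Longrightarrow> \<rho> x = 0"
  by (intro sum.neutral) auto

lemma sets_cell_measure [simp]: "sets (cell_measure m I A b) = sets m"
  unfolding cell_measure_def by simp

lemma emeasure_cell: "i \<in> I \<Longrightarrow> emeasure (cell_measure m I A b) (A i) = ennreal (b i)"
proof -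
  assume i: "i \<in> I"
  have "emeasure (cell_measure m I A b) (A i) = (\<integral>\<^sup>+x. ennreal (\<rho> x) * indicator (A i) x \<partial>m)"
    unfolding cell_measure_def using i by (intro emeasure_density) auto
  also have "\<dots> = (\<integral>\<^sup>+x. ennreal (b i / measure m (A i)) * indicator (A i) x \<partial>m)"
  proof (rule nn_integral_cong)
    fix x show "ennreal (\<rho> x) * indicator (A i) x = ennreal (b i / measure m (A i)) * indicator (A i) x"
    proof (cases "x \<in> A i")
      case True show ?thesis by (simp only: \<rho>_cell[OF i True])
    next
      case False then show ?thesis by simp
    qed
  qed
  also have "\<dots> = ennreal (b i / measure m (A i)) * ennreal (measure m (A i))"
    using i fin[OF i] by (simp add: nn_integral_cmult_indicator emeasure_eq_ennreal_measure)
  also have "\<dots> = ennreal (b i)" using pos[OF i] b0[OF i] by (simp add: ennreal_mult'[symmetric])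
  finally show ?thesis .
qed

lemma emeasure_Union: "emeasure (cell_measure m I A b) (\<Union>i\<in>I. A i) = 1"
proof -
  have "emeasure (cell_measure m I A b) (\<Union>i\<in>I. A i) = (\<Sum>i\<in>I. emeasure (cell_measure m I A b) (A i))"
    using I A disj by (intro sum_emeasure[symmetric]) auto
  also have "\<dots> = (\<Sum>i\<in>I. ennreal (b i))" by (intro sum.cong refl emeasure_cell)
  also have "\<dots> = ennreal (\<Sum>i\<in>I. b i)" using b0 by (intro sum_ennreal) auto
  finally show ?thesis using b1 by simp
qed

lemma Union_sets: "(\<Union>i\<in>I. A i) \<in> sets m" using I A by auto

lemma prob_space_cell_measure: "prob_space (cell_measure m I A b)"
proof (rule prob_spaceI)
  define E where "E = (\<Union>i\<in>I. A i)"
  have [measurable]: "E \<in> sets m" unfolding E_def by (rule Union_sets)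
  have EO: "E \<union> (space m - E) = space m" using sets.sets_into_space[of E m] by auto
  have "emeasure (cell_measure m I A b) (space m - E) = (\<integral>\<^sup>+x. ennreal (\<rho> x) * indicator (space m - E) x \<partial>m)"
    unfolding cell_measure_def by (rule emeasure_density) auto
  also have "\<dots> = (\<integral>\<^sup>+x. 0 \<partial>m)"
  proof (rule nn_integral_cong)
    fix x show "ennreal (\<rho> x) * indicator (space m - E) x = 0"
    proof (cases "x \<in> E")
      case False then show ?thesis unfolding \<rho>_outside[OF False[unfolded E_def]] by simp
    qed simp
  qed
  finally have 0: "emeasure (cell_measure m I A b) (space m - E) = 0" by simp
  have "emeasure (cell_measure m I A b) E + emeasure (cell_measure m I A b) (space m - E) = emeasure (cell_measure m I A b) (E \<union> (space m - E))"
    by (rule plus_emeasure) auto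
  then have "emeasure (cell_measure m I A b) (space m) = 1"
    unfolding EO 0 using emeasure_Union unfolding E_def by simp
  then show "emeasure (cell_measure m I A b) (space (cell_measure m I A b)) = 1"
    by (simp add: cell_measure_def)
qed

text \<open>The density is constant on every cell. The entropy therefore sees the reference measure
  only through the masses of the cells, and is stable when these masses change little.\<close>

lemma Ent_cell_measure: "Ent m (cell_measure m I A b) = ereal (\<Sum>i\<in>I. b i * ln (b i / measure m (A i)))"
proof -
  have eq: "\<rho> x * ln (\<rho> x) = (\<Sum>i\<in>I. b i / measure m (A i) * ln (b i / measure m (A i)) * indicator (A i) x)" for x
  proof (cases "x \<in> (\<Union>i\<in>I. A i)")
    case True
    then obtain i where i: "i \<in> I" "x \<in> A i" by auto
    show ?thesis unfolding sum_indicator_cell[OF I disj i] ..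
  next
    case False
    have "(\<Sum>i\<in>I. b i / measure m (A i) * ln (b i / measure m (A i)) * indicator (A i) x) = 0"
      using False by (intro sum.neutral) auto
    then show ?thesis unfolding \<rho>_outside[OF False] by (simp only: mult_zero_left)
  qed
  have hb: "has_bochner_integral m (\<lambda>x. b i / measure m (A i) * ln (b i / measure m (A i)) * indicator (A i) x)
      (b i / measure m (A i) * ln (b i / measure m (A i)) * measure m (A i))" if "i \<in> I" for i
    using that fin[OF that] by (intro has_bochner_integral_mult_right has_bochner_integral_real_indicator) auto
  have "has_bochner_integral m (\<lambda>x. \<rho> x * ln (\<rho> x)) (\<Sum>i\<in>I. b i / measure m (A i) * ln (b i / measure m (A i)) * measure m (A i))"
    unfolding eq by (rule has_bochner_integral_sum) (rule hb)
  moreover have "(\<Sum>i\<in>I. b i / measure m (A i) * ln (b i / measure m (A i)) * measure m (A i)) = (\<Sum>i\<in>I. b i * ln (b i / measure m (A i)))"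
  proof (rule sum.cong)
    fix i assume "i \<in> I"
    then have "measure m (A i) \<noteq> 0" using pos[of i] by simp
    then show "b i / measure m (A i) * ln (b i / measure m (A i)) * measure m (A i) = b i * ln (b i / measure m (A i))"
      by simp
  qed simp
  ultimately have *: "has_bochner_integral m (\<lambda>x. \<rho> x * ln (\<rho> x)) (\<Sum>i\<in>I. b i * ln (b i / measure m (A i)))" by (simp only:)
  show ?thesis unfolding cell_measure_def Ent_density_integrable[OF m \<rho>_measurable \<rho>_nonneg has_bochner_integral_iff[THEN iffD1, OF *, THEN conjunct1]]
    has_bochner_integral_integral_eq[OF *] ..
qed

end

section \<open>Gaussian weights and lower bounds for the entropy\<close>

context separable_metric
begin

text \<open>The reference weight for the dual formula. Its logarithm is quadratic in the distance,
  hence integrable for every member of \<open>P2\<close>, and the weight itself has finite integral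
  when balls grow at most like exp (C r^2) and c is large.\<close>

definition gauss :: "real \<Rightarrow> 'a \<Rightarrow> 'a \<Rightarrow> real" where
  "gauss c a x = exp (- c * (d a x)\<^sup>2)"

lemma gauss_measurable [measurable]: "a \<in> \<Omega> \<Longrightarrow> gauss c a \<in> borel_measurable B"
proof -
  assume "a \<in> \<Omega>"
  then have [measurable]: "d a \<in> borel_measurable B" by (rule d_point_measurable)
  show ?thesis unfolding gauss_def[abs_def] by measurable
qed

lemma gauss_pos: "0 < gauss c a x" unfolding gauss_def by simp

lemma gauss_le_1: "0 \<le> c \<Longrightarrow> gauss c a x \<le> 1" unfolding gauss_def by simp

lemma ln_gauss: "ln (gauss c a x) = - c * (d a x)\<^sup>2" unfolding gauss_def by simp

lemma gauss_mono: "c \<le> c' \<Longrightarrow> gauss c' a x \<le> gauss c a x"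
  unfolding gauss_def by (simp add: mult_right_mono)

lemma integrable_gauss_mono:
  assumes "sets m = sets B" "a \<in> \<Omega>" "integrable m (gauss c a)" "c \<le> c'"
  shows "integrable m (gauss c' a)"
proof -
  note [measurable_cong] = assms(1)
  have [measurable]: "gauss c' a \<in> borel_measurable B" using assms by simp
  show ?thesis
    by (rule Bochner_Integration.integrable_bound[OF assms(3)])
      (auto intro!: AE_I2 gauss_mono simp: less_imp_le[OF gauss_pos] assms)
qed

text \<open>The dual formula with the Gaussian multiplied by 1 + L on A. If A has small Gaussian
  mass, L may be taken large, and the bound for the mass of A is then of order 1 / ln (1 + L).
  Bounded entropy and bounded second moment thus imply absolute continuity uniformly in
  \<sigma>.\<close>

lemma Ent_uniform_absolute_continuity:
  assumes m: "sigma_finite_measure m" "sets m = sets B" and a: "a \<in> \<Omega>" and i: "integrable m (gauss c a)"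
    and \<sigma>: "\<sigma> \<in> P2 S" and h: "Ent m \<sigma> \<le> ereal h" and A [measurable]: "A \<in> sets B" and L: "0 \<le> L"
  shows "measure \<sigma> A * ln (1 + L) \<le> h + c * (\<integral>x. (d a x)\<^sup>2 \<partial>\<sigma>) + (\<integral>x. gauss c a x \<partial>m) + L * (\<integral>x. gauss c a x * indicator A x \<partial>m)"
proof -
  note [simp] = P2_D(1,2)[OF \<sigma>]
  interpret prob_space \<sigma> using P2_D[OF \<sigma>] by simp
  have [measurable_cong]: "sets \<sigma> = sets B" "sets m = sets B" using m by simp_all
  have [measurable]: "gauss c a \<in> borel_measurable B" "d a \<in> borel_measurable B" using a d_point_measurable by simp_all
  define \<theta> where "\<theta> x = gauss c a x + L * (gauss c a x * indicator A x)" for x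
  have iA: "integrable m (\<lambda>x. gauss c a x * indicator A x)"
    by (rule integrable_real_mult_indicator) (use i A m in auto)
  have ln\<theta>: "ln (\<theta> x) = - c * (d a x)\<^sup>2 + ln (1 + L) * indicator A x" for x
  proof -
    have th: "\<theta> x = gauss c a x * (1 + L * indicator A x)" unfolding \<theta>_def by (simp add: algebra_simps)
    have "ln (\<theta> x) = ln (gauss c a x) + ln (1 + L * indicator A x)"
      unfolding th using gauss_pos[of c a x] L by (subst ln_mult) (auto split: split_indicator)
    then show ?thesis by (simp add: ln_gauss split: split_indicator)
  qed
  have id: "integrable \<sigma> (\<lambda>x. (d a x)\<^sup>2)" by (rule P2_integrable[OF \<sigma> a])
  have iI: "integrable \<sigma> (indicator A :: 'a \<Rightarrow> real)" by (rule integrable_real_indicator) (auto simp: emeasure_eq_measure)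
  have "ereal ((\<integral>x. ln (\<theta> x) \<partial>\<sigma>) + 1 - (\<integral>x. \<theta> x \<partial>m)) \<le> Ent m \<sigma>"
  proof (rule Ent_dual[OF m(1)])
    show "\<theta> \<in> borel_measurable m" unfolding \<theta>_def[abs_def] by measurable
    show "0 \<le> \<theta> x" for x using gauss_pos[of c a x] L unfolding \<theta>_def by simp
    show "AE x in \<sigma>. 0 < \<theta> x" using gauss_pos[of c a] L unfolding \<theta>_def by (intro AE_I2) (simp add: add_pos_nonneg less_imp_le)
    show "integrable m \<theta>" unfolding \<theta>_def[abs_def] using i iA by simp
    show "integrable \<sigma> (\<lambda>x. ln (\<theta> x))" unfolding ln\<theta> using id iI by simp
  qed (use m in \<open>auto simp: prob_space_axioms\<close>)
  then have "ereal ((\<integral>x. ln (\<theta> x) \<partial>\<sigma>) + 1 - (\<integral>x. \<theta> x \<partial>m)) \<le> ereal h" using h by (rule order_trans)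
  moreover have "(\<integral>x. ln (\<theta> x) \<partial>\<sigma>) = - c * (\<integral>x. (d a x)\<^sup>2 \<partial>\<sigma>) + ln (1 + L) * measure \<sigma> A"
    unfolding ln\<theta> using id iI sets.sets_into_space[OF A] by (simp add: Int_absorb2)
  moreover have "(\<integral>x. \<theta> x \<partial>m) = (\<integral>x. gauss c a x \<partial>m) + L * (\<integral>x. gauss c a x * indicator A x \<partial>m)"
    unfolding \<theta>_def[abs_def] using i iA by simp
  ultimately show ?thesis by (simp add: algebra_simps)
qed

text \<open>The dual formula with \<theta> equal to b i / m (A i) on the cells and to the Gaussian
  outside; it expresses that averaging a density over cells does not raise the entropy. Replacing
  the masses under \<open>m\<close> by those under \<open>m'\<close> costs \<tau> and makes the sum
  the entropy of the transferred measure. The factor \<beta> appears because the weights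
  \<open>b\<close> are normalised, whereas \<sigma> has only the mass \<beta> on the cells.\<close>

lemma Ent_cells_ge:
  fixes I :: "nat set"
  assumes m: "sigma_finite_measure m" "sets m = sets B" and a: "a \<in> \<Omega>" and ig: "integrable m (gauss c a)"
    and I: "finite I" and A [measurable]: "\<And>i. i \<in> I \<Longrightarrow> A i \<in> sets B" and disj: "disjoint_family_on A I"
    and pos: "\<And>i. i \<in> I \<Longrightarrow> 0 < measure m (A i)" and fin: "\<And>i. i \<in> I \<Longrightarrow> emeasure m (A i) < \<infinity>"
    and pos': "\<And>i. i \<in> I \<Longrightarrow> 0 < measure m' (A i)"
    and close: "\<And>i. i \<in> I \<Longrightarrow> \<bar>ln (measure m (A i)) - ln (measure m' (A i))\<bar> \<le> \<tau>"
    and \<sigma>: "\<sigma> \<in> P2 S" and \<beta>: "\<beta> = measure \<sigma> (\<Union>i\<in>I. A i)" "0 < \<beta>" and b: "\<And>i. b i = measure \<sigma> (A i) / \<beta>"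
  shows "ereal (\<beta> * ((\<Sum>i\<in>I. b i * ln (b i / measure m' (A i))) - \<tau>)
      - c * (\<integral>x. (d a x)\<^sup>2 * indicator (\<Omega> - (\<Union>i\<in>I. A i)) x \<partial>\<sigma>)
      - (\<integral>x. gauss c a x * indicator (\<Omega> - (\<Union>i\<in>I. A i)) x \<partial>m)) \<le> Ent m \<sigma>"
proof -
  note [simp] = P2_D(1,2)[OF \<sigma>]
  interpret prob_space \<sigma> using P2_D[OF \<sigma>] by simp
  have [measurable_cong]: "sets \<sigma> = sets B" "sets m = sets B" using m by simp_all
  have spm: "space m = \<Omega>" using sets_eq_imp_space_eq[OF m(2)] by simp
  have [measurable]: "gauss c a \<in> borel_measurable B" "d a \<in> borel_measurable B" using a d_point_measurable by simp_all
  define E where "E = (\<Union>i\<in>I. A i)"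
  have [measurable]: "E \<in> sets B" unfolding E_def using I A by auto
  define q where "q i = b i / measure m (A i)" for i
  define \<theta> where "\<theta> x = (\<Sum>i\<in>I. q i * indicator (A i) x) + gauss c a x * indicator (\<Omega> - E) x" for x
  have b0: "0 \<le> b i" for i using \<beta>(2) by (simp add: b)
  have q0: "0 \<le> q i" for i using b0[of i] unfolding q_def by simp
  have sumb: "(\<Sum>i\<in>I. b i) = 1"
  proof -
    have "(\<Sum>i\<in>I. measure \<sigma> (A i)) = measure \<sigma> (\<Union>i\<in>I. A i)"
      using I A disj by (intro finite_measure_finite_Union[symmetric]) auto
    then show ?thesis using \<beta> by (simp add: b sum_divide_distrib[symmetric])
  qed
  have \<theta>A: "\<theta> x = q i" if "i \<in> I" "x \<in> A i" for x i
  proof -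
    have "x \<in> E" using that unfolding E_def by auto
    then show ?thesis unfolding \<theta>_def sum_indicator_cell[OF I disj that] by simp
  qed
  have sum0: "(\<Sum>i\<in>I. f i * indicator (A i) x) = (0::real)" if "x \<notin> E" for x f
    using that unfolding E_def by (intro sum.neutral) auto
  have ln\<theta>: "ln (\<theta> x) = (\<Sum>i\<in>I. ln (q i) * indicator (A i) x) + - c * ((d a x)\<^sup>2 * indicator (\<Omega> - E) x)" if "x \<in> \<Omega>" for x
  proof (cases "x \<in> E")
    case True
    then obtain i where i: "i \<in> I" "x \<in> A i" unfolding E_def by auto
    show ?thesis unfolding \<theta>A[OF i] sum_indicator_cell[OF I disj i] using True by simp
  next
    case False
    show ?thesis unfolding \<theta>_def sum0[OF False] using that False by (simp add: ln_gauss)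
  qed
  have id: "integrable \<sigma> (\<lambda>x. (d a x)\<^sup>2 * indicator (\<Omega> - E) x)"
    by (rule integrable_real_mult_indicator) (use P2_integrable[OF \<sigma> a] in auto)
  have ig': "integrable m (\<lambda>x. gauss c a x * indicator (\<Omega> - E) x)"
    by (rule integrable_real_mult_indicator) (use ig spm in auto)
  have hb\<sigma>: "has_bochner_integral \<sigma> (\<lambda>x. \<Sum>i\<in>I. ln (q i) * indicator (A i) x) (\<Sum>i\<in>I. ln (q i) * measure \<sigma> (A i))"
    by (intro has_bochner_integral_sum has_bochner_integral_mult_right has_bochner_integral_real_indicator) (auto simp: emeasure_eq_measure)
  have hbm: "has_bochner_integral m (\<lambda>x. \<Sum>i\<in>I. q i * indicator (A i) x) (\<Sum>i\<in>I. q i * measure m (A i))"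
    using fin by (intro has_bochner_integral_sum has_bochner_integral_mult_right has_bochner_integral_real_indicator) auto
  have sq: "(\<Sum>i\<in>I. q i * measure m (A i)) = 1"
  proof -
    have "(\<Sum>i\<in>I. q i * measure m (A i)) = (\<Sum>i\<in>I. b i)" using pos unfolding q_def by (intro sum.cong) (auto simp: less_le)
    then show ?thesis using sumb by simp
  qed
  have i\<theta>: "has_bochner_integral m \<theta> (1 + (\<integral>x. gauss c a x * indicator (\<Omega> - E) x \<partial>m))"
    unfolding \<theta>_def[abs_def] using hbm ig' unfolding sq by (intro has_bochner_integral_add) (auto simp: has_bochner_integral_iff)
  have iln: "has_bochner_integral \<sigma> (\<lambda>x. ln (\<theta> x)) ((\<Sum>i\<in>I. ln (q i) * measure \<sigma> (A i)) + - c * (\<integral>x. (d a x)\<^sup>2 * indicator (\<Omega> - E) x \<partial>\<sigma>))"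
  proof -
    have "has_bochner_integral \<sigma> (\<lambda>x. (\<Sum>i\<in>I. ln (q i) * indicator (A i) x) + - c * ((d a x)\<^sup>2 * indicator (\<Omega> - E) x))
      ((\<Sum>i\<in>I. ln (q i) * measure \<sigma> (A i)) + - c * (\<integral>x. (d a x)\<^sup>2 * indicator (\<Omega> - E) x \<partial>\<sigma>))"
      using id by (intro has_bochner_integral_add hb\<sigma> has_bochner_integral_mult_right) (simp add: has_bochner_integral_iff)
    then show ?thesis by (subst has_bochner_integral_cong[OF refl _ refl, of \<sigma>]) (use ln\<theta> in auto)
  qed
  have "ereal ((\<integral>x. ln (\<theta> x) \<partial>\<sigma>) + 1 - (\<integral>x. \<theta> x \<partial>m)) \<le> Ent m \<sigma>"
  proof (rule Ent_dual[OF m(1)])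
    show "\<theta> \<in> borel_measurable m" using i\<theta> by (rule borel_measurable_has_bochner_integral)
    show "0 \<le> \<theta> x" for x using gauss_pos[of c a x] q0 unfolding \<theta>_def by (auto intro!: add_nonneg_nonneg sum_nonneg)
    \<comment> \<open>On a cell with b i = 0 the function \<theta> vanishes, but such a cell has
      \<sigma>-measure 0.\<close>
    show "AE x in \<sigma>. 0 < \<theta> x"
    proof -
      have "AE x in \<sigma>. \<forall>i\<in>I. x \<in> A i \<longrightarrow> b i \<noteq> 0"
      proof (intro AE_finite_allI I)
        fix i assume "i \<in> I"
        show "AE x in \<sigma>. x \<in> A i \<longrightarrow> b i \<noteq> 0"
        proof (cases "b i = 0")
          case True
          then have "emeasure \<sigma> (A i) = 0" using \<beta>(2) by (simp add: b emeasure_eq_measure)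
          then have "A i \<in> null_sets \<sigma>" using A[OF \<open>i \<in> I\<close>] by (simp add: null_sets_def)
          from AE_not_in[OF this] show ?thesis by (rule eventually_mono) simp
        qed simp
      qed
      then show ?thesis
      proof (rule AE_mp, intro AE_I2 impI)
        fix x assume x: "x \<in> space \<sigma>" "\<forall>i\<in>I. x \<in> A i \<longrightarrow> b i \<noteq> 0"
        show "0 < \<theta> x"
        proof (cases "x \<in> E")
          case True
          then obtain i where i: "i \<in> I" "x \<in> A i" unfolding E_def by auto
          then have "0 < b i" using x b0[of i] by (auto simp: less_le)
          then show ?thesis unfolding \<theta>A[OF i] q_def using pos[OF i(1)] by simp
        next
          case False
          then show ?thesis unfolding \<theta>_def sum0[OF False] using x gauss_pos[of c a x] by simp
        qed
      qed
    qed
    show "integrable m \<theta>" using i\<theta> by (simp add: has_bochner_integral_iff)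
    show "integrable \<sigma> (\<lambda>x. ln (\<theta> x))" using iln by (simp add: has_bochner_integral_iff)
  qed (use m in \<open>auto simp: prob_space_axioms\<close>)
  then have le: "ereal ((\<Sum>i\<in>I. ln (q i) * measure \<sigma> (A i)) - c * (\<integral>x. (d a x)\<^sup>2 * indicator (\<Omega> - E) x \<partial>\<sigma>)
     - (\<integral>x. gauss c a x * indicator (\<Omega> - E) x \<partial>m)) \<le> Ent m \<sigma>"
    unfolding has_bochner_integral_integral_eq[OF i\<theta>] has_bochner_integral_integral_eq[OF iln] by (simp add: algebra_simps)
  have "\<beta> * ((\<Sum>i\<in>I. b i * ln (b i / measure m' (A i))) - \<tau>) \<le> (\<Sum>i\<in>I. ln (q i) * measure \<sigma> (A i))"
  proof -
    have "b i * ln (b i / measure m' (A i)) - b i * \<tau> \<le> b i * ln (q i)" if i: "i \<in> I" for i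
    proof (cases "b i = 0")
      case False
      then have bi: "0 < b i" using b0[of i] by simp
      have "ln (b i / measure m' (A i)) - \<tau> \<le> ln (q i)"
        using close[OF i] bi pos[OF i] pos'[OF i] unfolding q_def by (simp add: ln_div)
      then have "b i * (ln (b i / measure m' (A i)) - \<tau>) \<le> b i * ln (q i)" using bi by (intro mult_left_mono) auto
      then show ?thesis by (simp add: algebra_simps)
    qed simp
    then have "(\<Sum>i\<in>I. b i * ln (b i / measure m' (A i)) - b i * \<tau>) \<le> (\<Sum>i\<in>I. b i * ln (q i))" by (rule sum_mono)
    then have "(\<Sum>i\<in>I. b i * ln (b i / measure m' (A i))) - \<tau> \<le> (\<Sum>i\<in>I. b i * ln (q i))"
      using sumb by (simp add: sum_subtractf sum_distrib_right[symmetric])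
    then have "\<beta> * ((\<Sum>i\<in>I. b i * ln (b i / measure m' (A i))) - \<tau>) \<le> \<beta> * (\<Sum>i\<in>I. b i * ln (q i))"
      using \<beta>(2) by (intro mult_left_mono) auto
    also have "\<dots> = (\<Sum>i\<in>I. ln (q i) * measure \<sigma> (A i))"
      unfolding sum_distrib_left using \<beta>(2) by (intro sum.cong) (auto simp: b)
    finally show ?thesis .
  qed
  then show ?thesis using le unfolding E_def by (elim order_trans[rotated]) simp
qed

lemma cell_measure_P2:
  assumes c: "cells m I A b" and mB: "sets m = sets B" and a: "a \<in> \<Omega>" and R: "\<And>i x. i \<in> I \<Longrightarrow> x \<in> A i \<Longrightarrow> d a x \<le> R"
  shows "cell_measure m I A b \<in> P2 S"
proof -
  interpret cells m I A b by fact
  interpret prob_space "cell_measure m I A b" by (rule prob_space_cell_measure)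
  have s: "sets (cell_measure m I A b) = sets B" using mB by simp
  note [measurable_cong] = s
  have [measurable]: "d a \<in> borel_measurable B" using a d_point_measurable by simp
  have "AE x in cell_measure m I A b. x \<in> (\<Union>i\<in>I. A i)"
    using emeasure_Union Union_sets by (subst prob_eq_1[symmetric]) (auto simp: emeasure_eq_measure)
  then have bd: "AE x in cell_measure m I A b. norm ((d a x)\<^sup>2) \<le> R\<^sup>2"
  proof (rule eventually_mono)
    fix x assume "x \<in> (\<Union>i\<in>I. A i)"
    then have "d a x \<le> R" using R by auto
    then have "(d a x)\<^sup>2 \<le> R\<^sup>2" by (intro power_mono) auto
    then show "norm ((d a x)\<^sup>2) \<le> R\<^sup>2" by simp
  qed
  show ?thesis
  proof (rule P2_I[OF _ s prob_space_axioms a])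
    show "space (cell_measure m I A b) = \<Omega>" using sets_eq_imp_space_eq[OF s] by simp
    show "integrable (cell_measure m I A b) (\<lambda>x. (d a x)\<^sup>2)"
      by (rule integrable_const_bound[OF bd]) measurable
  qed
qed

end

section \<open>Transfer with vanishing error\<close>

text \<open>By \<open>small\<close>, measures of bounded entropy give the part of the \<open>k\<close>-ball outside the cells a mass of
  order \<open>1 / k ^ 3\<close>, and hence a second moment of order \<open>1 / k\<close>.\<close>

locale cell_approximation = separable_metric S for S :: "'a metric" +
  fixes a :: 'a and M M' :: "nat \<Rightarrow> 'a measure" and I :: "nat \<Rightarrow> nat set" and A :: "nat \<Rightarrow> nat \<Rightarrow> 'a set"
    and \<delta> \<tau> :: "nat \<Rightarrow> real"
  assumes a: "a \<in> \<Omega>"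
    and sf: "\<And>k. sigma_finite_measure (M k)" "\<And>k. sigma_finite_measure (M' k)"
    and sets_M: "\<And>k. sets (M k) = sets B" "\<And>k. sets (M' k) = sets B"
    and I: "\<And>k. finite (I k)" and A: "\<And>k i. i \<in> I k \<Longrightarrow> A k i \<in> sets B"
    and disj: "\<And>k. disjoint_family_on (A k) (I k)"
    and diam: "\<And>k i x y. i \<in> I k \<Longrightarrow> x \<in> A k i \<Longrightarrow> y \<in> A k i \<Longrightarrow> d x y \<le> \<delta> k"
    and bdd: "\<And>k i x. i \<in> I k \<Longrightarrow> x \<in> A k i \<Longrightarrow> d a x \<le> real k + 1"
    and pos: "\<And>k i. i \<in> I k \<Longrightarrow> 0 < measure (M k) (A k i)" "\<And>k i. i \<in> I k \<Longrightarrow> 0 < measure (M' k) (A k i)"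
    and fin: "\<And>k i. i \<in> I k \<Longrightarrow> emeasure (M k) (A k i) < \<infinity>" "\<And>k i. i \<in> I k \<Longrightarrow> emeasure (M' k) (A k i) < \<infinity>"
    and close: "\<And>k i. i \<in> I k \<Longrightarrow> \<bar>ln (measure (M k) (A k i)) - ln (measure (M' k) (A k i))\<bar> \<le> \<tau> k"
    and \<delta>: "\<And>k. 0 \<le> \<delta> k" "\<delta> \<longlonglongrightarrow> 0" and \<tau>: "\<tau> \<longlonglongrightarrow> 0"
    and small: "\<And>k. emeasure (M k) ({x \<in> \<Omega>. d a x \<le> real k} - (\<Union>i\<in>I k. A k i)) \<le> ennreal (exp (- (real k ^ 3)))"
begin

text \<open>Two errors have to vanish: \<open>D\<close>, the second moment of \<sigma> k outside the
  cells, which enters both the distance and the entropy, and \<open>G\<close>, the Gaussian mass of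
  M k outside the cells, which enters the entropy. Each is split into the part beyond radius k,
  handled by the tails or by the decay of the Gaussian, and the uncovered part \<open>F\<close> of
  the ball of radius k.\<close>

lemma transfer_measures:
  assumes c: "0 \<le> c" and ig: "\<And>k. integrable (M k) (gauss c a)" "\<And>k. (\<integral>x. gauss c a x \<partial>M k) \<le> C"
    and \<sigma>: "\<And>k. \<sigma> k \<in> P2 S" and Ent: "\<forall>\<^sub>F k in sequentially. Ent (M k) (\<sigma> k) \<le> ereal (h k)" and h: "h \<longlonglongrightarrow> h0"
    and V: "\<And>k. (\<integral>x. (d a x)\<^sup>2 \<partial>\<sigma> k) \<le> V" and tail: "(\<lambda>k. \<integral>x. sq_tail a (real k) x \<partial>\<sigma> k) \<longlonglongrightarrow> 0"
  obtains \<sigma>' h' where "\<And>k. \<sigma>' k \<in> P2 S" "(\<lambda>k. W2 S (\<sigma> k) (\<sigma>' k)) \<longlonglongrightarrow> 0"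
    "\<forall>\<^sub>F k in sequentially. Ent (M' k) (\<sigma>' k) \<le> ereal (h' k)" "h' \<longlonglongrightarrow> h0"
proof -
  have "\<forall>\<^sub>F k in sequentially. 1 \<le> k \<and> Ent (M k) (\<sigma> k) \<le> ereal (h k)"
    using Ent eventually_ge_at_top[of 1] by eventually_elim simp
  then obtain k0 where k0: "\<And>k. k0 \<le> k \<Longrightarrow> 1 \<le> k \<and> Ent (M k) (\<sigma> k) \<le> ereal (h k)"
    unfolding eventually_sequentially by blast
  have [measurable]: "d a \<in> borel_measurable B" "gauss c a \<in> borel_measurable B" for c using a d_point_measurable by auto
  have [measurable]: "sq_tail a r \<in> borel_measurable B" for r using a by simp
  have [measurable_cong]: "sets (\<sigma> k) = sets B" "sets (M k) = sets B" for k using P2_D[OF \<sigma>] sets_M by auto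
  have sp: "space (\<sigma> k) = \<Omega>" "space (M k) = \<Omega>" for k
    using P2_D[OF \<sigma>] sets_eq_imp_space_eq[OF sets_M(1)] by auto
  define E where "E k = (\<Union>i\<in>I k. A k i)" for k
  have [measurable]: "E k \<in> sets B" for k unfolding E_def using I A by auto
  have E\<Omega>: "E k \<subseteq> \<Omega>" for k using sets.sets_into_space[of "E k" B] by simp
  define F where "F k = {x \<in> \<Omega>. d a x \<le> real k} - E k" for k
  have [measurable]: "F k \<in> sets B" for k unfolding F_def
    using measurable_sets[of "d a" B borel "{.. real k}"] by (intro sets.Diff) (auto simp: vimage_def Int_def conj_commute)
  have p\<sigma>: "prob_space (\<sigma> k)" for k by (rule P2_D(3)[OF \<sigma>])
  obtain H where H: "0 \<le> H" "\<And>k. h k + c * V + C + 1 \<le> H"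
  proof -
    obtain K where "\<And>k. \<bar>h k\<bar> \<le> K" using h[THEN convergentI, THEN convergent_imp_Bseq] unfolding Bseq_def by auto
    then have "h k + c * V + C + 1 \<le> \<bar>K + c * V + C + 1\<bar>" for k
      using abs_ge_self[of "h k"] abs_ge_self[of "K + c * V + C + 1"] order_trans[of "h k" "\<bar>h k\<bar>" K] by simp
    then show ?thesis using that[of "\<bar>K + c * V + C + 1\<bar>"] by simp
  qed
  have MF: "measure (M k) (F k) \<le> exp (- (real k ^ 3))" "emeasure (M k) (F k) < \<infinity>" for k
    using small[of k] unfolding F_def E_def[symmetric] by (auto simp: measure_def intro: enn2real_leI le_less_trans)
  have igc: "integrable (M k) (\<lambda>x. gauss c' a x * indicator X x)" if "c \<le> c'" "X \<in> sets B" for k c' X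
    by (rule integrable_real_mult_indicator) (use that integrable_gauss_mono[OF sets_M(1) a ig(1)] sets_M in auto)
  have gF: "(\<integral>x. gauss c' a x * indicator (F k) x \<partial>M k) \<le> exp (- (real k ^ 3))" if "c \<le> c'" for k c'
  proof -
    have "(\<integral>x. gauss c' a x * indicator (F k) x \<partial>M k) \<le> (\<integral>x. indicator (F k) x \<partial>M k)"
      using MF(2)[of k] that c by (intro integral_mono igc) (auto split: split_indicator intro!: gauss_le_1 integrable_real_indicator)
    also have "\<dots> = measure (M k) (F k)" using sets.sets_into_space[of "F k" B] by (simp add: sp Int_absorb2)
    finally show ?thesis using MF(1)[of k] by simp
  qed
  have \<sigma>F: "measure (\<sigma> k) (F k) * real k ^ 3 \<le> H" if k: "k0 \<le> k" for k
  proof -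
    \<comment> \<open>Here L = exp (k^3) - 1: the logarithm becomes k^3, while L times the mass of
      \<open>F\<close>, which is at most exp (- k^3), stays below 1.\<close>
    have "measure (\<sigma> k) (F k) * ln (1 + (exp (real k ^ 3) - 1))
      \<le> h k + c * (\<integral>x. (d a x)\<^sup>2 \<partial>\<sigma> k) + (\<integral>x. gauss c a x \<partial>M k) + (exp (real k ^ 3) - 1) * (\<integral>x. gauss c a x * indicator (F k) x \<partial>M k)"
      by (rule Ent_uniform_absolute_continuity[OF sf(1) sets_M(1) a ig(1) \<sigma> k0[OF k, THEN conjunct2]]) auto
    also have "\<dots> \<le> h k + c * V + C + 1"
    proof -
      have "(exp (real k ^ 3) - 1) * (\<integral>x. gauss c a x * indicator (F k) x \<partial>M k) \<le> exp (real k ^ 3) * exp (- (real k ^ 3))"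
        using gF[of c k] by (intro mult_mono) (auto intro!: integral_nonneg_AE AE_I2 simp: less_imp_le[OF gauss_pos])
      also have "\<dots> = 1" by (simp add: exp_minus)
      finally show ?thesis using V[of k] c ig(2)[of k] by (intro add_mono mult_left_mono) auto
    qed
    finally show ?thesis using H(2)[of k] by simp
  qed
  define D where "D k = (\<integral>x. (d a x)\<^sup>2 * indicator (\<Omega> - E k) x \<partial>\<sigma> k)" for k
  have iD: "integrable (\<sigma> k) (\<lambda>x. (d a x)\<^sup>2 * indicator X x)" if "X \<in> sets B" for X k
    by (rule integrable_real_mult_indicator) (use P2_integrable[OF \<sigma> a] that sp P2_D[OF \<sigma>] in auto)
  have Dle: "D k \<le> (\<integral>x. sq_tail a (real k) x \<partial>\<sigma> k) + H / real k" if k: "k0 \<le> k" for k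
  proof -
    have k1: "1 \<le> k" using k0[OF k] by simp
    interpret prob_space "\<sigma> k" by (rule p\<sigma>)
    have i1: "integrable (\<sigma> k) (indicator (F k) :: 'a \<Rightarrow> real)"
      by (rule integrable_real_indicator) (auto simp: emeasure_eq_measure)
    have "D k \<le> (\<integral>x. sq_tail a (real k) x + (real k)\<^sup>2 * indicator (F k) x \<partial>\<sigma> k)"
      unfolding D_def
    proof (intro integral_mono iD)
      show "integrable (\<sigma> k) (\<lambda>x. sq_tail a (real k) x + (real k)\<^sup>2 * indicator (F k) x)"
        using integrable_sq_tail[OF \<sigma> a] i1 by simp
      fix x assume "x \<in> space (\<sigma> k)"
      then show "(d a x)\<^sup>2 * indicator (\<Omega> - E k) x \<le> sq_tail a (real k) x + (real k)\<^sup>2 * indicator (F k) x"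
        by (auto simp: sq_tail_def F_def sp split: split_indicator intro!: power_mono)
    qed auto
    also have "\<dots> = (\<integral>x. sq_tail a (real k) x \<partial>\<sigma> k) + (real k)\<^sup>2 * measure (\<sigma> k) (F k)"
      using integrable_sq_tail[OF \<sigma> a] i1 sets.sets_into_space[of "F k" B] by (simp add: sp Int_absorb2)
    also have "(real k)\<^sup>2 * measure (\<sigma> k) (F k) \<le> H / real k"
      using \<sigma>F[OF k] k1 by (simp add: le_divide_eq power3_eq_cube power2_eq_square mult_ac)
    finally show ?thesis by simp
  qed
  have D0: "0 \<le> D k" for k unfolding D_def by (intro integral_nonneg_AE AE_I2) auto
  have D: "D \<longlonglongrightarrow> 0"
  proof (rule tendsto_sandwich[of "\<lambda>_. 0" D sequentially])
    show "\<forall>\<^sub>F k in sequentially. D k \<le> (\<integral>x. sq_tail a (real k) x \<partial>\<sigma> k) + H / real k"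
      using eventually_ge_at_top[of k0] by eventually_elim (rule Dle)
    show "(\<lambda>k. (\<integral>x. sq_tail a (real k) x \<partial>\<sigma> k) + H / real k) \<longlonglongrightarrow> 0"
      using tendsto_add[OF tail lim_const_over_n[of H]] by simp
  qed (use D0 in auto)
  define \<beta> where "\<beta> k = measure (\<sigma> k) (E k)" for k
  have \<beta>ge: "1 - \<beta> k \<le> (\<integral>x. sq_tail a (real k) x \<partial>\<sigma> k) + H / real k" if k: "k0 \<le> k" for k
  proof -
    have "1 \<le> k" using k0[OF k] by simp
    interpret prob_space "\<sigma> k" by (rule p\<sigma>)
    have i1: "integrable (\<sigma> k) (indicator X :: 'a \<Rightarrow> real)" if "X \<in> sets B" for X
      by (rule integrable_real_indicator) (use that P2_D[OF \<sigma>] in \<open>auto simp: emeasure_eq_measure\<close>)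
    have "1 - \<beta> k = measure (\<sigma> k) (\<Omega> - E k)" using prob_compl[of "E k"] by (simp add: \<beta>_def sp)
    also have "\<dots> = (\<integral>x. indicator (\<Omega> - E k) x \<partial>\<sigma> k)" by (simp add: sp Int_absorb2)
    also have "\<dots> \<le> (\<integral>x. sq_tail a (real k) x + indicator (F k) x \<partial>\<sigma> k)"
    proof (intro integral_mono i1)
      show "integrable (\<sigma> k) (\<lambda>x. sq_tail a (real k) x + indicator (F k) x)"
        using integrable_sq_tail[OF \<sigma> a] i1[of "F k"] by simp
      fix x assume "x \<in> space (\<sigma> k)"
      have "1 \<le> (d a x)\<^sup>2" if "real k < d a x" using that \<open>k \<ge> 1\<close> by (intro one_le_power) simp
      then show "indicator (\<Omega> - E k) x \<le> sq_tail a (real k) x + indicator (F k) x"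
        using \<open>x \<in> space (\<sigma> k)\<close> by (auto simp: sq_tail_def F_def sp split: split_indicator)
    qed auto
    also have "\<dots> = (\<integral>x. sq_tail a (real k) x \<partial>\<sigma> k) + measure (\<sigma> k) (F k)"
      using integrable_sq_tail[OF \<sigma> a] i1[of "F k"] sets.sets_into_space[of "F k" B] by (simp add: sp Int_absorb2)
    also have "measure (\<sigma> k) (F k) \<le> H / real k"
    proof -
      have "1 \<le> (real k)\<^sup>2" using \<open>k \<ge> 1\<close> by (intro one_le_power) simp
      then have "measure (\<sigma> k) (F k) * real k * 1 \<le> measure (\<sigma> k) (F k) * real k * (real k)\<^sup>2" by (intro mult_left_mono) auto
      also have "\<dots> = measure (\<sigma> k) (F k) * real k ^ 3" by (simp add: power3_eq_cube power2_eq_square)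
      also have "\<dots> \<le> H" by (rule \<sigma>F[OF k])
      finally show ?thesis using \<open>k \<ge> 1\<close> by (simp add: le_divide_eq)
    qed
    finally show ?thesis by simp
  qed
  have \<beta>1: "\<beta> k \<le> 1" for k unfolding \<beta>_def using prob_space.prob_le_1[OF p\<sigma>] by blast
  have \<beta>: "\<beta> \<longlonglongrightarrow> 1"
  proof -
    have "(\<lambda>k. 1 - \<beta> k) \<longlonglongrightarrow> 0"
    proof (rule tendsto_sandwich[of "\<lambda>_. 0" _ sequentially])
      show "\<forall>\<^sub>F k in sequentially. 1 - \<beta> k \<le> (\<integral>x. sq_tail a (real k) x \<partial>\<sigma> k) + H / real k"
        using eventually_ge_at_top[of k0] by eventually_elim (rule \<beta>ge)
      show "(\<lambda>k. (\<integral>x. sq_tail a (real k) x \<partial>\<sigma> k) + H / real k) \<longlonglongrightarrow> 0"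
        using tendsto_add[OF tail lim_const_over_n[of H]] by simp
    qed (use \<beta>1 in auto)
    from tendsto_diff[OF tendsto_const[of 1] this] show ?thesis by simp
  qed
  have \<beta>pos: "\<forall>\<^sub>F k in sequentially. 0 < \<beta> k" using order_tendstoD(1)[OF \<beta>, of 0] by simp
  \<comment> \<open>The exponent is c + 1 and not c. Beyond radius k \<ge> 1 the spare factor exp (-
    d^2) is at most exp (- k), which makes the integral small although only a bound C is known for
    the exponent c.\<close>
  define G where "G k = (\<integral>x. gauss (c + 1) a x * indicator (\<Omega> - E k) x \<partial>M k)" for k
  have G0: "0 \<le> G k" for k unfolding G_def by (intro integral_nonneg_AE AE_I2) (simp add: less_imp_le[OF gauss_pos])
  have C0: "0 \<le> C"
  proof -
    have "0 \<le> (\<integral>x. gauss c a x \<partial>M 0)" by (intro integral_nonneg_AE AE_I2) (simp add: less_imp_le[OF gauss_pos])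
    then show ?thesis using ig(2)[of 0] by simp
  qed
  have Gle: "G k \<le> exp (- real k) * C + exp (- real k)" if "k \<ge> 1" for k
  proof -
    have "G k \<le> (\<integral>x. exp (- real k) * gauss c a x + gauss (c + 1) a x * indicator (F k) x \<partial>M k)"
      unfolding G_def
    proof (intro integral_mono igc)
      show "integrable (M k) (\<lambda>x. exp (- real k) * gauss c a x + gauss (c + 1) a x * indicator (F k) x)"
        using ig(1) igc[of "c + 1" "F k"] by simp
      fix x assume "x \<in> space (M k)"
      have "gauss (c + 1) a x \<le> exp (- real k) * gauss c a x" if "real k < d a x"
      proof -
        have "real k * 1 \<le> d a x * d a x" using that \<open>k \<ge> 1\<close> by (intro mult_mono) auto
        then show ?thesis by (simp add: gauss_def exp_add[symmetric] power2_eq_square algebra_simps)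
      qed
      then show "gauss (c + 1) a x * indicator (\<Omega> - E k) x \<le> exp (- real k) * gauss c a x + gauss (c + 1) a x * indicator (F k) x"
        using \<open>x \<in> space (M k)\<close> gauss_pos[of c a x] by (auto simp: F_def sp split: split_indicator)
    qed auto
    also have "\<dots> = exp (- real k) * (\<integral>x. gauss c a x \<partial>M k) + (\<integral>x. gauss (c + 1) a x * indicator (F k) x \<partial>M k)"
      using ig(1) igc[of "c + 1" "F k"] by simp
    also have "\<dots> \<le> exp (- real k) * C + exp (- (real k ^ 3))"
      using ig(2)[of k] gF[of "c + 1" k] by (intro add_mono mult_left_mono) auto
    also have "exp (- (real k ^ 3)) \<le> exp (- real k)"
      using that by (simp add: self_le_power)
    finally show ?thesis by simp
  qed
  have G: "G \<longlonglongrightarrow> 0"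
  proof (rule tendsto_sandwich[of "\<lambda>_. 0" G sequentially])
    show "\<forall>\<^sub>F k in sequentially. G k \<le> exp (- real k) * C + exp (- real k)"
      using eventually_ge_at_top[of 1] by eventually_elim (rule Gle)
    have e: "(\<lambda>k. exp (- real k)) \<longlonglongrightarrow> 0"
      by (rule filterlim_compose[OF exp_at_bot]) (simp add: filterlim_uminus_at_bot filterlim_real_sequentially)
    show "(\<lambda>k. exp (- real k) * C + exp (- real k)) \<longlonglongrightarrow> 0"
      using tendsto_add[OF tendsto_mult_left_zero[OF e, of C] e] by simp
  qed (use G0 in auto)
  define b where "b k i = measure (\<sigma> k) (A k i) / \<beta> k" for k i
  have cells': "cells (M' k) (I k) (A k) (b k)" if "0 < \<beta> k" for k
  proof (rule cells.intro)
    interpret prob_space "\<sigma> k" by (rule p\<sigma>)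
    show "sigma_finite_measure (M' k)" "finite (I k)" "disjoint_family_on (A k) (I k)" by (fact sf I disj)+
    show "A k i \<in> sets (M' k)" "0 < measure (M' k) (A k i)" "emeasure (M' k) (A k i) < \<infinity>" if "i \<in> I k" for i
      using A[OF that] pos(2)[OF that] fin(2)[OF that] sets_M by auto
    show "0 \<le> b k i" for i using that by (simp add: b_def)
    have "(\<Sum>i\<in>I k. measure (\<sigma> k) (A k i)) = measure (\<sigma> k) (\<Union>i\<in>I k. A k i)"
      using I A disj P2_D[OF \<sigma>] by (intro finite_measure_finite_Union[symmetric]) auto
    then show "(\<Sum>i\<in>I k. b k i) = 1" using that by (simp add: b_def \<beta>_def E_def sum_divide_distrib[symmetric])
  qed
  \<comment> \<open>The default \<sigma> k keeps the sequence in \<open>P2\<close> for every index.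
    It concerns only finitely many k, since \<beta> tends to 1.\<close>
  define \<sigma>' where "\<sigma>' k = (if 0 < \<beta> k then cell_measure (M' k) (I k) (A k) (b k) else \<sigma> k)" for k
  have \<sigma>': "\<sigma>' k \<in> P2 S" for k
    using cell_measure_P2[OF cells' sets_M(2) a bdd, of k] \<sigma> unfolding \<sigma>'_def by auto
  have W: "W2 S (\<sigma> k) (\<sigma>' k) \<le> \<delta> k + sqrt (2 * (D k + (1 / \<beta> k - 1) * V))" if \<beta>k: "0 < \<beta> k" for k
  proof -
    interpret c: cells "M' k" "I k" "A k" "b k" by (rule cells'[OF \<beta>k])
    have eq: "\<sigma>' k = cell_measure (M' k) (I k) (A k) (b k)" using \<beta>k unfolding \<sigma>'_def by simp
    \<comment> \<open>Normalisation multiplies the mass of every cell by 1 / \<beta> k, so 1 /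
      \<beta> k - 1 is the relative change required by \<open>W2_cells_le\<close>.\<close>
    have \<beta>': "0 \<le> 1 / \<beta> k - 1" using \<beta>k \<beta>1[of k] by simp
    have "W2 S (\<sigma> k) (\<sigma>' k) \<le> \<delta> k + sqrt (2 * (D k + (1 / \<beta> k - 1) * (\<integral>x. (d a x)\<^sup>2 \<partial>\<sigma> k)))"
      unfolding D_def E_def
    proof (rule W2_cells_le[OF \<sigma> \<sigma>' I A disj diam \<delta>(1) _ _ \<beta>' a])
      show "measure (\<sigma>' k) (\<Union>i\<in>I k. A k i) = 1" unfolding eq using c.emeasure_Union by (simp add: measure_def)
      fix i assume i: "i \<in> I k"
      have "measure (\<sigma>' k) (A k i) = b k i" unfolding eq using c.emeasure_cell[OF i] c.b0[OF i] by (simp add: measure_def)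
      then have "measure (\<sigma> k) (A k i) - measure (\<sigma>' k) (A k i) = - ((1 / \<beta> k - 1) * measure (\<sigma> k) (A k i))"
        by (simp add: b_def algebra_simps)
      then show "\<bar>measure (\<sigma> k) (A k i) - measure (\<sigma>' k) (A k i)\<bar> \<le> (1 / \<beta> k - 1) * measure (\<sigma> k) (A k i)"
        using \<beta>' by (simp add: abs_mult)
    qed
    also have "\<dots> \<le> \<delta> k + sqrt (2 * (D k + (1 / \<beta> k - 1) * V))"
      using V[of k] \<beta>' by (intro add_left_mono real_sqrt_le_mono mult_left_mono) auto
    finally show ?thesis .
  qed
  \<comment> \<open>The inequality of \<open>Ent_cells_ge\<close>, with exponent c + 1, solved for
    the entropy of the new measure.\<close>
  define h' where "h' k = (h k + (c + 1) * D k + G k) / \<beta> k + \<tau> k" for k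
  have Ent': "Ent (M' k) (\<sigma>' k) \<le> ereal (h' k)" if \<beta>k: "0 < \<beta> k" and k: "k0 \<le> k" for k
  proof -
    interpret c: cells "M' k" "I k" "A k" "b k" by (rule cells'[OF \<beta>k])
    have eq: "\<sigma>' k = cell_measure (M' k) (I k) (A k) (b k)" using \<beta>k unfolding \<sigma>'_def by simp
    have "ereal (\<beta> k * ((\<Sum>i\<in>I k. b k i * ln (b k i / measure (M' k) (A k i))) - \<tau> k) - (c + 1) * D k - G k) \<le> Ent (M k) (\<sigma> k)"
      unfolding D_def G_def E_def
      by (rule Ent_cells_ge[OF sf(1) sets_M(1) a integrable_gauss_mono[OF sets_M(1) a ig(1)] I A disj pos(1) fin(1) pos(2) close \<sigma> _ \<beta>k])
        (auto simp: \<beta>_def E_def b_def)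
    then have "ereal (\<beta> k * ((\<Sum>i\<in>I k. b k i * ln (b k i / measure (M' k) (A k i))) - \<tau> k) - (c + 1) * D k - G k) \<le> ereal (h k)"
      using k0[OF k, THEN conjunct2] by (rule order_trans)
    then have "\<beta> k * ((\<Sum>i\<in>I k. b k i * ln (b k i / measure (M' k) (A k i))) - \<tau> k) \<le> h k + (c + 1) * D k + G k" by simp
    then have "(\<Sum>i\<in>I k. b k i * ln (b k i / measure (M' k) (A k i))) - \<tau> k \<le> (h k + (c + 1) * D k + G k) / \<beta> k"
      using \<beta>k by (simp add: le_divide_eq mult.commute)
    then show ?thesis unfolding eq c.Ent_cell_measure h'_def by simp
  qed
  show ?thesis
  proof (rule that[of \<sigma>' h', OF \<sigma>'])
    show "\<forall>\<^sub>F k in sequentially. Ent (M' k) (\<sigma>' k) \<le> ereal (h' k)"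
      using \<beta>pos eventually_ge_at_top[of k0] by eventually_elim (rule Ent')
    have "h' \<longlonglongrightarrow> (h0 + (c + 1) * 0 + 0) / 1 + 0"
      unfolding h'_def[abs_def] by (intro tendsto_intros h D G \<beta> \<tau>) simp
    then show "h' \<longlonglongrightarrow> h0" by simp
    show "(\<lambda>k. W2 S (\<sigma> k) (\<sigma>' k)) \<longlonglongrightarrow> 0"
    proof (rule tendsto_sandwich[of "\<lambda>_. 0" _ sequentially])
      show "\<forall>\<^sub>F k in sequentially. W2 S (\<sigma> k) (\<sigma>' k) \<le> \<delta> k + sqrt (2 * (D k + (1 / \<beta> k - 1) * V))"
        using \<beta>pos by eventually_elim (rule W)
      have "(\<lambda>k. \<delta> k + sqrt (2 * (D k + (1 / \<beta> k - 1) * V))) \<longlonglongrightarrow> 0 + sqrt (2 * (0 + (1 / 1 - 1) * V))"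
        by (intro tendsto_intros \<delta> D \<beta>) simp
      then show "(\<lambda>k. \<delta> k + sqrt (2 * (D k + (1 / \<beta> k - 1) * V))) \<longlonglongrightarrow> 0" by simp
    qed (simp_all add: W2_nonneg)
  qed
qed

end

section \<open>Setwise limits\<close>

text \<open>By Tychonoff's theorem the sequence has a cluster point x in the product of unit
  intervals; G is generated by the tails of the sequence together with the preimages of the
  neighbourhoods of x. Since the index type may be uncountable, a convergent subsequence need not
  exist, and a filter takes its place.\<close>

lemma cluster_filter:
  fixes f :: "nat \<Rightarrow> 'i \<Rightarrow> real"
  assumes f: "\<And>k i. f k i \<in> {0..1}"
  obtains G x where "G \<noteq> bot" "G \<le> sequentially" "\<And>i. ((\<lambda>k. f k i) \<longlongrightarrow> x i) G"
proof -
  let ?K = "PiE UNIV (\<lambda>_ :: 'i. {0..1 :: real})"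
  have "compactin (product_topology (\<lambda>_. euclidean) UNIV) ?K"
    by (subst compactin_PiE) auto
  then have "compact ?K" by (simp add: euclidean_product_topology)
  moreover have "\<forall>\<^sub>F y in filtermap f sequentially. y \<in> ?K"
    unfolding eventually_filtermap using f by (intro always_eventually) auto
  moreover have "filtermap f sequentially \<noteq> bot" by (simp add: filtermap_bot_iff)
  ultimately obtain x where x: "inf (nhds x) (filtermap f sequentially) \<noteq> bot"
    unfolding compact_filter le_principal by blast
  define G where "G = inf sequentially (filtercomap f (nhds x))"
  show ?thesis
  proof (rule that[of G x])
    show "G \<le> sequentially" unfolding G_def by simp
    show "G \<noteq> bot"
    proof
      assume "G = bot"
      then have "eventually (\<lambda>_. False) (inf sequentially (filtercomap f (nhds x)))" unfolding G_def by simp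
      then obtain P Q where PQ: "eventually P sequentially" "eventually Q (filtercomap f (nhds x))" "\<And>k. P k \<Longrightarrow> Q k \<Longrightarrow> False"
        unfolding eventually_inf by blast
      then obtain R where R: "eventually R (nhds x)" "\<And>k. R (f k) \<Longrightarrow> Q k" unfolding eventually_filtercomap by blast
      have "eventually (\<lambda>y. \<not> R y) (filtermap f sequentially)"
        unfolding eventually_filtermap using PQ(1) by (rule eventually_mono) (use PQ(3) R(2) in blast)
      then have "eventually (\<lambda>_. False) (inf (nhds x) (filtermap f sequentially))"
        unfolding eventually_inf using R(1) by blast
      then show False using x by (simp add: trivial_limit_def)
    qed
    fix i
    have "filterlim f (nhds x) G"
      unfolding G_def by (rule filterlim_mono[OF filterlim_filtercomap order_refl inf_le2])
    moreover have "\<forall>\<^sub>F y in nhds x. y i \<in> U" if "open U" "x i \<in> U" for U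
    proof -
      have "open ((\<lambda>y :: 'i \<Rightarrow> real. y i) -` U)"
        by (rule open_vimage[OF that(1) continuous_on_product_coordinates])
      then show ?thesis using that(2) unfolding eventually_nhds by blast
    qed
    ultimately show "((\<lambda>k. f k i) \<longlongrightarrow> x i) G"
      by (intro topological_tendstoI) (auto simp: filterlim_iff)
  qed
qed

text \<open>A bounded function is uniformly within 1 / n of a finite combination of indicators of
  its level sets. This error is the same for all probability measures, and the integrals of the
  combination converge by assumption, so the argument works along any filter.\<close>

lemma tendsto_integral_setwise:
  fixes f :: "'a \<Rightarrow> real"
  assumes \<nu>: "\<And>k. prob_space (\<nu> k)" "\<And>k. sets (\<nu> k) = sets N" and \<mu>: "prob_space \<mu>" "sets \<mu> = sets N"
    and lim: "\<And>A. A \<in> sets N \<Longrightarrow> ((\<lambda>k. measure (\<nu> k) A) \<longlongrightarrow> measure \<mu> A) G"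
    and [measurable]: "f \<in> borel_measurable N" and bd: "\<And>x. x \<in> space N \<Longrightarrow> \<bar>f x\<bar> \<le> K"
  shows "((\<lambda>k. \<integral>x. f x \<partial>\<nu> k) \<longlongrightarrow> (\<integral>x. f x \<partial>\<mu>)) G"
proof (rule tendstoI)
  fix e :: real assume e: "0 < e"
  obtain n0 :: nat where n0: "inverse (real (Suc n0)) < e / 3"
    using reals_Archimedean[of "e / 3"] e by auto
  define n where "n = Suc n0"
  have n: "0 < n" "1 / real n < e / 3" using n0 by (auto simp: n_def inverse_eq_divide)
  define J where "J = {- \<lceil>K * real n\<rceil> - 1 .. \<lceil>K * real n\<rceil> + 1}"
  define A where "A j = {x \<in> space N. \<lfloor>f x * real n\<rfloor> = j}" for j
  have [measurable]: "A j \<in> sets N" for j unfolding A_def by measurable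
  define g where "g x = (\<Sum>j\<in>J. real_of_int j / real n * indicator (A j) x)" for x
  have close: "\<bar>f x - g x\<bar> \<le> 1 / real n" if x: "x \<in> space N" for x
  proof -
    have "\<bar>f x * real n\<bar> \<le> K * real n" using bd[OF x] by (simp add: abs_mult mult_right_mono)
    then have "\<lfloor>f x * real n\<rfloor> \<in> J" unfolding J_def by (auto, linarith+)
    moreover have "g x = (\<Sum>j\<in>J. if j = \<lfloor>f x * real n\<rfloor> then real_of_int j / real n else 0)"
      unfolding g_def by (rule sum.cong) (use x in \<open>auto simp: A_def\<close>)
    ultimately have g: "g x = real_of_int \<lfloor>f x * real n\<rfloor> / real n" by (simp add: J_def)
    have "f x - g x = (f x * real n - real_of_int \<lfloor>f x * real n\<rfloor>) / real n" unfolding g using n by (simp add: field_simps)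
    moreover have "0 \<le> f x * real n - real_of_int \<lfloor>f x * real n\<rfloor>" "f x * real n - real_of_int \<lfloor>f x * real n\<rfloor> \<le> 1" by linarith+
    ultimately show ?thesis using n by (simp add: divide_right_mono)
  qed
  have main: "(\<integral>x. g x \<partial>\<rho>) = (\<Sum>j\<in>J. real_of_int j / real n * measure \<rho> (A j))" "\<bar>(\<integral>x. f x \<partial>\<rho>) - (\<integral>x. g x \<partial>\<rho>)\<bar> \<le> 1 / real n"
    if \<rho>: "prob_space \<rho>" "sets \<rho> = sets N" for \<rho>
  proof -
    interpret prob_space \<rho> by fact
    have [measurable_cong]: "sets \<rho> = sets N" by fact
    have sp: "space \<rho> = space N" using sets_eq_imp_space_eq[OF \<rho>(2)] .
    have hb: "has_bochner_integral \<rho> g (\<Sum>j\<in>J. real_of_int j / real n * measure \<rho> (A j))"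
      unfolding g_def[abs_def]
      by (intro has_bochner_integral_sum has_bochner_integral_mult_right has_bochner_integral_real_indicator) (auto simp: emeasure_eq_measure)
    then show 1: "(\<integral>x. g x \<partial>\<rho>) = (\<Sum>j\<in>J. real_of_int j / real n * measure \<rho> (A j))"
      by (rule has_bochner_integral_integral_eq)
    have i: "integrable \<rho> f" by (rule integrable_const_bound[where B=K]) (auto intro!: AE_I2 bd simp: sp)
    have ig: "integrable \<rho> g" using hb by (simp add: has_bochner_integral_iff)
    have "\<bar>(\<integral>x. f x \<partial>\<rho>) - (\<integral>x. g x \<partial>\<rho>)\<bar> = \<bar>\<integral>x. f x - g x \<partial>\<rho>\<bar>" using i ig by simp
    also have "\<dots> \<le> (\<integral>x. \<bar>f x - g x\<bar> \<partial>\<rho>)" by (rule integral_abs_bound)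
    also have "\<dots> \<le> (\<integral>x. 1 / real n \<partial>\<rho>)" using i ig close by (intro integral_mono) (auto simp: sp)
    finally show "\<bar>(\<integral>x. f x \<partial>\<rho>) - (\<integral>x. g x \<partial>\<rho>)\<bar> \<le> 1 / real n" by (simp add: prob_space)
  qed
  have "((\<lambda>k. \<integral>x. g x \<partial>\<nu> k) \<longlongrightarrow> (\<integral>x. g x \<partial>\<mu>)) G"
    unfolding main(1)[OF \<nu>] main(1)[OF \<mu>] by (intro tendsto_intros lim) auto
  then have "\<forall>\<^sub>F k in G. \<bar>(\<integral>x. g x \<partial>\<nu> k) - (\<integral>x. g x \<partial>\<mu>)\<bar> < e / 3"
    using e unfolding dist_real_def[symmetric] by (intro tendstoD) auto
  then show "\<forall>\<^sub>F k in G. dist (\<integral>x. f x \<partial>\<nu> k) (\<integral>x. f x \<partial>\<mu>) < e"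
  proof (rule eventually_mono)
    fix k assume "\<bar>(\<integral>x. g x \<partial>\<nu> k) - (\<integral>x. g x \<partial>\<mu>)\<bar> < e / 3"
    then show "dist (\<integral>x. f x \<partial>\<nu> k) (\<integral>x. f x \<partial>\<mu>) < e"
      using main(2)[OF \<nu>(1) \<nu>(2), of k] main(2)[OF \<mu>] n(2) unfolding dist_real_def by linarith
  qed
qed

context separable_metric
begin

text \<open>A setwise limit along a filter is a priori only finitely additive. The bound of
  \<open>Ent_uniform_absolute_continuity\<close> passes to the limit as \<open>key\<close> and gives
  continuity at the empty set, because the Gaussian mass of a sequence of sets decreasing to the
  empty set tends to 0. Null sets of m are null for every measure of finite entropy, hence for the
  limit.\<close>

lemma setwise_limit_measure:
  assumes m: "sigma_finite_measure m" "sets m = sets B" and a: "a \<in> \<Omega>" and ig: "integrable m (gauss c a)" and c: "0 \<le> c"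
    and \<nu>: "\<And>k. \<nu> k \<in> P2 S" and Ent: "\<forall>\<^sub>F k in G. Ent m (\<nu> k) \<le> ereal H" and V: "\<And>k. (\<integral>x. (d a x)\<^sup>2 \<partial>\<nu> k) \<le> V"
    and G: "G \<noteq> bot" and lim: "\<And>A. A \<in> sets B \<Longrightarrow> ((\<lambda>k. measure (\<nu> k) A) \<longlongrightarrow> x A) G"
  obtains \<mu> where "prob_space \<mu>" "sets \<mu> = sets B" "\<And>A. A \<in> sets B \<Longrightarrow> measure \<mu> A = x A" "absolutely_continuous m \<mu>"
proof -
  have p: "prob_space (\<nu> k)" and sets\<nu>: "sets (\<nu> k) = sets B" for k using P2_D[OF \<nu>] by auto
  have [measurable_cong]: "sets m = sets B" by fact
  have [measurable]: "gauss c a \<in> borel_measurable B" using a by simp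
  have spm: "space m = \<Omega>" using sets_eq_imp_space_eq[OF m(2)] by simp
  have x0: "0 \<le> x A" if "A \<in> sets B" for A
    by (rule tendsto_lowerbound[OF lim[OF that] _ G]) auto
  have x1: "x \<Omega> = 1"
  proof -
    have "measure (\<nu> k) \<Omega> = 1" for k using prob_space.prob_space[OF p, of k] P2_D[OF \<nu>, of k] by simp
    then have "((\<lambda>k. 1) \<longlongrightarrow> x \<Omega>) G" using lim[of \<Omega>] by simp
    from tendsto_unique[OF G this tendsto_const] show ?thesis .
  qed
  define K where "K = H + c * V + (\<integral>x. gauss c a x \<partial>m)"
  have key: "x A * ln (1 + L) \<le> K + L * (\<integral>y. gauss c a y * indicator A y \<partial>m)" if "A \<in> sets B" "0 \<le> L" for A L
  proof (rule tendsto_upperbound[OF tendsto_mult_right[OF lim[OF that(1)]] _ G])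
    show "\<forall>\<^sub>F k in G. measure (\<nu> k) A * ln (1 + L) \<le> K + L * (\<integral>y. gauss c a y * indicator A y \<partial>m)"
      using Ent
    proof (rule eventually_mono)
      fix k assume "Ent m (\<nu> k) \<le> ereal H"
      from Ent_uniform_absolute_continuity[OF m a ig \<nu> this that]
      show "measure (\<nu> k) A * ln (1 + L) \<le> K + L * (\<integral>y. gauss c a y * indicator A y \<partial>m)"
        using mult_left_mono[OF V[of k] c] unfolding K_def by simp
    qed
  qed
  define \<mu> where "\<mu> = measure_of \<Omega> (sets B) (\<lambda>A. ennreal (x A))"
  have sub: "sets B \<subseteq> Pow \<Omega>" using sets.space_closed[of B] by simp
  have sa: "sigma_algebra \<Omega> (sets B)" using sets.sigma_algebra_axioms[of B] by simp
  interpret sa: sigma_algebra \<Omega> "sets B" by fact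
  have xe: "x {} = 0"
  proof -
    have "((\<lambda>k. 0) \<longlongrightarrow> x {}) G" using lim[of "{}"] by simp
    from tendsto_unique[OF G this tendsto_const] show ?thesis .
  qed
  have xadd: "x (A \<union> C) = x A + x C" if "A \<in> sets B" "C \<in> sets B" "A \<inter> C = {}" for A C
  proof -
    have "measure (\<nu> k) (A \<union> C) = measure (\<nu> k) A + measure (\<nu> k) C" for k
    proof -
      interpret prob_space "\<nu> k" by (rule p)
      show ?thesis using that sets\<nu> by (intro finite_measure_Union) auto
    qed
    then have "((\<lambda>k. measure (\<nu> k) A + measure (\<nu> k) C) \<longlongrightarrow> x (A \<union> C)) G" using lim[of "A \<union> C"] that by simp
    from tendsto_unique[OF G this tendsto_add[OF lim[OF that(1)] lim[OF that(2)]]] show ?thesis .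
  qed
  have posi: "positive (sets B) (\<lambda>A. ennreal (x A))" unfolding positive_def using xe by simp
  have ca: "countably_additive (sets B) (\<lambda>A. ennreal (x A))"
  proof (rule sa.empty_continuous_imp_countably_additive[OF posi])
    show "additive (sets B) (\<lambda>A. ennreal (x A))" unfolding additive_def using xadd x0 by (simp add: ennreal_plus)
    fix A :: "nat \<Rightarrow> 'a set" assume A: "range A \<subseteq> sets B" "decseq A" "(\<Inter>i. A i) = {}"
    then have [measurable]: "A i \<in> sets B" for i by auto
    have g: "(\<lambda>i. \<integral>y. gauss c a y * indicator (A i) y \<partial>m) \<longlonglongrightarrow> (\<integral>y. 0 \<partial>m)"
    proof (rule integral_dominated_convergence[where w="gauss c a"])
      show "AE y in m. (\<lambda>i. gauss c a y * indicator (A i) y) \<longlonglongrightarrow> 0"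
      proof (rule AE_I2)
        fix y
        obtain i where "y \<notin> A i" using A(3) by auto
        have "\<forall>\<^sub>F j in sequentially. gauss c a y * indicator (A j) y = 0"
        proof (rule eventually_mono[OF eventually_ge_at_top[of i]])
          fix j assume "i \<le> j"
          then have "A j \<subseteq> A i" using A(2) by (auto simp: decseq_def)
          then have "y \<notin> A j" using \<open>y \<notin> A i\<close> by auto
          then show "gauss c a y * indicator (A j) y = 0" by simp
        qed
        then show "(\<lambda>i. gauss c a y * indicator (A i) y) \<longlonglongrightarrow> 0" by (rule tendsto_eventually)
      qed
    qed (use ig gauss_pos[of c a] in \<open>auto intro!: AE_I2 simp: less_imp_le split: split_indicator\<close>)
    have "(\<lambda>i. x (A i)) \<longlonglongrightarrow> 0"
    proof (rule tendstoI)
      fix e :: real assume e: "0 < e"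
      \<comment> \<open>This makes ln (1 + L) equal to 2 |K| / e + 1, and |K| + e / 2 is e / 2 times
        that number; so the limit mass falls below e / 2.\<close>
      define L where "L = exp (2 * \<bar>K\<bar> / e + 1) - 1"
      have L: "0 \<le> L" "ln (1 + L) = 2 * \<bar>K\<bar> / e + 1" using e by (auto simp: L_def)
      have "(\<lambda>i. L * (\<integral>y. gauss c a y * indicator (A i) y \<partial>m)) \<longlonglongrightarrow> L * 0" using g by (intro tendsto_intros) simp
      then have "\<forall>\<^sub>F i in sequentially. L * (\<integral>y. gauss c a y * indicator (A i) y \<partial>m) < e / 2"
        using e by (intro order_tendstoD(2)) auto
      then show "\<forall>\<^sub>F i in sequentially. dist (x (A i)) 0 < e"
      proof (rule eventually_mono)
        fix i assume i: "L * (\<integral>y. gauss c a y * indicator (A i) y \<partial>m) < e / 2"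
        have "x (A i) * (2 * \<bar>K\<bar> / e + 1) < \<bar>K\<bar> + e / 2" using key[of "A i" L] L i by simp
        also have "\<bar>K\<bar> + e / 2 = e / 2 * (2 * \<bar>K\<bar> / e + 1)" using e by (simp add: field_simps)
        finally have "x (A i) < e / 2" using e by (subst (asm) mult_less_cancel_right_pos) (auto intro: add_nonneg_pos)
        then show "dist (x (A i)) 0 < e" using x0[of "A i"] e by (simp add: dist_real_def)
      qed
    qed
    then show "(\<lambda>i. ennreal (x (A i))) \<longlonglongrightarrow> 0" using tendsto_ennrealI by fastforce
  qed simp
  have em: "emeasure \<mu> A = ennreal (x A)" if "A \<in> sets B" for A
    unfolding \<mu>_def using sa posi ca that by (intro emeasure_measure_of_sigma)
  have sets\<mu>: "sets \<mu> = sets B" unfolding \<mu>_def using sub sa by (simp add: sigma_algebra.sets_measure_of_eq)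
  have sp: "space \<mu> = \<Omega>" using sets_eq_imp_space_eq[OF sets\<mu>] by simp
  show ?thesis
  proof (rule that[OF _ sets\<mu>])
    show "prob_space \<mu>" by (rule prob_spaceI) (simp add: sp em x1)
    show "measure \<mu> A = x A" if "A \<in> sets B" for A using em[OF that] x0[OF that] by (simp add: measure_def)
    show "absolutely_continuous m \<mu>" unfolding absolutely_continuous_def
    proof
      fix A assume A: "A \<in> null_sets m"
      then have [measurable]: "A \<in> sets B" using m(2) by (auto simp: null_sets_def)
      have "\<forall>\<^sub>F k in G. measure (\<nu> k) A = 0"
        using Ent
      proof (rule eventually_mono)
        fix k assume "Ent m (\<nu> k) \<le> ereal H"
        then have "absolutely_continuous m (\<nu> k)" unfolding Ent_def by (auto split: if_splits)
        then show "measure (\<nu> k) A = 0" using A unfolding absolutely_continuous_def by (auto simp: measure_eq_0_null_sets)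
      qed
      then have "((\<lambda>k. measure (\<nu> k) A) \<longlongrightarrow> 0) G" by (rule tendsto_eventually)
      then have "x A = 0" using tendsto_unique[OF G lim[of A]] by simp
      then show "A \<in> null_sets \<mu>" using em[of A] sets\<mu> by (simp add: null_sets_def)
    qed
  qed
qed

end

text \<open>\<open>mult_ln_ge\<close> with s = g x bounds \<rho> ln \<rho> from below by an
  integrable function.\<close>

lemma Ent_negative_part:
  fixes \<rho> g :: "'a \<Rightarrow> real"
  assumes [measurable]: "\<rho> \<in> borel_measurable m" "g \<in> borel_measurable m" and \<rho>0: "\<And>x. 0 \<le> \<rho> x" and i: "integrable m \<rho>"
    and g: "\<And>x. 0 < g x" "integrable m g" "integrable m (\<lambda>x. \<rho> x * ln (g x))"
  shows "integrable m (\<lambda>x. min 0 (\<rho> x * ln (\<rho> x)))"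
proof (rule Bochner_Integration.integrable_bound)
  show "integrable m (\<lambda>x. \<bar>\<rho> x * ln (g x)\<bar> + \<rho> x + g x)" using i g by simp
  show "AE x in m. norm (min 0 (\<rho> x * ln (\<rho> x))) \<le> norm (\<bar>\<rho> x * ln (g x)\<bar> + \<rho> x + g x)"
  proof (rule AE_I2)
    fix x
    have "\<rho> x * ln (g x) + \<rho> x - g x \<le> \<rho> x * ln (\<rho> x)" using g(1)[of x] \<rho>0[of x] by (intro mult_ln_ge) auto
    then show "norm (min 0 (\<rho> x * ln (\<rho> x))) \<le> norm (\<bar>\<rho> x * ln (g x)\<bar> + \<rho> x + g x)"
      using g(1)[of x] \<rho>0[of x] unfolding real_norm_def min_def by (auto split: abs_split)
  qed
qed measurable

section \<open>Second moments, entropy and \<open>W2\<close> under setwise convergence\<close>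

context separable_metric
begin

text \<open>The function is cut off at a radius n \<ge> 1. Beyond it 1 + d^2 \<le> 2 d^2, so the
  part removed is at most 2 K times the tail of the second moment, which is small for \<mu> and, by
  uniform integrability, for the \<nu> k along G. The rest is bounded.\<close>

lemma tendsto_integral_quadratic:
  fixes f :: "'a \<Rightarrow> real"
  assumes \<nu>: "\<And>k. \<nu> k \<in> P2 S" and \<mu>: "\<mu> \<in> P2 S" and a: "a \<in> \<Omega>"
    and lim: "\<And>A. A \<in> sets B \<Longrightarrow> ((\<lambda>k. measure (\<nu> k) A) \<longlongrightarrow> measure \<mu> A) G"
    and UI: "\<And>e. 0 < e \<Longrightarrow> \<exists>r. \<forall>\<^sub>F k in G. (\<integral>x. sq_tail a r x \<partial>\<nu> k) \<le> e"
    and [measurable]: "f \<in> borel_measurable B" and bd: "\<And>x. x \<in> \<Omega> \<Longrightarrow> \<bar>f x\<bar> \<le> K * (1 + (d a x)\<^sup>2)" and K: "0 \<le> K"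
  shows "((\<lambda>k. \<integral>x. f x \<partial>\<nu> k) \<longlongrightarrow> (\<integral>x. f x \<partial>\<mu>)) G"
proof (rule tendstoI)
  fix e :: real assume e: "0 < e"
  \<comment> \<open>With the summand 6 in the denominator, 2 K \<eta> is below e / 3 and K = 0
    causes no division by 0.\<close>
  define \<eta> where "\<eta> = e / (6 * K + 6)"
  have \<eta>: "0 < \<eta>" "2 * K * \<eta> < e / 3" using e K by (auto simp: \<eta>_def field_simps)
  have [measurable]: "d a \<in> borel_measurable B" using a d_point_measurable by simp
  obtain r0 where r0: "\<forall>\<^sub>F k in G. (\<integral>x. sq_tail a r0 x \<partial>\<nu> k) \<le> \<eta>" using UI[OF \<eta>(1)] by blast
  have "\<forall>\<^sub>F n in sequentially. (\<integral>x. sq_tail a (real n) x \<partial>\<mu>) < \<eta> \<and> nat \<lceil>r0\<rceil> \<le> n \<and> 1 \<le> n"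
    using \<eta>(1) by (intro eventually_conj order_tendstoD(2)[OF sq_tail_tendsto[OF \<mu> a]] eventually_ge_at_top)
  then obtain n where n: "(\<integral>x. sq_tail a (real n) x \<partial>\<mu>) < \<eta>" "nat \<lceil>r0\<rceil> \<le> n" "1 \<le> n"
    using eventually_happens'[OF sequentially_bot] by blast
  define g where "g x = (if d a x \<le> real n then f x else 0)" for x
  have [measurable]: "g \<in> borel_measurable B" unfolding g_def[abs_def] by measurable
  have close: "integrable \<rho> f" "\<bar>(\<integral>x. f x \<partial>\<rho>) - (\<integral>x. g x \<partial>\<rho>)\<bar> \<le> 2 * K * (\<integral>x. sq_tail a (real n) x \<partial>\<rho>)" if \<rho>: "\<rho> \<in> P2 S" for \<rho>
  proof -
    interpret prob_space \<rho> using P2_D[OF \<rho>] by simp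
    have [measurable_cong]: "sets \<rho> = sets B" using P2_D[OF \<rho>] by simp
    have sp: "space \<rho> = \<Omega>" using P2_D[OF \<rho>] by simp
    show i: "integrable \<rho> f"
      by (rule Bochner_Integration.integrable_bound[where f="\<lambda>x. K * (1 + (d a x)\<^sup>2)"])
        (use P2_integrable[OF \<rho> a] bd in \<open>auto intro!: AE_I2 simp: sp intro: order_trans[OF bd abs_ge_self]\<close>)
    have ig: "integrable \<rho> g"
      by (rule Bochner_Integration.integrable_bound[OF i]) (auto intro!: AE_I2 simp: g_def)
    have "\<bar>(\<integral>x. f x \<partial>\<rho>) - (\<integral>x. g x \<partial>\<rho>)\<bar> = \<bar>\<integral>x. f x - g x \<partial>\<rho>\<bar>" using i ig by simp
    also have "\<dots> \<le> (\<integral>x. \<bar>f x - g x\<bar> \<partial>\<rho>)" by (rule integral_abs_bound)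
    also have "\<dots> \<le> (\<integral>x. 2 * K * sq_tail a (real n) x \<partial>\<rho>)"
    proof (intro integral_mono)
      fix x assume x: "x \<in> space \<rho>"
      show "\<bar>f x - g x\<bar> \<le> 2 * K * sq_tail a (real n) x"
      proof (cases "d a x \<le> real n")
        case False
        then have "1 \<le> (d a x)\<^sup>2" using n(3) by (intro one_le_power) simp
        then have "K * (1 + (d a x)\<^sup>2) \<le> K * (2 * (d a x)\<^sup>2)" using K by (intro mult_left_mono) auto
        then show ?thesis using False bd[of x] x by (simp add: g_def sq_tail_def sp)
      qed (simp add: g_def sq_tail_def)
    qed (use i ig integrable_sq_tail[OF \<rho> a] in auto)
    finally show "\<bar>(\<integral>x. f x \<partial>\<rho>) - (\<integral>x. g x \<partial>\<rho>)\<bar> \<le> 2 * K * (\<integral>x. sq_tail a (real n) x \<partial>\<rho>)" by simp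
  qed
  have "((\<lambda>k. \<integral>x. g x \<partial>\<nu> k) \<longlongrightarrow> (\<integral>x. g x \<partial>\<mu>)) G"
  proof (rule tendsto_integral_setwise[where N=B and K="K * (1 + (real n)\<^sup>2)"])
    fix x assume "x \<in> space B"
    then have x: "x \<in> \<Omega>" by simp
    show "\<bar>g x\<bar> \<le> K * (1 + (real n)\<^sup>2)"
    proof (cases "d a x \<le> real n")
      case True
      then have "K * (1 + (d a x)\<^sup>2) \<le> K * (1 + (real n)\<^sup>2)" using K by (intro mult_left_mono add_left_mono power_mono) auto
      then show ?thesis using True bd[OF x] by (simp add: g_def)
    qed (use K in \<open>simp add: g_def\<close>)
  qed (use P2_D[OF \<nu>] P2_D[OF \<mu>] lim in auto)
  then have "\<forall>\<^sub>F k in G. \<bar>(\<integral>x. g x \<partial>\<nu> k) - (\<integral>x. g x \<partial>\<mu>)\<bar> < e / 3"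
    using e unfolding dist_real_def[symmetric] by (intro tendstoD) auto
  then show "\<forall>\<^sub>F k in G. dist (\<integral>x. f x \<partial>\<nu> k) (\<integral>x. f x \<partial>\<mu>) < e"
    using r0
  proof eventually_elim
    fix k assume g: "\<bar>(\<integral>x. g x \<partial>\<nu> k) - (\<integral>x. g x \<partial>\<mu>)\<bar> < e / 3" and r: "(\<integral>x. sq_tail a r0 x \<partial>\<nu> k) \<le> \<eta>"
    have "r0 \<le> real n" using n(2) by linarith
    then have "(\<integral>x. sq_tail a (real n) x \<partial>\<nu> k) \<le> (\<integral>x. sq_tail a r0 x \<partial>\<nu> k)"
      by (intro integral_mono integrable_sq_tail[OF \<nu> a]) (auto simp: sq_tail_def)
    then have "2 * K * (\<integral>x. sq_tail a (real n) x \<partial>\<nu> k) \<le> 2 * K * \<eta>" using r K by (intro mult_left_mono) auto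
    moreover have "2 * K * (\<integral>x. sq_tail a (real n) x \<partial>\<mu>) \<le> 2 * K * \<eta>" using n(1) K by (intro mult_left_mono) auto
    ultimately show "dist (\<integral>x. f x \<partial>\<nu> k) (\<integral>x. f x \<partial>\<mu>) < e"
      using close(2)[OF \<nu>, of k] close(2)[OF \<mu>] g \<eta>(2) unfolding dist_real_def by linarith
  qed
qed

text \<open>The truncations min d^2 n are bounded, so their integrals converge along G and inherit
  the bound V; Fatou's lemma in n removes the truncation.\<close>

lemma P2_setwise_limit:
  assumes \<nu>: "\<And>k. \<nu> k \<in> P2 S" and \<mu>: "prob_space \<mu>" "sets \<mu> = sets B" and a: "a \<in> \<Omega>"
    and lim: "\<And>A. A \<in> sets B \<Longrightarrow> ((\<lambda>k. measure (\<nu> k) A) \<longlongrightarrow> measure \<mu> A) G"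
    and G: "G \<noteq> bot" and V: "\<And>k. (\<integral>x. (d a x)\<^sup>2 \<partial>\<nu> k) \<le> V"
  shows "\<mu> \<in> P2 S" "(\<integral>x. (d a x)\<^sup>2 \<partial>\<mu>) \<le> V"
proof -
  interpret prob_space \<mu> by fact
  have [measurable_cong]: "sets \<mu> = sets B" "sets (\<nu> k) = sets B" for k using \<mu> P2_D[OF \<nu>] by auto
  have sp: "space \<mu> = \<Omega>" using sets_eq_imp_space_eq[OF \<mu>(2)] by simp
  have [measurable]: "d a \<in> borel_measurable B" using a d_point_measurable by simp
  define f where "f n x = min ((d a x)\<^sup>2) (real n)" for n x
  have [measurable]: "f n \<in> borel_measurable B" for n unfolding f_def[abs_def] by measurable
  have f: "(\<integral>x. f n x \<partial>\<mu>) \<le> V" for n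
  proof (rule tendsto_upperbound[OF _ _ G])
    show "((\<lambda>k. \<integral>x. f n x \<partial>\<nu> k) \<longlongrightarrow> (\<integral>x. f n x \<partial>\<mu>)) G"
      by (rule tendsto_integral_setwise[where N=B and K="real n"]) (use P2_D[OF \<nu>] \<mu> lim in \<open>auto simp: f_def\<close>)
    show "\<forall>\<^sub>F k in G. (\<integral>x. f n x \<partial>\<nu> k) \<le> V"
    proof (rule always_eventually, rule allI)
      fix k
      interpret k: prob_space "\<nu> k" using P2_D[OF \<nu>] by simp
      have "(\<integral>x. f n x \<partial>\<nu> k) \<le> (\<integral>x. (d a x)\<^sup>2 \<partial>\<nu> k)"
      proof (intro integral_mono P2_integrable[OF \<nu> a])
        show "integrable (\<nu> k) (f n)" by (rule k.integrable_const_bound[where B="real n"]) (auto simp: f_def)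
      qed (auto simp: f_def)
      then show "(\<integral>x. f n x \<partial>\<nu> k) \<le> V" using V[of k] by simp
    qed
  qed
  have int: "integrable \<mu> (f n)" for n by (rule integrable_const_bound[where B="real n"]) (auto simp: f_def)
  have "(\<integral>\<^sup>+x. ennreal ((d a x)\<^sup>2) \<partial>\<mu>) = (\<integral>\<^sup>+x. liminf (\<lambda>n. ennreal (f n x)) \<partial>\<mu>)"
  proof (rule nn_integral_cong)
    fix x
    obtain N :: nat where N: "(d a x)\<^sup>2 < real N" using reals_Archimedean2 by blast
    have "\<forall>\<^sub>F n in sequentially. ennreal (f n x) = ennreal ((d a x)\<^sup>2)"
      by (rule eventually_mono[OF eventually_ge_at_top[of N]]) (use N in \<open>auto simp: f_def min_def\<close>)
    then have "(\<lambda>n. ennreal (f n x)) \<longlonglongrightarrow> ennreal ((d a x)\<^sup>2)" by (rule tendsto_eventually)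
    then show "ennreal ((d a x)\<^sup>2) = liminf (\<lambda>n. ennreal (f n x))" by (simp add: lim_imp_Liminf)
  qed
  also have "\<dots> \<le> liminf (\<lambda>n. \<integral>\<^sup>+x. ennreal (f n x) \<partial>\<mu>)" by (rule nn_integral_liminf) measurable
  also have "\<dots> \<le> liminf (\<lambda>n :: nat. ennreal V)"
  proof (rule Liminf_mono, rule always_eventually, rule allI)
    fix n
    have "(\<integral>\<^sup>+x. ennreal (f n x) \<partial>\<mu>) = ennreal (\<integral>x. f n x \<partial>\<mu>)"
      by (rule nn_integral_eq_integral[OF int]) (auto simp: f_def)
    then show "(\<integral>\<^sup>+x. ennreal (f n x) \<partial>\<mu>) \<le> ennreal V" using f[of n] by (simp add: ennreal_leI)
  qed
  finally have le: "(\<integral>\<^sup>+x. ennreal ((d a x)\<^sup>2) \<partial>\<mu>) \<le> ennreal V" by (simp add: Liminf_const)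
  show P: "\<mu> \<in> P2 S" by (rule P2_I'[OF \<mu>(2,1) a]) (rule le_less_trans[OF le], simp)
  have V0: "0 \<le> V" using f[of 0] by (simp add: f_def)
  show "(\<integral>x. (d a x)\<^sup>2 \<partial>\<mu>) \<le> V"
    using le V0 nn_integral_eq_integral[OF P2_integrable[OF P a]] by simp
qed

text \<open>The optimal \<theta> in the dual formula is the density \<rho> of the limit, but ln
  \<rho> may grow too fast for its integrals to converge. The function \<open>\<theta> M\<close>
  caps \<rho> at M + 1 and keeps it above the Gaussian divided by M + 1. Its logarithm then has
  quadratic growth, and its total mass exceeds 1 by at most C / (M + 1). After the limit along G,
  letting M tend to infinity recovers the entropy by Fatou's lemma.\<close>

lemma Ent_lsc:
  assumes m: "sigma_finite_measure m" "sets m = sets B" and a: "a \<in> \<Omega>" and ig: "integrable m (gauss c a)" and c: "0 \<le> c"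
    and \<nu>: "\<And>k. \<nu> k \<in> P2 S" and \<mu>: "\<mu> \<in> P2 S" and ac: "absolutely_continuous m \<mu>"
    and lim: "\<And>A. A \<in> sets B \<Longrightarrow> ((\<lambda>k. measure (\<nu> k) A) \<longlongrightarrow> measure \<mu> A) G" and G: "G \<noteq> bot"
    and UI: "\<And>e. 0 < e \<Longrightarrow> \<exists>r. \<forall>\<^sub>F k in G. (\<integral>x. sq_tail a r x \<partial>\<nu> k) \<le> e"
    and Ent: "\<forall>\<^sub>F k in G. Ent m (\<nu> k) \<le> ereal (h k)" and h: "(h \<longlongrightarrow> h0) G"
  shows "Ent m \<mu> \<le> ereal h0"
proof -
  interpret m: sigma_finite_measure m by fact
  interpret prob_space \<mu> using P2_D[OF \<mu>] by simp
  have sets\<mu>: "sets \<mu> = sets m" using P2_D[OF \<mu>] m by simp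
  have [measurable_cong]: "sets \<mu> = sets B" "sets m = sets B" using P2_D[OF \<mu>] m by auto
  have [measurable]: "d a \<in> borel_measurable B" "gauss c a \<in> borel_measurable B" using a d_point_measurable by auto
  obtain \<rho> where [measurable]: "\<rho> \<in> borel_measurable m" and \<rho>0: "\<And>x. 0 \<le> \<rho> x" and \<rho>: "\<mu> = density m (\<lambda>x. ennreal (\<rho> x))"
  proof -
    obtain D where D: "D \<in> borel_measurable m" "AE x in m. RN_deriv m \<mu> x = ennreal (D x)" "\<And>x. 0 \<le> D x"
      using m.real_RN_deriv[OF finite_measure_axioms ac sets\<mu>] by metis
    have "\<mu> = density m (RN_deriv m \<mu>)" using m.density_RN_deriv[OF ac sets\<mu>] by simp
    also have "\<dots> = density m (\<lambda>x. ennreal (D x))" using D by (intro density_cong) auto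
    finally show ?thesis using that D by blast
  qed
  have [measurable]: "\<rho> \<in> borel_measurable B" using \<open>\<rho> \<in> borel_measurable m\<close> m(2) measurable_cong_sets by blast
  have "integrable \<mu> (\<lambda>x. 1 :: real)" by simp
  then have i\<rho>: "integrable m \<rho>" unfolding \<rho> by (subst (asm) integrable_density) (auto simp: \<rho>0)
  have int\<rho>: "(\<integral>x. \<rho> x \<partial>m) = 1"
  proof -
    have "(\<integral>x. \<rho> x \<partial>m) = (\<integral>x. 1 \<partial>\<mu>)" unfolding \<rho> by (subst integral_density) (auto simp: \<rho>0)
    then show ?thesis by (simp add: prob_space)
  qed
  define C where "C = (\<integral>x. gauss c a x \<partial>m)"
  define \<theta> where "\<theta> M x = max (min (\<rho> x) (real (Suc M))) (gauss c a x / real (Suc M))" for M x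
  have [measurable]: "\<theta> M \<in> borel_measurable B" for M unfolding \<theta>_def[abs_def] by measurable
  have \<theta>pos: "0 < \<theta> M x" for M x using gauss_pos[of c a x] unfolding \<theta>_def by (auto simp: less_max_iff_disj)
  have \<theta>le: "\<theta> M x \<le> \<rho> x + gauss c a x / real (Suc M)" for M x
  proof -
    have "0 < gauss c a x / real (Suc M)" using gauss_pos[of c a x] by simp
    then show ?thesis using \<rho>0[of x] unfolding \<theta>_def max_def min_def by (auto simp del: of_nat_Suc)
  qed
  have i\<theta>: "integrable m (\<theta> M)" for M
    by (rule Bochner_Integration.integrable_bound[where f="\<lambda>x. \<rho> x + gauss c a x / real (Suc M)"])
      (use i\<rho> ig \<theta>le[of M] \<theta>pos[of M] in \<open>auto intro!: AE_I2 simp: less_imp_le intro: order_trans[OF _ abs_ge_self]\<close>)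
  have int\<theta>: "(\<integral>x. \<theta> M x \<partial>m) \<le> 1 + C / real (Suc M)" for M
  proof -
    have "(\<integral>x. \<theta> M x \<partial>m) \<le> (\<integral>x. \<rho> x + gauss c a x / real (Suc M) \<partial>m)"
      by (intro integral_mono i\<theta> \<theta>le) (use i\<rho> ig in auto)
    then show ?thesis using i\<rho> ig int\<rho> by (simp add: C_def)
  qed
  have ln\<theta>: "- c * (d a x)\<^sup>2 - ln (real (Suc M)) \<le> ln (\<theta> M x)" "ln (\<theta> M x) \<le> ln (real (Suc M))" for M x
  proof -
    have "ln (gauss c a x / real (Suc M)) \<le> ln (\<theta> M x)"
      using gauss_pos[of c a x] by (intro ln_mono) (auto simp: \<theta>_def)
    moreover have "ln (gauss c a x / real (Suc M)) = - c * (d a x)\<^sup>2 - ln (real (Suc M))"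
      using gauss_pos[of c a x] by (subst ln_div) (auto simp: ln_gauss)
    ultimately show "- c * (d a x)\<^sup>2 - ln (real (Suc M)) \<le> ln (\<theta> M x)" by simp
    have "gauss c a x / real (Suc M) \<le> 1" using gauss_le_1[OF c, of a x] by (simp add: divide_le_eq)
    also have "\<dots> \<le> real (Suc M)" by simp
    finally have "\<theta> M x \<le> real (Suc M)" unfolding \<theta>_def by (intro max.boundedI min.cobounded2)
    then show "ln (\<theta> M x) \<le> ln (real (Suc M))" using \<theta>pos[of M x] by (intro ln_mono) auto
  qed
  have ln\<theta>b: "\<bar>ln (\<theta> M x)\<bar> \<le> (c + ln (real (Suc M))) * (1 + (d a x)\<^sup>2)" for M x
  proof -
    have "0 \<le> ln (real (Suc M))" by simp
    then have "0 \<le> ln (real (Suc M)) * (d a x)\<^sup>2" "0 \<le> c * (d a x)\<^sup>2" using c by auto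
    moreover have "(c + ln (real (Suc M))) * (1 + (d a x)\<^sup>2) = c + ln (real (Suc M)) + c * (d a x)\<^sup>2 + ln (real (Suc M)) * (d a x)\<^sup>2"
      by (simp add: algebra_simps)
    ultimately show ?thesis using ln\<theta>(1)[of x M] ln\<theta>(2)[of M x] c \<open>0 \<le> ln (real (Suc M))\<close> by linarith
  qed
  have iln: "integrable \<sigma> (\<lambda>x. ln (\<theta> M x))" if "\<sigma> \<in> P2 S" for \<sigma> M
  proof -
    have [measurable_cong]: "sets \<sigma> = sets B" using P2_D[OF that] by simp
    interpret s: prob_space \<sigma> using P2_D[OF that] by simp
    show ?thesis
      by (rule Bochner_Integration.integrable_bound[where f="\<lambda>x. (c + ln (real (Suc M))) * (1 + (d a x)\<^sup>2)"])
        (use P2_integrable[OF that a] ln\<theta>b[of M] in \<open>auto intro!: AE_I2 intro: order_trans[OF _ abs_ge_self]\<close>)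
  qed
  have dual: "(\<integral>x. ln (\<theta> M x) \<partial>\<mu>) \<le> h0 + C / real (Suc M)" for M
  proof -
    have l1: "((\<lambda>k. (\<integral>x. ln (\<theta> M x) \<partial>\<nu> k)) \<longlongrightarrow> (\<integral>x. ln (\<theta> M x) \<partial>\<mu>)) G"
      by (rule tendsto_integral_quadratic[OF \<nu> \<mu> a lim UI, where K="c + ln (real (Suc M))"]) (use ln\<theta>b c in auto)
    have l2: "((\<lambda>k. h k + C / real (Suc M)) \<longlongrightarrow> h0 + C / real (Suc M)) G" by (intro tendsto_intros h)
    show ?thesis
    proof (rule tendsto_le[OF G l2 l1])
      show "\<forall>\<^sub>F k in G. (\<integral>x. ln (\<theta> M x) \<partial>\<nu> k) \<le> h k + C / real (Suc M)"
        using Ent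
      proof (rule eventually_mono)
        fix k assume e: "Ent m (\<nu> k) \<le> ereal (h k)"
        have "ereal ((\<integral>x. ln (\<theta> M x) \<partial>\<nu> k) + 1 - (\<integral>x. \<theta> M x \<partial>m)) \<le> Ent m (\<nu> k)"
          by (rule Ent_dual[OF m(1)])
            (use P2_D[OF \<nu>, of k] m \<theta>pos[of M] i\<theta>[of M] in \<open>auto simp: less_imp_le intro!: iln \<nu>\<close>)
        from order_trans[OF this e] have "(\<integral>x. ln (\<theta> M x) \<partial>\<nu> k) + 1 - (\<integral>x. \<theta> M x \<partial>m) \<le> h k" by simp
        then show "(\<integral>x. ln (\<theta> M x) \<partial>\<nu> k) \<le> h k + C / real (Suc M)" using int\<theta>[of M] by linarith
      qed
    qed
  qed
  \<comment> \<open>\<open>u M\<close> is \<rho> ln \<rho> with the logarithm capped. It lies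
    between the integrable negative part \<open>n\<close> and \<rho> ln (\<theta> M), so Fatou's
    lemma applies to the nonnegative functions u M - n.\<close>
  define u where "u M x = \<rho> x * min (ln (\<rho> x)) (ln (real (Suc M)))" for M x
  have [measurable]: "u M \<in> borel_measurable B" for M unfolding u_def[abs_def] by measurable
  have ule: "u M x \<le> \<rho> x * ln (\<theta> M x)" for M x
  proof (cases "\<rho> x = 0")
    case False
    then have "0 < \<rho> x" using \<rho>0[of x] by simp
    then have "min (ln (\<rho> x)) (ln (real (Suc M))) = ln (min (\<rho> x) (real (Suc M)))"
      by (auto simp: min_def)
    also have "\<dots> \<le> ln (\<theta> M x)" using \<open>0 < \<rho> x\<close> by (intro ln_mono) (auto simp: \<theta>_def)
    finally show ?thesis using \<rho>0[of x] unfolding u_def by (intro mult_left_mono)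
  qed (simp add: u_def)
  define n where "n x = min 0 (\<rho> x * ln (\<rho> x))" for x
  have [measurable]: "n \<in> borel_measurable B" unfolding n_def[abs_def] by measurable
  have ilg: "integrable m (\<lambda>x. \<rho> x * ln (gauss c a x))"
  proof -
    have "integrable \<mu> (\<lambda>x. ln (gauss c a x))" unfolding ln_gauss using P2_integrable[OF \<mu> a] by simp
    then show ?thesis unfolding \<rho> by (subst (asm) integrable_density) (auto simp: \<rho>0)
  qed
  have in': "integrable m n" unfolding n_def[abs_def]
    by (rule Ent_negative_part[OF _ _ \<rho>0 i\<rho> gauss_pos ig ilg]) measurable
  have i\<rho>ln: "integrable m (\<lambda>x. \<rho> x * ln (\<theta> M x))" "(\<integral>x. \<rho> x * ln (\<theta> M x) \<partial>m) = (\<integral>x. ln (\<theta> M x) \<partial>\<mu>)" for M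
    using iln[OF \<mu>, of M] unfolding \<rho>
    by (subst (asm) integrable_density, auto simp: \<rho>0) (subst integral_density, auto simp: \<rho>0)
  have nu: "n x \<le> u M x" for M x
  proof -
    have "0 \<le> ln (real (Suc M))" by simp
    then have "\<rho> x * min (ln (\<rho> x)) 0 \<le> u M x" unfolding u_def using \<rho>0[of x] by (intro mult_left_mono min.mono) auto
    moreover have "\<rho> x * min (ln (\<rho> x)) 0 = n x" unfolding n_def using \<rho>0[of x]
      by (auto simp: min_def mult_le_0_iff zero_le_mult_iff)
    ultimately show ?thesis by simp
  qed
  have uint: "(\<integral>\<^sup>+x. ennreal (u M x - n x) \<partial>m) \<le> ennreal (h0 + C / real (Suc M) - (\<integral>x. n x \<partial>m))" for M
  proof -
    have "(\<integral>\<^sup>+x. ennreal (u M x - n x) \<partial>m) \<le> (\<integral>\<^sup>+x. ennreal (\<rho> x * ln (\<theta> M x) - n x) \<partial>m)"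
      by (intro nn_integral_mono ennreal_leI diff_right_mono ule)
    also have "\<dots> = ennreal (\<integral>x. \<rho> x * ln (\<theta> M x) - n x \<partial>m)"
    proof (rule nn_integral_eq_integral)
      show "integrable m (\<lambda>x. \<rho> x * ln (\<theta> M x) - n x)" using i\<rho>ln(1)[of M] in' by simp
      show "AE x in m. 0 \<le> \<rho> x * ln (\<theta> M x) - n x" using order_trans[OF nu ule] by simp
    qed
    also have "(\<integral>x. \<rho> x * ln (\<theta> M x) - n x \<partial>m) = (\<integral>x. ln (\<theta> M x) \<partial>\<mu>) - (\<integral>x. n x \<partial>m)"
      using i\<rho>ln[of M] in' by simp
    finally show ?thesis using dual[of M] by (elim order_trans) (intro ennreal_leI, simp)
  qed
  have lim0: "(\<lambda>M. ennreal (h0 + C / real (Suc M) - (\<integral>x. n x \<partial>m))) \<longlonglongrightarrow> ennreal (h0 + 0 - (\<integral>x. n x \<partial>m))"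
    by (intro tendsto_ennrealI tendsto_intros LIMSEQ_Suc[OF lim_const_over_n])
  have "(\<integral>\<^sup>+x. ennreal (\<rho> x * ln (\<rho> x) - n x) \<partial>m) = (\<integral>\<^sup>+x. liminf (\<lambda>M. ennreal (u M x - n x)) \<partial>m)"
  proof (rule nn_integral_cong)
    fix x
    obtain N :: nat where N: "\<rho> x < real N" using reals_Archimedean2 by blast
    have "\<forall>\<^sub>F M in sequentially. ennreal (u M x - n x) = ennreal (\<rho> x * ln (\<rho> x) - n x)"
    proof (rule eventually_mono[OF eventually_ge_at_top[of N]])
      fix M assume "N \<le> M"
      then have "\<rho> x \<le> real (Suc M)" using N by simp
      then show "ennreal (u M x - n x) = ennreal (\<rho> x * ln (\<rho> x) - n x)"
        using \<rho>0[of x] by (cases "\<rho> x = 0") (auto simp: u_def min_def)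
    qed
    then have "(\<lambda>M. ennreal (u M x - n x)) \<longlonglongrightarrow> ennreal (\<rho> x * ln (\<rho> x) - n x)" by (rule tendsto_eventually)
    then show "ennreal (\<rho> x * ln (\<rho> x) - n x) = liminf (\<lambda>M. ennreal (u M x - n x))" by (simp add: lim_imp_Liminf)
  qed
  also have "\<dots> \<le> liminf (\<lambda>M. \<integral>\<^sup>+x. ennreal (u M x - n x) \<partial>m)" by (rule nn_integral_liminf) measurable
  also have "\<dots> \<le> liminf (\<lambda>M. ennreal (h0 + C / real (Suc M) - (\<integral>x. n x \<partial>m)))"
    by (rule Liminf_mono, rule always_eventually, rule allI, rule uint)
  also have "\<dots> = ennreal (h0 - (\<integral>x. n x \<partial>m))" using lim_imp_Liminf[OF _ lim0] by simp
  finally have fin: "(\<integral>\<^sup>+x. ennreal (\<rho> x * ln (\<rho> x) - n x) \<partial>m) \<le> ennreal (h0 - (\<integral>x. n x \<partial>m))" .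
  have nle: "n x \<le> \<rho> x * ln (\<rho> x)" for x unfolding n_def by simp
  have i1: "integrable m (\<lambda>x. \<rho> x * ln (\<rho> x) - n x)"
    by (rule integrableI_nonneg) (use nle fin in \<open>auto intro: le_less_trans\<close>)
  from Bochner_Integration.integrable_add[OF this in'] have i2: "integrable m (\<lambda>x. \<rho> x * ln (\<rho> x))" by simp
  \<comment> \<open>\<open>ennreal\<close> sends negative numbers to 0, so \<open>fin\<close> yields
    an inequality between reals only once its right side is known to be nonnegative.\<close>
  have nn: "0 \<le> h0 - (\<integral>x. n x \<partial>m)"
  proof -
    have lim1: "(\<lambda>M. h0 + C / real (Suc M)) \<longlonglongrightarrow> h0 + 0"
      by (intro tendsto_intros LIMSEQ_Suc[OF lim_const_over_n])
    have "(\<integral>x. n x \<partial>m) \<le> h0 + C / real (Suc M)" for M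
    proof -
      have "(\<integral>x. n x \<partial>m) \<le> (\<integral>x. \<rho> x * ln (\<theta> M x) \<partial>m)"
        by (intro integral_mono in' i\<rho>ln order_trans[OF nu ule])
      then show ?thesis using dual[of M] i\<rho>ln(2)[of M] by simp
    qed
    then have "(\<integral>x. n x \<partial>m) \<le> h0 + 0" by (intro tendsto_lowerbound[OF lim1] always_eventually) auto
    then show ?thesis by simp
  qed
  have "(\<integral>x. \<rho> x * ln (\<rho> x) - n x \<partial>m) \<le> h0 - (\<integral>x. n x \<partial>m)"
    using fin nn nle nn_integral_eq_integral[OF i1] by simp
  then have "(\<integral>x. \<rho> x * ln (\<rho> x) \<partial>m) \<le> h0" using i2 in' by simp
  then show ?thesis unfolding \<rho> by (subst Ent_density_integrable[OF m(1) _ \<rho>0 i2]) auto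
qed


text \<open>Both \<mu> and \<nu> k are compared with one measure \<open>?E\<close>, the measure
  \<mu> conditioned on finitely many bounded small cells. \<open>W2_cells_le\<close> bounds both
  distances: the masses of the finitely many cells converge, and so does the second moment outside
  them.\<close>

lemma W2_setwise_limit:
  assumes \<nu>: "\<And>k. \<nu> k \<in> P2 S" and \<mu>: "\<mu> \<in> P2 S" and a: "a \<in> \<Omega>"
    and lim: "\<And>A. A \<in> sets B \<Longrightarrow> ((\<lambda>k. measure (\<nu> k) A) \<longlongrightarrow> measure \<mu> A) G"
    and UI: "\<And>e. 0 < e \<Longrightarrow> \<exists>r. \<forall>\<^sub>F k in G. (\<integral>x. sq_tail a r x \<partial>\<nu> k) \<le> e"
    and V: "\<And>k. (\<integral>x. (d a x)\<^sup>2 \<partial>\<nu> k) \<le> V" "(\<integral>x. (d a x)\<^sup>2 \<partial>\<mu>) \<le> V"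
  shows "((\<lambda>k. W2 S (\<nu> k) \<mu>) \<longlongrightarrow> 0) G"
proof (rule tendstoI)
  fix e :: real assume e: "0 < e"
  interpret prob_space \<mu> using P2_D[OF \<mu>] by simp
  have [measurable_cong]: "sets \<mu> = sets B" using P2_D[OF \<mu>] by auto
  have sp: "space \<mu> = \<Omega>" using P2_D[OF \<mu>] by simp
  have [measurable]: "d a \<in> borel_measurable B" using a d_point_measurable by auto
  have V0: "0 \<le> V" by (rule order_trans[OF integral_nonneg_AE V(2)]) simp
  \<comment> \<open>With 2 \<eta> for both error terms the square root in \<open>W2_cells_le\<close>
    is e / 4. The cells have diameter at most e / 8, so each of the two distances to
    \<open>?E\<close> is at most 3 e / 8.\<close>
  define \<eta> where "\<eta> = e\<^sup>2 / (64 * (1 + V))"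
  have \<eta>: "0 < \<eta>" "4 * (\<eta> + \<eta> * V) = (e / 4)\<^sup>2"
  proof -
    show "0 < \<eta>" using e V0 by (simp add: \<eta>_def)
    have "\<eta> * (1 + V) = e\<^sup>2 / 64" using V0 by (simp add: \<eta>_def divide_simps)
    then show "4 * (\<eta> + \<eta> * V) = (e / 4)\<^sup>2" by (simp add: algebra_simps power2_eq_square)
  qed
  obtain c :: "'a \<Rightarrow> nat" where c [measurable]: "c \<in> B \<rightarrow>\<^sub>M count_space UNIV"
    and cd: "\<And>x y. x \<in> \<Omega> \<Longrightarrow> y \<in> \<Omega> \<Longrightarrow> c x = c y \<Longrightarrow> d x y \<le> e / 8"
    using cell_function[of "e / 8"] e by auto
  define A where "A N i = {x \<in> \<Omega>. c x = i \<and> d a x \<le> real N}" for N i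
  have [measurable]: "A N i \<in> sets B" for N i
  proof -
    have "{x \<in> space B. c x = i \<and> d a x \<le> real N} \<in> sets B" by measurable
    then show ?thesis unfolding A_def by simp
  qed
  \<comment> \<open>Only cells of positive mass are kept, since for them convergence of the masses
    gives the relative closeness demanded by \<open>W2_cells_le\<close>. The unions \<open>E\<close>
    and \<open>E'\<close> differ by a null set of \<mu>.\<close>
  define I where "I N = {i. i < N \<and> 0 < measure \<mu> (A N i)}" for N
  define E where "E N = (\<Union>i\<in>I N. A N i)" for N
  define E' where "E' N = (\<Union>i<N. A N i)" for N
  have fI: "finite (I N)" for N unfolding I_def by simp
  have [measurable]: "E N \<in> sets B" "E' N \<in> sets B" for N unfolding E_def E'_def using fI by auto
  have EE': "AE x in \<mu>. indicator (\<Omega> - E N) x = (indicator (\<Omega> - E' N) x :: real)" for N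
  proof -
    have "AE x in \<mu>. \<forall>i\<in>{..<N}. x \<in> A N i \<longrightarrow> 0 < measure \<mu> (A N i)"
    proof (intro AE_finite_allI finite_lessThan)
      fix i
      show "AE x in \<mu>. x \<in> A N i \<longrightarrow> 0 < measure \<mu> (A N i)"
      proof (cases "0 < measure \<mu> (A N i)")
        case False
        then have "measure \<mu> (A N i) = 0" using measure_nonneg[of \<mu> "A N i"] by linarith
        then have "A N i \<in> null_sets \<mu>" by (simp add: null_sets_def emeasure_eq_measure)
        from AE_not_in[OF this] show ?thesis by (rule eventually_mono) simp
      qed simp
    qed
    then show ?thesis
    proof (rule eventually_mono)
      fix x assume "\<forall>i\<in>{..<N}. x \<in> A N i \<longrightarrow> 0 < measure \<mu> (A N i)"
      then have "x \<in> E N \<longleftrightarrow> x \<in> E' N" unfolding E_def E'_def I_def by auto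
      then show "indicator (\<Omega> - E N) x = (indicator (\<Omega> - E' N) x :: real)" by (simp add: indicator_def)
    qed
  qed
  have pw: "(\<lambda>N. f x * indicator (\<Omega> - E' N) x) \<longlonglongrightarrow> (0::real)" for f :: "'a \<Rightarrow> real" and x
  proof (cases "x \<in> \<Omega>")
    case True
    obtain n :: nat where n: "d a x \<le> real n" using real_arch_simple by blast
    have "\<forall>\<^sub>F N in sequentially. f x * indicator (\<Omega> - E' N) x = 0"
    proof (rule eventually_mono[OF eventually_ge_at_top[of "Suc (max n (c x))"]])
      fix N assume N: "Suc (max n (c x)) \<le> N"
      then have "d a x \<le> real N" using n by linarith
      then have "x \<in> A N (c x)" using True by (simp add: A_def)
      then have "x \<in> E' N" using N by (auto simp: E'_def)
      then show "f x * indicator (\<Omega> - E' N) x = 0" by simp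
    qed
    then show ?thesis by (rule tendsto_eventually)
  qed simp
  have "(\<lambda>N. \<integral>x. (d a x)\<^sup>2 * indicator (\<Omega> - E' N) x \<partial>\<mu>) \<longlonglongrightarrow> (\<integral>x. 0 \<partial>\<mu>)"
    by (rule integral_dominated_convergence[where w="\<lambda>x. (d a x)\<^sup>2"])
      (use P2_integrable[OF \<mu> a] pw in \<open>auto intro!: AE_I2 split: split_indicator\<close>)
  then have D: "(\<lambda>N. \<integral>x. (d a x)\<^sup>2 * indicator (\<Omega> - E' N) x \<partial>\<mu>) \<longlonglongrightarrow> 0" by simp
  have "(\<lambda>N. \<integral>x. (1 :: real) * indicator (\<Omega> - E' N) x \<partial>\<mu>) \<longlonglongrightarrow> (\<integral>x. 0 \<partial>\<mu>)"
    by (rule integral_dominated_convergence[where w="\<lambda>x. 1"])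
      (use pw[of "\<lambda>_. 1"] in \<open>auto intro!: AE_I2 split: split_indicator\<close>)
  then have "(\<lambda>N. measure \<mu> (\<Omega> - E' N)) \<longlonglongrightarrow> 0" by (simp add: sp Int_absorb2)
  from tendsto_diff[OF tendsto_const[of 1] this] have "(\<lambda>N. measure \<mu> (E' N)) \<longlonglongrightarrow> 1"
    using prob_compl[of "E' _"] by (simp add: sp)
  moreover have mE: "measure \<mu> (E N) = measure \<mu> (E' N)" for N
  proof (rule measure_eq_AE)
    show "AE x in \<mu>. (x \<in> E N) = (x \<in> E' N)"
      using EE'[of N] AE_space by eventually_elim (auto simp: sp split: split_indicator_asm)
  qed auto
  ultimately have \<beta>lim: "(\<lambda>N. measure \<mu> (E N)) \<longlonglongrightarrow> 1" by simp
  have "(\<lambda>N. 1 / measure \<mu> (E N) - 1) \<longlonglongrightarrow> 1 / 1 - 1" by (intro tendsto_intros \<beta>lim) simp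
  then have "\<forall>\<^sub>F N in sequentially. (\<integral>x. (d a x)\<^sup>2 * indicator (\<Omega> - E' N) x \<partial>\<mu>) < \<eta> \<and> 1 / measure \<mu> (E N) - 1 < \<eta> \<and> 0 < measure \<mu> (E N)"
    using \<eta>(1) order_tendstoD(1)[OF \<beta>lim, of 0] by (intro eventually_conj order_tendstoD(2)[OF D] order_tendstoD(2)) auto
  then obtain N where N: "(\<integral>x. (d a x)\<^sup>2 * indicator (\<Omega> - E' N) x \<partial>\<mu>) < \<eta>" "1 / measure \<mu> (E N) - 1 < \<eta>" "0 < measure \<mu> (E N)"
    using eventually_happens'[OF sequentially_bot] by blast
  have DE: "(\<integral>x. (d a x)\<^sup>2 * indicator (\<Omega> - E N) x \<partial>\<mu>) < \<eta>"
  proof -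
    have "(\<integral>x. (d a x)\<^sup>2 * indicator (\<Omega> - E N) x \<partial>\<mu>) = (\<integral>x. (d a x)\<^sup>2 * indicator (\<Omega> - E' N) x \<partial>\<mu>)"
      by (rule integral_cong_AE) (use EE'[of N] in \<open>auto elim: eventually_mono\<close>)
    then show ?thesis using N(1) by simp
  qed
  define \<beta> where "\<beta> = measure \<mu> (E N)"
  define b where "b i = measure \<mu> (A N i) / \<beta>" for i
  have disj: "disjoint_family_on (A N) (I N)" unfolding disjoint_family_on_def A_def by auto
  have \<beta>: "0 < \<beta>" "\<beta> \<le> 1" using N(3) unfolding \<beta>_def by auto
  have cells: "cells \<mu> (I N) (A N) b"
  proof (rule cells.intro)
    show "sigma_finite_measure \<mu>" ..
    show "0 < measure \<mu> (A N i)" if "i \<in> I N" for i using that unfolding I_def by simp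
    show "0 \<le> b i" for i using \<beta> unfolding b_def by simp
    have "(\<Sum>i\<in>I N. measure \<mu> (A N i)) = measure \<mu> (\<Union>i\<in>I N. A N i)"
      using fI disj by (intro finite_measure_finite_Union[symmetric]) auto
    then show "(\<Sum>i\<in>I N. b i) = 1" using \<beta> by (simp add: b_def \<beta>_def E_def sum_divide_distrib[symmetric])
  qed (use fI disj in \<open>auto simp: emeasure_eq_measure\<close>)
  interpret c: cells \<mu> "I N" "A N" b by (rule cells)
  let ?E = "cell_measure \<mu> (I N) (A N) b"
  have EP: "?E \<in> P2 S"
    by (rule cell_measure_P2[OF cells _ a, of "real N"]) (use P2_D[OF \<mu>] in \<open>auto simp: A_def\<close>)
  have meas: "measure ?E (A N i) = b i" if "i \<in> I N" for i
    using c.emeasure_cell[OF that] c.b0[OF that] by (simp add: measure_def)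
  have mU: "measure ?E (\<Union>i\<in>I N. A N i) = 1" using c.emeasure_Union by (simp add: measure_def)
  have diam: "d x y \<le> e / 8" if "x \<in> A N i" "y \<in> A N i" for i x y using that cd unfolding A_def by auto
  have bnd: "W2 S \<rho> ?E \<le> e / 8 + e / 4"
    if \<rho>: "\<rho> \<in> P2 S" and 1: "(\<integral>x. (d a x)\<^sup>2 * indicator (\<Omega> - E N) x \<partial>\<rho>) \<le> 2 * \<eta>" and 2: "(\<integral>x. (d a x)\<^sup>2 \<partial>\<rho>) \<le> V"
      and 3: "\<And>i. i \<in> I N \<Longrightarrow> \<bar>measure \<rho> (A N i) - b i\<bar> \<le> 2 * \<eta> * measure \<rho> (A N i)" for \<rho>
  proof -
    have "W2 S \<rho> ?E \<le> e / 8 + sqrt (2 * ((\<integral>x. (d a x)\<^sup>2 * indicator (\<Omega> - (\<Union>i\<in>I N. A N i)) x \<partial>\<rho>) + 2 * \<eta> * (\<integral>x. (d a x)\<^sup>2 \<partial>\<rho>)))"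
      by (rule W2_cells_le[OF \<rho> EP fI _ disj diam _ _ _ _ a])
        (use e 3 \<eta> mU meas in auto)
    also have "\<dots> \<le> e / 8 + sqrt (2 * (2 * \<eta> + 2 * \<eta> * V))"
      using 1 2 \<eta> unfolding E_def by (intro add_left_mono real_sqrt_le_mono mult_left_mono add_mono) auto
    also have "2 * (2 * \<eta> + 2 * \<eta> * V) = (e / 4)\<^sup>2" using \<eta>(2) by (simp add: algebra_simps)
    also have "sqrt ((e / 4)\<^sup>2) = e / 4" using e by simp
    finally show ?thesis .
  qed
  have b1: "W2 S \<mu> ?E \<le> e / 8 + e / 4"
  proof (rule bnd[OF \<mu> _ V(2)])
    show "(\<integral>x. (d a x)\<^sup>2 * indicator (\<Omega> - E N) x \<partial>\<mu>) \<le> 2 * \<eta>" using DE \<eta>(1) by simp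
    fix i
    have "measure \<mu> (A N i) - b i = - ((1 / \<beta> - 1) * measure \<mu> (A N i))" by (simp add: b_def algebra_simps)
    then have "\<bar>measure \<mu> (A N i) - b i\<bar> = (1 / \<beta> - 1) * measure \<mu> (A N i)" using \<beta> by (simp add: abs_mult)
    also have "\<dots> \<le> 2 * \<eta> * measure \<mu> (A N i)" using N(2) \<eta>(1) by (intro mult_right_mono) (auto simp: \<beta>_def)
    finally show "\<bar>measure \<mu> (A N i) - b i\<bar> \<le> 2 * \<eta> * measure \<mu> (A N i)" .
  qed
  have ev1: "\<forall>\<^sub>F k in G. (\<integral>x. (d a x)\<^sup>2 * indicator (\<Omega> - E N) x \<partial>\<nu> k) < 2 * \<eta>"
  proof (rule order_tendstoD(2))
    show "((\<lambda>k. \<integral>x. (d a x)\<^sup>2 * indicator (\<Omega> - E N) x \<partial>\<nu> k) \<longlongrightarrow> (\<integral>x. (d a x)\<^sup>2 * indicator (\<Omega> - E N) x \<partial>\<mu>)) G"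
      by (rule tendsto_integral_quadratic[OF \<nu> \<mu> a lim UI, where K=1]) (auto split: split_indicator)
    show "(\<integral>x. (d a x)\<^sup>2 * indicator (\<Omega> - E N) x \<partial>\<mu>) < 2 * \<eta>" using DE \<eta>(1) by simp
  qed
  have ev2: "\<forall>\<^sub>F k in G. \<forall>i\<in>I N. \<bar>measure (\<nu> k) (A N i) - b i\<bar> < 2 * \<eta> * measure (\<nu> k) (A N i)"
  proof (intro eventually_ball_finite fI ballI)
    fix i assume i: "i \<in> I N"
    have pos: "0 < measure \<mu> (A N i)" using i unfolding I_def by simp
    have "((\<lambda>k. 2 * \<eta> * measure (\<nu> k) (A N i) - \<bar>measure (\<nu> k) (A N i) - b i\<bar>) \<longlongrightarrow> 2 * \<eta> * measure \<mu> (A N i) - \<bar>measure \<mu> (A N i) - b i\<bar>) G"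
      by (intro tendsto_intros lim) auto
    moreover have "0 < 2 * \<eta> * measure \<mu> (A N i) - \<bar>measure \<mu> (A N i) - b i\<bar>"
    proof -
      have "measure \<mu> (A N i) - b i = - ((1 / \<beta> - 1) * measure \<mu> (A N i))" by (simp add: b_def algebra_simps)
      then have "\<bar>measure \<mu> (A N i) - b i\<bar> = (1 / \<beta> - 1) * measure \<mu> (A N i)" using \<beta> by (simp add: abs_mult)
      also have "\<dots> < 2 * \<eta> * measure \<mu> (A N i)" using N(2) \<eta>(1) pos by (intro mult_strict_right_mono) (auto simp: \<beta>_def)
      finally show ?thesis by simp
    qed
    ultimately have "\<forall>\<^sub>F k in G. 0 < 2 * \<eta> * measure (\<nu> k) (A N i) - \<bar>measure (\<nu> k) (A N i) - b i\<bar>" by (rule order_tendstoD(1))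
    then show "\<forall>\<^sub>F k in G. \<bar>measure (\<nu> k) (A N i) - b i\<bar> < 2 * \<eta> * measure (\<nu> k) (A N i)"
      by (rule eventually_mono) simp
  qed
  show "\<forall>\<^sub>F k in G. dist (W2 S (\<nu> k) \<mu>) 0 < e"
    using ev1 ev2
  proof eventually_elim
    fix k assume 1: "(\<integral>x. (d a x)\<^sup>2 * indicator (\<Omega> - E N) x \<partial>\<nu> k) < 2 * \<eta>"
      and 2: "\<forall>i\<in>I N. \<bar>measure (\<nu> k) (A N i) - b i\<bar> < 2 * \<eta> * measure (\<nu> k) (A N i)"
    have "W2 S (\<nu> k) ?E \<le> e / 8 + e / 4"
      by (rule bnd[OF \<nu> _ V(1)]) (use 1 2 in \<open>auto simp: less_imp_le\<close>)
    moreover have "W2 S ?E \<mu> \<le> e / 8 + e / 4" using b1 W2_commute[OF EP \<mu>] by simp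
    moreover have "W2 S (\<nu> k) \<mu> \<le> W2 S (\<nu> k) ?E + W2 S ?E \<mu>" by (rule W2_triangle[OF \<nu> EP \<mu>])
    ultimately show "dist (W2 S (\<nu> k) \<mu>) 0 < e" using e W2_nonneg[of "\<nu> k" \<mu>] by (simp add: dist_real_def)
  qed
qed

lemma setwise_limit:
  assumes m: "sigma_finite_measure m" "sets m = sets B" and a: "a \<in> \<Omega>" and ig: "integrable m (gauss c a)" and c: "0 \<le> c"
    and \<nu>: "\<And>k. \<nu> k \<in> P2 S" and Ent: "\<forall>\<^sub>F k in G. Ent m (\<nu> k) \<le> ereal (h k)" and h: "(h \<longlongrightarrow> h0) G"
    and V: "\<And>k. (\<integral>x. (d a x)\<^sup>2 \<partial>\<nu> k) \<le> V"
    and UI: "\<And>e. 0 < e \<Longrightarrow> \<exists>r. \<forall>\<^sub>F k in G. (\<integral>x. sq_tail a r x \<partial>\<nu> k) \<le> e"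
    and G: "G \<noteq> bot" and lim: "\<And>A. A \<in> sets B \<Longrightarrow> ((\<lambda>k. measure (\<nu> k) A) \<longlongrightarrow> x A) G"
  obtains \<mu> where "\<mu> \<in> P2 S" "((\<lambda>k. W2 S (\<nu> k) \<mu>) \<longlongrightarrow> 0) G" "Ent m \<mu> \<le> ereal h0"
proof -
  have "\<forall>\<^sub>F k in G. h k < h0 + 1" using h by (rule order_tendstoD(2)) simp
  then have ev: "\<forall>\<^sub>F k in G. Ent m (\<nu> k) \<le> ereal (h0 + 1)"
    using Ent
  proof eventually_elim
    fix k assume "h k < h0 + 1" "Ent m (\<nu> k) \<le> ereal (h k)"
    then show "Ent m (\<nu> k) \<le> ereal (h0 + 1)" by (elim order_trans) simp
  qed
  obtain \<mu> where \<mu>: "prob_space \<mu>" "sets \<mu> = sets B" "\<And>A. A \<in> sets B \<Longrightarrow> measure \<mu> A = x A" "absolutely_continuous m \<mu>"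
    using setwise_limit_measure[OF m a ig c \<nu> ev V G lim] by metis
  have lim': "((\<lambda>k. measure (\<nu> k) A) \<longlongrightarrow> measure \<mu> A) G" if "A \<in> sets B" for A
    using lim[OF that] \<mu>(3)[OF that] by simp
  note P = P2_setwise_limit[OF \<nu> \<mu>(1,2) a lim' G V]
  show ?thesis
    by (rule that[OF P(1) W2_setwise_limit[OF \<nu> P(1) a lim' UI V P(2)] Ent_lsc[OF m a ig c \<nu> P(1) \<mu>(4) lim' G UI Ent h]])
qed


section \<open>Growth of balls\<close>

text \<open>The interpolation part of \<open>CD_infinity\<close>, for a measure without base point
  and growth condition. In this form it can be moved to the push-forwards in the common space, and
  the growth bounds are deduced from it.\<close>

definition CD_inequality :: "real \<Rightarrow> 'a measure \<Rightarrow> bool" where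
  "CD_inequality K m \<longleftrightarrow> (\<forall>\<mu>0\<in>Ent_dom S m. \<forall>\<mu>1\<in>Ent_dom S m.
     \<exists>\<mu>. W2_geodesic S \<mu> \<and> \<mu> 0 = \<mu>0 \<and> \<mu> 1 = \<mu>1 \<and>
       (\<forall>t\<in>{0..1}. Ent m (\<mu> t) \<le> ereal (1 - t) * Ent m (\<mu> 0) + ereal t * Ent m (\<mu> 1)
          - ereal (K / 2 * t * (1 - t) * (W2 S (\<mu> 0) (\<mu> 1))\<^sup>2)))"

text \<open>The measure is m conditioned on A, a cell measure with one cell; its density is the
  constant 1 / m A.\<close>

lemma single_cell:
  assumes m: "sigma_finite_measure m" "sets m = sets B" and A: "A \<in> sets B" and pos: "0 < measure m A" and fin: "emeasure m A < \<infinity>"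
    and a: "a \<in> \<Omega>" and R: "\<And>x. x \<in> A \<Longrightarrow> d a x \<le> R"
  obtains \<mu> where "\<mu> \<in> P2 S" "measure \<mu> A = 1" "Ent m \<mu> = ereal (- ln (measure m A))"
proof -
  have c: "cells m {0} (\<lambda>_. A) (\<lambda>_. 1)"
    by (rule cells.intro) (use assms in \<open>auto simp: disjoint_family_on_def\<close>)
  interpret cells m "{0}" "\<lambda>_. A" "\<lambda>_. 1" by (rule c)
  show ?thesis
  proof (rule that[of "cell_measure m {0} (\<lambda>_. A) (\<lambda>_. 1)"])
    show "cell_measure m {0} (\<lambda>_. A) (\<lambda>_. 1) \<in> P2 S" by (rule cell_measure_P2[OF c assms(2) a R])
    show "measure (cell_measure m {0} (\<lambda>_. A) (\<lambda>_. 1)) A = 1" using emeasure_cell[of 0] by (simp add: measure_def)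
    show "Ent m (cell_measure m {0} (\<lambda>_. A) (\<lambda>_. 1)) = ereal (- ln (measure m A))"
      unfolding Ent_cell_measure using pos by (simp add: ln_div)
  qed
qed

text \<open>The dual formula with \<theta> the indicator of A divided by m A, in other words
  Jensen's inequality: among measures carried by A, the uniform one has the least entropy.\<close>

lemma Ent_ge_support:
  assumes m: "sigma_finite_measure m" "sets m = sets B" and A [measurable]: "A \<in> sets B" and pos: "0 < measure m A" and fin: "emeasure m A < \<infinity>"
    and \<mu>: "\<mu> \<in> P2 S" "measure \<mu> A = 1"
  shows "ereal (- ln (measure m A)) \<le> Ent m \<mu>"
proof -
  interpret prob_space \<mu> using P2_D[OF \<mu>(1)] by simp
  have [measurable_cong]: "sets \<mu> = sets B" "sets m = sets B" using P2_D[OF \<mu>(1)] m by simp_all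
  have spm: "space m = \<Omega>" using sets_eq_imp_space_eq[OF m(2)] by simp
  define q where "q = 1 / measure m A"
  have q: "0 < q" using pos by (simp add: q_def)
  have ae: "AE x in \<mu>. x \<in> A" using \<mu>(2) prob_eq_1[of A] by simp
  have lnq: "AE x in \<mu>. ln (q * indicator A x) = ln q" by (rule eventually_mono[OF ae]) simp
  have "ereal ((\<integral>x. ln (q * indicator A x) \<partial>\<mu>) + 1 - (\<integral>x. q * indicator A x \<partial>m)) \<le> Ent m \<mu>"
  proof (rule Ent_dual[OF m(1) prob_space_axioms])
    show "AE x in \<mu>. 0 < q * indicator A x" by (rule eventually_mono[OF ae]) (simp add: q)
    show "integrable m (\<lambda>x. q * indicator A x)" using fin by simp
    have "integrable \<mu> (\<lambda>x. ln (q * indicator A x)) \<longleftrightarrow> integrable \<mu> (\<lambda>x. ln q)"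
      by (rule integrable_cong_AE[OF _ _ lnq]) measurable
    then show "integrable \<mu> (\<lambda>x. ln (q * indicator A x))" by simp
  qed (use q m P2_D[OF \<mu>(1)] in auto)
  moreover have "(\<integral>x. ln (q * indicator A x) \<partial>\<mu>) = ln q"
  proof -
    have "(\<integral>x. ln (q * indicator A x) \<partial>\<mu>) = (\<integral>x. ln q \<partial>\<mu>)" by (rule integral_cong_AE[OF _ _ lnq]) measurable
    then show ?thesis by (simp add: prob_space)
  qed
  moreover have "(\<integral>x. q * indicator A x \<partial>m) = 1"
    using pos sets.sets_into_space[OF A] by (simp add: q_def spm Int_absorb2)
  ultimately show ?thesis using pos by (simp add: q_def ln_div)
qed

lemma W2_geodesicD:
  assumes "W2_geodesic S \<mu>"
  shows "t \<in> {0..1} \<Longrightarrow> \<mu> t \<in> P2 S"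
    and "s \<in> {0..1} \<Longrightarrow> t \<in> {0..1} \<Longrightarrow> W2 S (\<mu> t) (\<mu> s) = \<bar>t - s\<bar> * W2 S (\<mu> 0) (\<mu> 1)"
  using assms unfolding W2_geodesic_def by blast+

text \<open>Interpolating between the unit ball and the ball of radius \<open>R\<close> at time \<open>1 / (R + 1)\<close> gives
  a measure carried by a ball of fixed radius, so its entropy bounds the mass of the large ball.\<close>

lemma CD_ball_growth:
  assumes m: "sigma_finite_measure m" "sets m = sets B" and x: "x \<in> \<Omega>" and CD: "CD_inequality K m"
    and fin: "\<And>r. emeasure m (mball_of S x r) < \<infinity>" and pos: "0 < measure m (mball_of S x 1)" and R: "1 \<le> R"
  shows "ln (measure m (mball_of S x R)) \<le> (R + 1) * (\<bar>ln (measure m (mball_of S x 3))\<bar> + \<bar>ln (measure m (mball_of S x 1))\<bar>) + 2 * \<bar>K\<bar> * R\<^sup>2"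
proof -
  have mono: "measure m (mball_of S x 1) \<le> measure m (mball_of S x r)" if "1 \<le> r" for r
    using fin that m by (intro measure_mono_fmeasurable fmeasurableI) (auto simp: fmeasurable_def)
  have posr: "0 < measure m (mball_of S x r)" if "1 \<le> r" for r using mono[OF that] pos by simp
  have bd: "y \<in> mball_of S x r \<Longrightarrow> d x y \<le> r" for y r by simp
  obtain \<mu>0 where \<mu>0: "\<mu>0 \<in> P2 S" "measure \<mu>0 (mball_of S x 1) = 1" "Ent m \<mu>0 = ereal (- ln (measure m (mball_of S x 1)))"
    by (rule single_cell[OF m mball_of_sets pos fin x bd])
  obtain \<mu>1 where \<mu>1: "\<mu>1 \<in> P2 S" "measure \<mu>1 (mball_of S x R) = 1" "Ent m \<mu>1 = ereal (- ln (measure m (mball_of S x R)))"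
    by (rule single_cell[OF m mball_of_sets posr[OF R] fin x bd])
  have dom: "\<mu>0 \<in> Ent_dom S m" "\<mu>1 \<in> Ent_dom S m" using \<mu>0 \<mu>1 unfolding Ent_dom_def by auto
  obtain \<mu> where geo: "W2_geodesic S \<mu>" "\<mu> 0 = \<mu>0" "\<mu> 1 = \<mu>1"
    and E: "\<And>t. t \<in> {0..1} \<Longrightarrow> Ent m (\<mu> t) \<le> ereal (1 - t) * Ent m (\<mu> 0) + ereal t * Ent m (\<mu> 1)
          - ereal (K / 2 * t * (1 - t) * (W2 S (\<mu> 0) (\<mu> 1))\<^sup>2)"
    using CD dom unfolding CD_inequality_def by blast
  interpret P0: prob_space \<mu>0 using P2_D[OF \<mu>0(1)] by simp
  interpret P1: prob_space \<mu>1 using P2_D[OF \<mu>1(1)] by simp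
  \<comment> \<open>Points of the two balls are at most R + 1 apart, so at this time a point
    starting in the unit ball has moved by at most t (R + 1) = 1 and is within 2 of x. The radius 3
    leaves a margin of 1 for the L2 error, to which Chebyshev's argument is applied.\<close>
  define t where "t = 1 / (R + 1)"
  have t: "0 < t" "t \<le> 1" "t * (R + 1) = 1" using R by (auto simp: t_def)
  define w where "w = W2 S \<mu>0 \<mu>1"
  have w0: "0 \<le> w" unfolding w_def by (rule W2_nonneg)
  have \<mu>t: "\<mu> t \<in> P2 S" by (rule W2_geodesicD(1)[OF geo(1)]) (use t in auto)
  have W: "W2 S \<mu>0 (\<mu> t) = t * w" "W2 S (\<mu> t) \<mu>1 = (1 - t) * w"
  proof -
    have "W2 S (\<mu> 0) (\<mu> t) = \<bar>0 - t\<bar> * W2 S (\<mu> 0) (\<mu> 1)" by (rule W2_geodesicD(2)[OF geo(1)]) (use t in auto)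
    then show "W2 S \<mu>0 (\<mu> t) = t * w" unfolding geo using t by (simp add: w_def)
    have "W2 S (\<mu> t) (\<mu> 1) = \<bar>t - 1\<bar> * W2 S (\<mu> 0) (\<mu> 1)" by (rule W2_geodesicD(2)[OF geo(1)]) (use t in auto)
    then show "W2 S (\<mu> t) \<mu>1 = (1 - t) * w" unfolding geo using t by (simp add: w_def)
  qed
  have wR: "w \<le> 2 * R"
    unfolding w_def
  proof (rule W2_same_cells_le[OF \<mu>0(1) \<mu>1(1), of "\<lambda>_. 0" "mball_of S x R"])
    show "measure \<mu>0 {x \<in> \<Omega>. 0 = j} = measure \<mu>1 {x \<in> \<Omega>. 0 = j}" for j :: nat
    proof (cases "0 = j")
      case True
      then show ?thesis using P0.prob_space P1.prob_space P2_D(1)[OF \<mu>0(1)] P2_D(1)[OF \<mu>1(1)] by simp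
    qed simp
    have "measure \<mu>0 (mball_of S x 1) \<le> measure \<mu>0 (mball_of S x R)"
      using R P2_D[OF \<mu>0(1)] by (intro P0.finite_measure_mono) auto
    then show "measure \<mu>0 (mball_of S x R) = 1" using \<mu>0(2) P0.prob_le_1[of "mball_of S x R"] by simp
    show "measure \<mu>1 (mball_of S x R) = 1" by fact
    fix u v assume "u \<in> mball_of S x R" "v \<in> mball_of S x R"
    then show "d u v \<le> 2 * R" using mdist_triangle[of u S x v] by (simp add: mdist_commute)
  qed (use R in auto)
  have B3: "measure (\<mu> t) (mball_of S x 3) = 1"
  proof -
    interpret Pt: prob_space "\<mu> t" using P2_D[OF \<mu>t] by simp
    \<comment> \<open>The points of a geodesic are exactly intermediate, so the estimate holds for
      every k > 0, and letting k tend to 0 shows that no mass lies outside the ball.\<close>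
    have sub: "measure (\<mu> t) (\<Omega> - mball_of S x 3) \<le> 200 * k * (w + k)" if k: "0 < k" for k
    proof -
      have le: "W2 S \<mu>0 (\<mu> t) \<le> t * w + k" "W2 S (\<mu> t) \<mu>1 \<le> (1 - t) * w + k" "w - k \<le> W2 S \<mu>0 \<mu>1"
        using W k by (auto simp: w_def)
      obtain \<Gamma> :: "(('a \<times> 'a) \<times> ('a \<times> 'a)) measure" and X Y Z where \<Gamma>: "prob_space \<Gamma>"
        and [measurable]: "X \<in> \<Gamma> \<rightarrow>\<^sub>M B" "Y \<in> \<Gamma> \<rightarrow>\<^sub>M B" "Z \<in> \<Gamma> \<rightarrow>\<^sub>M B"
        and D: "distr \<Gamma> B X = \<mu>0" "distr \<Gamma> B Z = \<mu> t" "distr \<Gamma> B Y = \<mu>1"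
        and I: "(\<integral>\<^sup>+z. ennreal ((d (X z) (Z z) - t * d (X z) (Y z))\<^sup>2) \<partial>\<Gamma>) \<le> ennreal (200 * k * (w + k))"
        using intermediate_point[OF \<mu>0(1) \<mu>t \<mu>1(1) less_imp_le[OF t(1)] t(2) w0 k le] by blast
      interpret G: prob_space \<Gamma> by fact
      have in\<Omega>: "X z \<in> \<Omega>" "Y z \<in> \<Omega>" "Z z \<in> \<Omega>" if "z \<in> space \<Gamma>" for z
        using that measurable_space[of X \<Gamma> B z] measurable_space[of Y \<Gamma> B z] measurable_space[of Z \<Gamma> B z] by auto
      have "AE y in distr \<Gamma> B X. y \<in> mball_of S x 1" unfolding D using \<mu>0 P0.prob_eq_1[of "mball_of S x 1"] P2_D[OF \<mu>0(1)] by simp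
      then have 1: "AE z in \<Gamma>. X z \<in> mball_of S x 1" by (subst (asm) AE_distr_iff) auto
      have "AE y in distr \<Gamma> B Y. y \<in> mball_of S x R" unfolding D using \<mu>1 P1.prob_eq_1[of "mball_of S x R"] P2_D[OF \<mu>1(1)] by simp
      then have 2: "AE z in \<Gamma>. Y z \<in> mball_of S x R" by (subst (asm) AE_distr_iff) auto
      have "emeasure (\<mu> t) (\<Omega> - mball_of S x 3) = (\<integral>\<^sup>+y. indicator (\<Omega> - mball_of S x 3) y \<partial>\<mu> t)"
        using P2_D[OF \<mu>t] by (subst nn_integral_indicator) auto
      also have "\<dots> = (\<integral>\<^sup>+z. indicator (\<Omega> - mball_of S x 3) (Z z) \<partial>\<Gamma>)"
        unfolding D(2)[symmetric] by (subst nn_integral_distr) auto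
      also have "\<dots> \<le> (\<integral>\<^sup>+z. ennreal ((d (X z) (Z z) - t * d (X z) (Y z))\<^sup>2) \<partial>\<Gamma>)"
      proof (rule nn_integral_mono_AE)
        show "AE z in \<Gamma>. indicator (\<Omega> - mball_of S x 3) (Z z) \<le> ennreal ((d (X z) (Z z) - t * d (X z) (Y z))\<^sup>2)"
          using 1 2 AE_space
        proof eventually_elim
          fix z assume z: "X z \<in> mball_of S x 1" "Y z \<in> mball_of S x R" "z \<in> space \<Gamma>"
          note o = in\<Omega>[OF z(3)]
          show "indicator (\<Omega> - mball_of S x 3) (Z z) \<le> ennreal ((d (X z) (Z z) - t * d (X z) (Y z))\<^sup>2)"
          proof (cases "Z z \<in> mball_of S x 3")
            case False
            then have "3 \<le> d x (Z z)" using x o by auto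
            moreover have "d x (Z z) \<le> d x (X z) + d (X z) (Z z)" using x o by (intro mdist_triangle)
            moreover have "d (X z) (Y z) \<le> R + 1" using mdist_triangle[of "X z" S x "Y z"] x o z by (simp add: mdist_commute)
            then have "t * d (X z) (Y z) \<le> t * (R + 1)" using t by (intro mult_left_mono) auto
            ultimately have "1 \<le> d (X z) (Z z) - t * d (X z) (Y z)" using z(1) t(3) by simp
            then have "1 \<le> (d (X z) (Z z) - t * d (X z) (Y z))\<^sup>2" by (rule one_le_power)
            then show ?thesis using False o by (simp add: indicator_def)
          qed simp
        qed
      qed
      finally have "ennreal (measure (\<mu> t) (\<Omega> - mball_of S x 3)) \<le> ennreal (200 * k * (w + k))"
        using I by (simp add: Pt.emeasure_eq_measure)
      then show ?thesis using k w0 by (subst (asm) ennreal_le_iff) auto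
    qed
    have "((\<lambda>k. 200 * k * (w + k)) \<longlongrightarrow> 200 * 0 * (w + 0)) (at_right 0)" by (intro tendsto_intros)
    then have "measure (\<mu> t) (\<Omega> - mball_of S x 3) \<le> 200 * 0 * (w + 0)"
    proof (rule tendsto_lowerbound)
      show "\<forall>\<^sub>F k in at_right 0. measure (\<mu> t) (\<Omega> - mball_of S x 3) \<le> 200 * k * (w + k)"
        using eventually_at_right_less by (rule eventually_mono) (rule sub)
    qed simp
    then have "measure (\<mu> t) (\<Omega> - mball_of S x 3) = 0" by (simp add: measure_le_0_iff)
    then show ?thesis using Pt.prob_compl[of "mball_of S x 3"] P2_D[OF \<mu>t] by simp
  qed
  define l0 where "l0 = ln (measure m (mball_of S x 1))"
  define lR where "lR = ln (measure m (mball_of S x R))"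
  define l3 where "l3 = ln (measure m (mball_of S x 3))"
  have "ereal (- l3) \<le> Ent m (\<mu> t)" unfolding l3_def
    by (rule Ent_ge_support[OF m mball_of_sets posr fin \<mu>t B3]) simp
  also have "\<dots> \<le> ereal (1 - t) * ereal (- l0) + ereal t * ereal (- lR) - ereal (K / 2 * t * (1 - t) * w\<^sup>2)"
    using E[of t] t unfolding geo \<mu>0 \<mu>1 by (simp add: l0_def lR_def w_def)
  finally have "- l3 \<le> (1 - t) * (- l0) + t * (- lR) - K / 2 * t * (1 - t) * w\<^sup>2" by simp
  then have "t * lR \<le> l3 - (1 - t) * l0 - K / 2 * t * (1 - t) * w\<^sup>2" by simp
  also have "\<dots> \<le> \<bar>l3\<bar> + \<bar>l0\<bar> + t * (2 * \<bar>K\<bar> * R\<^sup>2)"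
  proof -
    have "- ((1 - t) * l0) \<le> \<bar>(1 - t) * l0\<bar>" by simp
    also have "\<dots> \<le> 1 * \<bar>l0\<bar>" unfolding abs_mult using t by (intro mult_right_mono) auto
    finally have 1: "- ((1 - t) * l0) \<le> \<bar>l0\<bar>" by simp
    have "- (K / 2 * t * (1 - t) * w\<^sup>2) \<le> \<bar>K / 2 * t * (1 - t) * w\<^sup>2\<bar>" by simp
    also have "\<dots> = \<bar>K\<bar> / 2 * t * (1 - t) * w\<^sup>2" using t by (simp add: abs_mult)
    also have "\<dots> \<le> \<bar>K\<bar> / 2 * t * 1 * (2 * R)\<^sup>2"
      using t w0 wR by (intro mult_mono power_mono) auto
    also have "\<dots> = t * (2 * \<bar>K\<bar> * R\<^sup>2)" by (simp add: power2_eq_square)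
    finally have 2: "- (K / 2 * t * (1 - t) * w\<^sup>2) \<le> t * (2 * \<bar>K\<bar> * R\<^sup>2)" .
    show ?thesis using 1 2 abs_ge_self[of l3] by linarith
  qed
  finally have "(R + 1) * (t * lR) \<le> (R + 1) * (\<bar>l3\<bar> + \<bar>l0\<bar> + t * (2 * \<bar>K\<bar> * R\<^sup>2))" using R by (intro mult_left_mono) auto
  moreover have "(R + 1) * (t * y) = y" for y using t(3) by (metis mult.assoc mult.commute mult_1)
  ultimately show ?thesis unfolding l0_def lR_def l3_def by (simp add: distrib_left)
qed

text \<open>A point with j \<le> d a x < j + 1 lies in the ball of radius j + 1, and the Gaussian is
  at most exp (- (2 C + 1) j^2) there. Since (j + 3)^2 \<le> 2 j^2 + 18, the j-th term of the sum is
  at most exp (18 C - j^2), hence at most exp (18 C) exp (- j). This is the origin of both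
  constants.\<close>

lemma gauss_integral_bound:
  assumes m: "sets m = sets B" and a: "a \<in> \<Omega>" and C: "0 \<le> C"
    and le: "\<And>j :: nat. emeasure m (mball_of S a (real (Suc j))) \<le> ennreal (exp (C * (real j + 3)\<^sup>2))"
  shows "integrable m (gauss (2 * C + 1) a)" "(\<integral>x. gauss (2 * C + 1) a x \<partial>m) \<le> exp (18 * C) * (\<Sum>j. exp (- real j))"
proof -
  have [measurable_cong]: "sets m = sets B" by fact
  have spm: "space m = \<Omega>" using sets_eq_imp_space_eq[OF m] by simp
  have [measurable]: "gauss c a \<in> borel_measurable B" for c using a by simp
  have summ: "summable (\<lambda>j. exp (- real j))"
  proof -
    have "summable (\<lambda>j. exp (- 1 :: real) ^ j)" by (rule summable_geometric) simp
    then show ?thesis by (simp add: exp_of_nat_mult[symmetric])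
  qed
  have "(\<integral>\<^sup>+x. ennreal (gauss (2 * C + 1) a x) \<partial>m)
    \<le> (\<integral>\<^sup>+x. (\<Sum>j. ennreal (exp (- ((2 * C + 1) * (real j)\<^sup>2))) * indicator (mball_of S a (real (Suc j))) x) \<partial>m)"
  proof (rule nn_integral_mono)
    fix x assume x: "x \<in> space m"
    define j where "j = nat \<lfloor>d a x\<rfloor>"
    have j: "real j \<le> d a x" "d a x < real (Suc j)" unfolding j_def by (auto simp: of_nat_nat) linarith
    have "gauss (2 * C + 1) a x \<le> exp (- ((2 * C + 1) * (real j)\<^sup>2))"
      using j(1) C unfolding gauss_def mult_minus_left exp_le_cancel_iff neg_le_iff_le
      by (intro mult_left_mono power_mono) auto
    then have "ennreal (gauss (2 * C + 1) a x) \<le> ennreal (exp (- ((2 * C + 1) * (real j)\<^sup>2))) * indicator (mball_of S a (real (Suc j))) x"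
      using j(2) x a spm by (simp add: ennreal_leI)
    also have "\<dots> \<le> (\<Sum>j. ennreal (exp (- ((2 * C + 1) * (real j)\<^sup>2))) * indicator (mball_of S a (real (Suc j))) x)"
    proof -
      have "F j \<le> suminf F" for F :: "nat \<Rightarrow> ennreal" using sum_le_suminf[of F "{j}"] by simp
      then show ?thesis .
    qed
    finally show "ennreal (gauss (2 * C + 1) a x) \<le> (\<Sum>j. ennreal (exp (- ((2 * C + 1) * (real j)\<^sup>2))) * indicator (mball_of S a (real (Suc j))) x)" .
  qed
  also have "\<dots> = (\<Sum>j. ennreal (exp (- ((2 * C + 1) * (real j)\<^sup>2))) * emeasure m (mball_of S a (real (Suc j))))"
    by (subst nn_integral_suminf) (auto simp: nn_integral_cmult_indicator m)
  also have "\<dots> \<le> (\<Sum>j. ennreal (exp (18 * C) * exp (- real j)))"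
  proof (intro suminf_le)
    fix j :: nat
    have "ennreal (exp (- ((2 * C + 1) * (real j)\<^sup>2))) * emeasure m (mball_of S a (real (Suc j)))
      \<le> ennreal (exp (- ((2 * C + 1) * (real j)\<^sup>2))) * ennreal (exp (C * (real j + 3)\<^sup>2))" by (intro mult_left_mono le) simp
    also have "\<dots> = ennreal (exp (- ((2 * C + 1) * (real j)\<^sup>2) + C * (real j + 3)\<^sup>2))" by (simp add: ennreal_mult'[symmetric] mult_exp_exp)
    also have "\<dots> \<le> ennreal (exp (18 * C + - real j))"
    proof (intro ennreal_leI, simp only: exp_le_cancel_iff)
      have "0 \<le> C * (real j - 3)\<^sup>2" using C by simp
      moreover have "real j \<le> (real j)\<^sup>2" unfolding power2_eq_square using le_square[of j] by (simp add: of_nat_mult[symmetric] del: of_nat_mult)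
      ultimately show "- ((2 * C + 1) * (real j)\<^sup>2) + C * (real j + 3)\<^sup>2 \<le> 18 * C + - real j"
        by (simp add: power2_eq_square algebra_simps)
    qed
    finally show "ennreal (exp (- ((2 * C + 1) * (real j)\<^sup>2))) * emeasure m (mball_of S a (real (Suc j))) \<le> ennreal (exp (18 * C) * exp (- real j))"
      by (simp add: mult_exp_exp)
  qed auto
  also have "\<dots> = ennreal (\<Sum>j. exp (18 * C) * exp (- real j))" by (rule suminf_ennreal2) (auto intro: summable_mult summ)
  also have "\<dots> = ennreal (exp (18 * C) * (\<Sum>j. exp (- real j)))" using suminf_mult[OF summ] by simp
  finally have le: "(\<integral>\<^sup>+x. ennreal (gauss (2 * C + 1) a x) \<partial>m) \<le> ennreal (exp (18 * C) * (\<Sum>j. exp (- real j)))" .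
  show i: "integrable m (gauss (2 * C + 1) a)"
    by (rule integrableI_nonneg) (use le gauss_pos in \<open>auto intro: le_less_trans simp: less_imp_le\<close>)
  have "0 \<le> (\<Sum>j. exp (- real j))" by (intro suminf_nonneg summ) simp
  then show "(\<integral>x. gauss (2 * C + 1) a x \<partial>m) \<le> exp (18 * C) * (\<Sum>j. exp (- real j))"
    using le nn_integral_eq_integral[OF i] gauss_pos[of _ a] by (simp add: less_imp_le)
qed


section \<open>Convergence on cells\<close>

text \<open>The test functions used for squeezing indicators. The bounds 0 and 1 make the class
  stable under products with functions such as 1 - f; vanishing outside a ball makes its members
  integrable for measures finite on balls.\<close>

definition cut_off :: "('a \<Rightarrow> real) \<Rightarrow> bool" where
  "cut_off \<phi> \<longleftrightarrow> continuous_map (mtopology_of S) euclideanreal \<phi> \<and> (\<forall>z\<in>\<Omega>. 0 \<le> \<phi> z \<and> \<phi> z \<le> 1) \<and>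
     (\<exists>a\<in>\<Omega>. \<exists>R. \<forall>z\<in>\<Omega>. R < d a z \<longrightarrow> \<phi> z = 0)"

lemma cut_off_measurable: "cut_off \<phi> \<Longrightarrow> \<phi> \<in> borel_measurable B"
  unfolding cut_off_def by (intro measurable_metric_borel_continuous) auto

lemma bounded_test_function_cut_off:
  assumes "cut_off \<phi>"
  shows "bounded_test_function S \<phi>"
proof -
  obtain a R where aR: "a \<in> \<Omega>" "\<And>z. z \<in> \<Omega> \<Longrightarrow> R < d a z \<Longrightarrow> \<phi> z = 0" using assms unfolding cut_off_def by blast
  interpret MS: Metric_space \<Omega> d by (rule Metric_space_mspace_mdist)
  have "bounded (\<phi> ` \<Omega>)" using assms unfolding cut_off_def bounded_iff by (intro exI[of _ 1]) auto
  moreover have "bounded_in S (mtopology_of S closure_of {z \<in> \<Omega>. \<phi> z \<noteq> 0})"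
  proof -
    have "mtopology_of S closure_of {z \<in> \<Omega>. \<phi> z \<noteq> 0} \<subseteq> MS.mcball a R"
    proof (rule closure_of_minimal)
      show "{z \<in> \<Omega>. \<phi> z \<noteq> 0} \<subseteq> MS.mcball a R" using aR by (auto simp: MS.in_mcball not_less[symmetric])
      show "closedin (mtopology_of S) (MS.mcball a R)" unfolding mtopology_of_def by (rule MS.closedin_mcball)
    qed
    then show ?thesis unfolding bounded_in_def MS.mbounded_def by blast
  qed
  ultimately show ?thesis using assms unfolding bounded_test_function_def cut_off_def by blast
qed

lemma integrable_cut_off:
  assumes \<phi>: "cut_off \<phi>" and m: "sets m = sets B" and fin: "\<And>a r. a \<in> \<Omega> \<Longrightarrow> emeasure m (mball_of S a r) < \<infinity>"
  shows "integrable m \<phi>"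
proof -
  obtain a R where aR: "a \<in> \<Omega>" "\<And>z. z \<in> \<Omega> \<Longrightarrow> R < d a z \<Longrightarrow> \<phi> z = 0" using \<phi> unfolding cut_off_def by blast
  have [measurable_cong]: "sets m = sets B" by fact
  have sp: "space m = \<Omega>" using sets_eq_imp_space_eq[OF m] by simp
  have [measurable]: "\<phi> \<in> borel_measurable B" by (rule cut_off_measurable[OF \<phi>])
  show ?thesis
  proof (rule Bochner_Integration.integrable_bound)
    show "integrable m (indicator (mball_of S a (R + 1)) :: 'a \<Rightarrow> real)"
      using fin[OF aR(1)] by (intro integrable_real_indicator) auto
    show "AE x in m. norm (\<phi> x) \<le> norm (indicator (mball_of S a (R + 1)) x :: real)"
    proof (rule AE_I2)
      fix x assume "x \<in> space m"
      then have x: "x \<in> \<Omega>" by (simp add: sp)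
      show "norm (\<phi> x) \<le> norm (indicator (mball_of S a (R + 1)) x :: real)"
      proof (cases "R < d a x")
        case True then show ?thesis using aR(2)[OF x] by simp
      next
        case False
        then have "x \<in> mball_of S a (R + 1)" using x aR(1) by simp
        then show ?thesis using \<phi> x unfolding cut_off_def by simp
      qed
    qed
  qed measurable
qed

lemma cut_off_mult: "cut_off \<phi> \<Longrightarrow> continuous_map (mtopology_of S) euclideanreal \<psi> \<Longrightarrow> (\<And>z. z \<in> \<Omega> \<Longrightarrow> 0 \<le> \<psi> z \<and> \<psi> z \<le> 1) \<Longrightarrow> cut_off (\<lambda>z. \<phi> z * \<psi> z)"
proof -
  assume a: "cut_off \<phi>" "continuous_map (mtopology_of S) euclideanreal \<psi>" "\<And>z. z \<in> \<Omega> \<Longrightarrow> 0 \<le> \<psi> z \<and> \<psi> z \<le> 1"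
  obtain b R where bR: "b \<in> \<Omega>" "\<And>z. z \<in> \<Omega> \<Longrightarrow> R < d b z \<Longrightarrow> \<phi> z = 0" using a(1) unfolding cut_off_def by blast
  show ?thesis unfolding cut_off_def
  proof (intro conjI ballI)
    show "continuous_map (mtopology_of S) euclideanreal (\<lambda>z. \<phi> z * \<psi> z)"
      using a unfolding cut_off_def by (intro continuous_map_real_mult) auto
    fix z assume z: "z \<in> \<Omega>"
    then have "0 \<le> \<phi> z" "\<phi> z \<le> 1" using a(1) unfolding cut_off_def by auto
    then show "0 \<le> \<phi> z * \<psi> z" "\<phi> z * \<psi> z \<le> 1" using a(3)[OF z] by (auto intro: mult_le_one)
  qed (use bR in auto)
qed

definition tent :: "'a \<Rightarrow> real \<Rightarrow> real \<Rightarrow> 'a \<Rightarrow> real" where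
  "tent b r s z = max 0 (min 1 ((r - d b z) / s))"

lemma cut_off_tent:
  assumes "b \<in> \<Omega>" "0 < s"
  shows "cut_off (tent b r s)"
proof -
  have "continuous_map (mtopology_of S) euclideanreal ((\<lambda>u. max 0 (min 1 ((r - u) / s))) \<circ> d b)"
  proof (rule continuous_map_compose[OF continuous_on_mdist[OF assms(1)]])
    have "continuous_on UNIV (\<lambda>u. max 0 (min 1 ((r - u) / s)))" using assms(2) by (intro continuous_intros) auto
    then show "continuous_map euclideanreal euclideanreal (\<lambda>u. max 0 (min 1 ((r - u) / s)))" by simp
  qed
  then have "continuous_map (mtopology_of S) euclideanreal (tent b r s)" by (simp add: comp_def tent_def[abs_def])
  moreover have "tent b r s z = 0" if "r < d b z" for z
  proof -
    have "(r - d b z) / s < 0" using that assms(2) by (simp add: divide_neg_pos)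
    then show ?thesis unfolding tent_def by simp
  qed
  ultimately show ?thesis unfolding cut_off_def using assms(1) by (auto simp: tent_def)
qed

lemma tent_eq_1: "0 < s \<Longrightarrow> d b z \<le> r - s \<Longrightarrow> tent b r s z = 1"
  unfolding tent_def by (simp add: le_divide_eq)

lemma tent_eq_0: "0 < s \<Longrightarrow> r \<le> d b z \<Longrightarrow> tent b r s z = 0"
  unfolding tent_def using divide_nonpos_pos[of "r - d b z" s] by simp

lemma tent_bounds: "0 \<le> tent b r s z" "tent b r s z \<le> 1" unfolding tent_def by auto

section \<open>Sets whose mass passes to the limit\<close>

text \<open>The counterpart of a continuity set of m, phrased through test functions: the indicator
  is squeezed between two cut-offs with almost equal integrals. This form is inherited by
  differences without any discussion of boundaries.\<close>

definition test_measurable :: "'a measure \<Rightarrow> 'a set \<Rightarrow> bool" where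
  "test_measurable m A \<longleftrightarrow> A \<in> sets B \<and> (\<forall>e>0. \<exists>f g. cut_off f \<and> cut_off g \<and>
     (\<forall>z\<in>\<Omega>. f z \<le> indicator A z \<and> indicator A z \<le> g z) \<and> (\<integral>z. g z - f z \<partial>m) < e)"

definition test_converges :: "(nat \<Rightarrow> 'a measure) \<Rightarrow> 'a measure \<Rightarrow> bool" where
  "test_converges M m \<longleftrightarrow> (\<forall>\<phi>. bounded_test_function S \<phi> \<longrightarrow> (\<lambda>n. \<integral>z. \<phi> z \<partial>M n) \<longlonglongrightarrow> (\<integral>z. \<phi> z \<partial>m))"

lemma test_measurable_bounded:
  assumes "test_measurable m A" and m: "sets M = sets B" and fin: "\<And>a r. a \<in> \<Omega> \<Longrightarrow> emeasure M (mball_of S a r) < \<infinity>"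
  shows "emeasure M A < \<infinity>"
proof -
  obtain g where g: "cut_off g" "\<And>z. z \<in> \<Omega> \<Longrightarrow> indicator A z \<le> g z" using assms(1) zero_less_one unfolding test_measurable_def by blast
  have A: "A \<in> sets M" using assms(1) m unfolding test_measurable_def by simp
  have i: "integrable M g" by (rule integrable_cut_off[OF g(1) m fin])
  have sp: "space M = \<Omega>" using sets_eq_imp_space_eq[OF m] by simp
  have "emeasure M A = (\<integral>\<^sup>+z. ennreal (indicator A z) \<partial>M)" using A by (subst nn_integral_indicator[symmetric]) (auto simp: ennreal_indicator)
  also have "\<dots> \<le> (\<integral>\<^sup>+z. ennreal (g z) \<partial>M)" using g(2) by (intro nn_integral_mono ennreal_leI) (simp add: sp)
  also have "\<dots> < \<infinity>" using i unfolding real_integrable_def by (simp add: less_top)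
  finally show ?thesis .
qed

text \<open>The portmanteau argument: both masses lie between the integrals of f and g, these
  integrals converge, and their limits differ by less than e / 2.\<close>

lemma test_measurable_tendsto:
  assumes A: "test_measurable m A" and conv: "test_converges M m"
    and m: "sets m = sets B" "\<And>a r. a \<in> \<Omega> \<Longrightarrow> emeasure m (mball_of S a r) < \<infinity>"
    and M: "\<And>n. sets (M n) = sets B" "\<And>n a r. a \<in> \<Omega> \<Longrightarrow> emeasure (M n) (mball_of S a r) < \<infinity>"
  shows "(\<lambda>n. measure (M n) A) \<longlonglongrightarrow> measure m A"
proof (rule tendstoI)
  fix e :: real assume e: "0 < e"
  obtain f g where fg: "cut_off f" "cut_off g" "\<And>z. z \<in> \<Omega> \<Longrightarrow> f z \<le> indicator A z \<and> indicator A z \<le> g z" "(\<integral>z. g z - f z \<partial>m) < e / 2"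
    using A half_gt_zero[OF e] unfolding test_measurable_def by blast
  have AB: "A \<in> sets B" using A unfolding test_measurable_def by simp
  have bounds: "(\<integral>z. f z \<partial>N) \<le> measure N A" "measure N A \<le> (\<integral>z. g z \<partial>N)"
    if N: "sets N = sets B" "\<And>a r. a \<in> \<Omega> \<Longrightarrow> emeasure N (mball_of S a r) < \<infinity>" for N
  proof -
    have sp: "space N = \<Omega>" using sets_eq_imp_space_eq[OF N(1)] by simp
    have iA: "integrable N (indicator A :: 'a \<Rightarrow> real)"
      by (rule integrable_real_indicator) (use AB N test_measurable_bounded[OF A N] in auto)
    have AO: "A \<inter> space N = A" using sets.sets_into_space[OF AB] by (auto simp: sp)
    have eq: "measure N A = (\<integral>z. indicator A z \<partial>N)" by (simp add: AO)
    show "(\<integral>z. f z \<partial>N) \<le> measure N A" unfolding eq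
      by (rule integral_mono[OF integrable_cut_off[OF fg(1) N] iA]) (use fg(3) sp in auto)
    show "measure N A \<le> (\<integral>z. g z \<partial>N)" unfolding eq
      by (rule integral_mono[OF iA integrable_cut_off[OF fg(2) N]]) (use fg(3) sp in auto)
  qed
  have sm: "(\<integral>z. g z \<partial>m) - (\<integral>z. f z \<partial>m) < e / 2"
    using fg(4) integrable_cut_off[OF fg(1) m] integrable_cut_off[OF fg(2) m] by simp
  have "\<forall>\<^sub>F n in sequentially. dist (\<integral>z. f z \<partial>M n) (\<integral>z. f z \<partial>m) < e / 2"
    using conv bounded_test_function_cut_off[OF fg(1)] e unfolding test_converges_def by (intro tendstoD) auto
  moreover have "\<forall>\<^sub>F n in sequentially. dist (\<integral>z. g z \<partial>M n) (\<integral>z. g z \<partial>m) < e / 2"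
    using conv bounded_test_function_cut_off[OF fg(2)] e unfolding test_converges_def by (intro tendstoD) auto
  ultimately show "\<forall>\<^sub>F n in sequentially. dist (measure (M n) A) (measure m A) < e"
  proof eventually_elim
    fix n assume "dist (\<integral>z. f z \<partial>M n) (\<integral>z. f z \<partial>m) < e / 2" "dist (\<integral>z. g z \<partial>M n) (\<integral>z. g z \<partial>m) < e / 2"
    then show "dist (measure (M n) A) (measure m A) < e"
      using bounds[OF M(1) M(2), of n] bounds[OF m] sm unfolding dist_real_def abs_less_iff by linarith
  qed
qed

text \<open>The indicator of the difference is a product of the indicator of A with one minus that
  of C, hence squeezed between f (1 - g') and g (1 - f'). As all functions take values in the unit
  interval, the gap is at most the sum of the two gaps.\<close>

lemma test_measurable_Diff:
  assumes A: "test_measurable m A" and C: "test_measurable m C"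
    and m: "sets m = sets B" "\<And>a r. a \<in> \<Omega> \<Longrightarrow> emeasure m (mball_of S a r) < \<infinity>"
  shows "test_measurable m (A - C)"
  unfolding test_measurable_def
proof (intro conjI allI impI)
  show "A - C \<in> sets B" using A C unfolding test_measurable_def by auto
  fix e :: real assume e: "0 < e"
  obtain f g where fg: "cut_off f" "cut_off g" "\<And>z. z \<in> \<Omega> \<Longrightarrow> f z \<le> indicator A z \<and> indicator A z \<le> g z" "(\<integral>z. g z - f z \<partial>m) < e / 2"
    using A half_gt_zero[OF e] unfolding test_measurable_def by blast
  obtain f' g' where fg': "cut_off f'" "cut_off g'" "\<And>z. z \<in> \<Omega> \<Longrightarrow> f' z \<le> indicator C z \<and> indicator C z \<le> g' z" "(\<integral>z. g' z - f' z \<partial>m) < e / 2"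
    using C half_gt_zero[OF e] unfolding test_measurable_def by blast
  have b: "0 \<le> f z" "f z \<le> 1" "0 \<le> g z" "g z \<le> 1" "0 \<le> f' z" "f' z \<le> 1" "0 \<le> g' z" "g' z \<le> 1" if "z \<in> \<Omega>" for z
    using that fg(1,2) fg'(1,2) unfolding cut_off_def by auto
  have c: "continuous_map (mtopology_of S) euclideanreal (\<lambda>z. 1 - f' z)" "continuous_map (mtopology_of S) euclideanreal (\<lambda>z. 1 - g' z)"
    using fg'(1,2) unfolding cut_off_def by (auto intro!: continuous_map_diff)
  have k1: "cut_off (\<lambda>z. f z * (1 - g' z))" by (rule cut_off_mult[OF fg(1) c(2)]) (use b in auto)
  have k2: "cut_off (\<lambda>z. g z * (1 - f' z))" by (rule cut_off_mult[OF fg(2) c(1)]) (use b in auto)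
  have sp: "space m = \<Omega>" using sets_eq_imp_space_eq[OF m(1)] by simp
  note i = integrable_cut_off[OF _ m]
  have "f z * (1 - g' z) \<le> indicator (A - C) z \<and> indicator (A - C) z \<le> g z * (1 - f' z)" if z: "z \<in> \<Omega>" for z
  proof -
    have "f z * (1 - g' z) \<le> indicator A z * (1 - indicator C z)" "indicator A z * (1 - indicator C z) \<le> g z * (1 - f' z)"
      using b[OF z] fg(3)[OF z] fg'(3)[OF z] by (intro mult_mono; simp)+
    moreover have "indicator (A - C) z = (indicator A z * (1 - indicator C z) :: real)" by (auto split: split_indicator)
    ultimately show ?thesis by simp
  qed
  moreover have "(\<integral>z. g z * (1 - f' z) - f z * (1 - g' z) \<partial>m) < e"
  proof -
    have "(\<integral>z. g z * (1 - f' z) - f z * (1 - g' z) \<partial>m) \<le> (\<integral>z. (g z - f z) + (g' z - f' z) \<partial>m)"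
    proof (intro integral_mono)
      fix z assume "z \<in> space m"
      then have z: "z \<in> \<Omega>" by (simp add: sp)
      have fgz: "0 \<le> g z - f z" "0 \<le> g' z - f' z" using fg(3)[OF z] fg'(3)[OF z] by auto
      have "g z * (1 - f' z) - f z * (1 - g' z) = (g z - f z) * (1 - f' z) + f z * (g' z - f' z)" by (simp add: algebra_simps)
      also have "\<dots> \<le> (g z - f z) * 1 + 1 * (g' z - f' z)" using b[OF z] fgz by (intro add_mono mult_left_mono mult_right_mono) auto
      finally show "g z * (1 - f' z) - f z * (1 - g' z) \<le> (g z - f z) + (g' z - f' z)" by simp
    qed (use i[OF k1] i[OF k2] i[OF fg(1)] i[OF fg(2)] i[OF fg'(1)] i[OF fg'(2)] in auto)
    also have "\<dots> = (\<integral>z. g z - f z \<partial>m) + (\<integral>z. g' z - f' z \<partial>m)"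
      using i[OF fg(1)] i[OF fg(2)] i[OF fg'(1)] i[OF fg'(2)] by simp
    finally show ?thesis using fg(4) fg'(4) by simp
  qed
  ultimately show "\<exists>f g. cut_off f \<and> cut_off g \<and> (\<forall>z\<in>\<Omega>. f z \<le> indicator (A - C) z \<and> indicator (A - C) z \<le> g z) \<and> (\<integral>z. g z - f z \<partial>m) < e"
    using k1 k2 by (intro exI[of _ "\<lambda>z. f z * (1 - g' z)"] exI[of _ "\<lambda>z. g z * (1 - f' z)"]) auto
qed

lemma test_measurable_Diff_UN:
  fixes I :: "nat set"
  assumes "finite I" "test_measurable m A" "\<And>i. i \<in> I \<Longrightarrow> test_measurable m (C i)"
    and m: "sets m = sets B" "\<And>a r. a \<in> \<Omega> \<Longrightarrow> emeasure m (mball_of S a r) < \<infinity>"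
  shows "test_measurable m (A - (\<Union>i\<in>I. C i))"
  using assms(1,3)
proof (induction I rule: finite_induct)
  case empty then show ?case using assms(2) by simp
next
  case (insert i I)
  have "A - (\<Union>j\<in>insert i I. C j) = (A - (\<Union>j\<in>I. C j)) - C i" by auto
  then show ?case using test_measurable_Diff[OF insert.IH insert.prems, of i] insert.prems m by simp
qed

text \<open>Tents of width s n approximate the ball from inside and from outside. Their difference
  tends to the indicator of the sphere, which is null, and dominated convergence makes the gap
  small.\<close>

lemma test_measurable_ball:
  assumes b: "b \<in> \<Omega>" and null: "measure m {z \<in> \<Omega>. d b z = r} = 0"
    and m: "sets m = sets B" "\<And>a r. a \<in> \<Omega> \<Longrightarrow> emeasure m (mball_of S a r) < \<infinity>"
  shows "test_measurable m (mball_of S b r)"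
  unfolding test_measurable_def
proof (intro conjI allI impI)
  show "mball_of S b r \<in> sets B" by simp
  fix e :: real assume e: "0 < e"
  have [measurable_cong]: "sets m = sets B" by fact
  have sp: "space m = \<Omega>" using sets_eq_imp_space_eq[OF m(1)] by simp
  have [measurable]: "d b \<in> borel_measurable B" by (rule d_point_measurable[OF b])
  have sph: "{z \<in> \<Omega>. d b z = r} \<in> sets B"
  proof -
    have "{z \<in> space B. d b z = r} \<in> sets B" by measurable
    then show ?thesis by simp
  qed
  define s where "s n = 1 / real (Suc n)" for n
  have s: "0 < s n" "s n \<le> 1" for n unfolding s_def by auto
  have s0: "s \<longlonglongrightarrow> 0" unfolding s_def[abs_def] by (rule LIMSEQ_Suc[OF lim_const_over_n])
  define f where "f n = tent b r (s n)" for n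
  define g where "g n = tent b (r + s n) (s n)" for n
  have cf: "cut_off (f n)" and cg: "cut_off (g n)" for n unfolding f_def g_def using b s by (auto intro: cut_off_tent)
  have [measurable]: "f n \<in> borel_measurable B" "g n \<in> borel_measurable B" for n using cut_off_measurable[OF cf] cut_off_measurable[OF cg] by auto
  have pf: "f n z \<le> indicator (mball_of S b r) z" and pg: "indicator (mball_of S b r) z \<le> g n z" if "z \<in> \<Omega>" for n z
  proof -
    have "f n z = 0" if "r \<le> d b z" unfolding f_def by (rule tent_eq_0[OF s(1) that])
    then show "f n z \<le> indicator (mball_of S b r) z" using tent_bounds[of b r "s n" z] \<open>z \<in> \<Omega>\<close> b unfolding f_def by (auto split: split_indicator)
    have "g n z = 1" if "d b z \<le> r" unfolding g_def by (rule tent_eq_1[OF s(1)]) (use that in simp)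
    then show "indicator (mball_of S b r) z \<le> g n z" using tent_bounds[of b "r + s n" "s n" z] unfolding g_def by (auto split: split_indicator)
  qed
  have lim: "(\<lambda>n. g n z - f n z) \<longlonglongrightarrow> indicator {z \<in> \<Omega>. d b z = r} z" if z: "z \<in> \<Omega>" for z
  proof (rule tendsto_eventually)
    consider "d b z < r" | "d b z = r" | "r < d b z" by linarith
    then show "\<forall>\<^sub>F n in sequentially. g n z - f n z = indicator {z \<in> \<Omega>. d b z = r} z"
    proof cases
      case 1
      have "\<forall>\<^sub>F n in sequentially. s n < r - d b z" by (rule order_tendstoD(2)[OF s0]) (use 1 in simp)
      then show ?thesis
      proof (rule eventually_mono)
        fix n assume "s n < r - d b z"
        then have "f n z = 1" "g n z = 1" unfolding f_def g_def using s[of n] 1 by (auto intro: tent_eq_1)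
        then show "g n z - f n z = indicator {z \<in> \<Omega>. d b z = r} z" using 1 by simp
      qed
    next
      case 2
      have "f n z = 0" "g n z = 1" for n unfolding f_def g_def using s[of n] 2 by (auto intro: tent_eq_1 tent_eq_0)
      then show ?thesis using 2 z by simp
    next
      case 3
      have "\<forall>\<^sub>F n in sequentially. s n < d b z - r" by (rule order_tendstoD(2)[OF s0]) (use 3 in simp)
      then show ?thesis
      proof (rule eventually_mono)
        fix n assume "s n < d b z - r"
        then have "f n z = 0" "g n z = 0" unfolding f_def g_def using s[of n] 3 by (auto intro: tent_eq_0)
        then show "g n z - f n z = indicator {z \<in> \<Omega>. d b z = r} z" using 3 by simp
      qed
    qed
  qed
  have "(\<lambda>n. \<integral>z. g n z - f n z \<partial>m) \<longlonglongrightarrow> (\<integral>z. indicator {z \<in> \<Omega>. d b z = r} z \<partial>m)"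
  proof (rule integral_dominated_convergence[where w="indicator (mball_of S b (r + 2))"])
    show "integrable m (indicator (mball_of S b (r + 2)) :: 'a \<Rightarrow> real)" using m(2)[OF b] by (intro integrable_real_indicator) auto
    show "AE z in m. (\<lambda>n. g n z - f n z) \<longlonglongrightarrow> indicator {z \<in> \<Omega>. d b z = r} z" using lim by (intro AE_I2) (simp add: sp)
    show "AE z in m. norm (g n z - f n z) \<le> indicator (mball_of S b (r + 2)) z" for n
    proof (rule AE_I2)
      fix z assume "z \<in> space m"
      then have z: "z \<in> \<Omega>" by (simp add: sp)
      show "norm (g n z - f n z) \<le> indicator (mball_of S b (r + 2)) z"
      proof (cases "d b z < r + 2")
        case True
        then have "z \<in> mball_of S b (r + 2)" using b z by simp
        then show ?thesis using tent_bounds[of b r "s n" z] tent_bounds[of b "r + s n" "s n" z] unfolding f_def g_def by (simp add: abs_le_iff)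
      next
        case False
        then have "f n z = 0" "g n z = 0" unfolding f_def g_def using s[of n] by (auto intro: tent_eq_0)
        then show ?thesis by simp
      qed
    qed
  qed (use sph m in auto)
  also have "(\<integral>z. indicator {z \<in> \<Omega>. d b z = r} z \<partial>m) = (0 :: real)"
  proof -
    have "{z \<in> \<Omega>. d b z = r} \<inter> space m = {z \<in> \<Omega>. d b z = r}" by (auto simp: sp)
    then show ?thesis using null by (simp only: Bochner_Integration.integral_indicator)
  qed
  finally have "\<forall>\<^sub>F n in sequentially. (\<integral>z. g n z - f n z \<partial>m) < e" using e by (rule order_tendstoD(2))
  then obtain n where "(\<integral>z. g n z - f n z \<partial>m) < e" using eventually_happens'[OF sequentially_bot] by blast
  then show "\<exists>f g. cut_off f \<and> cut_off g \<and> (\<forall>z\<in>\<Omega>. f z \<le> indicator (mball_of S b r) z \<and> indicator (mball_of S b r) z \<le> g z) \<and> (\<integral>z. g z - f z \<partial>m) < e"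
    using cf cg pf pg by (intro exI[of _ "f n"] exI[of _ "g n"]) auto
qed

text \<open>Radii whose sphere has positive mass are atoms of the distribution of the distance from
  b, and a finite measure has only countably many atoms.\<close>

lemma null_sphere:
  assumes b: "b \<in> \<Omega>" and lr: "l < r"
    and m: "sets m = sets B" "\<And>a r. a \<in> \<Omega> \<Longrightarrow> emeasure m (mball_of S a r) < \<infinity>"
  obtains u where "l < u" "u < r" "measure m {z \<in> \<Omega>. d b z = u} = 0"
proof -
  have [measurable_cong]: "sets m = sets B" by fact
  have sp: "space m = \<Omega>" using sets_eq_imp_space_eq[OF m(1)] by simp
  have [measurable]: "d b \<in> borel_measurable B" by (rule d_point_measurable[OF b])
  have [measurable]: "mball_of S b r \<in> sets m" using m by simp
  \<comment> \<open>The restriction to a ball of radius r makes the distribution finite and changes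
    nothing for the radii below r that are considered.\<close>
  define N where "N = distr (density m (indicator (mball_of S b r))) borel (d b)"
  interpret N: finite_measure N
  proof
    have "emeasure N (space N) = emeasure (density m (indicator (mball_of S b r))) (space m)"
      unfolding N_def by (subst emeasure_distr) auto
    also have "\<dots> = emeasure m (mball_of S b r)"
      by (subst emeasure_density) (auto simp: sp nn_integral_indicator[symmetric] simp del: nn_integral_indicator intro!: nn_integral_cong split: split_indicator)
    finally show "emeasure N (space N) \<noteq> \<infinity>" using m(2)[OF b, of r] by simp
  qed
  have "countable {u. measure N {u} \<noteq> 0}" by (rule N.countable_support)
  moreover have "uncountable {l<..<r}" using lr by (rule uncountable_open_interval[THEN iffD2])
  ultimately have "\<not> {l<..<r} \<subseteq> {u. measure N {u} \<noteq> 0}" by (meson countable_subset)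
  then obtain u where u: "l < u" "u < r" "measure N {u} = 0" by auto
  have sph: "{z \<in> \<Omega>. d b z = u} \<in> sets B"
  proof -
    have "{z \<in> space B. d b z = u} \<in> sets B" by measurable
    then show ?thesis by simp
  qed
  have "emeasure N {u} = emeasure (density m (indicator (mball_of S b r))) {z \<in> \<Omega>. d b z = u}"
    unfolding N_def by (subst emeasure_distr) (auto simp: sp vimage_def Int_def conj_commute intro!: arg_cong2[where f=emeasure])
  also have "\<dots> = (\<integral>\<^sup>+z. indicator (mball_of S b r) z * indicator {z \<in> \<Omega>. d b z = u} z \<partial>m)"
    using sph m by (intro emeasure_density) auto
  also have "\<dots> = (\<integral>\<^sup>+z. indicator {z \<in> \<Omega>. d b z = u} z \<partial>m)"
    using u(2) b by (intro nn_integral_cong) (auto split: split_indicator)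
  also have "\<dots> = emeasure m {z \<in> \<Omega>. d b z = u}" using sph m by (intro nn_integral_indicator) auto
  finally have "measure m {z \<in> \<Omega>. d b z = u} = 0" using u(3) by (simp add: measure_def)
  then show ?thesis using that u by blast
qed


section \<open>Cells of comparable mass for m and the approximating measures\<close>

text \<open>Balls with null spheres around a dense sequence are made disjoint inside a ball
  \<open>V\<close> of radius between k and k + 1. Radii above \<delta> / 4 guarantee a cover, radii
  below \<delta> / 2 the diameter. Finitely many balls leave arbitrarily little of \<open>V\<close>,
  by continuity from above. Null cells are dropped because logarithms of masses are compared later.
  The remainder \<open>X\<close> is again \<open>test_measurable\<close>, so its mass is controlled
  for the approximating measures as well.\<close>

lemma fine_cells:
  assumes a: "a \<in> \<Omega>" and \<delta>: "0 < \<delta>" and \<theta>: "0 < \<theta>"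
    and m: "sets m = sets B" "\<And>a r. a \<in> \<Omega> \<Longrightarrow> emeasure m (mball_of S a r) < \<infinity>"
  obtains I :: "nat set" and A where "finite I" "\<And>i. i \<in> I \<Longrightarrow> test_measurable m (A i)" "disjoint_family_on A I"
    "\<And>i x y. i \<in> I \<Longrightarrow> x \<in> A i \<Longrightarrow> y \<in> A i \<Longrightarrow> d x y \<le> \<delta>" "\<And>i x. i \<in> I \<Longrightarrow> x \<in> A i \<Longrightarrow> d a x \<le> real k + 1"
    "\<And>i. i \<in> I \<Longrightarrow> 0 < measure m (A i)"
    "\<exists>X. test_measurable m X \<and> {x \<in> \<Omega>. d a x \<le> real k} - (\<Union>i\<in>I. A i) \<subseteq> X \<and> measure m X < \<theta>"
proof -
  have sp: "space m = \<Omega>" using sets_eq_imp_space_eq[OF m(1)] by simp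
  obtain R where R: "real k < R" "R < real k + 1" "measure m {z \<in> \<Omega>. d a z = R} = 0"
    using null_sphere[OF a _ m, of "real k" "real k + 1"] by auto
  define V where "V = mball_of S a R"
  have V: "test_measurable m V" unfolding V_def by (rule test_measurable_ball[OF a R(3) m])
  obtain z :: "nat \<Rightarrow> 'a" where z: "\<And>i. z i \<in> \<Omega>" "\<And>x r. x \<in> \<Omega> \<Longrightarrow> r > 0 \<Longrightarrow> \<exists>i. d x (z i) < r"
    using dense_sequence a by blast
  have "\<forall>i. \<exists>r. \<delta> / 4 < r \<and> r < \<delta> / 2 \<and> measure m {x \<in> \<Omega>. d (z i) x = r} = 0"
  proof
    fix i
    obtain u where "\<delta> / 4 < u" "u < \<delta> / 2" "measure m {x \<in> \<Omega>. d (z i) x = u} = 0"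
      using null_sphere[OF z(1) _ m, of "\<delta> / 4" "\<delta> / 2" i] \<delta> by auto
    then show "\<exists>r. \<delta> / 4 < r \<and> r < \<delta> / 2 \<and> measure m {x \<in> \<Omega>. d (z i) x = r} = 0" by blast
  qed
  then obtain r where r: "\<And>i. \<delta> / 4 < r i" "\<And>i. r i < \<delta> / 2" "\<And>i. measure m {x \<in> \<Omega>. d (z i) x = r i} = 0"
    using choice[of "\<lambda>i r. \<delta> / 4 < r \<and> r < \<delta> / 2 \<and> measure m {x \<in> \<Omega>. d (z i) x = r} = 0"] by blast
  define D where "D i = mball_of S (z i) (r i)" for i
  have D: "test_measurable m (D i)" for i unfolding D_def by (rule test_measurable_ball[OF z(1) r(3) m])
  \<comment> \<open>The double difference is the intersection of V and D i, written with the one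
    operation under which \<open>test_measurable\<close> is known to be closed.\<close>
  define A where "A i = (V - (V - D i)) - (\<Union>j\<in>{..<i}. D j)" for i
  have A: "test_measurable m (A i)" for i unfolding A_def
    by (intro test_measurable_Diff_UN test_measurable_Diff finite_lessThan V D m)
  have Asets: "A i \<in> sets m" "D i \<in> sets m" "V \<in> sets m" for i using A[of i] D[of i] V m(1) unfolding test_measurable_def by auto
  have AUN: "(\<Union>i<N. A i) = V \<inter> (\<Union>i<N. D i)" for N
  proof (induction N)
    case (Suc N)
    have "(\<Union>i<Suc N. A i) = (\<Union>i<N. A i) \<union> A N" by (auto simp: lessThan_Suc)
    also have "A N = (V \<inter> D N) - (\<Union>j<N. D j)" unfolding A_def by auto
    also have "(\<Union>i<N. A i) \<union> (V \<inter> D N - (\<Union>j<N. D j)) = V \<inter> (\<Union>i<Suc N. D i)" unfolding Suc.IH by (auto simp: lessThan_Suc)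
    finally show ?case .
  qed simp
  have VO: "V \<subseteq> \<Omega>" unfolding V_def by auto
  have cover: "(\<Inter>N. V - (\<Union>i<N. D i)) = {}"
  proof -
    have "\<exists>N. x \<in> (\<Union>i<N. D i)" if "x \<in> V" for x
    proof -
      have x: "x \<in> \<Omega>" using that VO by auto
      obtain i where "d x (z i) < \<delta> / 4" using z(2)[OF x, of "\<delta> / 4"] \<delta> by auto
      then have "x \<in> D i" unfolding D_def using x z(1) r(1)[of i] by (simp add: mdist_commute)
      then have "x \<in> (\<Union>j<Suc i. D j)" by auto
      then show ?thesis by blast
    qed
    then show ?thesis by blast
  qed
  have finV: "emeasure m V < \<infinity>" unfolding V_def by (rule m(2)[OF a])
  have "(\<lambda>N. measure m (V - (\<Union>i<N. D i))) \<longlonglongrightarrow> measure m (\<Inter>N. V - (\<Union>i<N. D i))"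
  proof (rule Lim_measure_decseq)
    show "range (\<lambda>N. V - (\<Union>i<N. D i)) \<subseteq> sets m" using Asets by auto
    show "decseq (\<lambda>N. V - (\<Union>i<N. D i))" by (rule antimonoI) auto
    show "emeasure m (V - (\<Union>i<N. D i)) \<noteq> \<infinity>" for N
      using emeasure_mono[of "V - (\<Union>i<N. D i)" V m] Asets finV by (auto simp: top_unique less_top)
  qed
  then have "(\<lambda>N. measure m (V - (\<Union>i<N. D i))) \<longlonglongrightarrow> 0" unfolding cover by simp
  then have "\<forall>\<^sub>F N in sequentially. measure m (V - (\<Union>i<N. D i)) < \<theta>" using \<theta> by (rule order_tendstoD(2))
  then obtain N where N: "measure m (V - (\<Union>i<N. D i)) < \<theta>" using eventually_happens'[OF sequentially_bot] by blast
  define I where "I = {i. i < N \<and> 0 < measure m (A i)}"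
  have fI: "finite I" unfolding I_def by simp
  define X where "X = V - (\<Union>i\<in>I. A i)"
  have X: "test_measurable m X" unfolding X_def by (intro test_measurable_Diff_UN fI V A m)
  have mX: "measure m X < \<theta>"
  proof -
    define Z where "Z = (\<Union>i\<in>{..<N} - I. A i)"
    have Z: "Z \<in> null_sets m" unfolding Z_def
    proof (rule null_sets.finite_UN)
      fix i assume "i \<in> {..<N} - I"
      then have "measure m (A i) = 0" unfolding I_def using measure_nonneg[of m "A i"] by (auto simp: less_le)
      moreover have "emeasure m (A i) < \<infinity>" by (rule test_measurable_bounded[OF A m])
      ultimately show "A i \<in> null_sets m" using Asets by (auto simp: null_sets_def emeasure_eq_ennreal_measure)
    qed simp
    have "X \<subseteq> (V - (\<Union>i<N. D i)) \<union> Z" using AUN[of N] unfolding X_def Z_def by blast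
    then have "emeasure m X \<le> emeasure m ((V - (\<Union>i<N. D i)) \<union> Z)"
      using Asets Z by (intro emeasure_mono) auto
    also have "\<dots> = emeasure m (V - (\<Union>i<N. D i))" using Asets Z by (intro emeasure_Un_null_set) auto
    finally have "measure m X \<le> measure m (V - (\<Union>i<N. D i))"
      unfolding measure_def using emeasure_mono[of "V - (\<Union>i<N. D i)" V m] Asets finV
      by (intro enn2real_mono) (auto intro: le_less_trans)
    then show ?thesis using N by simp
  qed
  show ?thesis
  proof (rule that[of I A])
    show "disjoint_family_on A I" unfolding disjoint_family_on_def
    proof (intro ballI impI)
      fix i j :: nat assume "i \<noteq> j"
      then consider "i < j" | "j < i" by linarith
      then show "A i \<inter> A j = {}" by cases (auto simp: A_def)
    qed
    show "d x y \<le> \<delta>" if "i \<in> I" "x \<in> A i" "y \<in> A i" for i x y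
    proof -
      have "x \<in> D i" "y \<in> D i" using that unfolding A_def by auto
      then show ?thesis using mdist_triangle[of x S "z i" y] r(2)[of i] unfolding D_def by (simp add: mdist_commute[of S x])
    qed
    show "d a x \<le> real k + 1" if "i \<in> I" "x \<in> A i" for i x
      using that R(2) unfolding A_def V_def by auto
    have "{x \<in> \<Omega>. d a x \<le> real k} - (\<Union>i\<in>I. A i) \<subseteq> X" using a R(1) unfolding X_def V_def by auto
    then show "\<exists>X. test_measurable m X \<and> {x \<in> \<Omega>. d a x \<le> real k} - (\<Union>i\<in>I. A i) \<subseteq> X \<and> measure m X < \<theta>"
      using X mX by blast
  qed (use fI A in \<open>auto simp: I_def\<close>)
qed

text \<open>For each k the cells are built for m alone, and then N k is chosen so large that the
  masses of these finitely many cells and of the remainder are almost the same for M (N k). The two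
  locale instances exchange the roles of the measures, for the transfer in either direction. The
  lower bound n0 confines the sequence to indices with uniform growth bounds.\<close>

lemma cell_approximation_exists:
  assumes a: "a \<in> \<Omega>" and conv: "test_converges M m"
    and m: "sigma_finite_measure m" "sets m = sets B" "\<And>a r. a \<in> \<Omega> \<Longrightarrow> emeasure m (mball_of S a r) < \<infinity>"
    and M: "\<And>n. sigma_finite_measure (M n)" "\<And>n. sets (M n) = sets B" "\<And>n a r. a \<in> \<Omega> \<Longrightarrow> emeasure (M n) (mball_of S a r) < \<infinity>"
  obtains N I A where "\<And>k. n0 \<le> N k"
    "cell_approximation S a (\<lambda>_. m) (\<lambda>k. M (N k)) I A (\<lambda>k. 1 / real (Suc k)) (\<lambda>k. 1 / real (Suc k))"
    "cell_approximation S a (\<lambda>k. M (N k)) (\<lambda>_. m) I A (\<lambda>k. 1 / real (Suc k)) (\<lambda>k. 1 / real (Suc k))"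
proof -
  define P where "P k n I A \<longleftrightarrow> n0 \<le> n \<and> finite I \<and> (\<forall>i\<in>I. test_measurable m (A i)) \<and> disjoint_family_on A I \<and>
    (\<forall>i\<in>I. \<forall>x\<in>A i. \<forall>y\<in>A i. d x y \<le> 1 / real (Suc k)) \<and> (\<forall>i\<in>I. \<forall>x\<in>A i. d a x \<le> real k + 1) \<and>
    (\<forall>i\<in>I. 0 < measure m (A i) \<and> 0 < measure (M n) (A i) \<and> \<bar>ln (measure (M n) (A i)) - ln (measure m (A i))\<bar> \<le> 1 / real (Suc k)) \<and>
    emeasure m ({x \<in> \<Omega>. d a x \<le> real k} - (\<Union>i\<in>I. A i)) \<le> ennreal (exp (- (real k ^ 3))) \<and>
    emeasure (M n) ({x \<in> \<Omega>. d a x \<le> real k} - (\<Union>i\<in>I. A i)) \<le> ennreal (exp (- (real k ^ 3)))" for k n I and A :: "nat \<Rightarrow> 'a set"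
  have "\<exists>n I A. P k n I A" for k
  proof -
    obtain I :: "nat set" and A where IA: "finite I" "\<And>i. i \<in> I \<Longrightarrow> test_measurable m (A i)" "disjoint_family_on A I"
      "\<And>i x y. i \<in> I \<Longrightarrow> x \<in> A i \<Longrightarrow> y \<in> A i \<Longrightarrow> d x y \<le> 1 / real (Suc k)" "\<And>i x. i \<in> I \<Longrightarrow> x \<in> A i \<Longrightarrow> d a x \<le> real k + 1"
      "\<And>i. i \<in> I \<Longrightarrow> 0 < measure m (A i)"
      "\<exists>X. test_measurable m X \<and> {x \<in> \<Omega>. d a x \<le> real k} - (\<Union>i\<in>I. A i) \<subseteq> X \<and> measure m X < exp (- (real k ^ 3))"
      by (rule fine_cells[OF a _ _ m(2,3), of "1 / real (Suc k)" "exp (- (real k ^ 3))" k]) (auto simp del: of_nat_Suc)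
    obtain X where X: "test_measurable m X" "{x \<in> \<Omega>. d a x \<le> real k} - (\<Union>i\<in>I. A i) \<subseteq> X" "measure m X < exp (- (real k ^ 3))"
      using IA(7) by blast
    note lim = test_measurable_tendsto[OF _ conv m(2,3) M(2,3)]
    have 1: "\<forall>\<^sub>F n in sequentially. measure (M n) X < exp (- (real k ^ 3))" by (rule order_tendstoD(2)[OF lim[OF X(1)] X(3)])
    have 2: "\<forall>\<^sub>F n in sequentially. \<forall>i\<in>I. 0 < measure (M n) (A i) \<and> \<bar>ln (measure (M n) (A i)) - ln (measure m (A i))\<bar> < 1 / real (Suc k)"
    proof (intro eventually_ball_finite IA(1) ballI eventually_conj)
      fix i assume i: "i \<in> I"
      note l = lim[OF IA(2)[OF i]]
      show "\<forall>\<^sub>F n in sequentially. 0 < measure (M n) (A i)" by (rule order_tendstoD(1)[OF l IA(6)[OF i]])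
      have "(\<lambda>n. ln (measure (M n) (A i))) \<longlonglongrightarrow> ln (measure m (A i))" using IA(6)[OF i] by (intro tendsto_ln l) auto
      then have "\<forall>\<^sub>F n in sequentially. dist (ln (measure (M n) (A i))) (ln (measure m (A i))) < 1 / real (Suc k)"
        by (rule tendstoD) simp
      then show "\<forall>\<^sub>F n in sequentially. \<bar>ln (measure (M n) (A i)) - ln (measure m (A i))\<bar> < 1 / real (Suc k)"
        by (simp only: dist_real_def)
    qed
    have "\<forall>\<^sub>F n in sequentially. measure (M n) X < exp (- (real k ^ 3)) \<and> (\<forall>i\<in>I. 0 < measure (M n) (A i) \<and> \<bar>ln (measure (M n) (A i)) - ln (measure m (A i))\<bar> < 1 / real (Suc k)) \<and> n0 \<le> n"
      using 1 2 eventually_ge_at_top[of n0] by eventually_elim simp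
    then obtain n where n: "measure (M n) X < exp (- (real k ^ 3))" "\<And>i. i \<in> I \<Longrightarrow> 0 < measure (M n) (A i)"
      "\<And>i. i \<in> I \<Longrightarrow> \<bar>ln (measure (M n) (A i)) - ln (measure m (A i))\<bar> < 1 / real (Suc k)" "n0 \<le> n"
      using eventually_happens'[OF sequentially_bot] by blast
    have sm: "emeasure Q ({x \<in> \<Omega>. d a x \<le> real k} - (\<Union>i\<in>I. A i)) \<le> ennreal (exp (- (real k ^ 3)))"
      if Q: "sets Q = sets B" "\<And>a r. a \<in> \<Omega> \<Longrightarrow> emeasure Q (mball_of S a r) < \<infinity>" and "measure Q X < exp (- (real k ^ 3))" for Q
    proof -
      have "emeasure Q ({x \<in> \<Omega>. d a x \<le> real k} - (\<Union>i\<in>I. A i)) \<le> emeasure Q X"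
        using X(1) Q by (intro emeasure_mono X(2)) (auto simp: test_measurable_def)
      also have "\<dots> = ennreal (measure Q X)"
        using test_measurable_bounded[OF X(1) Q] by (intro emeasure_eq_ennreal_measure) simp
      also have "\<dots> \<le> ennreal (exp (- (real k ^ 3)))" using that(3) by (intro ennreal_leI) simp
      finally show ?thesis .
    qed
    have "P k n I A" unfolding P_def
      using IA(1-6) n sm[OF m(2,3) X(3)] sm[OF M(2,3) n(1)] by (auto simp: less_imp_le)
    then show ?thesis by blast
  qed
  then have "\<forall>k. \<exists>y. P k (fst y) (fst (snd y)) (snd (snd y))" by simp
  from choice[OF this] obtain y where y: "\<And>k. P k (fst (y k)) (fst (snd (y k))) (snd (snd (y k)))" by blast
  define N where "N k = fst (y k)" for k
  define I where "I k = fst (snd (y k))" for k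
  define A where "A k = snd (snd (y k))" for k
  have P: "P k (N k) (I k) (A k)" for k using y unfolding N_def I_def A_def .
  have fin: "emeasure m (A k i) < \<infinity>" "emeasure (M n) (A k i) < \<infinity>" "A k i \<in> sets B" if "i \<in> I k" for k i n
  proof -
    have t: "test_measurable m (A k i)" using P[of k] that unfolding P_def by blast
    show "emeasure m (A k i) < \<infinity>" "emeasure (M n) (A k i) < \<infinity>" "A k i \<in> sets B"
      using test_measurable_bounded[OF t m(2,3)] test_measurable_bounded[OF t M(2,3)] t unfolding test_measurable_def by auto
  qed
  have s0: "(\<lambda>k. 1 / real (Suc k)) \<longlonglongrightarrow> 0" by (rule LIMSEQ_Suc[OF lim_const_over_n])
  have ca: "cell_approximation_axioms S a Q Q' I A (\<lambda>k. 1 / real (Suc k)) (\<lambda>k. 1 / real (Suc k))"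
    if "\<And>k. sigma_finite_measure (Q k) \<and> sigma_finite_measure (Q' k) \<and> sets (Q k) = sets B \<and> sets (Q' k) = sets B"
      "\<And>k i. i \<in> I k \<Longrightarrow> 0 < measure (Q k) (A k i) \<and> 0 < measure (Q' k) (A k i) \<and> emeasure (Q k) (A k i) < \<infinity> \<and> emeasure (Q' k) (A k i) < \<infinity>"
      "\<And>k i. i \<in> I k \<Longrightarrow> \<bar>ln (measure (Q k) (A k i)) - ln (measure (Q' k) (A k i))\<bar> \<le> 1 / real (Suc k)"
      "\<And>k. emeasure (Q k) ({x \<in> \<Omega>. d a x \<le> real k} - (\<Union>i\<in>I k. A k i)) \<le> ennreal (exp (- (real k ^ 3)))" for Q Q'
  proof (rule cell_approximation_axioms.intro)
    show "finite (I k)" "disjoint_family_on (A k) (I k)" for k using P[of k] unfolding P_def by blast+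
    show "d x y \<le> 1 / real (Suc k)" if "i \<in> I k" "x \<in> A k i" "y \<in> A k i" for k i x y
      using P[of k] that unfolding P_def by blast
    show "d a x \<le> real k + 1" if "i \<in> I k" "x \<in> A k i" for k i x
      using P[of k] that unfolding P_def by blast
    show "A k i \<in> sets B" if "i \<in> I k" for k i using fin(3)[OF that] .
  qed (use that a s0 in \<open>simp_all\<close>)
  show ?thesis
  proof (rule that[of N I A])
    show "n0 \<le> N k" for k using P[of k] unfolding P_def by blast
    have P': "0 < measure m (A k i)" "0 < measure (M (N k)) (A k i)" "\<bar>ln (measure (M (N k)) (A k i)) - ln (measure m (A k i))\<bar> \<le> 1 / real (Suc k)"
      if "i \<in> I k" for k i using P[of k] that unfolding P_def by blast+
    have P'': "emeasure m ({x \<in> \<Omega>. d a x \<le> real k} - (\<Union>i\<in>I k. A k i)) \<le> ennreal (exp (- (real k ^ 3)))"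
      "emeasure (M (N k)) ({x \<in> \<Omega>. d a x \<le> real k} - (\<Union>i\<in>I k. A k i)) \<le> ennreal (exp (- (real k ^ 3)))" for k
      using P[of k] unfolding P_def by blast+
    show "cell_approximation S a (\<lambda>_. m) (\<lambda>k. M (N k)) I A (\<lambda>k. 1 / real (Suc k)) (\<lambda>k. 1 / real (Suc k))"
      by (intro cell_approximation.intro separable_metric_axioms ca) (use P' P'' fin m M in \<open>auto simp: abs_minus_commute\<close>)
    show "cell_approximation S a (\<lambda>k. M (N k)) (\<lambda>_. m) I A (\<lambda>k. 1 / real (Suc k)) (\<lambda>k. 1 / real (Suc k))"
      by (intro cell_approximation.intro separable_metric_axioms ca) (use P' P'' fin m M in auto)
  qed
qed

section \<open>Growth bounds independent of the index\<close>

text \<open>\<open>CD_ball_growth\<close> reduces large balls about x n to those of radius 1 and 3.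
  For large n the mass of these lies between positive constants, because the integrals of tents
  about a converge and m charges every ball about a. The bound for m itself is obtained afterwards
  as the limit of integrals of tents.\<close>

lemma uniform_growth:
  assumes a: "a \<in> \<Omega>" and x: "\<And>n. x n \<in> \<Omega>" "(\<lambda>n. d a (x n)) \<longlonglongrightarrow> 0" and conv: "test_converges M m"
    and m: "sets m = sets B" "\<And>a r. a \<in> \<Omega> \<Longrightarrow> emeasure m (mball_of S a r) < \<infinity>" "\<And>r. 0 < r \<Longrightarrow> 0 < emeasure m (mball_of S a r)"
    and M: "\<And>n. sigma_finite_measure (M n)" "\<And>n. sets (M n) = sets B" "\<And>n a r. a \<in> \<Omega> \<Longrightarrow> emeasure (M n) (mball_of S a r) < \<infinity>"
    and CD: "\<And>n. CD_inequality K (M n)"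
  obtains C n0 where "0 \<le> C" "\<And>j :: nat. emeasure m (mball_of S a (real (Suc j))) \<le> ennreal (exp (C * (real j + 3)\<^sup>2))"
    "\<And>n (j :: nat). n0 \<le> n \<Longrightarrow> emeasure (M n) (mball_of S a (real (Suc j))) \<le> ennreal (exp (C * (real j + 3)\<^sup>2))"
proof -
  have measm: "emeasure m (mball_of S a r) = ennreal (measure m (mball_of S a r))" for r
    using m(2)[OF a, of r] by (intro emeasure_eq_ennreal_measure) simp
  have measM: "emeasure (M n) (mball_of S a r) = ennreal (measure (M n) (mball_of S a r))" for n r
    using M(3)[OF a, of n r] by (intro emeasure_eq_ennreal_measure) simp
  have tentl: "(\<lambda>n. \<integral>z. tent a r s z \<partial>M n) \<longlonglongrightarrow> (\<integral>z. tent a r s z \<partial>m)" if "0 < s" for r s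
    using conv bounded_test_function_cut_off[OF cut_off_tent[OF a that]] unfolding test_converges_def by blast
  have tent_upper: "(\<integral>z. tent b r s z \<partial>Q) \<le> measure Q (mball_of S b r)" and tent_lower: "measure Q (mball_of S b (r - s)) \<le> (\<integral>z. tent b r s z \<partial>Q)"
    if Q: "sets Q = sets B" "\<And>a r. a \<in> \<Omega> \<Longrightarrow> emeasure Q (mball_of S a r) < \<infinity>" and b: "b \<in> \<Omega>" and s: "0 < s" for Q b r s
  proof -
    have sp: "space Q = \<Omega>" using sets_eq_imp_space_eq[OF Q(1)] by simp
    have iA: "integrable Q (indicator (mball_of S b r) :: 'a \<Rightarrow> real)" for r
      using Q b by (intro integrable_real_indicator) auto
    have eq: "measure Q (mball_of S b r) = (\<integral>z. indicator (mball_of S b r) z \<partial>Q)" for r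
    proof -
      have "mball_of S b r \<inter> space Q = mball_of S b r" by (auto simp: sp)
      then show ?thesis by simp
    qed
    note it = integrable_cut_off[OF cut_off_tent[OF b s] Q]
    show "(\<integral>z. tent b r s z \<partial>Q) \<le> measure Q (mball_of S b r)" unfolding eq
    proof (intro integral_mono it iA)
      fix z assume "z \<in> space Q"
      then show "tent b r s z \<le> indicator (mball_of S b r) z"
        using tent_bounds[of b r s z] tent_eq_0[OF s, of r b z] b by (auto simp: sp split: split_indicator)
    qed
    show "measure Q (mball_of S b (r - s)) \<le> (\<integral>z. tent b r s z \<partial>Q)" unfolding eq
    proof (intro integral_mono it iA)
      fix z assume "z \<in> space Q"
      show "indicator (mball_of S b (r - s)) z \<le> tent b r s z"
        using tent_bounds[of b r s z] tent_eq_1[OF s, of b z r] by (auto split: split_indicator)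
    qed
  qed
  have mono: "measure Q (mball_of S b r) \<le> measure Q (mball_of S b' r')"
    if Q: "sets Q = sets B" "\<And>a r. a \<in> \<Omega> \<Longrightarrow> emeasure Q (mball_of S a r) < \<infinity>" and b: "b \<in> \<Omega>" "b' \<in> \<Omega>" "d b' b + r \<le> r'" for Q b b' r r'
  proof -
    have "mball_of S b r \<subseteq> mball_of S b' r'"
    proof
      fix z assume "z \<in> mball_of S b r"
      then have z: "z \<in> \<Omega>" "d b z < r" by auto
      have "d b' z \<le> d b' b + d b z" using b z by (intro mdist_triangle) auto
      then show "z \<in> mball_of S b' r'" using b z by simp
    qed
    then show ?thesis unfolding measure_def using Q b(2)
      by (intro enn2real_mono emeasure_mono) auto
  qed
  \<comment> \<open>\<open>p\<close> bounds unit balls from below: once d a (x n) < 1/2, the ball of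
    radius 1/2 about a lies in the unit ball about x n. \<open>q\<close> bounds balls of radius 3
    from above: they lie in the ball of radius 4 about a, on which the tent in \<open>q\<close>
    equals 1.\<close>
  define p where "p = (\<integral>z. tent a (1/2) (1/4) z \<partial>m)"
  define q where "q = (\<integral>z. tent a 5 1 z \<partial>m)"
  have p0: "0 < p"
  proof -
    have "0 < measure m (mball_of S a (1/2 - 1/4))"
      unfolding measure_def enn2real_positive_iff using m(3)[of "1/2 - 1/4"] m(2)[OF a] by simp
    also have "\<dots> \<le> p" unfolding p_def by (rule tent_lower[OF m(1,2) a]) simp_all
    finally show ?thesis .
  qed
  have "\<forall>\<^sub>F n in sequentially. p / 2 < (\<integral>z. tent a (1/2) (1/4) z \<partial>M n)"
    by (rule order_tendstoD(1)[of _ p]) (use tentl[of "1/4" "1/2"] p0 in \<open>auto simp: p_def\<close>)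
  moreover have "\<forall>\<^sub>F n in sequentially. (\<integral>z. tent a 5 1 z \<partial>M n) < q + 1"
    by (rule order_tendstoD(2)[of _ q]) (use tentl[of 1 5] in \<open>auto simp: q_def\<close>)
  moreover have "\<forall>\<^sub>F n in sequentially. d a (x n) < 1 / 2" by (rule order_tendstoD(2)[OF x(2)]) simp
  ultimately have "\<forall>\<^sub>F n in sequentially. p / 2 < (\<integral>z. tent a (1/2) (1/4) z \<partial>M n) \<and> (\<integral>z. tent a 5 1 z \<partial>M n) < q + 1 \<and> d a (x n) < 1 / 2"
    by eventually_elim simp
  then obtain n0 where n0: "\<And>n. n0 \<le> n \<Longrightarrow> p / 2 < (\<integral>z. tent a (1/2) (1/4) z \<partial>M n)"
    "\<And>n. n0 \<le> n \<Longrightarrow> (\<integral>z. tent a 5 1 z \<partial>M n) < q + 1" "\<And>n. n0 \<le> n \<Longrightarrow> d a (x n) < 1 / 2"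
    unfolding eventually_sequentially by blast
  define L where "L = \<bar>ln (p / 2)\<bar> + \<bar>ln (q + 1)\<bar>"
  define C where "C = 2 * L + 2 * \<bar>K\<bar>"
  have C0: "0 \<le> C" unfolding C_def L_def by simp
  have bound: "measure (M n) (mball_of S a (real (Suc j))) \<le> exp (C * (real j + 3)\<^sup>2)" if n: "n0 \<le> n" for n and j :: nat
  proof -
    have dx: "d (x n) a < 1 / 2" "d a (x n) < 1 / 2" using n0(3)[OF n] by (auto simp: mdist_commute)
    have "(\<integral>z. tent a (1/2) (1/4) z \<partial>M n) \<le> measure (M n) (mball_of S a (1/2))"
      by (rule tent_upper[OF M(2,3) a]) simp_all
    also have "\<dots> \<le> measure (M n) (mball_of S (x n) 1)"
      by (rule mono[OF M(2,3) a x(1)]) (use dx in simp_all)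
    finally have m1: "p / 2 \<le> measure (M n) (mball_of S (x n) 1)" using n0(1)[OF n] by simp
    have "measure (M n) (mball_of S (x n) 3) \<le> measure (M n) (mball_of S a (5 - 1))"
      by (rule mono[OF M(2,3) x(1) a]) (use dx in simp_all)
    also have "\<dots> \<le> (\<integral>z. tent a 5 1 z \<partial>M n)"
      by (rule tent_lower[OF M(2,3) a]) simp_all
    finally have m3: "measure (M n) (mball_of S (x n) 3) \<le> q + 1" using n0(2)[OF n] by simp
    have m13: "measure (M n) (mball_of S (x n) 1) \<le> measure (M n) (mball_of S (x n) 3)"
      by (rule mono[OF M(2,3) x(1) x(1)]) (use x(1) in simp_all)
    have pos: "0 < measure (M n) (mball_of S (x n) 1)" using m1 p0 by simp
    have "ln (p / 2) \<le> ln (measure (M n) (mball_of S (x n) 1))" using m1 p0 pos by simp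
    moreover have "ln (measure (M n) (mball_of S (x n) 1)) \<le> ln (measure (M n) (mball_of S (x n) 3))" using m13 pos by simp
    moreover have "ln (measure (M n) (mball_of S (x n) 3)) \<le> ln (q + 1)" using m3 m13 pos by (intro ln_mono) auto
    ultimately have "\<bar>ln (measure (M n) (mball_of S (x n) 3))\<bar> \<le> L" "\<bar>ln (measure (M n) (mball_of S (x n) 1))\<bar> \<le> L"
      unfolding L_def by linarith+
    then have L: "\<bar>ln (measure (M n) (mball_of S (x n) 3))\<bar> + \<bar>ln (measure (M n) (mball_of S (x n) 1))\<bar> \<le> 2 * L" by simp
    \<comment> \<open>The radius j + 2 is used because the ball of radius j + 2 about x n contains
      the ball of radius j + 1 about a.\<close>
    have g: "ln (measure (M n) (mball_of S (x n) (real j + 2))) \<le> (real j + 2 + 1) * (\<bar>ln (measure (M n) (mball_of S (x n) 3))\<bar> + \<bar>ln (measure (M n) (mball_of S (x n) 1))\<bar>) + 2 * \<bar>K\<bar> * (real j + 2)\<^sup>2"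
      by (rule CD_ball_growth[OF M(1,2) x(1) CD M(3)[OF x(1)] pos]) simp
    also have "\<dots> \<le> (real j + 2 + 1) * (2 * L) + 2 * \<bar>K\<bar> * (real j + 2)\<^sup>2"
      using L by (intro add_right_mono mult_left_mono) auto
    also have "\<dots> \<le> (real j + 3)\<^sup>2 * (2 * L) + 2 * \<bar>K\<bar> * (real j + 3)\<^sup>2"
    proof (intro add_mono mult_right_mono mult_left_mono power_mono)
      show "real j + 2 + 1 \<le> (real j + 3)\<^sup>2" unfolding power2_eq_square by (simp add: algebra_simps)
    qed (auto simp: L_def)
    also have "\<dots> = C * (real j + 3)\<^sup>2" unfolding C_def by (simp add: algebra_simps)
    finally have g: "ln (measure (M n) (mball_of S (x n) (real j + 2))) \<le> C * (real j + 3)\<^sup>2" .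
    have "measure (M n) (mball_of S (x n) 1) \<le> measure (M n) (mball_of S (x n) (real j + 2))"
      by (rule mono[OF M(2,3) x(1) x(1)]) (use x(1) in simp_all)
    then have "measure (M n) (mball_of S (x n) (real j + 2)) = exp (ln (measure (M n) (mball_of S (x n) (real j + 2))))" using pos by simp
    also have "\<dots> \<le> exp (C * (real j + 3)\<^sup>2)" using g by (simp only: exp_le_cancel_iff)
    finally have "measure (M n) (mball_of S (x n) (real j + 2)) \<le> exp (C * (real j + 3)\<^sup>2)" .
    moreover have "measure (M n) (mball_of S a (real (Suc j))) \<le> measure (M n) (mball_of S (x n) (real j + 2))"
      by (rule mono[OF M(2,3) a x(1)]) (use dx in simp_all)
    ultimately show ?thesis by simp
  qed
  \<comment> \<open>The constant is doubled for the sake of m, whose ball of radius j + 1 is bounded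
    through balls of radius j + 2 of the approximating measures: (j + 4)^2 \<le> 2 (j +
    3)^2.\<close>
  have C2: "C * (real j + 3)\<^sup>2 \<le> 2 * C * (real j + 3)\<^sup>2" for j :: nat using C0 by (intro mult_right_mono) auto
  show ?thesis
  proof (rule that[of "2 * C" n0])
    fix n and j :: nat assume "n0 \<le> n"
    then have "measure (M n) (mball_of S a (real (Suc j))) \<le> exp (2 * C * (real j + 3)\<^sup>2)"
      using bound[of n j] C2[of j] by (simp add: order_trans[OF _ exp_le_cancel_iff[THEN iffD2]])
    then show "emeasure (M n) (mball_of S a (real (Suc j))) \<le> ennreal (exp (2 * C * (real j + 3)\<^sup>2))"
      unfolding measM by (rule ennreal_leI)
  next
    fix j :: nat
    have "(\<integral>z. tent a (real (Suc j) + 1) 1 z \<partial>m) \<le> exp (C * (real (Suc j) + 3)\<^sup>2)"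
    proof (rule tendsto_upperbound[OF tentl])
      show "\<forall>\<^sub>F n in sequentially. (\<integral>z. tent a (real (Suc j) + 1) 1 z \<partial>M n) \<le> exp (C * (real (Suc j) + 3)\<^sup>2)"
      proof (rule eventually_mono[OF eventually_ge_at_top[of n0]])
        fix n assume n: "n0 \<le> n"
        have "(\<integral>z. tent a (real (Suc j) + 1) 1 z \<partial>M n) \<le> measure (M n) (mball_of S a (real (Suc j) + 1))"
          by (rule tent_upper[OF M(2,3) a]) simp_all
        also have "real (Suc j) + 1 = real (Suc (Suc j))" by simp
        also note bound[OF n, of "Suc j"]
        finally show "(\<integral>z. tent a (real (Suc j) + 1) 1 z \<partial>M n) \<le> exp (C * (real (Suc j) + 3)\<^sup>2)" by simp
      qed
    qed auto
    moreover have "measure m (mball_of S a (real (Suc j))) \<le> (\<integral>z. tent a (real (Suc j) + 1) 1 z \<partial>m)"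
      using tent_lower[OF m(1,2) a, of 1 "real (Suc j) + 1"] by simp
    moreover have "exp (C * (real (Suc j) + 3)\<^sup>2) \<le> exp (2 * C * (real j + 3)\<^sup>2)"
    proof -
      have "(real (Suc j) + 3)\<^sup>2 \<le> 2 * (real j + 3)\<^sup>2" by (simp add: power2_eq_square algebra_simps)
      then have "C * (real (Suc j) + 3)\<^sup>2 \<le> C * (2 * (real j + 3)\<^sup>2)" using C0 by (rule mult_left_mono)
      then show ?thesis by (simp only: exp_le_cancel_iff mult.assoc mult.left_commute)
    qed
    ultimately have "measure m (mball_of S a (real (Suc j))) \<le> exp (2 * C * (real j + 3)\<^sup>2)" by linarith
    then show "emeasure m (mball_of S a (real (Suc j))) \<le> ennreal (exp (2 * C * (real j + 3)\<^sup>2))"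
      unfolding measm by (rule ennreal_leI)
  qed (use C0 in simp)
qed

end

section \<open>Stability in a common space\<close>

lemma eventually_bounded_above_sequence:
  fixes f :: "nat \<Rightarrow> real"
  assumes "\<forall>\<^sub>F k in sequentially. f k \<le> b"
  shows "\<exists>V. \<forall>k. f k \<le> V"
proof -
  obtain N where N: "\<And>k. N \<le> k \<Longrightarrow> f k \<le> b" using assms unfolding eventually_sequentially by blast
  have "f k \<le> max b (Max (f ` {..N}))" for k
  proof (cases "N \<le> k")
    case True then show ?thesis using N by (simp add: le_max_iff_disj)
  next
    case False
    then have "f k \<le> Max (f ` {..N})" by (intro Max_ge) auto
    then show ?thesis by simp
  qed
  then show ?thesis by blast
qed

context separable_metric
begin

lemma sq_tail_mono: "r \<le> s \<Longrightarrow> sq_tail a s x \<le> sq_tail a r x"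
  unfolding sq_tail_def by auto

text \<open>Uniform integrability is put in the form in which the transfer uses it, with the radius
  growing along with the index, and it bounds the second moments through d^2 \<le> r^2 +
  tail.\<close>

lemma uniform_tails:
  assumes \<nu>: "\<And>k. \<nu> k \<in> P2 S" and a: "a \<in> \<Omega>"
    and UI: "\<And>e. 0 < e \<Longrightarrow> \<exists>r. \<forall>\<^sub>F k in sequentially. (\<integral>x. sq_tail a r x \<partial>\<nu> k) \<le> e"
  shows "(\<lambda>k. \<integral>x. sq_tail a (real k) x \<partial>\<nu> k) \<longlonglongrightarrow> 0" and "\<exists>V. \<forall>k. (\<integral>x. (d a x)\<^sup>2 \<partial>\<nu> k) \<le> V"
proof -
  have nn: "0 \<le> (\<integral>x. sq_tail a r x \<partial>\<nu> k)" for r k by (intro integral_nonneg_AE AE_I2 sq_tail_nonneg)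
  show "(\<lambda>k. \<integral>x. sq_tail a (real k) x \<partial>\<nu> k) \<longlonglongrightarrow> 0"
  proof (rule tendstoI)
    fix e :: real assume e: "0 < e"
    obtain r where r: "\<forall>\<^sub>F k in sequentially. (\<integral>x. sq_tail a r x \<partial>\<nu> k) \<le> e / 2" using UI[of "e / 2"] e by auto
    then show "\<forall>\<^sub>F k in sequentially. dist (\<integral>x. sq_tail a (real k) x \<partial>\<nu> k) 0 < e"
      using eventually_ge_at_top[of "nat \<lceil>r\<rceil>"]
    proof eventually_elim
      fix k assume 1: "(\<integral>x. sq_tail a r x \<partial>\<nu> k) \<le> e / 2" and "nat \<lceil>r\<rceil> \<le> k"
      then have "r \<le> real k" by linarith
      then have "(\<integral>x. sq_tail a (real k) x \<partial>\<nu> k) \<le> (\<integral>x. sq_tail a r x \<partial>\<nu> k)"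
        by (intro integral_mono integrable_sq_tail \<nu> a sq_tail_mono)
      then show "dist (\<integral>x. sq_tail a (real k) x \<partial>\<nu> k) 0 < e" using 1 e nn[of k "real k"] by (simp add: dist_real_def)
    qed
  qed
  obtain r where r: "\<forall>\<^sub>F k in sequentially. (\<integral>x. sq_tail a r x \<partial>\<nu> k) \<le> 1" using UI[of 1] by auto
  then have "\<forall>\<^sub>F k in sequentially. (\<integral>x. (d a x)\<^sup>2 \<partial>\<nu> k) \<le> r\<^sup>2 + 1"
  proof (rule eventually_mono)
    fix k assume 1: "(\<integral>x. sq_tail a r x \<partial>\<nu> k) \<le> 1"
    interpret prob_space "\<nu> k" using P2_D[OF \<nu>] by simp
    have "(\<integral>x. (d a x)\<^sup>2 \<partial>\<nu> k) \<le> (\<integral>x. r\<^sup>2 + sq_tail a r x \<partial>\<nu> k)"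
    proof (intro integral_mono P2_integrable \<nu> a)
      show "integrable (\<nu> k) (\<lambda>x. r\<^sup>2 + sq_tail a r x)" using integrable_sq_tail[OF \<nu> a] by simp
      show "(d a x)\<^sup>2 \<le> r\<^sup>2 + sq_tail a r x" for x
        by (auto simp: sq_tail_def intro!: power_mono)
    qed
    also have "\<dots> = r\<^sup>2 + (\<integral>x. sq_tail a r x \<partial>\<nu> k)" using integrable_sq_tail[OF \<nu> a, of k r] by (simp add: prob_space)
    finally show "(\<integral>x. (d a x)\<^sup>2 \<partial>\<nu> k) \<le> r\<^sup>2 + 1" using 1 by simp
  qed
  then show "\<exists>V. \<forall>k. (\<integral>x. (d a x)\<^sup>2 \<partial>\<nu> k) \<le> V"
    by (rule eventually_bounded_above_sequence)
qed

text \<open>The dual formula with \<theta> the Gaussian excludes the value - \<infinity>.\<close>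

lemma Ent_P2_real:
  assumes m: "sigma_finite_measure m" "sets m = sets B" and a: "a \<in> \<Omega>" and ig: "integrable m (gauss c a)"
    and \<mu>: "\<mu> \<in> Ent_dom S m"
  obtains e where "Ent m \<mu> = ereal e"
proof -
  have \<mu>P: "\<mu> \<in> P2 S" and fin: "Ent m \<mu> < \<infinity>" using \<mu> unfolding Ent_dom_def by auto
  have [measurable_cong]: "sets m = sets B" by fact
  have "ereal ((\<integral>x. ln (gauss c a x) \<partial>\<mu>) + 1 - (\<integral>x. gauss c a x \<partial>m)) \<le> Ent m \<mu>"
    by (rule Ent_dual[OF m(1)])
      (use P2_D[OF \<mu>P] m gauss_pos[of c a] gauss_measurable[OF a] ig P2_integrable[OF \<mu>P a] in \<open>auto simp: less_imp_le ln_gauss\<close>)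
  then show ?thesis using fin that by (cases "Ent m \<mu>") auto
qed

text \<open>For fixed t the carried-back points \<nu> t k are close in \<open>W2\<close> to \<gamma>
  k t, but they form no geodesic. The distances along the limit curve are therefore computed from
  \<gamma>, while the entropies of its interior points are bounded through \<nu>.\<close>

theorem CD_inequality_limit:
  assumes a: "a \<in> \<Omega>" and x: "\<And>n. x n \<in> \<Omega>" "(\<lambda>n. d a (x n)) \<longlonglongrightarrow> 0" and conv: "test_converges M m"
    and m: "sigma_finite_measure m" "sets m = sets B" "\<And>a r. a \<in> \<Omega> \<Longrightarrow> emeasure m (mball_of S a r) < \<infinity>" "\<And>r. 0 < r \<Longrightarrow> 0 < emeasure m (mball_of S a r)"
    and M: "\<And>n. sigma_finite_measure (M n)" "\<And>n. sets (M n) = sets B" "\<And>n a r. a \<in> \<Omega> \<Longrightarrow> emeasure (M n) (mball_of S a r) < \<infinity>"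
    and CD: "\<And>n. CD_inequality K (M n)"
  shows "CD_inequality K m"
  unfolding CD_inequality_def
proof (intro ballI)
  fix \<mu>0 \<mu>1 assume dom: "\<mu>0 \<in> Ent_dom S m" "\<mu>1 \<in> Ent_dom S m"
  then have \<mu>0: "\<mu>0 \<in> P2 S" and \<mu>1: "\<mu>1 \<in> P2 S" unfolding Ent_dom_def by auto
  obtain C n0 where C: "0 \<le> C" and gm: "\<And>j :: nat. emeasure m (mball_of S a (real (Suc j))) \<le> ennreal (exp (C * (real j + 3)\<^sup>2))"
    and gM: "\<And>n (j :: nat). n0 \<le> n \<Longrightarrow> emeasure (M n) (mball_of S a (real (Suc j))) \<le> ennreal (exp (C * (real j + 3)\<^sup>2))"
    using uniform_growth[OF a x conv m(2-4) M CD] by blast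
  define c where "c = 2 * C + 1"
  define Cg where "Cg = exp (18 * C) * (\<Sum>j. exp (- real j))"
  have c: "0 \<le> c" using C by (simp add: c_def)
  have igm: "integrable m (gauss c a)" "(\<integral>x. gauss c a x \<partial>m) \<le> Cg"
    using gauss_integral_bound[OF m(2) a C gm] unfolding c_def Cg_def by auto
  have igM: "integrable (M n) (gauss c a)" "(\<integral>x. gauss c a x \<partial>M n) \<le> Cg" if "n0 \<le> n" for n
    using gauss_integral_bound[OF M(2) a C gM[OF that]] unfolding c_def Cg_def by auto
  obtain e0 where e0: "Ent m \<mu>0 = ereal e0" by (rule Ent_P2_real[OF m(1,2) a igm(1) dom(1)])
  obtain e1 where e1: "Ent m \<mu>1 = ereal e1" by (rule Ent_P2_real[OF m(1,2) a igm(1) dom(2)])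
  define w where "w = W2 S \<mu>0 \<mu>1"
  have w0: "0 \<le> w" unfolding w_def by (rule W2_nonneg)
  obtain N I A where N: "\<And>k. n0 \<le> N k"
    and fwd: "cell_approximation S a (\<lambda>_. m) (\<lambda>k. M (N k)) I A (\<lambda>k. 1 / real (Suc k)) (\<lambda>k. 1 / real (Suc k))"
    and bwd: "cell_approximation S a (\<lambda>k. M (N k)) (\<lambda>_. m) I A (\<lambda>k. 1 / real (Suc k)) (\<lambda>k. 1 / real (Suc k))"
    using cell_approximation_exists[OF a conv m(1-3) M, where ?n0.0=n0] by blast
  interpret fwd: cell_approximation S a "\<lambda>_. m" "\<lambda>k. M (N k)" I A "\<lambda>k. 1 / real (Suc k)" "\<lambda>k. 1 / real (Suc k)" by (rule fwd)
  interpret bwd: cell_approximation S a "\<lambda>k. M (N k)" "\<lambda>_. m" I A "\<lambda>k. 1 / real (Suc k)" "\<lambda>k. 1 / real (Suc k)" by (rule bwd)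
  obtain \<alpha>0 h0 where \<alpha>0: "\<And>k. \<alpha>0 k \<in> P2 S" "(\<lambda>k. W2 S \<mu>0 (\<alpha>0 k)) \<longlonglongrightarrow> 0"
    "\<forall>\<^sub>F k in sequentially. Ent (M (N k)) (\<alpha>0 k) \<le> ereal (h0 k)" "h0 \<longlonglongrightarrow> e0"
    by (rule fwd.transfer_measures[where \<sigma>="\<lambda>_. \<mu>0" and h="\<lambda>_. e0" and ?h0.0=e0, OF c igm \<mu>0 _ _ order_refl sq_tail_tendsto[OF \<mu>0 a]]) (auto simp: e0)
  obtain \<alpha>1 h1 where \<alpha>1: "\<And>k. \<alpha>1 k \<in> P2 S" "(\<lambda>k. W2 S \<mu>1 (\<alpha>1 k)) \<longlonglongrightarrow> 0"
    "\<forall>\<^sub>F k in sequentially. Ent (M (N k)) (\<alpha>1 k) \<le> ereal (h1 k)" "h1 \<longlonglongrightarrow> e1"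
    by (rule fwd.transfer_measures[where \<sigma>="\<lambda>_. \<mu>1" and h="\<lambda>_. e1" and ?h0.0=e1, OF c igm \<mu>1 _ _ order_refl sq_tail_tendsto[OF \<mu>1 a]]) (auto simp: e1)
  \<comment> \<open>The approximate endpoints are known to have finite entropy only for large k. For
    the other k the curve is set to the constant \<mu>0, so that membership in \<open>P2\<close>
    holds for every k.\<close>
  define good where "good k \<longleftrightarrow> Ent (M (N k)) (\<alpha>0 k) \<le> ereal (h0 k) \<and> Ent (M (N k)) (\<alpha>1 k) \<le> ereal (h1 k)" for k
  have good: "\<forall>\<^sub>F k in sequentially. good k" unfolding good_def using \<alpha>0(3) \<alpha>1(3) by (rule eventually_conj)
  define wk where "wk k = W2 S (\<alpha>0 k) (\<alpha>1 k)" for k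
  define h where "h t k = (1 - t) * h0 k + t * h1 k - K / 2 * t * (1 - t) * (wk k)\<^sup>2" for t k
  have "\<forall>k. \<exists>\<gamma>. (\<forall>t\<in>{0..1}. \<gamma> t \<in> P2 S) \<and> (good k \<longrightarrow> \<gamma> 0 = \<alpha>0 k \<and> \<gamma> 1 = \<alpha>1 k \<and>
      (\<forall>s\<in>{0..1}. \<forall>t\<in>{0..1}. W2 S (\<gamma> t) (\<gamma> s) = \<bar>t - s\<bar> * wk k) \<and> (\<forall>t\<in>{0..1}. Ent (M (N k)) (\<gamma> t) \<le> ereal (h t k)))"
  proof
    fix k
    show "\<exists>\<gamma>. (\<forall>t\<in>{0..1}. \<gamma> t \<in> P2 S) \<and> (good k \<longrightarrow> \<gamma> 0 = \<alpha>0 k \<and> \<gamma> 1 = \<alpha>1 k \<and>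
      (\<forall>s\<in>{0..1}. \<forall>t\<in>{0..1}. W2 S (\<gamma> t) (\<gamma> s) = \<bar>t - s\<bar> * wk k) \<and> (\<forall>t\<in>{0..1}. Ent (M (N k)) (\<gamma> t) \<le> ereal (h t k)))"
    proof (cases "good k")
      case True
      then have E: "Ent (M (N k)) (\<alpha>0 k) \<le> ereal (h0 k)" "Ent (M (N k)) (\<alpha>1 k) \<le> ereal (h1 k)" unfolding good_def by auto
      then have "\<alpha>0 k \<in> Ent_dom S (M (N k))" "\<alpha>1 k \<in> Ent_dom S (M (N k))"
        using \<alpha>0(1) \<alpha>1(1) unfolding Ent_dom_def by (auto intro: le_less_trans)
      then obtain \<gamma> where \<gamma>: "W2_geodesic S \<gamma>" "\<gamma> 0 = \<alpha>0 k" "\<gamma> 1 = \<alpha>1 k"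
        "\<And>t. t \<in> {0..1} \<Longrightarrow> Ent (M (N k)) (\<gamma> t) \<le> ereal (1 - t) * Ent (M (N k)) (\<gamma> 0) + ereal t * Ent (M (N k)) (\<gamma> 1)
          - ereal (K / 2 * t * (1 - t) * (W2 S (\<gamma> 0) (\<gamma> 1))\<^sup>2)"
        using CD[of "N k"] unfolding CD_inequality_def by blast
      have "Ent (M (N k)) (\<gamma> t) \<le> ereal (h t k)" if t: "t \<in> {0..1}" for t
      proof -
        note \<gamma>(4)[OF t]
        also have "ereal (1 - t) * Ent (M (N k)) (\<gamma> 0) + ereal t * Ent (M (N k)) (\<gamma> 1) - ereal (K / 2 * t * (1 - t) * (W2 S (\<gamma> 0) (\<gamma> 1))\<^sup>2)
          \<le> ereal (1 - t) * ereal (h0 k) + ereal t * ereal (h1 k) - ereal (K / 2 * t * (1 - t) * (W2 S (\<gamma> 0) (\<gamma> 1))\<^sup>2)"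
          unfolding \<gamma>(2,3) using t E by (intro ereal_minus_mono add_mono ereal_mult_left_mono) auto
        also have "\<dots> = ereal (h t k)" unfolding \<gamma>(2,3) h_def wk_def by simp
        finally show ?thesis .
      qed
      moreover have "W2 S (\<gamma> t) (\<gamma> s) = \<bar>t - s\<bar> * wk k" if "s \<in> {0..1}" "t \<in> {0..1}" for s t
        using W2_geodesicD(2)[OF \<gamma>(1) that] unfolding \<gamma>(2,3) wk_def .
      ultimately show ?thesis using W2_geodesicD(1)[OF \<gamma>(1)] \<gamma>(2,3) by blast
    next
      case False
      then show ?thesis using \<mu>0 by (intro exI[of _ "\<lambda>_. \<mu>0"]) simp
    qed
  qed
  from choice[OF this] obtain \<gamma> where \<gamma>': "\<forall>k. (\<forall>t\<in>{0..1}. \<gamma> k t \<in> P2 S) \<and> (good k \<longrightarrow> \<gamma> k 0 = \<alpha>0 k \<and> \<gamma> k 1 = \<alpha>1 k \<and>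
      (\<forall>s\<in>{0..1}. \<forall>t\<in>{0..1}. W2 S (\<gamma> k t) (\<gamma> k s) = \<bar>t - s\<bar> * wk k) \<and> (\<forall>t\<in>{0..1}. Ent (M (N k)) (\<gamma> k t) \<le> ereal (h t k)))"
    by blast
  have \<gamma>P: "\<gamma> k t \<in> P2 S" if "t \<in> {0..1}" for k t using \<gamma>' that by blast
  have \<gamma>01: "\<gamma> k 0 = \<alpha>0 k" "\<gamma> k 1 = \<alpha>1 k" if "good k" for k using \<gamma>' that by blast+
  have \<gamma>W: "W2 S (\<gamma> k t) (\<gamma> k s) = \<bar>t - s\<bar> * wk k" if "good k" "s \<in> {0..1}" "t \<in> {0..1}" for k s t using \<gamma>' that by blast
  have \<gamma>E: "Ent (M (N k)) (\<gamma> k t) \<le> ereal (h t k)" if "good k" "t \<in> {0..1}" for k t using \<gamma>' that by blast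
  \<comment> \<open>The total displacement of the two endpoints, which also bounds the change of
    their distance.\<close>
  define \<epsilon> where "\<epsilon> k = W2 S \<mu>0 (\<alpha>0 k) + W2 S \<mu>1 (\<alpha>1 k)" for k
  have \<epsilon>: "\<epsilon> \<longlonglongrightarrow> 0" unfolding \<epsilon>_def[abs_def] using tendsto_add[OF \<alpha>0(2) \<alpha>1(2)] by simp
  have \<epsilon>0: "0 \<le> \<epsilon> k" for k unfolding \<epsilon>_def using W2_nonneg by (simp add: add_nonneg_nonneg)
  have wk: "\<bar>wk k - w\<bar> \<le> \<epsilon> k" for k
  proof -
    have "w \<le> W2 S \<mu>0 (\<alpha>0 k) + W2 S (\<alpha>0 k) \<mu>1" unfolding w_def by (rule W2_triangle[OF \<mu>0 \<alpha>0(1) \<mu>1])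
    moreover have "W2 S (\<alpha>0 k) \<mu>1 \<le> wk k + W2 S (\<alpha>1 k) \<mu>1" unfolding wk_def by (rule W2_triangle[OF \<alpha>0(1) \<alpha>1(1) \<mu>1])
    moreover have "wk k \<le> W2 S (\<alpha>0 k) \<mu>0 + W2 S \<mu>0 (\<alpha>1 k)" unfolding wk_def by (rule W2_triangle[OF \<alpha>0(1) \<mu>0 \<alpha>1(1)])
    moreover have "W2 S \<mu>0 (\<alpha>1 k) \<le> w + W2 S \<mu>1 (\<alpha>1 k)" unfolding w_def by (rule W2_triangle[OF \<mu>0 \<mu>1 \<alpha>1(1)])
    ultimately show ?thesis
      using W2_commute[OF \<mu>0 \<alpha>0(1), of k] W2_commute[OF \<mu>1 \<alpha>1(1), of k] unfolding \<epsilon>_def by linarith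
  qed
  have wklim: "wk \<longlonglongrightarrow> w"
  proof -
    have "(\<lambda>k. wk k - w) \<longlonglongrightarrow> 0" by (rule Lim_null_comparison[OF _ \<epsilon>]) (use wk in auto)
    from tendsto_add[OF this tendsto_const[of w]] show ?thesis by simp
  qed
  define X where "X t = (1 - t) * e0 + t * e1 - K / 2 * t * (1 - t) * w\<^sup>2" for t
  have hlim: "h t \<longlonglongrightarrow> X t" for t unfolding h_def[abs_def] X_def by (intro tendsto_intros \<alpha>0(4) \<alpha>1(4) wklim)
  \<comment> \<open>Of the two \<epsilon> one pays for moving the endpoint and the other for
    replacing wk k by w. Hence \<gamma> k t is almost intermediate between the original endpoints,
    as \<open>intermediate_tail\<close> requires.\<close>
  have near: "W2 S \<mu>0 (\<gamma> k t) \<le> t * w + 2 * \<epsilon> k" "W2 S (\<gamma> k t) \<mu>1 \<le> (1 - t) * w + 2 * \<epsilon> k" if k: "good k" and t: "t \<in> {0..1}" for k t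
  proof -
    have tw: "t * wk k \<le> t * w + \<epsilon> k" "(1 - t) * wk k \<le> (1 - t) * w + \<epsilon> k"
    proof -
      have "wk k \<le> w + \<epsilon> k" using wk[of k] by linarith
      then have "t * wk k \<le> t * (w + \<epsilon> k)" "(1 - t) * wk k \<le> (1 - t) * (w + \<epsilon> k)" using t by (auto intro: mult_left_mono)
      moreover have "t * \<epsilon> k \<le> \<epsilon> k" "(1 - t) * \<epsilon> k \<le> \<epsilon> k" using t \<epsilon>0[of k] by (auto intro: mult_left_le_one_le)
      ultimately show "t * wk k \<le> t * w + \<epsilon> k" "(1 - t) * wk k \<le> (1 - t) * w + \<epsilon> k" by (simp_all add: distrib_left)
    qed
    have "W2 S \<mu>0 (\<gamma> k t) \<le> W2 S \<mu>0 (\<alpha>0 k) + W2 S (\<gamma> k 0) (\<gamma> k t)"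
      unfolding \<gamma>01[OF k] by (rule W2_triangle[OF \<mu>0 \<alpha>0(1) \<gamma>P[OF t]])
    then show "W2 S \<mu>0 (\<gamma> k t) \<le> t * w + 2 * \<epsilon> k"
      using \<gamma>W[OF k t, of 0] t tw(1) W2_nonneg[of \<mu>1 "\<alpha>1 k"] by (simp add: \<epsilon>_def)
    have "W2 S (\<gamma> k t) \<mu>1 \<le> W2 S (\<gamma> k t) (\<gamma> k 1) + W2 S (\<alpha>1 k) \<mu>1"
      unfolding \<gamma>01[OF k] by (rule W2_triangle[OF \<gamma>P[OF t] \<alpha>1(1) \<mu>1])
    then show "W2 S (\<gamma> k t) \<mu>1 \<le> (1 - t) * w + 2 * \<epsilon> k"
      using \<gamma>W[OF k _ t, of 1] t tw(2) W2_nonneg[of \<mu>0 "\<alpha>0 k"] W2_commute[OF \<mu>1 \<alpha>1(1), of k] by (simp add: \<epsilon>_def abs_minus_commute[of t])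
  qed
  have tails: "\<exists>r. \<forall>\<^sub>F k in sequentially. (\<integral>x. sq_tail a r x \<partial>\<nu> k) \<le> e"
    if t: "t \<in> {0..1}" and \<nu>: "\<And>k. \<nu> k \<in> P2 S" and close: "(\<lambda>k. W2 S (\<gamma> k t) (\<nu> k)) \<longlonglongrightarrow> 0" and e: "0 < e" for t \<nu> e
  proof -
    obtain r \<kappa> where r: "0 \<le> r" "0 < \<kappa>" and T: "\<And>\<sigma> t. \<sigma> \<in> P2 S \<Longrightarrow> 0 \<le> t \<Longrightarrow> t \<le> 1 \<Longrightarrow> W2 S \<mu>0 \<sigma> \<le> t * W2 S \<mu>0 \<mu>1 + \<kappa> \<Longrightarrow>
       W2 S \<sigma> \<mu>1 \<le> (1 - t) * W2 S \<mu>0 \<mu>1 + \<kappa> \<Longrightarrow> (\<integral>z. sq_tail a r z \<partial>\<sigma>) \<le> e"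
      using intermediate_tail[OF \<mu>0 \<mu>1 a e] by metis
    have "(\<lambda>k. 2 * \<epsilon> k + W2 S (\<gamma> k t) (\<nu> k)) \<longlonglongrightarrow> 2 * 0 + 0" by (intro tendsto_intros \<epsilon> close)
    then have "\<forall>\<^sub>F k in sequentially. 2 * \<epsilon> k + W2 S (\<gamma> k t) (\<nu> k) < \<kappa>" by (rule order_tendstoD(2)) (use r in simp)
    then have "\<forall>\<^sub>F k in sequentially. (\<integral>x. sq_tail a r x \<partial>\<nu> k) \<le> e"
      using good
    proof eventually_elim
      fix k assume 1: "2 * \<epsilon> k + W2 S (\<gamma> k t) (\<nu> k) < \<kappa>" and k: "good k"
      have "W2 S \<mu>0 (\<nu> k) \<le> W2 S \<mu>0 (\<gamma> k t) + W2 S (\<gamma> k t) (\<nu> k)" by (rule W2_triangle[OF \<mu>0 \<gamma>P[OF t] \<nu>])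
      moreover have "W2 S (\<nu> k) \<mu>1 \<le> W2 S (\<nu> k) (\<gamma> k t) + W2 S (\<gamma> k t) \<mu>1" by (rule W2_triangle[OF \<nu> \<gamma>P[OF t] \<mu>1])
      ultimately show "(\<integral>x. sq_tail a r x \<partial>\<nu> k) \<le> e"
        using near[OF k t] 1 t W2_commute[OF \<nu> \<gamma>P[OF t], of k k] by (intro T[OF \<nu>, of t]) (auto simp: w_def)
    qed
    then show ?thesis by blast
  qed
  have selfclose: "(\<lambda>k. W2 S (\<gamma> k t) (\<gamma> k t)) \<longlonglongrightarrow> 0" if t: "t \<in> {0..1}" for t
    using W2_self P2_D(2)[OF \<gamma>P[OF t]] by simp
  \<comment> \<open>The transfer back to m is carried out for each t separately; its rates may
    depend on t, but only the limit for each fixed t matters.\<close>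
  have "\<exists>\<nu> h'. (\<forall>k. \<nu> k \<in> P2 S) \<and> (\<lambda>k. W2 S (\<gamma> k t) (\<nu> k)) \<longlonglongrightarrow> 0 \<and>
      (\<forall>\<^sub>F k in sequentially. Ent m (\<nu> k) \<le> ereal (h' k)) \<and> h' \<longlonglongrightarrow> X t" if t: "t \<in> {0..1}" for t
  proof -
    note T = tails[OF t \<gamma>P[OF t] selfclose[OF t]]
    obtain V where V: "\<And>k. (\<integral>x. (d a x)\<^sup>2 \<partial>\<gamma> k t) \<le> V" using uniform_tails(2)[OF \<gamma>P[OF t] a T] by blast
    have E: "\<forall>\<^sub>F k in sequentially. Ent (M (N k)) (\<gamma> k t) \<le> ereal (h t k)" using good by (rule eventually_mono) (rule \<gamma>E[OF _ t])
    obtain \<nu> h' where "\<And>k. \<nu> k \<in> P2 S" "(\<lambda>k. W2 S (\<gamma> k t) (\<nu> k)) \<longlonglongrightarrow> 0"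
      "\<forall>\<^sub>F k in sequentially. Ent m (\<nu> k) \<le> ereal (h' k)" "h' \<longlonglongrightarrow> X t"
      using bwd.transfer_measures[OF c igM(1)[OF N] igM(2)[OF N] \<gamma>P[OF t] E hlim V uniform_tails(1)[OF \<gamma>P[OF t] a T]] by blast
    then show ?thesis by blast
  qed
  then have "\<forall>t\<in>{0..1}. \<exists>y. (\<forall>k. fst y k \<in> P2 S) \<and> (\<lambda>k. W2 S (\<gamma> k t) (fst y k)) \<longlonglongrightarrow> 0 \<and>
      (\<forall>\<^sub>F k in sequentially. Ent m (fst y k) \<le> ereal (snd y k)) \<and> snd y \<longlonglongrightarrow> X t" by fastforce
  from bchoice[OF this] obtain y where y: "\<forall>t\<in>{0..1}. (\<forall>k. fst (y t) k \<in> P2 S) \<and> (\<lambda>k. W2 S (\<gamma> k t) (fst (y t) k)) \<longlonglongrightarrow> 0 \<and>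
      (\<forall>\<^sub>F k in sequentially. Ent m (fst (y t) k) \<le> ereal (snd (y t) k)) \<and> snd (y t) \<longlonglongrightarrow> X t" by blast
  define \<nu> where "\<nu> t k = fst (y t) k" for t k
  define h' where "h' t = snd (y t)" for t
  have \<nu>: "\<nu> t k \<in> P2 S" "(\<lambda>k. W2 S (\<gamma> k t) (\<nu> t k)) \<longlonglongrightarrow> 0" "\<forall>\<^sub>F k in sequentially. Ent m (\<nu> t k) \<le> ereal (h' t k)" "h' t \<longlonglongrightarrow> X t"
    if "t \<in> {0..1}" for t k using y that unfolding \<nu>_def h'_def by blast+
  \<comment> \<open>The coordinates of the product are pairs of a time and a set. For times outside
    the unit interval nothing is known about \<nu> t, and the value 0 keeps the family inside the
    product of unit intervals.\<close>
  have p01: "(if t \<in> {0..1} then measure (\<nu> t k) Q else 0) \<in> {0..1}" for t k Q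
    using prob_space.prob_le_1[OF P2_D(3)[OF \<nu>(1)], of t k Q] by auto
  obtain G xl where G: "G \<noteq> bot" "G \<le> sequentially"
    and xl: "\<And>i :: real \<times> 'a set. ((\<lambda>k. if fst i \<in> {0..1} then measure (\<nu> (fst i) k) (snd i) else 0) \<longlongrightarrow> xl i) G"
    using cluster_filter[of "\<lambda>k i. if fst i \<in> {0..1} then measure (\<nu> (fst i) k) (snd i) else 0"] p01 by blast
  have evG: "\<forall>\<^sub>F k in G. P k" if "\<forall>\<^sub>F k in sequentially. P k" for P using that G(2) by (rule filter_leD[rotated])
  have tendG: "(f \<longlongrightarrow> l) G" if "f \<longlonglongrightarrow> l" for f :: "nat \<Rightarrow> real" and l using that by (rule tendsto_mono[OF G(2)])
  have lim1: "\<exists>\<mu>\<in>P2 S. ((\<lambda>k. W2 S (\<nu> t k) \<mu>) \<longlongrightarrow> 0) G \<and> Ent m \<mu> \<le> ereal (X t)" if t: "t \<in> {0..1}" for t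
  proof -
    note T = tails[OF t \<nu>(1)[OF t] \<nu>(2)[OF t]]
    obtain V where V: "\<And>k. (\<integral>x. (d a x)\<^sup>2 \<partial>\<nu> t k) \<le> V" using uniform_tails(2)[OF \<nu>(1)[OF t] a T] by blast
    have TG: "\<exists>r. \<forall>\<^sub>F k in G. (\<integral>x. sq_tail a r x \<partial>\<nu> t k) \<le> e" if "0 < e" for e using T[OF that] evG by blast
    have l: "((\<lambda>k. measure (\<nu> t k) Q) \<longlongrightarrow> xl (t, Q)) G" for Q using xl[of "(t, Q)"] t by simp
    obtain \<mu> where "\<mu> \<in> P2 S" "((\<lambda>k. W2 S (\<nu> t k) \<mu>) \<longlongrightarrow> 0) G" "Ent m \<mu> \<le> ereal (X t)"
      by (rule setwise_limit[OF m(1,2) a igm(1) c \<nu>(1)[OF t] evG[OF \<nu>(3)[OF t]] tendG[OF \<nu>(4)[OF t]] V TG G(1) l])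
    then show ?thesis by blast
  qed
  have lim2: "\<exists>\<mu>. \<mu> \<in> P2 S \<and> ((\<lambda>k. W2 S (\<gamma> k t) \<mu>) \<longlongrightarrow> 0) G \<and> Ent m \<mu> \<le> ereal (X t) \<and> (t = 0 \<longrightarrow> \<mu> = \<mu>0) \<and> (t = 1 \<longrightarrow> \<mu> = \<mu>1)" if t: "t \<in> {0..1}" for t
  proof -
    \<comment> \<open>The curve has to equal \<mu>0 and \<mu>1 at its ends, so these measures are
      taken there outright instead of identifying a setwise limit with them.\<close>
    consider "t = 0" | "t = 1" | "t \<noteq> 0" "t \<noteq> 1" by blast
    then show ?thesis
    proof cases
      case 1
      have "\<forall>\<^sub>F k in sequentially. W2 S \<mu>0 (\<alpha>0 k) = W2 S (\<gamma> k t) \<mu>0"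
        using good by (rule eventually_mono) (simp add: 1 \<gamma>01 W2_commute[OF \<mu>0 \<alpha>0(1)])
      then have "(\<lambda>k. W2 S (\<gamma> k t) \<mu>0) \<longlonglongrightarrow> 0" using \<alpha>0(2) by (rule Lim_transform_eventually[rotated])
      then show ?thesis using 1 \<mu>0 e0 tendG by (intro exI[of _ \<mu>0]) (auto simp: X_def)
    next
      case 2
      have "\<forall>\<^sub>F k in sequentially. W2 S \<mu>1 (\<alpha>1 k) = W2 S (\<gamma> k t) \<mu>1"
        using good by (rule eventually_mono) (simp add: 2 \<gamma>01 W2_commute[OF \<mu>1 \<alpha>1(1)])
      then have "(\<lambda>k. W2 S (\<gamma> k t) \<mu>1) \<longlonglongrightarrow> 0" using \<alpha>1(2) by (rule Lim_transform_eventually[rotated])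
      then show ?thesis using 2 \<mu>1 e1 tendG by (intro exI[of _ \<mu>1]) (auto simp: X_def)
    next
      case 3
      obtain \<mu> where \<mu>: "\<mu> \<in> P2 S" "((\<lambda>k. W2 S (\<nu> t k) \<mu>) \<longlongrightarrow> 0) G" "Ent m \<mu> \<le> ereal (X t)" using lim1[OF t] by blast
      have "((\<lambda>k. W2 S (\<gamma> k t) \<mu>) \<longlongrightarrow> 0) G"
      proof (rule tendsto_sandwich[of "\<lambda>_. 0"])
        show "\<forall>\<^sub>F k in G. W2 S (\<gamma> k t) \<mu> \<le> W2 S (\<gamma> k t) (\<nu> t k) + W2 S (\<nu> t k) \<mu>"
          by (intro always_eventually allI W2_triangle \<gamma>P \<nu>(1) t \<mu>(1))
        show "((\<lambda>k. W2 S (\<gamma> k t) (\<nu> t k) + W2 S (\<nu> t k) \<mu>) \<longlongrightarrow> 0) G"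
          using tendsto_add[OF tendG[OF \<nu>(2)[OF t]] \<mu>(2)] by simp
      qed (simp_all add: W2_nonneg)
      then show ?thesis using \<mu> 3 by blast
    qed
  qed
  then have "\<forall>t\<in>{0..1}. \<exists>\<mu>. \<mu> \<in> P2 S \<and> ((\<lambda>k. W2 S (\<gamma> k t) \<mu>) \<longlongrightarrow> 0) G \<and> Ent m \<mu> \<le> ereal (X t) \<and> (t = 0 \<longrightarrow> \<mu> = \<mu>0) \<and> (t = 1 \<longrightarrow> \<mu> = \<mu>1)" by blast
  from bchoice[OF this] obtain \<mu> where \<mu>: "\<forall>t\<in>{0..1}. \<mu> t \<in> P2 S \<and> ((\<lambda>k. W2 S (\<gamma> k t) (\<mu> t)) \<longlongrightarrow> 0) G \<and> Ent m (\<mu> t) \<le> ereal (X t) \<and> (t = 0 \<longrightarrow> \<mu> t = \<mu>0) \<and> (t = 1 \<longrightarrow> \<mu> t = \<mu>1)" by blast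
  have \<mu>01: "\<mu> 0 = \<mu>0" "\<mu> 1 = \<mu>1" using \<mu> by auto
  have \<mu>P: "\<mu> t \<in> P2 S" and \<mu>W: "((\<lambda>k. W2 S (\<gamma> k t) (\<mu> t)) \<longlongrightarrow> 0) G" and \<mu>E: "Ent m (\<mu> t) \<le> ereal (X t)" if "t \<in> {0..1}" for t
    using \<mu> that by blast+
  have geo: "W2 S (\<mu> t) (\<mu> s) = \<bar>t - s\<bar> * w" if s: "s \<in> {0..1}" and t: "t \<in> {0..1}" for s t
  proof -
    \<comment> \<open>Along the filter the distance of the limit points is compared with that of
      \<gamma> k t and \<gamma> k s, which is exactly |t - s| wk k. Four triangle inequalities give
      the two-sided bound.\<close>
    have "((\<lambda>k. W2 S (\<mu> t) (\<mu> s) - \<bar>t - s\<bar> * wk k) \<longlongrightarrow> 0) G"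
    proof (rule Lim_null_comparison)
      show "\<forall>\<^sub>F k in G. norm (W2 S (\<mu> t) (\<mu> s) - \<bar>t - s\<bar> * wk k) \<le> W2 S (\<gamma> k t) (\<mu> t) + W2 S (\<gamma> k s) (\<mu> s)"
        using evG[OF good]
      proof (rule eventually_mono)
        fix k assume k: "good k"
        have "W2 S (\<mu> t) (\<mu> s) \<le> W2 S (\<mu> t) (\<gamma> k t) + W2 S (\<gamma> k t) (\<mu> s)" by (rule W2_triangle[OF \<mu>P[OF t] \<gamma>P[OF t] \<mu>P[OF s]])
        moreover have "W2 S (\<gamma> k t) (\<mu> s) \<le> W2 S (\<gamma> k t) (\<gamma> k s) + W2 S (\<gamma> k s) (\<mu> s)" by (rule W2_triangle[OF \<gamma>P[OF t] \<gamma>P[OF s] \<mu>P[OF s]])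
        moreover have "W2 S (\<gamma> k t) (\<gamma> k s) \<le> W2 S (\<gamma> k t) (\<mu> t) + W2 S (\<mu> t) (\<gamma> k s)" by (rule W2_triangle[OF \<gamma>P[OF t] \<mu>P[OF t] \<gamma>P[OF s]])
        moreover have "W2 S (\<mu> t) (\<gamma> k s) \<le> W2 S (\<mu> t) (\<mu> s) + W2 S (\<mu> s) (\<gamma> k s)" by (rule W2_triangle[OF \<mu>P[OF t] \<mu>P[OF s] \<gamma>P[OF s]])
        ultimately show "norm (W2 S (\<mu> t) (\<mu> s) - \<bar>t - s\<bar> * wk k) \<le> W2 S (\<gamma> k t) (\<mu> t) + W2 S (\<gamma> k s) (\<mu> s)"
          using \<gamma>W[OF k s t] W2_commute[OF \<mu>P[OF t] \<gamma>P[OF t], of k] W2_commute[OF \<mu>P[OF s] \<gamma>P[OF s], of k] unfolding real_norm_def by linarith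
      qed
      show "((\<lambda>k. W2 S (\<gamma> k t) (\<mu> t) + W2 S (\<gamma> k s) (\<mu> s)) \<longlongrightarrow> 0) G" using tendsto_add[OF \<mu>W[OF t] \<mu>W[OF s]] by simp
    qed
    moreover have "((\<lambda>k. W2 S (\<mu> t) (\<mu> s) - \<bar>t - s\<bar> * wk k) \<longlongrightarrow> W2 S (\<mu> t) (\<mu> s) - \<bar>t - s\<bar> * w) G"
      by (intro tendsto_intros tendG wklim)
    ultimately have "0 = W2 S (\<mu> t) (\<mu> s) - \<bar>t - s\<bar> * w" by (rule tendsto_unique[OF G(1)])
    then show ?thesis by simp
  qed
  have "W2_geodesic S \<mu>" unfolding W2_geodesic_def using \<mu>P geo \<mu>01 by (auto simp: w_def)
  moreover have "Ent m (\<mu> t) \<le> ereal (1 - t) * Ent m (\<mu> 0) + ereal t * Ent m (\<mu> 1) - ereal (K / 2 * t * (1 - t) * (W2 S (\<mu> 0) (\<mu> 1))\<^sup>2)" if "t \<in> {0..1}" for t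
    using \<mu>E[OF that] unfolding \<mu>01 e0 e1 X_def w_def by simp
  ultimately show "\<exists>\<mu>. W2_geodesic S \<mu> \<and> \<mu> 0 = \<mu>0 \<and> \<mu> 1 = \<mu>1 \<and>
       (\<forall>t\<in>{0..1}. Ent m (\<mu> t) \<le> ereal (1 - t) * Ent m (\<mu> 0) + ereal t * Ent m (\<mu> 1)
          - ereal (K / 2 * t * (1 - t) * (W2 S (\<mu> 0) (\<mu> 1))\<^sup>2))" using \<mu>01 by blast
qed

end

section \<open>Isometric images\<close>

lemma ereal_mult_less_infty: "0 \<le> t \<Longrightarrow> a < \<infinity> \<Longrightarrow> ereal t * a < \<infinity>"
  by (cases a; cases "t = 0") (auto simp: ereal_mult_less_0_iff)

text \<open>\<open>G\<close> and \<open>H\<close> are total Borel maps, but they are isometric and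
  inverse to each other only between the Borel sets \<open>D\<close> and \<open>D'\<close> of full
  measure: an isometry of supports is made total by constants. The lemma \<open>swap\<close>
  exchanges the two spaces, so results come with their converses.\<close>

locale almost_isometry = S: separable_metric S + T: separable_metric T
  for S :: "'a metric" and T :: "'b metric" +
  fixes m :: "'a measure" and m' :: "'b measure" and D :: "'a set" and D' :: "'b set" and G :: "'a \<Rightarrow> 'b" and H :: "'b \<Rightarrow> 'a"
  assumes G [measurable]: "G \<in> metric_borel S \<rightarrow>\<^sub>M metric_borel T" and H [measurable]: "H \<in> metric_borel T \<rightarrow>\<^sub>M metric_borel S"
    and D [measurable]: "D \<in> sets (metric_borel S)" and D' [measurable]: "D' \<in> sets (metric_borel T)"
    and GD: "\<And>x. x \<in> D \<Longrightarrow> G x \<in> D'" "\<And>x. x \<in> D \<Longrightarrow> H (G x) = x"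
    and HD: "\<And>y. y \<in> D' \<Longrightarrow> H y \<in> D" "\<And>y. y \<in> D' \<Longrightarrow> G (H y) = y"
    and iso: "\<And>x x'. x \<in> D \<Longrightarrow> x' \<in> D \<Longrightarrow> mdist T (G x) (G x') = mdist S x x'"
    and m: "sigma_finite_measure m" "sets m = sets (metric_borel S)"
    and m': "sigma_finite_measure m'" "sets m' = sets (metric_borel T)"
    and AE_D: "AE x in m. x \<in> D" and AE_D': "AE y in m'. y \<in> D'"
    and push: "distr m (metric_borel T) G = m'"
begin

lemma pull: "distr m' (metric_borel S) H = m"
proof (rule measure_eqI)
  have [measurable_cong]: "sets m = sets (metric_borel S)" "sets m' = sets (metric_borel T)" using m m' by auto
  fix A assume "A \<in> sets (distr m' (metric_borel S) H)"
  then have A [measurable]: "A \<in> sets (metric_borel S)" by simp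
  have "emeasure (distr m' (metric_borel S) H) A = (\<integral>\<^sup>+y. indicator A y \<partial>distr m' (metric_borel S) H)" by simp
  also have "\<dots> = (\<integral>\<^sup>+y. indicator A (H y) \<partial>m')" by (rule nn_integral_distr) measurable
  also have "\<dots> = (\<integral>\<^sup>+x. indicator A (H (G x)) \<partial>m)" unfolding push[symmetric] by (rule nn_integral_distr) measurable
  also have "\<dots> = (\<integral>\<^sup>+x. indicator A x \<partial>m)"
    by (rule nn_integral_cong_AE, rule eventually_mono[OF AE_D]) (simp add: GD)
  finally show "emeasure (distr m' (metric_borel S) H) A = emeasure m A" using A m by simp
qed (use m in simp)

lemma swap: "almost_isometry T S m' m D' D H G"
  using G H D D' GD HD iso m m' AE_D AE_D' pull
  by (intro almost_isometry.intro almost_isometry_axioms.intro S.separable_metric_axioms T.separable_metric_axioms) (auto simp: iso[symmetric])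

lemma push_P2:
  assumes \<mu>: "\<mu> \<in> P2 S" and ae: "AE x in \<mu>. x \<in> D"
  shows "distr \<mu> (metric_borel T) G \<in> P2 T" "AE y in distr \<mu> (metric_borel T) G. y \<in> D'"
    "distr (distr \<mu> (metric_borel T) G) (metric_borel S) H = \<mu>"
proof -
  note P = S.P2_D[OF \<mu>]
  interpret prob_space \<mu> by (rule P(3))
  have [measurable_cong]: "sets \<mu> = sets (metric_borel S)" by (rule P(2))
  have "\<exists>a. a \<in> D"
  proof (rule ccontr)
    assume "\<not> (\<exists>a. a \<in> D)"
    then have "AE x in \<mu>. False" using ae by simp
    then show False by simp
  qed
  then obtain a where a: "a \<in> D" by blast
  have a\<Omega>: "a \<in> mspace S" using a sets.sets_into_space[OF D] by auto
  have Ga: "G a \<in> mspace T" using GD(1)[OF a] sets.sets_into_space[OF D'] by auto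
  have [measurable]: "mdist T (G a) \<in> borel_measurable (metric_borel T)" by (rule T.d_point_measurable[OF Ga])
  show "distr \<mu> (metric_borel T) G \<in> P2 T"
  proof (rule T.P2_I'[OF _ _ Ga])
    show "prob_space (distr \<mu> (metric_borel T) G)" by (rule prob_space_distr) measurable
    have "(\<integral>\<^sup>+y. ennreal ((mdist T (G a) y)\<^sup>2) \<partial>distr \<mu> (metric_borel T) G) = (\<integral>\<^sup>+x. ennreal ((mdist T (G a) (G x))\<^sup>2) \<partial>\<mu>)"
      by (rule nn_integral_distr) measurable
    also have "\<dots> = (\<integral>\<^sup>+x. ennreal ((mdist S a x)\<^sup>2) \<partial>\<mu>)"
      by (rule nn_integral_cong_AE, rule eventually_mono[OF ae]) (simp add: iso a)
    also have "\<dots> < \<infinity>" using S.P2_integrable[OF \<mu> a\<Omega>] by (simp add: nn_integral_eq_integral)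
    finally show "(\<integral>\<^sup>+y. ennreal ((mdist T (G a) y)\<^sup>2) \<partial>distr \<mu> (metric_borel T) G) < \<infinity>" .
  qed simp
  show "AE y in distr \<mu> (metric_borel T) G. y \<in> D'"
    by (subst AE_distr_iff) (use ae GD in \<open>auto elim: eventually_mono\<close>)
  show "distr (distr \<mu> (metric_borel T) G) (metric_borel S) H = \<mu>"
  proof (rule measure_eqI)
    fix A assume "A \<in> sets (distr (distr \<mu> (metric_borel T) G) (metric_borel S) H)"
    then have A [measurable]: "A \<in> sets (metric_borel S)" by simp
    have "emeasure (distr (distr \<mu> (metric_borel T) G) (metric_borel S) H) A = (\<integral>\<^sup>+y. indicator A y \<partial>distr (distr \<mu> (metric_borel T) G) (metric_borel S) H)" by simp
    also have "\<dots> = (\<integral>\<^sup>+y. indicator A (H y) \<partial>distr \<mu> (metric_borel T) G)" by (rule nn_integral_distr) measurable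
    also have "\<dots> = (\<integral>\<^sup>+x. indicator A (H (G x)) \<partial>\<mu>)" by (rule nn_integral_distr) measurable
    also have "\<dots> = (\<integral>\<^sup>+x. indicator A x \<partial>\<mu>)"
      by (rule nn_integral_cong_AE, rule eventually_mono[OF ae]) (simp add: GD)
    finally show "emeasure (distr (distr \<mu> (metric_borel T) G) (metric_borel S) H) A = emeasure \<mu> A" using A P(2) by simp
  qed (use P in simp)
qed

text \<open>A coupling is concentrated on pairs of points of D, because both marginals are
  concentrated on D; its image under G in both coordinates has the same cost.\<close>

lemma W2_push_le:
  assumes \<mu>: "\<mu> \<in> P2 S" "AE x in \<mu>. x \<in> D" and \<nu>: "\<nu> \<in> P2 S" "AE x in \<nu>. x \<in> D"
  shows "W2 T (distr \<mu> (metric_borel T) G) (distr \<nu> (metric_borel T) G) \<le> W2 S \<mu> \<nu>"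
proof (rule field_le_epsilon)
  fix e :: real assume e: "0 < e"
  define w where "w = W2 S \<mu> \<nu> + e"
  have w: "W2 S \<mu> \<nu> < w" "0 \<le> w" using e S.W2_nonneg[of \<mu> \<nu>] by (auto simp: w_def)
  obtain \<gamma> where \<gamma>: "\<gamma> \<in> couplings S \<mu> \<nu>" "(\<integral>\<^sup>+z. ennreal ((mdist S (fst z) (snd z))\<^sup>2) \<partial>\<gamma>) \<le> ennreal (w\<^sup>2)"
    by (rule S.W2_lessE[OF \<mu>(1) \<nu>(1) w(1)])
  note C = S.couplings_D[OF \<gamma>(1)]
  have [measurable_cong]: "sets \<gamma> = sets (metric_borel S \<Otimes>\<^sub>M metric_borel S)" by (rule C(1))
  have 1: "AE z in \<gamma>. fst z \<in> D" using \<mu>(2) unfolding C(2)[symmetric] by (subst (asm) AE_distr_iff) auto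
  have 2: "AE z in \<gamma>. snd z \<in> D" using \<nu>(2) unfolding C(3)[symmetric] by (subst (asm) AE_distr_iff) auto
  have "(\<integral>\<^sup>+z. ennreal ((mdist T (G (fst z)) (G (snd z)))\<^sup>2) \<partial>\<gamma>) = (\<integral>\<^sup>+z. ennreal ((mdist S (fst z) (snd z))\<^sup>2) \<partial>\<gamma>)"
  proof (rule nn_integral_cong_AE)
    show "AE z in \<gamma>. ennreal ((mdist T (G (fst z)) (G (snd z)))\<^sup>2) = ennreal ((mdist S (fst z) (snd z))\<^sup>2)"
      using 1 2 by eventually_elim (simp add: iso)
  qed
  then have "(\<integral>\<^sup>+z. ennreal ((mdist T (G (fst z)) (G (snd z)))\<^sup>2) \<partial>\<gamma>) \<le> ennreal (w\<^sup>2)" using \<gamma>(2) by simp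
  from T.W2_le_distr[OF _ _ this w(2)]
  have "W2 T (distr \<gamma> (metric_borel T) (\<lambda>z. G (fst z))) (distr \<gamma> (metric_borel T) (\<lambda>z. G (snd z))) \<le> w" by simp
  moreover have "distr \<gamma> (metric_borel T) (\<lambda>z. G (fst z)) = distr \<mu> (metric_borel T) G"
    unfolding C(2)[symmetric] by (subst distr_distr) (auto simp: comp_def)
  moreover have "distr \<gamma> (metric_borel T) (\<lambda>z. G (snd z)) = distr \<nu> (metric_borel T) G"
    unfolding C(3)[symmetric] by (subst distr_distr) (auto simp: comp_def)
  ultimately show "W2 T (distr \<mu> (metric_borel T) G) (distr \<nu> (metric_borel T) G) \<le> W2 S \<mu> \<nu> + e" by (simp add: w_def)
qed

lemma W2_push:
  assumes \<mu>: "\<mu> \<in> P2 S" "AE x in \<mu>. x \<in> D" and \<nu>: "\<nu> \<in> P2 S" "AE x in \<nu>. x \<in> D"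
  shows "W2 T (distr \<mu> (metric_borel T) G) (distr \<nu> (metric_borel T) G) = W2 S \<mu> \<nu>"
  using W2_push_le[OF \<mu> \<nu>] almost_isometry.W2_push_le[OF swap push_P2(1,2)[OF \<mu>] push_P2(1,2)[OF \<nu>]]
  unfolding push_P2(3)[OF \<mu>] push_P2(3)[OF \<nu>] by simp

text \<open>Finite entropy implies absolute continuity, which puts \<mu> on D. The image then has
  the density \<open>\<rho>\<close> composed with \<open>H\<close>, and integrals of functions of
  the density are unchanged.\<close>

lemma Ent_push:
  assumes \<mu>: "\<mu> \<in> P2 S" and fin: "Ent m \<mu> < \<infinity>"
  shows "AE x in \<mu>. x \<in> D" "Ent m' (distr \<mu> (metric_borel T) G) = Ent m \<mu>"
proof -
  note P = S.P2_D[OF \<mu>]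
  have [measurable_cong]: "sets m = sets (metric_borel S)" "sets m' = sets (metric_borel T)" using m m' by auto
  obtain \<rho> where [measurable]: "\<rho> \<in> borel_measurable m" and \<rho>0: "\<And>x. 0 \<le> \<rho> x" and \<rho>: "\<mu> = density m (\<lambda>x. ennreal (\<rho> x))"
    using Ent_less_inftyE[OF m(1) P(3) _ fin] P(2) m(2) by auto
  have [measurable]: "\<rho> \<in> borel_measurable (metric_borel S)" using \<open>\<rho> \<in> borel_measurable m\<close> m(2) measurable_cong_sets by blast
  show "AE x in \<mu>. x \<in> D" unfolding \<rho> by (subst AE_density) (use AE_D in \<open>auto elim: eventually_mono\<close>)
  have eq: "distr \<mu> (metric_borel T) G = density m' (\<lambda>y. ennreal (\<rho> (H y)))"
  proof (rule measure_eqI)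
    fix A assume "A \<in> sets (distr \<mu> (metric_borel T) G)"
    then have A [measurable]: "A \<in> sets (metric_borel T)" by simp
    have "emeasure (distr \<mu> (metric_borel T) G) A = (\<integral>\<^sup>+y. indicator A y \<partial>distr \<mu> (metric_borel T) G)" by simp
    also have "\<dots> = (\<integral>\<^sup>+x. indicator A (G x) \<partial>\<mu>)" by (rule nn_integral_distr) (use P(2) in measurable)
    also have "\<dots> = (\<integral>\<^sup>+x. ennreal (\<rho> x) * indicator A (G x) \<partial>m)" unfolding \<rho> by (rule nn_integral_density) measurable
    also have "\<dots> = (\<integral>\<^sup>+x. ennreal (\<rho> (H (G x))) * indicator A (G x) \<partial>m)"
      by (rule nn_integral_cong_AE, rule eventually_mono[OF AE_D]) (simp add: GD)
    also have "\<dots> = (\<integral>\<^sup>+y. ennreal (\<rho> (H y)) * indicator A y \<partial>m')"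
      unfolding push[symmetric] by (rule nn_integral_distr[symmetric]) measurable
    also have "\<dots> = emeasure (density m' (\<lambda>y. ennreal (\<rho> (H y)))) A" by (rule emeasure_density[symmetric]) measurable
    finally show "emeasure (distr \<mu> (metric_borel T) G) A = emeasure (density m' (\<lambda>y. ennreal (\<rho> (H y)))) A" .
  qed (use m' in simp)
  have int: "(\<integral>\<^sup>+y. F (\<rho> (H y)) \<partial>m') = (\<integral>\<^sup>+x. F (\<rho> x) \<partial>m)" if [measurable]: "F \<in> borel_measurable borel" for F :: "real \<Rightarrow> ennreal"
  proof -
    have "(\<integral>\<^sup>+y. F (\<rho> (H y)) \<partial>m') = (\<integral>\<^sup>+x. F (\<rho> (H (G x))) \<partial>m)" unfolding push[symmetric] by (rule nn_integral_distr) measurable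
    also have "\<dots> = (\<integral>\<^sup>+x. F (\<rho> x) \<partial>m)" by (rule nn_integral_cong_AE, rule eventually_mono[OF AE_D]) (simp add: GD)
    finally show ?thesis .
  qed
  have "Ent m' (distr \<mu> (metric_borel T) G) = enn2ereal (\<integral>\<^sup>+y. ennreal (\<rho> (H y) * ln (\<rho> (H y))) \<partial>m') - enn2ereal (\<integral>\<^sup>+y. ennreal (- (\<rho> (H y) * ln (\<rho> (H y)))) \<partial>m')"
    unfolding eq by (rule Ent_density[OF m'(1)]) (auto simp: \<rho>0)
  also have "\<dots> = enn2ereal (\<integral>\<^sup>+x. ennreal (\<rho> x * ln (\<rho> x)) \<partial>m) - enn2ereal (\<integral>\<^sup>+x. ennreal (- (\<rho> x * ln (\<rho> x))) \<partial>m)"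
    using int[of "\<lambda>r. ennreal (r * ln r)"] int[of "\<lambda>r. ennreal (- (r * ln r))"] by simp
  also have "\<dots> = Ent m \<mu>" unfolding \<rho> by (rule Ent_density[OF m(1) _ \<rho>0, symmetric]) measurable
  finally show "Ent m' (distr \<mu> (metric_borel T) G) = Ent m \<mu>" .
qed

text \<open>The endpoints are pulled back by \<open>H\<close>, joined in S, and the geodesic is
  pushed forward by \<open>G\<close>. By the inequality itself each of its points has finite
  entropy, hence is concentrated on D, where distances and entropies are preserved.\<close>

lemma CD_push:
  assumes CD: "S.CD_inequality K m"
  shows "T.CD_inequality K m'"
  unfolding T.CD_inequality_def
proof (intro ballI)
  fix \<mu>0 \<mu>1 assume dom: "\<mu>0 \<in> Ent_dom T m'" "\<mu>1 \<in> Ent_dom T m'"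
  interpret inv: almost_isometry T S m' m D' D H G by (rule swap)
  have 0: "\<mu>0 \<in> P2 T" "Ent m' \<mu>0 < \<infinity>" and 1: "\<mu>1 \<in> P2 T" "Ent m' \<mu>1 < \<infinity>" using dom unfolding Ent_dom_def by auto
  note E0 = inv.Ent_push[OF 0] and E1 = inv.Ent_push[OF 1]
  note P0 = inv.push_P2[OF 0(1) E0(1)] and P1 = inv.push_P2[OF 1(1) E1(1)]
  have "distr \<mu>0 (metric_borel S) H \<in> Ent_dom S m" "distr \<mu>1 (metric_borel S) H \<in> Ent_dom S m"
    unfolding Ent_dom_def using P0(1) P1(1) E0(2) E1(2) 0(2) 1(2) by auto
  then obtain \<mu> where geo: "W2_geodesic S \<mu>" "\<mu> 0 = distr \<mu>0 (metric_borel S) H" "\<mu> 1 = distr \<mu>1 (metric_borel S) H"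
    and E: "\<And>t. t \<in> {0..1} \<Longrightarrow> Ent m (\<mu> t) \<le> ereal (1 - t) * Ent m (\<mu> 0) + ereal t * Ent m (\<mu> 1)
          - ereal (K / 2 * t * (1 - t) * (W2 S (\<mu> 0) (\<mu> 1))\<^sup>2)"
    using CD unfolding S.CD_inequality_def by blast
  have fin: "Ent m (\<mu> t) < \<infinity>" if t: "t \<in> {0..1}" for t
  proof -
    have "ereal (1 - t) * Ent m (\<mu> 0) < \<infinity>" "ereal t * Ent m (\<mu> 1) < \<infinity>"
      using t 0(2) 1(2) unfolding geo(2,3) E0(2) E1(2) by (auto intro!: ereal_mult_less_infty)
    then have "ereal (1 - t) * Ent m (\<mu> 0) + ereal t * Ent m (\<mu> 1) - ereal (K / 2 * t * (1 - t) * (W2 S (\<mu> 0) (\<mu> 1))\<^sup>2) < \<infinity>"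
      by (cases "ereal (1 - t) * Ent m (\<mu> 0)"; cases "ereal t * Ent m (\<mu> 1)") auto
    then show ?thesis by (rule le_less_trans[OF E[OF t]])
  qed
  note P = S.W2_geodesicD(1)[OF geo(1)]
  note AE = Ent_push(1)[OF P fin] and EE = Ent_push(2)[OF P fin]
  define \<nu> where "\<nu> t = distr (\<mu> t) (metric_borel T) G" for t
  have \<nu>01: "\<nu> 0 = \<mu>0" "\<nu> 1 = \<mu>1" unfolding \<nu>_def geo(2,3) by (fact P0(3), fact P1(3))
  have W: "W2 T (\<nu> t) (\<nu> s) = W2 S (\<mu> t) (\<mu> s)" if "s \<in> {0..1}" "t \<in> {0..1}" for s t
    unfolding \<nu>_def by (rule W2_push) (use that P AE in auto)
  have EN: "Ent m' (\<nu> t) = Ent m (\<mu> t)" if "t \<in> {0..1}" for t unfolding \<nu>_def by (rule EE) (use that in auto)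
  have W01: "W2 T (\<nu> 0) (\<nu> 1) = W2 S (\<mu> 0) (\<mu> 1)" by (rule W) auto
  have "W2_geodesic T \<nu>" unfolding W2_geodesic_def
  proof (intro conjI ballI)
    show "\<nu> t \<in> P2 T" if "t \<in> {0..1}" for t unfolding \<nu>_def by (rule push_P2(1)) (use that P AE in auto)
    show "W2 T (\<nu> t) (\<nu> s) = \<bar>t - s\<bar> * W2 T (\<nu> 0) (\<nu> 1)" if "s \<in> {0..1}" "t \<in> {0..1}" for s t
      unfolding W[OF that] W01 by (rule S.W2_geodesicD(2)[OF geo(1) that])
  qed
  moreover have "Ent m' (\<nu> t) \<le> ereal (1 - t) * Ent m' (\<nu> 0) + ereal t * Ent m' (\<nu> 1) - ereal (K / 2 * t * (1 - t) * (W2 T (\<nu> 0) (\<nu> 1))\<^sup>2)"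
    if "t \<in> {0..1}" for t
    using E[OF that] unfolding W01 EN[OF that] by (subst (1 2) EN) auto
  ultimately show "\<exists>\<mu>. W2_geodesic T \<mu> \<and> \<mu> 0 = \<mu>0 \<and> \<mu> 1 = \<mu>1 \<and>
       (\<forall>t\<in>{0..1}. Ent m' (\<mu> t) \<le> ereal (1 - t) * Ent m' (\<mu> 0) + ereal t * Ent m' (\<mu> 1)
          - ereal (K / 2 * t * (1 - t) * (W2 T (\<mu> 0) (\<mu> 1))\<^sup>2))"
    using \<nu>01 by blast
qed

lemma emeasure_ball_le:
  assumes a: "a \<in> D"
  shows "emeasure m (mball_of S a r) \<le> emeasure m' (mball_of T (G a) r)"
proof -
  have [measurable_cong]: "sets m = sets (metric_borel S)" by (rule m(2))
  have sp: "space m = mspace S" using sets_eq_imp_space_eq[OF m(2)] by simp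
  have DO: "D \<subseteq> mspace S" "D' \<subseteq> mspace T" using sets.sets_into_space[OF D] sets.sets_into_space[OF D'] by auto
  have "emeasure m (mball_of S a r) \<le> emeasure m (G -` mball_of T (G a) r \<inter> space m)"
  proof (rule emeasure_mono_AE)
    show "AE x in m. x \<in> mball_of S a r \<longrightarrow> x \<in> G -` mball_of T (G a) r \<inter> space m"
      using AE_D
    proof (rule eventually_mono, intro impI)
      fix x assume x: "x \<in> D" "x \<in> mball_of S a r"
      have "G x \<in> mspace T" "G a \<in> mspace T" using GD(1)[OF x(1)] GD(1)[OF a] DO by auto
      then show "x \<in> G -` mball_of T (G a) r \<inter> space m" using x iso[OF a x(1)] DO by (auto simp: sp)
    qed
    show "G -` mball_of T (G a) r \<inter> space m \<in> sets m" by measurable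
  qed
  also have "\<dots> = emeasure m' (mball_of T (G a) r)"
    unfolding push[symmetric] by (rule emeasure_distr[symmetric]) measurable
  finally show ?thesis .
qed

end

section \<open>Supports and their isometric images\<close>

context separable_metric
begin

text \<open>By separability the complement of the support is the union of those null balls that have
  a centre in a dense sequence and a radius 1 / (n + 1). These are countably many, so the union is
  open and null.\<close>

lemma msupp_full:
  assumes m: "sets m = sets B"
  shows "closedin (mtopology_of S) (msupp S m)" "AE x in m. x \<in> msupp S m"
proof -
  have sp: "space m = \<Omega>" using sets_eq_imp_space_eq[OF m] by simp
  have "\<exists>U. openin (mtopology_of S) U \<and> U \<in> null_sets m \<and> \<Omega> - msupp S m = U"
  proof (cases "\<Omega> = {}")
    case True
    then show ?thesis by (intro exI[of _ "{}"]) auto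
  next
    case False
    obtain z :: "nat \<Rightarrow> 'a" where z: "\<And>k. z k \<in> \<Omega>" "\<And>x r. x \<in> \<Omega> \<Longrightarrow> r > 0 \<Longrightarrow> \<exists>k. d x (z k) < r"
      using dense_sequence[OF False] by blast
    define Q where "Q k n = mball_of S (z k) (1 / real (Suc n))" for k n
    define I where "I = {(k, n). Q k n \<in> null_sets m}"
    define U where "U = (\<Union>(k, n)\<in>I. Q k n)"
    have "openin (mtopology_of S) U"
      unfolding U_def Q_def by (intro openin_Union) (auto intro: openin_mball_of)
    moreover have "U \<in> null_sets m" unfolding U_def by (intro null_sets_UN') (auto simp: I_def)
    moreover have "\<Omega> - msupp S m = U"
    proof (intro equalityI subsetI)
      fix x assume x: "x \<in> \<Omega> - msupp S m"
      then obtain r where r: "0 < r" "emeasure m (mball_of S x r) = 0" unfolding msupp_def by (auto simp: not_gr_zero)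
      obtain n where n: "1 / real (Suc n) < r / 2" using nat_approx_posE[of "r / 2"] r by auto
      obtain k where k: "d x (z k) < 1 / real (Suc n)" using z(2)[of x "1 / real (Suc n)"] x by auto
      have "Q k n \<subseteq> mball_of S x r"
      proof
        fix y assume y: "y \<in> Q k n"
        then have "d x y \<le> d x (z k) + d (z k) y" using x z(1) by (intro mdist_triangle) (auto simp: Q_def)
        also have "\<dots> < r" using y k n by (auto simp: Q_def)
        finally show "y \<in> mball_of S x r" using x y by (auto simp: Q_def)
      qed
      then have "Q k n \<in> null_sets m" using r(2) m unfolding Q_def
        by (intro null_setsI) (auto dest: emeasure_mono[of _ "mball_of S x r" m])
      moreover have "x \<in> Q k n" using x k z(1) by (simp add: Q_def mdist_commute[of S x])
      ultimately show "x \<in> U" unfolding U_def I_def by auto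
    next
      fix x assume "x \<in> U"
      then obtain k n where kn: "Q k n \<in> null_sets m" "x \<in> Q k n" unfolding U_def I_def by auto
      then have x: "x \<in> \<Omega>" "d (z k) x < 1 / real (Suc n)" by (auto simp: Q_def)
      define r where "r = 1 / real (Suc n) - d (z k) x"
      have "mball_of S x r \<subseteq> Q k n"
      proof
        fix y assume y: "y \<in> mball_of S x r"
        then have "d (z k) y \<le> d (z k) x + d x y" using x z(1) by (intro mdist_triangle) auto
        also have "\<dots> < 1 / real (Suc n)" using y by (auto simp: r_def)
        finally show "y \<in> Q k n" using y z(1) by (auto simp: Q_def)
      qed
      then have "emeasure m (mball_of S x r) = 0"
        using emeasure_mono[of "mball_of S x r" "Q k n" m] kn(1) by (auto simp: null_sets_def)
      moreover have "0 < r" using x by (simp add: r_def)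
      ultimately show "x \<in> \<Omega> - msupp S m" using x unfolding msupp_def by auto
    qed
    ultimately show ?thesis by blast
  qed
  then obtain U where U: "openin (mtopology_of S) U" "U \<in> null_sets m" "\<Omega> - msupp S m = U" by blast
  show "closedin (mtopology_of S) (msupp S m)" unfolding closedin_def using U by (auto simp: msupp_def)
  show "AE x in m. x \<in> msupp S m" by (rule AE_I'[OF U(2)]) (use U(3) sp in auto)
qed

lemma sigma_finite_balls:
  assumes m: "sets m = sets B" and a: "a \<in> \<Omega>" and fin: "\<And>r. emeasure m (mball_of S a r) < \<infinity>"
  shows "sigma_finite_measure m"
proof (rule sigma_finite_measure.intro)
  have sp: "space m = \<Omega>" using sets_eq_imp_space_eq[OF m] by simp
  have "x \<in> (\<Union>j. mball_of S a (real j))" if "x \<in> \<Omega>" for x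
  proof -
    obtain j where "d a x < real j" using reals_Archimedean2 by blast
    then show ?thesis using that a by auto
  qed
  then show "\<exists>A. countable A \<and> A \<subseteq> sets m \<and> \<Union> A = space m \<and> (\<forall>a\<in>A. emeasure m a \<noteq> \<infinity>)"
    by (intro exI[of _ "range (\<lambda>j. mball_of S a (real j))"]) (use fin in \<open>auto simp: m sp less_top[symmetric]\<close>)
qed

end

text \<open>The map is extended by the constant p. The preimage of an open set U under g is the
  trace on D of an open set of S, namely the union \<open>W\<close> of the balls about points of D
  whose points in D are mapped into U.\<close>

lemma isometric_on_measurable:
  assumes D: "D \<in> sets (metric_borel S)" and g: "isometric_on S D T g" and p: "p \<in> mspace T"
  shows "(\<lambda>x. if x \<in> D then g x else p) \<in> metric_borel S \<rightarrow>\<^sub>M metric_borel T"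
  unfolding metric_borel_def[of T]
proof (rule measurable_measure_of)
  have DO: "D \<subseteq> mspace S" using sets.sets_into_space[OF D] by simp
  have g': "\<And>x. x \<in> D \<Longrightarrow> g x \<in> mspace T" "\<And>x y. x \<in> D \<Longrightarrow> y \<in> D \<Longrightarrow> mdist T (g x) (g y) = mdist S x y"
    using g unfolding isometric_on_def by auto
  show "{U. openin (mtopology_of T) U} \<subseteq> Pow (mspace T)" by (auto dest: openin_mtopology_of_subset)
  show "(\<lambda>x. if x \<in> D then g x else p) \<in> space (metric_borel S) \<rightarrow> mspace T" using g' p by auto
  show "(\<lambda>x. if x \<in> D then g x else p) -` U \<inter> space (metric_borel S) \<in> sets (metric_borel S)"
    if "U \<in> {U. openin (mtopology_of T) U}" for U
  proof -
    have U: "openin (mtopology_of T) U" using that by simp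
    define W where "W = \<Union>{mball_of S x r | x r. x \<in> D \<and> (\<forall>y\<in>D. mdist S x y < r \<longrightarrow> g y \<in> U)}"
    have W: "W \<in> sets (metric_borel S)"
      unfolding W_def by (intro openin_metric_borel openin_Union) (auto intro: openin_mball_of)
    have "g x \<in> U \<longleftrightarrow> x \<in> W" if x: "x \<in> D" for x
    proof
      assume "g x \<in> U"
      moreover have "Metric_space.mball (mspace T) (mdist T) y r = mball_of T y r" for y r by (simp add: mball_of_def)
      ultimately obtain r where r: "0 < r" "mball_of T (g x) r \<subseteq> U"
        using U unfolding mtopology_of_def Metric_space.openin_mtopology[OF Metric_space_mspace_mdist] by auto
      have "g y \<in> U" if "y \<in> D" "mdist S x y < r" for y
        using r(2) that g' x by auto
      moreover have "x \<in> mball_of S x r" using x r DO by auto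
      ultimately show "x \<in> W" unfolding W_def using x by blast
    next
      assume "x \<in> W"
      then show "g x \<in> U" unfolding W_def using x by auto
    qed
    then have "(\<lambda>x. if x \<in> D then g x else p) -` U \<inter> space (metric_borel S) = (D \<inter> W) \<union> (if p \<in> U then mspace S - D else {})"
      using DO by (auto split: if_splits)
    also have "\<dots> \<in> sets (metric_borel S)" using D W by auto
    finally show "(\<lambda>x. if x \<in> D then g x else p) -` U \<inter> space (metric_borel S) \<in> sets (metric_borel S)" .
  qed
qed

text \<open>The preimages of a convergent sequence in the image form a Cauchy sequence, which
  converges in the closed set D by completeness. In particular the image is a Borel set.\<close>

lemma isometric_on_closed_image:
  assumes S: "mcomplete_of S" and D: "closedin (mtopology_of S) D" and g: "isometric_on S D T g"
  shows "closedin (mtopology_of T) (g ` D)"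
proof -
  interpret S: Metric_space "mspace S" "mdist S" by (rule Metric_space_mspace_mdist)
  interpret T: Metric_space "mspace T" "mdist T" by (rule Metric_space_mspace_mdist)
  have DO: "D \<subseteq> mspace S" using closedin_subset[OF D] by simp
  have g': "\<And>x. x \<in> D \<Longrightarrow> g x \<in> mspace T" "\<And>x y. x \<in> D \<Longrightarrow> y \<in> D \<Longrightarrow> mdist T (g x) (g y) = mdist S x y"
    using g unfolding isometric_on_def by auto
  show ?thesis unfolding mtopology_of_def T.metric_closedin_iff_sequentially_closed
  proof (intro conjI allI impI)
    show "g ` D \<subseteq> mspace T" using g' by auto
    fix \<sigma> l assume "range \<sigma> \<subseteq> g ` D \<and> limitin T.mtopology \<sigma> l sequentially"
    then have \<sigma>: "range \<sigma> \<subseteq> g ` D" and lim: "limitin T.mtopology \<sigma> l sequentially" by auto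
    have "\<forall>n. \<exists>x. x \<in> D \<and> \<sigma> n = g x" using \<sigma> by auto
    then obtain x where x: "\<And>n. x n \<in> D" "\<And>n. \<sigma> n = g (x n)" by metis
    have "range \<sigma> \<subseteq> mspace T" using x g' by auto
    then have "T.MCauchy \<sigma>" by (rule T.convergent_imp_MCauchy[OF _ lim])
    then have "S.MCauchy x" unfolding S.MCauchy_def T.MCauchy_def using x DO g' by auto
    then obtain y where y: "limitin S.mtopology x y sequentially"
      using S unfolding mcomplete_of_def S.mcomplete_def by blast
    have "range x \<subseteq> D" using x by auto
    then have yD: "y \<in> D" using D y unfolding mtopology_of_def S.metric_closedin_iff_sequentially_closed by blast
    have xS: "x n \<in> mspace S" for n using x DO by auto
    have "limitin T.mtopology \<sigma> (g y) sequentially"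
      using y unfolding T.limit_metric_sequentially S.limit_metric_sequentially by (simp add: x xS yD g')
    then have "l = g y" using T.limitin_metric_unique[OF lim] by simp
    then show "l \<in> g ` D" using yD by auto
  qed
qed

text \<open>The measure \<open>m'\<close> is the push-forward as it appears in the isomorphism of
  spaces, by a map defined on the support only. As the support carries all mass, it is also the
  push-forward of m by the total map \<open>G\<close>, and this fits the locale.\<close>

lemma isometric_push_forward:
  assumes S: "mcomplete_of S" "separable_space (mtopology_of S)" and T: "separable_space (mtopology_of T)"
    and m: "sets m = sets (metric_borel S)" and fin: "\<And>a r. a \<in> mspace S \<Longrightarrow> emeasure m (mball_of S a r) < \<infinity>"
    and a: "a \<in> msupp S m" and g: "isometric_on S (msupp S m) T g"
    and m': "m' = distr (restrict_space m (msupp S m)) (metric_borel T) g"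
  obtains G H where "almost_isometry S T m m' (msupp S m) (g ` msupp S m) G H"
    "\<And>x. x \<in> msupp S m \<Longrightarrow> G x = g x" "\<And>b r. b \<in> mspace T \<Longrightarrow> emeasure m' (mball_of T b r) < \<infinity>"
proof -
  interpret S: separable_metric S by unfold_locales (rule S)
  interpret T: separable_metric T by unfold_locales (rule T)
  define D where "D = msupp S m"
  note supp = S.msupp_full[OF m, folded D_def]
  have aD: "a \<in> D" using a by (simp add: D_def)
  have D: "D \<in> sets (metric_borel S)" by (rule closedin_metric_borel[OF supp(1)])
  have DO: "D \<subseteq> mspace S" using sets.sets_into_space[OF D] by simp
  have sp: "space m = mspace S" using sets_eq_imp_space_eq[OF m] by simp
  have iso: "isometric_on S D T g" using g by (simp add: D_def)
  have g': "\<And>x. x \<in> D \<Longrightarrow> g x \<in> mspace T" "\<And>x y. x \<in> D \<Longrightarrow> y \<in> D \<Longrightarrow> mdist T (g x) (g y) = mdist S x y"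
    using iso unfolding isometric_on_def by auto
  have inj: "inj_on g D"
  proof (rule inj_onI)
    fix x y assume xy: "x \<in> D" "y \<in> D" "g x = g y"
    then have "mdist S x y = 0" using g'(2)[of x y] g'(1)[of x] by simp
    moreover have "x \<in> mspace S" "y \<in> mspace S" using xy DO by auto
    ultimately show "x = y" by (simp only: mdist_zero)
  qed
  have D': "g ` D \<in> sets (metric_borel T)"
    by (rule closedin_metric_borel[OF isometric_on_closed_image[OF S(1) supp(1) iso]])
  define G where "G x = (if x \<in> D then g x else g a)" for x
  define H where "H y = (if y \<in> g ` D then inv_into D g y else a)" for y
  have G [measurable]: "G \<in> metric_borel S \<rightarrow>\<^sub>M metric_borel T"
    unfolding G_def by (rule isometric_on_measurable[OF D iso]) (use g' aD in auto)
  have "isometric_on T (g ` D) S (inv_into D g)"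
    unfolding isometric_on_def using inj DO g' by (auto simp: inv_into_f_f)
  then have H [measurable]: "H \<in> metric_borel T \<rightarrow>\<^sub>M metric_borel S"
    unfolding H_def by (rule isometric_on_measurable[OF D']) (use aD DO in auto)
  have [measurable_cong]: "sets m = sets (metric_borel S)" by (rule m)
  have [measurable]: "D \<in> sets (metric_borel S)" by (rule D)
  have gr: "g \<in> restrict_space m D \<rightarrow>\<^sub>M metric_borel T"
    using measurable_restrict_space1[of G m "metric_borel T" D]
    by (subst measurable_cong[of _ _ G]) (auto simp: space_restrict_space G_def)
  have push: "distr m (metric_borel T) G = m'"
  proof (rule measure_eqI)
    fix A assume "A \<in> sets (distr m (metric_borel T) G)"
    then have A [measurable]: "A \<in> sets (metric_borel T)" by simp
    have "emeasure m' A = emeasure (restrict_space m D) (g -` A \<inter> space (restrict_space m D))"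
      unfolding m' D_def[symmetric] by (rule emeasure_distr[OF gr A])
    also have "g -` A \<inter> space (restrict_space m D) = D \<inter> (G -` A \<inter> space m)"
      by (auto simp: space_restrict_space G_def sp)
    also have "emeasure (restrict_space m D) \<dots> = emeasure m (D \<inter> (G -` A \<inter> space m))"
      by (rule emeasure_restrict_space) (use D DO m sp in \<open>auto simp: Int_absorb2\<close>)
    also have "\<dots> = emeasure m (G -` A \<inter> space m)"
    proof (rule emeasure_eq_AE)
      show "AE x in m. (x \<in> D \<inter> (G -` A \<inter> space m)) = (x \<in> G -` A \<inter> space m)"
        using supp(2) by eventually_elim auto
      have A': "G -` A \<inter> space m \<in> sets m" by measurable
      show "G -` A \<inter> space m \<in> sets m" by (rule A')
      show "D \<inter> (G -` A \<inter> space m) \<in> sets m" using D A' m by auto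
    qed
    also have "\<dots> = emeasure (distr m (metric_borel T) G) A" by (rule emeasure_distr[symmetric]) measurable
    finally show "emeasure (distr m (metric_borel T) G) A = emeasure m' A" by simp
  qed (simp add: m')
  have fin': "emeasure m' (mball_of T b r) < \<infinity>" if b: "b \<in> mspace T" for b r
  proof -
    have "emeasure m' (mball_of T b r) = emeasure m (G -` mball_of T b r \<inter> space m)"
      unfolding push[symmetric] by (rule emeasure_distr) measurable
    also have "\<dots> \<le> emeasure m (mball_of S a (mdist T (g a) b + r))"
    proof (rule emeasure_mono_AE)
      show "AE x in m. x \<in> G -` mball_of T b r \<inter> space m \<longrightarrow> x \<in> mball_of S a (mdist T (g a) b + r)"
        using supp(2)
      proof (rule eventually_mono, intro impI)
        fix x assume x: "x \<in> D" "x \<in> G -` mball_of T b r \<inter> space m"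
        have "mdist S a x \<le> mdist T (g a) b + mdist T b (g x)"
          unfolding g'(2)[OF aD x(1), symmetric] using g' aD x b by (intro mdist_triangle) auto
        also have "\<dots> < mdist T (g a) b + r" using x by (auto simp: G_def)
        finally show "x \<in> mball_of S a (mdist T (g a) b + r)" using aD x DO by auto
      qed
      show "mball_of S a (mdist T (g a) b + r) \<in> sets m" by measurable
    qed
    also have "\<dots> < \<infinity>" using aD DO by (intro fin) auto
    finally show ?thesis .
  qed
  have m's: "sets m' = sets (metric_borel T)" by (simp add: m')
  have "almost_isometry S T m m' D (g ` D) G H"
  proof (intro almost_isometry.intro almost_isometry_axioms.intro S.separable_metric_axioms T.separable_metric_axioms G H D D' push m m's supp(2))
    show "sigma_finite_measure m" by (rule S.sigma_finite_balls[OF m _ fin]) (use aD DO in auto)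
    show "sigma_finite_measure m'" by (rule T.sigma_finite_balls[OF m's _ fin']) (use aD g' in auto)
    show "AE y in m'. y \<in> g ` D" unfolding push[symmetric]
      by (subst AE_distr_iff) (use D' aD in \<open>auto simp: G_def\<close>)
  qed (use inj g' in \<open>auto simp: G_def H_def\<close>)
  then show ?thesis using that fin' unfolding D_def G_def by auto
qed

section \<open>Pointed spaces in the common space\<close>

lemma pmm_spaceD:
  assumes "pmm_space X"
  shows "mcomplete_of (pmm_metric X)" "separable_space (mtopology_of (pmm_metric X))"
    "sets (pmm_measure X) = sets (metric_borel (pmm_metric X))"
    "\<And>a r. emeasure (pmm_measure X) (mball_of (pmm_metric X) a r) < \<infinity>"
    "pmm_point X \<in> msupp (pmm_metric X) (pmm_measure X)" "pmm_point X \<in> mspace (pmm_metric X)"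
proof -
  interpret Metric_space "mspace (pmm_metric X)" "mdist (pmm_metric X)" by (rule Metric_space_mspace_mdist)
  show "emeasure (pmm_measure X) (mball_of (pmm_metric X) a r) < \<infinity>" for a r
  proof -
    have "bounded_in (pmm_metric X) (mball_of (pmm_metric X) a r)"
      unfolding bounded_in_def mball_of_def by (rule mbounded_mball)
    moreover have "mball_of (pmm_metric X) a r \<in> sets (pmm_measure X)"
      using assms by (simp add: pmm_space_def mball_of_sets)
    ultimately show ?thesis using assms by (simp add: pmm_space_def)
  qed
qed (use assms in \<open>auto simp: pmm_space_def polish_metric_def msupp_def\<close>)

lemma CD_infinity_iff:
  assumes "pmm_space X"
  shows "CD_infinity K X \<longleftrightarrow> growth_condition X \<and> separable_metric.CD_inequality (pmm_metric X) K (pmm_measure X)"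
proof -
  interpret separable_metric "pmm_metric X" by unfold_locales (rule pmm_spaceD[OF assms])
  show ?thesis unfolding CD_infinity_def CD_inequality_def Let_def using assms by auto
qed

text \<open>The isomorphism of X with its representative Y and the embedding of Y compose to one
  isometry from the support of X into Z, and the push-forwards compose likewise. The interpolation
  inequality thus goes from X to Z in one step.\<close>

lemma realization_push_forward:
  assumes XY: "pmm_isomorphic X Y" and \<iota>: "isometric_on (pmm_metric Y) (mspace (pmm_metric Y)) Z \<iota>"
    and Z: "separable_space (mtopology_of Z)" and M: "M = distr (pmm_measure Y) (metric_borel Z) \<iota>"
  obtains D D' G H where "almost_isometry (pmm_metric X) Z (pmm_measure X) M D D' G H"
    "pmm_point X \<in> D" "G (pmm_point X) = \<iota> (pmm_point Y)" "\<And>b r. b \<in> mspace Z \<Longrightarrow> emeasure M (mball_of Z b r) < \<infinity>"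
proof -
  obtain f where X: "pmm_space X" and Y: "pmm_space Y"
    and f: "isometric_on (pmm_metric X) (msupp (pmm_metric X) (pmm_measure X)) (pmm_metric Y) f"
    and push: "distr (restrict_space (pmm_measure X) (msupp (pmm_metric X) (pmm_measure X))) (metric_borel (pmm_metric Y)) f = pmm_measure Y"
    and pt: "f (pmm_point X) = pmm_point Y"
    using XY unfolding pmm_isomorphic_def by auto
  interpret S: separable_metric "pmm_metric X" by unfold_locales (rule pmm_spaceD[OF X])
  define D where "D = msupp (pmm_metric X) (pmm_measure X)"
  note f = f[folded D_def] and push = push[folded D_def]
  have D: "D \<in> sets (metric_borel (pmm_metric X))"
    unfolding D_def by (rule closedin_metric_borel[OF S.msupp_full(1)[OF pmm_spaceD(3)[OF X]]])
  have g: "isometric_on (pmm_metric X) D Z (\<iota> \<circ> f)" using f \<iota> by (simp add: isometric_on_def image_subset_iff)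
  obtain p where p: "p \<in> mspace (pmm_metric Y)" using pmm_spaceD(6)[OF Y] by blast
  then have \<iota>p: "\<iota> p \<in> mspace Z" using \<iota> unfolding isometric_on_def by auto
  have \<iota>m: "\<iota> \<in> metric_borel (pmm_metric Y) \<rightarrow>\<^sub>M metric_borel Z"
    using isometric_on_measurable[OF mspace_sets \<iota> \<iota>p] by (subst measurable_cong[of _ _ "\<lambda>x. if x \<in> mspace (pmm_metric Y) then \<iota> x else \<iota> p"]) auto
  have fm: "f \<in> restrict_space (pmm_measure X) D \<rightarrow>\<^sub>M metric_borel (pmm_metric Y)"
  proof -
    have "(\<lambda>x. if x \<in> D then f x else p) \<in> pmm_measure X \<rightarrow>\<^sub>M metric_borel (pmm_metric Y)"
      using isometric_on_measurable[OF D f p] by (simp add: measurable_cong_sets[OF pmm_spaceD(3)[OF X] refl])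
    from measurable_restrict_space1[OF this, of D] show ?thesis
      by (subst measurable_cong[of _ _ "\<lambda>x. if x \<in> D then f x else p"]) (auto simp: space_restrict_space)
  qed
  have "M = distr (restrict_space (pmm_measure X) D) (metric_borel Z) (\<iota> \<circ> f)"
    unfolding M push[symmetric] by (rule distr_distr[OF \<iota>m fm])
  from isometric_push_forward[OF pmm_spaceD(1,2)[OF X] Z pmm_spaceD(3,4)[OF X] pmm_spaceD(5)[OF X] g[unfolded D_def] this[unfolded D_def]]
  obtain G H where *: "almost_isometry (pmm_metric X) Z (pmm_measure X) M D ((\<iota> \<circ> f) ` D) G H"
    "\<And>x. x \<in> D \<Longrightarrow> G x = (\<iota> \<circ> f) x" "\<And>b r. b \<in> mspace Z \<Longrightarrow> emeasure M (mball_of Z b r) < \<infinity>"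
    unfolding D_def[symmetric] by blast
  moreover have "pmm_point X \<in> D" using pmm_spaceD(5)[OF X] by (simp add: D_def)
  ultimately show ?thesis using that pt by auto
qed

theorem theorem4p9:
  fixes K :: real
    and X :: "nat \<Rightarrow> 'a pmm"
    and X_inf :: "'b pmm"
  assumes "\<And>n. pmm_space (X n)"
    and "pmm_space X_inf"
    and "\<And>n. CD_infinity K (X n)"
    and "pmG_converges TYPE('z) X X_inf"
  shows "CD_infinity K X_inf"
proof -
  obtain Y :: "nat \<Rightarrow> 'a pmm" and Y_inf :: "'b pmm" and Z :: "'z metric" and \<iota> \<iota>_inf
    where Y: "\<And>n. pmm_isomorphic (X n) (Y n)" "pmm_isomorphic X_inf Y_inf" and real: "pmG_realization Z \<iota> \<iota>_inf Y Y_inf"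
    using assms(4) unfolding pmG_converges_def by blast
  have Z: "separable_space (mtopology_of Z)"
    and \<iota>: "\<And>n. isometric_on (pmm_metric (Y n)) (mspace (pmm_metric (Y n))) Z (\<iota> n)"
      "isometric_on (pmm_metric Y_inf) (mspace (pmm_metric Y_inf)) Z \<iota>_inf"
    and lim: "limitin (mtopology_of Z) (\<lambda>n. \<iota> n (pmm_point (Y n))) (\<iota>_inf (pmm_point Y_inf)) sequentially"
    using real unfolding pmG_realization_def polish_metric_def by auto
  interpret Z: separable_metric Z by unfold_locales (rule Z)
  define M where "M n = distr (pmm_measure (Y n)) (metric_borel Z) (\<iota> n)" for n
  define m where "m = distr (pmm_measure Y_inf) (metric_borel Z) \<iota>_inf"
  define x where "x n = \<iota> n (pmm_point (Y n))" for n
  define a where "a = \<iota>_inf (pmm_point Y_inf)"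
  have Yp: "pmm_space (Y n)" "pmm_space Y_inf" for n using Y unfolding pmm_isomorphic_def by auto
  have a: "a \<in> mspace Z" "x n \<in> mspace Z" for n
    unfolding a_def x_def using \<iota> pmm_spaceD(6)[OF Yp(1)] pmm_spaceD(6)[OF Yp(2)] by (simp_all add: isometric_on_def image_subset_iff)
  have xa: "(\<lambda>n. mdist Z a (x n)) \<longlonglongrightarrow> 0"
  proof (rule tendstoI)
    interpret M: Metric_space "mspace Z" "mdist Z" by (rule Metric_space_mspace_mdist)
    fix e :: real assume "0 < e"
    then obtain N where "\<And>n. N \<le> n \<Longrightarrow> mdist Z (x n) a < e"
      using lim unfolding mtopology_of_def M.limit_metric_sequentially x_def a_def by blast
    then show "\<forall>\<^sub>F n in sequentially. dist (mdist Z a (x n)) 0 < e"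
      unfolding eventually_sequentially by (intro exI[of _ N]) (simp add: mdist_commute[of Z a])
  qed
  have conv: "Z.test_converges M m"
    using real by (simp add: Z.test_converges_def pmG_realization_def M_def m_def)
  have CD: "Z.CD_inequality K (M n)" and M: "sigma_finite_measure (M n)" "sets (M n) = sets (metric_borel Z)"
    "\<And>b r. b \<in> mspace Z \<Longrightarrow> emeasure (M n) (mball_of Z b r) < \<infinity>" for n
  proof -
    obtain D D' G H where AI: "almost_isometry (pmm_metric (X n)) Z (pmm_measure (X n)) (M n) D D' G H"
      and fin: "\<And>b r. b \<in> mspace Z \<Longrightarrow> emeasure (M n) (mball_of Z b r) < \<infinity>"
      by (rule realization_push_forward[OF Y(1)[of n] \<iota>(1) Z M_def]) (rule that)
    interpret AI: almost_isometry "pmm_metric (X n)" Z "pmm_measure (X n)" "M n" D D' G H by (rule AI)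
    show "Z.CD_inequality K (M n)" by (rule AI.CD_push) (use assms(3)[of n] in \<open>simp add: CD_infinity_iff[OF assms(1)]\<close>)
    show "sigma_finite_measure (M n)" "sets (M n) = sets (metric_borel Z)" by (fact AI.m')+
    show "\<And>b r. b \<in> mspace Z \<Longrightarrow> emeasure (M n) (mball_of Z b r) < \<infinity>" by (rule fin)
  qed
  obtain D D' G H where AI: "almost_isometry (pmm_metric X_inf) Z (pmm_measure X_inf) m D D' G H"
    and pD: "pmm_point X_inf \<in> D" and Gp: "G (pmm_point X_inf) = \<iota>_inf (pmm_point Y_inf)"
    and fin: "\<And>b r. b \<in> mspace Z \<Longrightarrow> emeasure m (mball_of Z b r) < \<infinity>"
    by (rule realization_push_forward[OF Y(2) \<iota>(2) Z m_def]) (rule that)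
  interpret AI: almost_isometry "pmm_metric X_inf" Z "pmm_measure X_inf" m D D' G H by (rule AI)
  note ball = AI.emeasure_ball_le[OF pD, unfolded Gp, folded a_def]
  \<comment> \<open>The base point lies in the support, so its balls have positive mass, and the
    balls about its image a are at least as heavy.\<close>
  have pos: "0 < emeasure m (mball_of Z a r)" if "0 < r" for r
    using pmm_spaceD(5)[OF assms(2)] ball[of r] that unfolding msupp_def by (auto intro: less_le_trans)
  have "Z.CD_inequality K m"
    by (rule Z.CD_inequality_limit[of a x M m]) (fact a xa conv AI.m' fin pos M CD)+
  then have "AI.S.CD_inequality K (pmm_measure X_inf)" by (rule almost_isometry.CD_push[OF AI.swap])
  \<comment> \<open>The growth condition of the limit space is part of the claim. It is read off
    from the bound for m in the common space, whose balls dominate those of the limit space.\<close>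
  moreover have "growth_condition X_inf"
  proof -
    obtain C where C: "0 \<le> C" "\<And>j::nat. emeasure m (mball_of Z a (real (Suc j))) \<le> ennreal (exp (C * (real j + 3)\<^sup>2))"
      by (rule Z.uniform_growth[OF a xa conv AI.m'(2) fin pos M CD]) (assumption | rule that)+
    show "growth_condition X_inf" unfolding growth_condition_def
    proof (rule exI[of _ "exp (32 * C)"], rule exI[of _ "2 * C"], intro allI impI)
      fix r :: real assume r: "0 < r"
      define j where "j = nat \<lfloor>r\<rfloor>"
      have j: "r \<le> real (Suc j)" "real j \<le> r" using r by (auto simp: j_def) linarith+
      \<comment> \<open>With j the integer part of r, (j + 3)^2 \<le> (r + 3)^2 \<le> 2 r^2 + 32,
        which gives the two constants exp (32 C) and 2 C.\<close>
      have "(real j + 3)\<^sup>2 \<le> (r + 3)\<^sup>2" using j by (intro power_mono) auto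
      also have "\<dots> \<le> 2 * r\<^sup>2 + 32" using sum_squares_ge_zero[of "r - 3" 0] by (simp add: power2_eq_square algebra_simps)
      finally have "C * (real j + 3)\<^sup>2 \<le> C * (2 * r\<^sup>2 + 32)" using C(1) by (rule mult_left_mono)
      then have e: "exp (C * (real j + 3)\<^sup>2) \<le> exp (32 * C) * exp (2 * C * r\<^sup>2)"
        unfolding exp_add[symmetric] by (simp add: algebra_simps)
      have "emeasure (pmm_measure X_inf) (mball_of (pmm_metric X_inf) (pmm_point X_inf) r) \<le> emeasure m (mball_of Z a r)" by (rule ball)
      also have "\<dots> \<le> emeasure m (mball_of Z a (real (Suc j)))"
        by (rule emeasure_mono) (use j AI.m' in auto)
      also have "\<dots> \<le> ennreal (exp (C * (real j + 3)\<^sup>2))" by (rule C)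
      also have "\<dots> \<le> ennreal (exp (32 * C) * exp (2 * C * r\<^sup>2))" by (rule ennreal_leI[OF e])
      finally show "emeasure (pmm_measure X_inf) (mball_of (pmm_metric X_inf) (pmm_point X_inf) r) \<le> ennreal (exp (32 * C) * exp (2 * C * r\<^sup>2))" .
    qed
  qed
  ultimately show ?thesis using CD_infinity_iff[OF assms(2)] by simp
qed

end
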